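(* Let $N\ge 3$ and $0<\gamma_2<\gamma_1=2$. Then there exists a constant $c_1^*>\tilde c_1$ such that, for any $\tilde c_1<c<c_1^*$, the problem $$-\Delta u+\lambda u=\left(|x|^{-\gamma_1}\ast|u|^2\right)u-\left(|x|^{-\gamma_2}\ast|u|^2\right)u\ \text{ in }\mathbb{R}^N,\qquad \int_{\mathbb{R}^N}|u|^2\,dx=c$$ has a ground state $u_c\in S(c)$ satisfying $E(u_c)=\Gamma(c)$.
   Context: For $\gamma\in(0,N)$ and $u\in H^1(\mathbb{R}^N)$ write $D_\gamma(u):=\int_{\mathbb{R}^N}\int_{\mathbb{R}^N}\frac{|u(x)|^2|u(y)|^2}{|x-y|^{\gamma}}\,dx\,dy$. Set $E(u):=\frac12\int_{\mathbb{R}^N}|\nabla u|^2\,dx+\frac14 D_{\gamma_2}(u)-\frac14 D_{\gamma_1}(u)$, $Q(u):=\int_{\mathbb{R}^N}|\nabla u|^2\,dx+\frac{\gamma_2}{4}D_{\gamma_2}(u)-\frac{\gamma_1}{4}D_{\gamma_1}(u)$, $S(c):=\{u\in H^1(\mathbb{R}^N):\int_{\mathbb{R}^N}|u|^2\,dx=c\}$, $P(c):=\{u\in S(c):Q(u)=0\}$, $\Gamma(c):=\inf_{u\in P(c)}E(u)$ and $m(c):=\inf_{u\in S(c)}E(u)$. The constant $\tilde c_1>0$, depending only on $N$, is the threshold such that (for $\gamma_1=2$) $m(c)=0$ for $0<c\le\tilde c_1$ and $m(c)=-\infty$ for $c>\tilde c_1$; explicitly $\tilde c_1=2/C_{N,2}$,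 where $C_{N,2}$ is the best constant in the inequality $D_2(u)\le C_{N,2}\left(\int_{\mathbb{R}^N}|\nabla u|^2\,dx\right)\left(\int_{\mathbb{R}^N}|u|^2\,dx\right)$, $u\in H^1(\mathbb{R}^N)$. A solution of the problem is a function $u\in S(c)$ for which there is some $\lambda\in\mathbb{R}$ (unknown, a Lagrange multiplier) such that the equation holds (in the weak sense). A ground state is a solution in $S(c)$ whose energy $E$ is least among all solutions in $S(c)$. *)

theory Defs
  imports "HOL-Analysis.Analysis"
begin

text \<open>
  Functions on \<open>real ^ 'n\<close> are real-valued. Elements of \<open>L\<^sup>2\<close> and \<open>H\<^sup>1\<close> are Borel representatives
  rather than almost-everywhere classes; every class has one, and all functionals below depend
  only on the class.
\<close>

definition partial_deriv :: "'n::finite \<Rightarrow> (real ^ 'n \<Rightarrow> real) \<Rightarrow> real ^ 'n \<Rightarrow> real" where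
  "partial_deriv i f x = frechet_derivative f (at x) (axis i 1)"

primrec C_k :: "nat \<Rightarrow> (real ^ 'n::finite \<Rightarrow> real) \<Rightarrow> bool" where
  "C_k 0 f \<longleftrightarrow> continuous_on UNIV f"
| "C_k (Suc k) f \<longleftrightarrow> (\<forall>x. f differentiable (at x)) \<and> (\<forall>i. C_k k (partial_deriv i f))"

definition test_functions :: "(real ^ 'n::finite \<Rightarrow> real) set" where
  "test_functions = {\<phi>. (\<forall>k. C_k k \<phi>) \<and> compact (closure {x. \<phi> x \<noteq> 0})}"

definition L2 :: "('a::euclidean_space \<Rightarrow> 'b::euclidean_space) set" where
  "L2 = {f. f \<in> borel_measurable lborel \<and> integrable lborel (\<lambda>x. (norm (f x))\<^sup>2)}"

definition is_weak_grad :: "(real ^ 'n::finite \<Rightarrow> real) \<Rightarrow> (real ^ 'n \<Rightarrow> real ^ 'n) \<Rightarrow> bool" where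
  "is_weak_grad u g \<longleftrightarrow> (\<forall>\<phi>\<in>test_functions. \<forall>i.
     (LINT x|lborel. u x * partial_deriv i \<phi> x) = - (LINT x|lborel. (g x $ i) * \<phi> x))"

definition H1 :: "(real ^ 'n::finite \<Rightarrow> real) set" where
  "H1 = {u. u \<in> L2 \<and> (\<exists>g\<in>L2. is_weak_grad u g)}"

text \<open>For \<open>u\<close> in \<open>H\<^sup>1\<close> the weak gradient is unique up to null sets.\<close>

definition weak_grad :: "(real ^ 'n::finite \<Rightarrow> real) \<Rightarrow> real ^ 'n \<Rightarrow> real ^ 'n" where
  "weak_grad u = (SOME g. g \<in> L2 \<and> is_weak_grad u g)"

definition mass :: "(real ^ 'n::finite \<Rightarrow> real) \<Rightarrow> real" where
  "mass u = (LINT x|lborel. \<bar>u x\<bar>\<^sup>2)"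

definition dirichlet :: "(real ^ 'n::finite \<Rightarrow> real) \<Rightarrow> real" where
  "dirichlet u = (LINT x|lborel. (norm (weak_grad u x))\<^sup>2)"

definition D :: "real \<Rightarrow> (real ^ 'n::finite \<Rightarrow> real) \<Rightarrow> real" where
  "D \<gamma> u = (LINT x|lborel. LINT y|lborel. \<bar>u x\<bar>\<^sup>2 * \<bar>u y\<bar>\<^sup>2 / norm (x - y) powr \<gamma>)"

definition energy :: "real \<Rightarrow> real \<Rightarrow> (real ^ 'n::finite \<Rightarrow> real) \<Rightarrow> real" where
  "energy \<gamma>1 \<gamma>2 u = 1/2 * dirichlet u + 1/4 * D \<gamma>2 u - 1/4 * D \<gamma>1 u"

definition pohozaev :: "real \<Rightarrow> real \<Rightarrow> (real ^ 'n::finite \<Rightarrow> real) \<Rightarrow> real" where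
  "pohozaev \<gamma>1 \<gamma>2 u = dirichlet u + \<gamma>2/4 * D \<gamma>2 u - \<gamma>1/4 * D \<gamma>1 u"

definition mass_sphere :: "real \<Rightarrow> (real ^ 'n::finite \<Rightarrow> real) set" where
  "mass_sphere c = {u\<in>H1. mass u = c}"

definition pohozaev_set :: "real \<Rightarrow> real \<Rightarrow> real \<Rightarrow> (real ^ 'n::finite \<Rightarrow> real) set" where
  "pohozaev_set \<gamma>1 \<gamma>2 c = {u\<in>mass_sphere c. pohozaev \<gamma>1 \<gamma>2 u = 0}"

text \<open>
  The infimum is taken in the extended reals, so that it is meaningful also over an empty set
  or for an energy that is unbounded below. The type argument only passes the dimension.
\<close>

definition Gamma_inf :: "'n::finite itself \<Rightarrow> real \<Rightarrow> real \<Rightarrow> real \<Rightarrow> ereal" where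
  "Gamma_inf _ \<gamma>1 \<gamma>2 c =
     (INF u \<in> (pohozaev_set \<gamma>1 \<gamma>2 c :: (real ^ 'n \<Rightarrow> real) set). ereal (energy \<gamma>1 \<gamma>2 u))"

definition best_const :: "'n::finite itself \<Rightarrow> real \<Rightarrow> real" where
  "best_const _ \<gamma> = Inf {C. \<forall>u\<in>(H1 :: (real ^ 'n \<Rightarrow> real) set). D \<gamma> u \<le> C * dirichlet u * mass u}"

text \<open>
  The mass threshold: for \<open>\<gamma>1 = 2\<close> the infimum of the energy over \<open>mass_sphere c\<close> is \<open>0\<close> when
  \<open>0 < c \<le> c1_tilde\<close> and \<open>-\<infinity>\<close> when \<open>c > c1_tilde\<close>.
\<close>

definition c1_tilde :: "'n::finite itself \<Rightarrow> real" where
  "c1_tilde T = 2 / best_const T 2"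

definition riesz_conv :: "real \<Rightarrow> (real ^ 'n::finite \<Rightarrow> real) \<Rightarrow> real ^ 'n \<Rightarrow> real" where
  "riesz_conv \<gamma> u x = (LINT y|lborel. norm (x - y) powr (- \<gamma>) * \<bar>u y\<bar>\<^sup>2)"

definition weak_solution :: "real \<Rightarrow> real \<Rightarrow> real \<Rightarrow> (real ^ 'n::finite \<Rightarrow> real) \<Rightarrow> bool" where
  "weak_solution \<gamma>1 \<gamma>2 l u \<longleftrightarrow> (\<forall>v\<in>H1.
     (LINT x|lborel. weak_grad u x \<bullet> weak_grad v x) + l * (LINT x|lborel. u x * v x)
     = (LINT x|lborel. riesz_conv \<gamma>1 u x * u x * v x)
       - (LINT x|lborel. riesz_conv \<gamma>2 u x * u x * v x))"

definition normalized_solution :: "real \<Rightarrow> real \<Rightarrow> real \<Rightarrow> (real ^ 'n::finite \<Rightarrow> real) \<Rightarrow> bool" where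
  "normalized_solution \<gamma>1 \<gamma>2 c u \<longleftrightarrow> u \<in> mass_sphere c \<and> (\<exists>l. weak_solution \<gamma>1 \<gamma>2 l u)"

definition ground_state :: "real \<Rightarrow> real \<Rightarrow> real \<Rightarrow> (real ^ 'n::finite \<Rightarrow> real) \<Rightarrow> bool" where
  "ground_state \<gamma>1 \<gamma>2 c u \<longleftrightarrow> normalized_solution \<gamma>1 \<gamma>2 c u \<and>
     (\<forall>v :: real ^ 'n \<Rightarrow> real. normalized_solution \<gamma>1 \<gamma>2 c v \<longrightarrow> energy \<gamma>1 \<gamma>2 u \<le> energy \<gamma>1 \<gamma>2 v)"

end

theory Submission
  imports Defs "HOL-Library.Diagonal_Subsequence" "HOL-Complex_Analysis.Great_Picard"
begin

text \<open>
  Write \<open>A\<close> for the Dirichlet integral, \<open>\<theta> = \<gamma>2\<close>, \<open>B = D \<theta> u\<close> and \<open>K = D 2 u / 4 - A / 2\<close>.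
  Under the mass-preserving dilations \<open>u\<close> becomes \<open>t\<^bsup>N/2\<^esup> u(t x)\<close>, \<open>K\<close> is multiplied by \<open>t\<^sup>2\<close> and \<open>B\<close>
  by \<open>t\<^bsup>\<theta>\<^esup>\<close>, so \<open>F = B\<^sup>2 / K\<^bsup>\<theta>\<^esup>\<close> is invariant; every \<open>u\<close> with \<open>K > 0\<close> has exactly one
  dilate on the Pohozaev set, where \<open>K = \<theta> B / 8\<close>, and there the energy is an increasing function of \<open>F\<close>.
  Hence \<open>F\<close> is minimised over the functions of mass \<open>c\<close> with \<open>K > 0\<close>; they exist because \<open>c > c1_tilde\<close>.

  Minimising sequences normalised by \<open>A = 1\<close> do not vanish, since \<open>K > 0\<close> forces \<open>D 2 u > 2\<close>, and so
  have a nonzero weak limit up to translation. If mass escaped, then by the Brezis-Lieb splitting the limit or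
  the remainder would have \<open>K > 0\<close>, mass less than \<open>c\<close> and \<open>F\<close> at most the infimum. This is impossible when \<open>c\<close>
  is close to \<open>c1_tilde\<close>, because raising the mass to \<open>c\<close> by a constant factor then lowers \<open>F\<close>.

  The minimiser is a critical point of the scale-invariant quotient, and this Euler-Lagrange
  equation is the required one. It has least energy among all solutions because every
  solution lies on the Pohozaev set: difference quotients give second weak derivatives, and the
  equation can be tested with \<open>X \<bullet> \<nabla> u\<close> for truncations \<open>X\<close> of the identity field.
\<close>

section \<open>Smooth functions and test functions\<close>

text \<open>At exponent 2 the focusing term \<open>D 2\<close> and the Dirichlet integral scale
  alike under mass-preserving dilations, so above \<open>c1_tilde\<close> the energy is unbounded
  below on the mass sphere and only the term of lower exponent \<theta> fixes a length scale. This
  is why a dilation-invariant quotient is minimised. The main tool for the nonlocal terms is Hardy's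
  inequality: for N >= 3 every potential of u^2 with exponent in [0,2] is bounded by the H1 norm,
  which takes the place of Sobolev and Hardy-Littlewood-Sobolev estimates. Smallness near the
  diagonal comes from the slightly stronger singularity 5/2, still below N. The condition
  \<open>Kf u > 0\<close> is open and the mass is restored by an amplitude factor, so the first
  variation is an ordinary derivative of a logarithm along a line, and the multiplier is read off
  from it. The constant \<open>c1_star\<close> is 2^(\<theta>/(4-\<theta>)) times
  \<open>c1_tilde\<close>, a range in which a chord estimate for x^((4-\<theta>)/\<theta>) makes an
  increase of amplitude profitable. It also gives c < 2 * \<open>c1_tilde\<close>, so that two
  separated pieces cannot both have \<open>Kf > 0\<close>.\<close>

lemma partial_deriv_eq:
  "(f has_derivative f') (at x) \<Longrightarrow> partial_deriv i f x = f' (axis i 1)"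
  unfolding partial_deriv_def by (metis frechet_derivative_at)

lemma C_k_SucD: "C_k (Suc k) f \<Longrightarrow> C_k k f"
proof (induction k arbitrary: f)
  case 0
  then show ?case
    by (simp add: continuous_on_eq_continuous_at differentiable_imp_continuous_within)
next
  case (Suc k)
  then show ?case by simp
qed

lemma C_k_const: "C_k k (\<lambda>x. c)"
proof (induction k arbitrary: c)
  case (Suc k)
  have "partial_deriv i (\<lambda>x::real^'a. c) = (\<lambda>x. 0)" for i
    by (intro ext) (simp add: partial_deriv_eq[OF has_derivative_const])
  with Suc show ?case by simp
qed simp

lemma has_derivative_coord: "((\<lambda>x::real^'n. x $ j) has_derivative (\<lambda>h. h $ j)) F"
  by (rule bounded_linear_imp_has_derivative[OF bounded_linear_vec_nth])

lemma partial_deriv_coord: "partial_deriv i (\<lambda>x. x $ j) = (\<lambda>x. if i = j then 1 else 0)"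
  by (intro ext) (auto simp: partial_deriv_eq[OF has_derivative_coord] axis_def)

lemma C_k_coord: "C_k k (\<lambda>x. x $ j)"
  by (cases k) (auto simp: partial_deriv_coord C_k_const differentiable_def
      intro: has_derivative_coord continuous_intros)

lemma C_k_add: "C_k k f \<Longrightarrow> C_k k g \<Longrightarrow> C_k k (\<lambda>x. f x + g x)"
proof (induction k arbitrary: f g)
  case (Suc k)
  have "partial_deriv i (\<lambda>x. f x + g x) = (\<lambda>x. partial_deriv i f x + partial_deriv i g x)" for i
  proof
    fix x
    show "partial_deriv i (\<lambda>x. f x + g x) x = partial_deriv i f x + partial_deriv i g x"
      using Suc.prems frechet_derivative_works
      by (subst partial_deriv_eq[OF has_derivative_add]) (auto simp: partial_deriv_def)
  qed
  with Suc show ?case by (auto intro: differentiable_add)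
qed (auto intro: continuous_intros)

lemma partial_deriv_mult:
  assumes "f differentiable (at x)" "g differentiable (at x)"
  shows "partial_deriv i (\<lambda>x. f x * g x) x = f x * partial_deriv i g x + partial_deriv i f x * g x"
  using partial_deriv_eq[OF has_derivative_mult[OF assms[unfolded frechet_derivative_works]], of i]
  by (simp add: partial_deriv_def)

lemma C_k_mult: "C_k k f \<Longrightarrow> C_k k g \<Longrightarrow> C_k k (\<lambda>x. f x * g x)"
proof (induction k arbitrary: f g)
  case (Suc k)
  have "partial_deriv i (\<lambda>x. f x * g x) = (\<lambda>x. f x * partial_deriv i g x + partial_deriv i f x * g x)" for i
    using Suc.prems by (intro ext partial_deriv_mult) auto
  moreover have "C_k k (\<lambda>x. f x * partial_deriv i g x + partial_deriv i f x * g x)" for i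
    using Suc.prems Suc.prems[THEN C_k_SucD] by (intro C_k_add Suc.IH) auto
  ultimately show ?case using Suc.prems by (auto intro: differentiable_mult)
qed (auto intro: continuous_intros)

definition smooth :: "(real^'n::finite \<Rightarrow> real) \<Rightarrow> bool" where
  "smooth f \<longleftrightarrow> (\<forall>k. C_k k f)"

lemma smooth_const [intro, simp]: "smooth (\<lambda>x. c)" by (simp add: smooth_def C_k_const)
lemma smooth_coord [intro, simp]: "smooth (\<lambda>x. x $ j)" by (simp add: smooth_def C_k_coord)
lemma smooth_add [intro]: "smooth f \<Longrightarrow> smooth g \<Longrightarrow> smooth (\<lambda>x. f x + g x)"
  by (simp add: smooth_def C_k_add)
lemma smooth_mult [intro]: "smooth f \<Longrightarrow> smooth g \<Longrightarrow> smooth (\<lambda>x. f x * g x)"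
  by (simp add: smooth_def C_k_mult)
lemma smooth_minus [intro]: "smooth f \<Longrightarrow> smooth (\<lambda>x. - f x)"
  using smooth_mult[OF smooth_const[of "-1"], of f] by simp
lemma smooth_diff [intro]: "smooth f \<Longrightarrow> smooth g \<Longrightarrow> smooth (\<lambda>x. f x - g x)"
  using smooth_add[OF _ smooth_minus, of f g] by simp
lemma smooth_sum [intro]: "(\<And>j. j \<in> J \<Longrightarrow> smooth (f j)) \<Longrightarrow> smooth (\<lambda>x. \<Sum>j\<in>J. f j x)"
  by (induction J rule: infinite_finite_induct) auto
lemma smooth_prod [intro]: "(\<And>j. j \<in> J \<Longrightarrow> smooth (f j)) \<Longrightarrow> smooth (\<lambda>x. \<Prod>j\<in>J. f j x)"
  by (induction J rule: infinite_finite_induct) auto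
lemma smooth_partial [intro]: "smooth f \<Longrightarrow> smooth (partial_deriv i f)"
  unfolding smooth_def by (metis C_k.simps(2))
lemma smooth_differentiable: "smooth f \<Longrightarrow> f differentiable (at x)"
  unfolding smooth_def by (metis C_k.simps(2))
lemma smooth_continuous: "smooth f \<Longrightarrow> continuous_on UNIV f"
  unfolding smooth_def by (metis C_k.simps(1))
lemma smooth_measurable [intro]: "smooth f \<Longrightarrow> f \<in> borel_measurable borel"
  using smooth_continuous borel_measurable_continuous_onI by blast

lemma smooth_has_derivative:
  assumes "smooth f"
  shows "(f has_derivative (\<lambda>h. \<Sum>i\<in>UNIV. h $ i * partial_deriv i f x)) (at x)"
proof -
  have d: "(f has_derivative frechet_derivative f (at x)) (at x)"
    using smooth_differentiable[OF assms] frechet_derivative_works by blast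
  then interpret bounded_linear "frechet_derivative f (at x)" by (rule has_derivative_bounded_linear)
  have "frechet_derivative f (at x) h = (\<Sum>i\<in>UNIV. h $ i * partial_deriv i f x)" for h
  proof -
    have "frechet_derivative f (at x) h = frechet_derivative f (at x) (\<Sum>i\<in>UNIV. h $ i *\<^sub>R axis i 1)"
      using basis_expansion[of h] by (simp add: scalar_mult_eq_scaleR)
    then show ?thesis by (simp add: sum scaleR partial_deriv_def)
  qed
  then have "frechet_derivative f (at x) = (\<lambda>h. \<Sum>i\<in>UNIV. h $ i * partial_deriv i f x)" by auto
  with d show ?thesis by simp
qed

lemma partial_deriv_smooth_mult:
  "smooth f \<Longrightarrow> smooth g \<Longrightarrow> partial_deriv i (\<lambda>x. f x * g x) x = f x * partial_deriv i g x + partial_deriv i f x * g x"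
  by (simp add: partial_deriv_mult smooth_differentiable)

lemma sum_axis: "(\<Sum>i\<in>UNIV. axis j c $ i * f i) = (c::real) * f j"
proof -
  have "axis j c $ i * f i = (if i = j then c * f j else 0)" for i by (simp add: axis_def)
  then show ?thesis by simp
qed

text \<open>Serves translations (a = 1) and dilations (b = 0) alike; both are later moved from a
  function to the test function.\<close>

lemma partial_deriv_affine:
  assumes "smooth f"
  shows "partial_deriv i (\<lambda>x. f (a *\<^sub>R x + b)) = (\<lambda>x. a * partial_deriv i f (a *\<^sub>R x + b))"
proof
  fix x
  have 1: "((\<lambda>x. a *\<^sub>R x + b) has_derivative (\<lambda>h. a *\<^sub>R h)) (at x)"
    by (auto intro!: derivative_eq_intros)
  show "partial_deriv i (\<lambda>x. f (a *\<^sub>R x + b)) x = a * partial_deriv i f (a *\<^sub>R x + b)"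
    using partial_deriv_eq[OF has_derivative_compose[OF 1 smooth_has_derivative[OF assms]], of i]
    by (simp add: sum_axis mult.assoc flip: sum_distrib_left)
qed

lemma smooth_affine:
  assumes "smooth f"
  shows "smooth (\<lambda>x. f (a *\<^sub>R x + b))"
proof -
  have "smooth f \<Longrightarrow> C_k k (\<lambda>x. f (a *\<^sub>R x + b))" for k
  proof (induction k arbitrary: f)
    case 0
    then show ?case
      by (auto intro!: continuous_on_compose2[OF smooth_continuous] continuous_intros)
  next
    case (Suc k)
    have "(\<lambda>x. f (a *\<^sub>R x + b)) differentiable (at x)" for x
      by (rule differentiable_compose[OF smooth_differentiable[OF Suc.prems]]) simp
    then show ?case
      using Suc by (auto simp: partial_deriv_affine[OF Suc.prems] intro!: C_k_mult C_k_const)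
  qed
  with assms show ?thesis by (simp add: smooth_def)
qed

lemma partial_deriv_comp_real:
  assumes "(h has_real_derivative h') (at (q x))" "smooth q"
  shows "((\<lambda>x. h (q x)) has_derivative (\<lambda>v. h' * (\<Sum>i\<in>UNIV. v $ i * partial_deriv i q x))) (at x)"
    and "partial_deriv i (\<lambda>x. h (q x)) x = h' * partial_deriv i q x"
proof -
  show *: "((\<lambda>x. h (q x)) has_derivative (\<lambda>v. h' * (\<Sum>i\<in>UNIV. v $ i * partial_deriv i q x))) (at x)"
    using has_derivative_compose[OF smooth_has_derivative[OF assms(2)], of h "(*) h'" x] assms(1)
    by (simp add: has_field_derivative_def)
  show "partial_deriv i (\<lambda>x. h (q x)) x = h' * partial_deriv i q x"
    using partial_deriv_eq[OF *, of i]
    by (simp add: sum_axis)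
qed

text \<open>The functions \<open>eta m\<close> are closed under differentiation up to linear combinations, which
  makes compositions of \<open>eta 0\<close> smooth.\<close>

definition eta :: "nat \<Rightarrow> real \<Rightarrow> real" where
  "eta m s = (if s > 0 then exp (- inverse s) * inverse s ^ m else 0)"

lemma eta_tendsto_0: "(eta m \<longlongrightarrow> 0) (at 0)"
proof -
  have "((\<lambda>y::real. y ^ m / exp y) \<longlongrightarrow> 0) at_top" for m :: nat
    by (rule tendsto_power_div_exp_0)
  then have "((\<lambda>s. (inverse s) ^ m / exp (inverse s)) \<longlongrightarrow> (0::real)) (at_right 0)"
    by (rule filterlim_compose[OF _ filterlim_inverse_at_top_right])
  moreover have "eventually (\<lambda>s. (inverse s) ^ m / exp (inverse s) = eta m s) (at_right 0)"
    unfolding eventually_at_right_field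
    by (intro exI[of _ 1]) (auto simp: eta_def exp_minus divide_inverse)
  ultimately have "(eta m \<longlongrightarrow> 0) (at_right 0)"
    by (rule Lim_transform_eventually)
  moreover have "(eta m \<longlongrightarrow> 0) (at_left 0)"
    by (rule tendsto_eventually) (auto simp: eventually_at_left_field eta_def intro: exI[of _ "-1"])
  ultimately show ?thesis by (simp add: filterlim_at_split)
qed

lemma eta_deriv: "(eta m has_real_derivative (eta (m + 2) s - real m * eta (Suc m) s)) (at s)"
proof -
  consider "s > 0" | "s < 0" | "s = 0" by linarith
  then show ?thesis
  proof cases
    case 1
    have "((\<lambda>s. exp (- inverse s) * inverse s ^ m) has_real_derivative (eta (m + 2) s - real m * eta (Suc m) s)) (at s)"
      using 1 
      by (cases m) (auto intro!: derivative_eq_intros simp: eta_def algebra_simps power2_eq_square, case_tac nat, auto)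
    then show ?thesis
      by (rule has_field_derivative_transform_within_open[where S="{0<..}"]) (use 1 in \<open>auto simp: eta_def\<close>)
  next
    case 2
    have "((\<lambda>s. 0) has_real_derivative (eta (m + 2) s - real m * eta (Suc m) s)) (at s)"
      using 2 by (auto simp: eta_def)
    then show ?thesis
      by (rule has_field_derivative_transform_within_open[where S="{..<0}"]) (use 2 in \<open>auto simp: eta_def\<close>)
  next
    \<comment> \<open>At the origin the difference quotient of \<open>eta m\<close> is
      \<open>eta (Suc m)\<close> itself, so the derivative is the limit from
      \<open>eta_tendsto_0\<close>.\<close>
    case 3
    have "((\<lambda>h. eta (Suc m) h) \<longlongrightarrow> 0) (at 0)" by (rule eta_tendsto_0)
    moreover have "eventually (\<lambda>h. eta (Suc m) h = (eta m (0 + h) - eta m 0) / h) (at 0)"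
      by (auto simp: eventually_at eta_def divide_inverse intro: exI[of _ 1])
    ultimately show ?thesis
      unfolding DERIV_def 3 by (simp add: tendsto_cong) (simp add: eta_def)
  qed
qed

text \<open>The induction on the order of differentiation keeps m arbitrary, because
  \<open>eta_deriv\<close> raises the index.\<close>

lemma smooth_eta [intro]:
  assumes "smooth q" shows "smooth (\<lambda>x. eta m (q x))"
proof -
  have "C_k k (\<lambda>x. eta m (q x))" for k
  proof (induction k arbitrary: m)
    case 0
    have "continuous_on UNIV (eta m)"
      by (meson DERIV_isCont eta_deriv continuous_at_imp_continuous_on)
    then show ?case
      using continuous_on_compose2[of UNIV "eta m" UNIV q] smooth_continuous[OF assms] by simp
  next
    case (Suc k)
    have "partial_deriv i (\<lambda>x. eta m (q x)) = (\<lambda>x. (eta (m + 2) (q x) + (- real m) * eta (Suc m) (q x)) * partial_deriv i q x)" for i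
      by (intro ext) (simp add: partial_deriv_comp_real(2)[OF eta_deriv assms])
    moreover have "C_k k (partial_deriv i q)" for i
      using assms smooth_partial smooth_def by blast
    moreover have "(\<lambda>x. eta m (q x)) differentiable (at x)" for x
      using partial_deriv_comp_real(1)[OF eta_deriv assms] by (auto simp: differentiable_def)
    ultimately show ?case
      by (simp only: C_k.simps simp_thms) (intro allI C_k_mult C_k_add C_k_const Suc.IH, simp)
  qed
  then show ?thesis by (simp add: smooth_def)
qed

lemma smooth_powr:
  assumes "smooth q" "\<And>x. q x > 0" shows "smooth (\<lambda>x. q x powr a)"
proof -
  have d: "((\<lambda>s. s powr a) has_real_derivative a * q x powr (a - 1)) (at (q x))" for a x
    using assms(2)[of x] by (auto intro!: derivative_eq_intros)
  have "C_k k (\<lambda>x. q x powr a)" for k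
  proof (induction k arbitrary: a)
    case 0
    then show ?case
      using continuous_on_powr[OF smooth_continuous[OF assms(1)] continuous_on_const] assms(2)
      by (metis C_k.simps(1) less_irrefl)
  next
    case (Suc k)
    have "partial_deriv i (\<lambda>x. q x powr a) = (\<lambda>x. (a * q x powr (a - 1)) * partial_deriv i q x)" for i
      by (intro ext) (simp add: partial_deriv_comp_real(2)[OF d assms(1)])
    moreover have "C_k k (partial_deriv i q)" for i
      using assms smooth_partial smooth_def by blast
    moreover have "(\<lambda>x. q x powr a) differentiable (at x)" for x
      using partial_deriv_comp_real(1)[OF d assms(1)] by (auto simp: differentiable_def)
    ultimately show ?case
      using Suc.IH by (auto intro!: C_k_mult C_k_const)
  qed
  then show ?thesis by (simp add: smooth_def)
qed

section \<open>Test functions: closure properties, bounds and cut-offs\<close>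

lemma test_functions_iff: "\<phi> \<in> test_functions \<longleftrightarrow> smooth \<phi> \<and> bounded {x. \<phi> x \<noteq> 0}"
  by (auto simp: test_functions_def smooth_def)

lemma test_smooth: "\<phi> \<in> test_functions \<Longrightarrow> smooth \<phi>"
  by (simp add: test_functions_iff)

lemma test_mult: "\<phi> \<in> test_functions \<Longrightarrow> smooth f \<Longrightarrow> (\<lambda>x. f x * \<phi> x) \<in> test_functions"
  by (auto simp: test_functions_iff intro: bounded_subset)

lemma test_scale: "\<phi> \<in> test_functions \<Longrightarrow> (\<lambda>x. c * \<phi> x) \<in> test_functions"
  by (rule test_mult) auto

lemma test_add: "\<phi> \<in> test_functions \<Longrightarrow> \<psi> \<in> test_functions \<Longrightarrow> (\<lambda>x. \<phi> x + \<psi> x) \<in> test_functions"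
  by (auto simp: test_functions_iff intro: bounded_subset[of "{x. \<phi> x \<noteq> 0} \<union> {x. \<psi> x \<noteq> 0}"])

lemma test_zero: "(\<lambda>x. 0) \<in> test_functions"
  by (simp add: test_functions_iff)

lemma test_partial: "\<phi> \<in> test_functions \<Longrightarrow> partial_deriv i \<phi> \<in> test_functions"
proof -
  assume a: "\<phi> \<in> test_functions"
  let ?S = "{x. \<phi> x \<noteq> 0}"
  have "partial_deriv i \<phi> x = 0" if "x \<notin> closure ?S" for x
  proof -
    have "(\<phi> has_derivative (\<lambda>h. 0)) (at x)"
      by (rule has_derivative_transform_within_open[where s="- closure ?S" and f="\<lambda>x. 0"])
        (use that closure_subset[of ?S] in auto)
    then show ?thesis by (simp add: partial_deriv_eq)
  qed
  then have "{x. partial_deriv i \<phi> x \<noteq> 0} \<subseteq> closure ?S" by auto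
  with a show ?thesis
    by (auto simp: test_functions_iff intro: bounded_subset)
qed

lemma test_affine: "\<phi> \<in> test_functions \<Longrightarrow> a \<noteq> 0 \<Longrightarrow> (\<lambda>x. \<phi> (a *\<^sub>R x + b)) \<in> test_functions"
proof -
  assume a: "\<phi> \<in> test_functions" "a \<noteq> 0"
  obtain R where R: "\<And>x. \<phi> x \<noteq> 0 \<Longrightarrow> norm x \<le> R"
    using a(1) by (auto simp: test_functions_iff bounded_iff)
  have "bounded {x. \<phi> (a *\<^sub>R x + b) \<noteq> 0}"
  proof (rule boundedI)
    fix x assume "x \<in> {x. \<phi> (a *\<^sub>R x + b) \<noteq> 0}"
    then have "norm (a *\<^sub>R x + b) \<le> R" using R by simp
    then have "norm (a *\<^sub>R x) \<le> R + norm b"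
      using norm_triangle_ineq4[of "a *\<^sub>R x + b" b] by simp
    then show "norm x \<le> (R + norm b) / \<bar>a\<bar>" using a(2) by (simp add: field_simps)
  qed
  then show ?thesis
    using a(1) smooth_affine[OF test_smooth[OF a(1)], of a b] by (simp add: test_functions_iff)
qed

lemma test_bounded:
  assumes "\<phi> \<in> test_functions"
  obtains B where "B > 0" "\<And>x. \<bar>\<phi> x\<bar> \<le> B"
proof -
  let ?K = "closure {x. \<phi> x \<noteq> 0}"
  have "compact (\<phi> ` ?K)"
    using assms smooth_continuous[OF test_smooth[OF assms]]
    by (intro compact_continuous_image) (auto simp: test_functions_def intro: continuous_on_subset)
  then obtain B where B: "B > 0" "\<forall>y\<in>\<phi> ` ?K. norm y \<le> B" using compact_imp_bounded bounded_pos by blast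
  have "\<bar>\<phi> x\<bar> \<le> B" for x
    using B closure_subset[of "{x. \<phi> x \<noteq> 0}"] by (cases "\<phi> x = 0") auto
  with B(1) that show ?thesis by blast
qed

lemma test_support:
  assumes "\<phi> \<in> test_functions"
  obtains R where "R > 0" "\<And>x. norm x > R \<Longrightarrow> \<phi> x = 0"
proof -
  obtain R where "R > 0" "\<forall>x\<in>{x. \<phi> x \<noteq> 0}. norm x \<le> R"
    using assms by (auto simp: test_functions_iff bounded_pos)
  then show ?thesis by (intro that[of R]) force+
qed

lemma test_measurable [measurable_dest]: "\<phi> \<in> test_functions \<Longrightarrow> \<phi> \<in> borel_measurable borel"
  using test_smooth by blast

lemma integrable_bounded_support:
  fixes f :: "'a::euclidean_space \<Rightarrow> real"
  assumes [measurable]: "f \<in> borel_measurable borel"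
    and "\<And>x. \<bar>f x\<bar> \<le> B" "\<And>x. norm x > R \<Longrightarrow> f x = 0"
  shows "integrable lborel f"
proof (rule Bochner_Integration.integrable_bound)
  have "emeasure lborel (cball (0::'a) R) < \<infinity>" by (rule emeasure_lborel_cball_finite)
  then show "integrable lborel (\<lambda>x::'a. indicator (cball 0 R) x * B)" by simp
  show "AE x in lborel. norm (f x) \<le> norm (indicator (cball 0 R) x * B)"
  proof (intro AE_I2)
    fix x
    show "norm (f x) \<le> norm (indicator (cball 0 R) x * B)"
      using assms(2)[of x] assms(3)[of x] by (cases "norm x > R") (auto simp: indicator_def)
  qed
qed simp

lemma test_integrable: "\<phi> \<in> test_functions \<Longrightarrow> integrable lborel \<phi>"
  by (metis test_bounded test_support test_measurable integrable_bounded_support)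

lemma test_L2: "\<phi> \<in> test_functions \<Longrightarrow> \<phi> \<in> L2"
proof -
  assume a: "\<phi> \<in> test_functions"
  have "(\<lambda>x. \<phi> x * \<phi> x) \<in> test_functions" using a test_mult test_smooth by blast
  from test_integrable[OF this] show ?thesis
    using test_measurable[OF a] by (simp add: L2_def power2_eq_square)
qed

lemma test_Lipschitz:
  assumes "\<phi> \<in> test_functions"
  obtains L where "L > 0" "\<And>x y. \<bar>\<phi> x - \<phi> y\<bar> \<le> L * norm (x - y)"
proof -
  have "\<exists>B>0. \<forall>x. \<bar>partial_deriv i \<phi> x\<bar> \<le> B" for i
    using test_bounded[OF test_partial[OF assms, of i]] by metis
  then obtain B where B: "\<And>i. B i > 0" "\<And>i x. \<bar>partial_deriv i \<phi> x\<bar> \<le> B i" by metis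
  let ?L = "\<Sum>i\<in>UNIV. B i"
  have "norm (\<phi> x - \<phi> y) \<le> ?L * norm (x - y)" for x y
  proof (rule differentiable_bound[where S=UNIV and f' = "\<lambda>x h. \<Sum>i\<in>UNIV. h $ i * partial_deriv i \<phi> x"])
    fix z
    show "onorm (\<lambda>h. \<Sum>i\<in>UNIV. h $ i * partial_deriv i \<phi> z) \<le> ?L"
    proof (rule onorm_le)
      fix h :: "real^'a"
      have "\<bar>\<Sum>i\<in>UNIV. h $ i * partial_deriv i \<phi> z\<bar> \<le> (\<Sum>i\<in>UNIV. norm h * B i)"
        by (rule order_trans[OF sum_abs sum_mono])
          (auto simp: abs_mult intro!: mult_mono B component_le_norm_cart)
      then show "norm (\<Sum>i\<in>UNIV. h $ i * partial_deriv i \<phi> z) \<le> ?L * norm h"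
        by (simp add: sum_distrib_left mult.commute)
    qed
  qed (use smooth_has_derivative[OF test_smooth[OF assms]] in auto)
  moreover have "?L > 0" using B(1) by (intro sum_pos) auto
  ultimately show ?thesis using that by auto
qed

text \<open>The profile exp(1 - 1/(1 - |x|^2)) on the unit ball. The factor \<open>exp 1\<close>
  makes the value at the origin 1, so that the rescaled functions
  \<open>bump (x /\<^sub>R (1 + real n))\<close> are cut-offs tending to 1 pointwise.\<close>

definition bump :: "real^'n::finite \<Rightarrow> real" where
  "bump x = exp 1 * eta 0 (1 - x \<bullet> x)"

lemma bump_test: "bump \<in> test_functions"
proof -
  have "smooth (\<lambda>x::real^'n. \<Sum>i\<in>UNIV. x $ i * x $ i)" by (intro smooth_sum) auto
  then have "smooth (\<lambda>x::real^'n. x \<bullet> x)" by (simp add: inner_vec_def)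
  then have "smooth (bump::real^'n\<Rightarrow>_)" unfolding bump_def by (intro smooth_mult smooth_eta smooth_diff) auto
  moreover have "{x::real^'n. bump x \<noteq> 0} \<subseteq> ball 0 1"
    by (auto simp: bump_def eta_def norm_eq_sqrt_inner split: if_splits)
  ultimately show ?thesis
    by (auto simp: test_functions_iff intro: bounded_subset)
qed

lemma bump_0: "bump 0 = 1" by (simp add: bump_def eta_def flip: exp_add)

lemma bump_bounds: "0 \<le> bump x" "bump x \<le> 1"
proof -
  show "0 \<le> bump x" by (simp add: bump_def eta_def)
  have "1 - inverse s \<le> 0" if "0 < s" "s \<le> 1" for s :: real using that by (simp add: field_simps)
  then show "bump x \<le> 1" by (auto simp: bump_def eta_def simp flip: exp_add)
qed

lemma bump_scaled: "(\<lambda>x. bump (x /\<^sub>R (1 + real n))) \<in> test_functions"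
  using test_affine[OF bump_test, of "inverse (1 + real n)" 0] by simp

lemma scaled_tendsto_0: "(\<lambda>n. (x :: 'a::real_normed_vector) /\<^sub>R (1 + real n)) \<longlonglongrightarrow> 0"
proof -
  have "(\<lambda>n. x /\<^sub>R (1 + real n)) \<longlonglongrightarrow> 0 *\<^sub>R x"
    by (intro tendsto_intros) (use LIMSEQ_inverse_real_of_nat in \<open>simp add: add.commute\<close>)
  then show ?thesis by simp
qed

lemma bump_tendsto: "(\<lambda>n. bump (x /\<^sub>R (1 + real n))) \<longlonglongrightarrow> 1"
proof -
  have "isCont bump (0::real^'a)"
    using smooth_continuous[OF test_smooth[OF bump_test]] continuous_on_eq_continuous_at by blast
  from isCont_tendsto_compose[OF this scaled_tendsto_0] show ?thesis by (simp add: bump_0)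
qed

section \<open>The Hilbert space \<open>L\<^sup>2\<close>\<close>

lemma L2_iff: "(f :: 'a::euclidean_space \<Rightarrow> real) \<in> L2 \<longleftrightarrow> f \<in> borel_measurable borel \<and> integrable lborel (\<lambda>x. (f x)\<^sup>2)"
  by (simp add: L2_def)

lemma L2_measurable [measurable_dest]: "f \<in> L2 \<Longrightarrow> f \<in> borel_measurable borel"
  by (simp add: L2_def)

lemma L2_integrable_square: "(f :: 'a::euclidean_space \<Rightarrow> real) \<in> L2 \<Longrightarrow> integrable lborel (\<lambda>x. (f x)\<^sup>2)"
  by (simp add: L2_iff)

lemma L2_integrable_mult:
  fixes f g :: "'a::euclidean_space \<Rightarrow> real"
  assumes [measurable]: "f \<in> L2" "g \<in> L2"
  shows "integrable lborel (\<lambda>x. f x * g x)"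
proof (rule Bochner_Integration.integrable_bound)
  show "integrable lborel (\<lambda>x. (f x)\<^sup>2 + (g x)\<^sup>2)"
    by (intro Bochner_Integration.integrable_add L2_integrable_square assms)
  have "\<bar>a * b\<bar> \<le> a\<^sup>2 + b\<^sup>2" for a b :: real
    using sum_squares_bound[of "\<bar>a\<bar>" "\<bar>b\<bar>"] zero_le_power2[of a] zero_le_power2[of b]
    unfolding abs_mult power2_abs by linarith
  then show "AE x in lborel. norm (f x * g x) \<le> norm ((f x)\<^sup>2 + (g x)\<^sup>2)" by auto
qed (use assms in measurable)

lemma L2_add:
  fixes f g :: "'a::euclidean_space \<Rightarrow> real"
  assumes [measurable]: "f \<in> L2" "g \<in> L2"
  shows "(\<lambda>x. f x + g x) \<in> L2"
proof -
  have "(f x + g x)\<^sup>2 = (f x)\<^sup>2 + 2 * (f x * g x) + (g x)\<^sup>2" for x by (simp add: power2_sum)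
  then show ?thesis
    using assms L2_integrable_square[OF assms(1)] L2_integrable_square[OF assms(2)] L2_integrable_mult[OF assms]
    by (auto simp: L2_iff)
qed

lemma L2_bounded_mult:
  fixes f h :: "'a::euclidean_space \<Rightarrow> real"
  assumes [measurable]: "f \<in> L2" "h \<in> borel_measurable borel" and b: "\<And>x. \<bar>h x\<bar> \<le> B"
  shows "(\<lambda>x. h x * f x) \<in> L2"
  unfolding L2_iff
proof
  show "integrable lborel (\<lambda>x. (h x * f x)\<^sup>2)"
  proof (rule Bochner_Integration.integrable_bound)
    show "integrable lborel (\<lambda>x. B\<^sup>2 * (f x)\<^sup>2)" using assms L2_integrable_square by auto
    have "(h x * f x)\<^sup>2 \<le> B\<^sup>2 * (f x)\<^sup>2" for x
      unfolding power_mult_distrib using b[of x]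
      by (intro mult_right_mono) (auto simp: abs_le_square_iff[symmetric])
    then show "AE x in lborel. norm ((h x * f x)\<^sup>2) \<le> norm (B\<^sup>2 * (f x)\<^sup>2)" by auto
  qed (use assms in measurable)
qed (use assms in measurable)

lemma L2_scale: "(f :: 'a::euclidean_space \<Rightarrow> real) \<in> L2 \<Longrightarrow> (\<lambda>x. c * f x) \<in> L2"
  by (rule L2_bounded_mult[where B="\<bar>c\<bar>"]) auto

lemma L2_uminus: "(f :: 'a::euclidean_space \<Rightarrow> real) \<in> L2 \<Longrightarrow> (\<lambda>x. - f x) \<in> L2"
  using L2_scale[of f "-1"] by simp

lemma L2_diff: "(f :: 'a::euclidean_space \<Rightarrow> real) \<in> L2 \<Longrightarrow> g \<in> L2 \<Longrightarrow> (\<lambda>x. f x - g x) \<in> L2"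
  using L2_add[OF _ L2_uminus, of f g] by simp

lemma L2_zero: "(\<lambda>x::'a::euclidean_space. 0::real) \<in> L2" by (simp add: L2_iff)

lemma L2_sum: "(\<And>j. j \<in> J \<Longrightarrow> (f j :: 'a::euclidean_space \<Rightarrow> real) \<in> L2) \<Longrightarrow> (\<lambda>x. \<Sum>j\<in>J. f j x) \<in> L2"
  by (induction J rule: infinite_finite_induct) (auto intro: L2_add L2_zero)

lemma L2_abs: "(f :: 'a::euclidean_space \<Rightarrow> real) \<in> L2 \<Longrightarrow> (\<lambda>x. \<bar>f x\<bar>) \<in> L2"
  by (auto simp: L2_iff)

text \<open>Elements of \<open>L2\<close> are functions and not classes, so this form is only
  semidefinite: \<open>nm f = 0\<close> means that f vanishes almost everywhere.\<close>

definition ip :: "('a::euclidean_space \<Rightarrow> real) \<Rightarrow> ('a \<Rightarrow> real) \<Rightarrow> real" where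
  "ip f g = (LINT x|lborel. f x * g x)"

definition nm :: "('a::euclidean_space \<Rightarrow> real) \<Rightarrow> real" where
  "nm f = sqrt (ip f f)"

lemma ip_commute: "ip f g = ip g f" by (simp add: ip_def mult.commute)

lemma ip_nonneg: "ip f f \<ge> 0" by (simp add: ip_def)

lemma nm_nonneg [simp]: "nm f \<ge> 0" by (simp add: nm_def ip_nonneg)

lemma nm_square: "(nm f)\<^sup>2 = ip f f" by (simp add: nm_def ip_nonneg)

lemma ip_add_left: "f \<in> L2 \<Longrightarrow> g \<in> L2 \<Longrightarrow> h \<in> L2 \<Longrightarrow> ip (\<lambda>x. f x + g x) h = ip f h + ip g h"
  by (simp add: ip_def distrib_right L2_integrable_mult)

lemma ip_diff_left: "f \<in> L2 \<Longrightarrow> g \<in> L2 \<Longrightarrow> h \<in> L2 \<Longrightarrow> ip (\<lambda>x. f x - g x) h = ip f h - ip g h"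
  by (simp add: ip_def left_diff_distrib L2_integrable_mult)

lemma ip_scale_left: "ip (\<lambda>x. c * f x) g = c * ip f g"
  by (simp add: ip_def mult.assoc)

lemma ip_scale_right: "ip f (\<lambda>x. c * g x) = c * ip f g"
  by (simp add: ip_def mult.left_commute)

lemma ip_add_right: "f \<in> L2 \<Longrightarrow> g \<in> L2 \<Longrightarrow> h \<in> L2 \<Longrightarrow> ip h (\<lambda>x. f x + g x) = ip h f + ip h g"
  by (simp add: ip_commute[of h] ip_add_left)

lemma ip_diff_right: "f \<in> L2 \<Longrightarrow> g \<in> L2 \<Longrightarrow> h \<in> L2 \<Longrightarrow> ip h (\<lambda>x. f x - g x) = ip h f - ip h g"
  by (simp add: ip_commute[of h] ip_diff_left)

lemma ip_lin_left:
  "f \<in> L2 \<Longrightarrow> g \<in> L2 \<Longrightarrow> h \<in> L2 \<Longrightarrow> ip (\<lambda>x. a * f x + b * g x) h = a * ip f h + b * ip g h"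
  by (simp add: ip_add_left L2_scale ip_scale_left)

lemma ip_add_square:
  assumes "f \<in> L2" "g \<in> L2"
  shows "ip (\<lambda>x. f x + t * g x) (\<lambda>x. f x + t * g x) = ip f f + 2 * t * ip f g + t\<^sup>2 * ip g g"
  using assms by (simp add: ip_add_left ip_add_right L2_add L2_scale ip_scale_left ip_scale_right
      ip_commute[of g f] power2_eq_square algebra_simps)

lemma ip_diff_square:
  assumes "f \<in> L2" "g \<in> L2"
  shows "ip (\<lambda>x. f x - g x) (\<lambda>x. f x - g x) = ip f f - 2 * ip f g + ip g g"
  using ip_add_square[OF assms, of "-1"] by simp

lemma ip_Cauchy_Schwarz:
  assumes "f \<in> L2" "g \<in> L2"
  shows "\<bar>ip f g\<bar> \<le> nm f * nm g"
proof -
  have nn: "0 \<le> ip f f + 2 * t * ip f g + t\<^sup>2 * ip g g" for t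
    using ip_nonneg[of "\<lambda>x. f x + t * g x"] by (simp add: ip_add_square[OF assms])
  have "(ip f g)\<^sup>2 \<le> ip f f * ip g g"
  proof (cases "ip g g = 0")
    case True
    have "ip f g = 0"
    proof (rule ccontr)
      assume "ip f g \<noteq> 0"
      \<comment> \<open>In the degenerate case the quadratic is affine in t; this t gives it the
        value -1.\<close>
      then show False using nn[of "- (ip f f + 1) / (2 * ip f g)"] True by (simp add: field_simps)
    qed
    then show ?thesis using True by simp
  next
    case False
    then have "ip g g > 0" using ip_nonneg[of g] by linarith
    then show ?thesis
      using nn[of "- ip f g / ip g g"] by (simp add: field_simps power2_eq_square)
  qed
  then show ?thesis
    by (intro power2_le_imp_le[where x="\<bar>ip f g\<bar>"]) (auto simp: power_mult_distrib nm_square)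
qed

lemma nm_triangle:
  assumes "f \<in> L2" "g \<in> L2"
  shows "nm (\<lambda>x. f x + g x) \<le> nm f + nm g"
proof (rule power2_le_imp_le)
  show "(nm (\<lambda>x. f x + g x))\<^sup>2 \<le> (nm f + nm g)\<^sup>2"
    using ip_add_square[OF assms, of 1] ip_Cauchy_Schwarz[OF assms]
    by (simp add: nm_square power2_sum)
qed simp

lemma nm_scale: "nm (\<lambda>x. c * f x) = \<bar>c\<bar> * nm f"
  by (simp add: nm_def ip_scale_left ip_scale_right real_sqrt_mult flip: mult.assoc)

lemma nm_diff_commute: "nm (\<lambda>x. f x - g x) = nm (\<lambda>x. g x - f x)"
  using nm_scale[of "-1" "\<lambda>x. f x - g x"] by simp

lemma nm_mono_abs:
  assumes "f \<in> L2" "g \<in> L2" "\<And>x. \<bar>f x\<bar> \<le> \<bar>g x\<bar>"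
  shows "nm f \<le> nm g"
  unfolding nm_def ip_def
  using assms by (auto intro!: integral_mono L2_integrable_square simp: abs_le_square_iff simp flip: power2_eq_square)

lemma nm_mult_bounded:
  assumes "f \<in> L2" "h \<in> borel_measurable borel" "\<And>x. \<bar>h x\<bar> \<le> B" "B \<ge> 0"
  shows "nm (\<lambda>x. h x * f x) \<le> B * nm f"
proof -
  have "nm (\<lambda>x. h x * f x) \<le> nm (\<lambda>x. B * f x)"
    using assms by (intro nm_mono_abs L2_bounded_mult[where B=B] L2_scale)
      (auto simp: abs_mult intro: mult_right_mono)
  then show ?thesis using assms by (simp add: nm_scale)
qed

text \<open>Riesz-Fischer: a subsequence with geometrically decreasing increments converges almost
  everywhere, because \<open>\<Sum>n. 4^n |f (n+1) - f n|\<^sup>2\<close> is integrable.\<close>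

lemma L2_complete:
  fixes f :: "nat \<Rightarrow> 'a::euclidean_space \<Rightarrow> real"
  assumes L2: "\<And>n. f n \<in> L2"
    and Cauchy: "\<And>e. e > 0 \<Longrightarrow> \<exists>n0. \<forall>m\<ge>n0. \<forall>n\<ge>n0. nm (\<lambda>x. f m x - f n x) < e"
  obtains g where "g \<in> L2" "(\<lambda>n. nm (\<lambda>x. f n x - g x)) \<longlonglongrightarrow> 0"
proof -
  note [measurable] = L2_measurable[OF L2]
  have "\<exists>n0. \<forall>m\<ge>n0. \<forall>n\<ge>n0. nm (\<lambda>x. f m x - f n x) < (1/4)^k" for k
    by (rule Cauchy) simp
  then obtain N where N: "\<And>k m n. m \<ge> N k \<Longrightarrow> n \<ge> N k \<Longrightarrow> nm (\<lambda>x. f m x - f n x) < (1/4)^k" by metis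
  define r where "r = rec_nat (N 0) (\<lambda>k p. max (Suc p) (N (Suc k)))"
  have r_Suc: "r (Suc k) = max (Suc (r k)) (N (Suc k))" for k by (simp add: r_def)
  have rN: "r k \<ge> N k" for k by (cases k) (auto simp: r_def)
  have r_mono: "strict_mono r" by (auto simp: strict_mono_Suc_iff r_Suc)
  define d where "d k x = f (r (Suc k)) x - f (r k) x" for k x
  have d_L2: "d k \<in> L2" for k unfolding d_def by (intro L2_diff L2)
  note [measurable] = L2_measurable[OF d_L2]
  have dn: "nm (d k) \<le> (1/4)^k" for k
    unfolding d_def
    by (rule less_imp_le, rule N) (use rN[of k] in \<open>simp_all add: r_Suc max_def\<close>)
  have "(\<integral>\<^sup>+x. (\<Sum>k. ennreal (4^k * (d k x)\<^sup>2)) \<partial>lborel) = (\<Sum>k. \<integral>\<^sup>+x. ennreal (4^k * (d k x)\<^sup>2) \<partial>lborel)"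
    by (rule nn_integral_suminf) measurable
  also have "\<dots> \<le> (\<Sum>k. ennreal ((1/4)^k))"
  proof (rule suminf_le)
    fix k
    have "(\<integral>\<^sup>+x. ennreal (4^k * (d k x)\<^sup>2) \<partial>lborel) = ennreal (LINT x|lborel. 4^k * (d k x)\<^sup>2)"
      by (rule nn_integral_eq_integral) (use L2_integrable_square[OF d_L2] in auto)
    also have "(LINT x|lborel. 4^k * (d k x)\<^sup>2) = 4^k * (nm (d k))\<^sup>2"
      by (simp add: nm_square ip_def flip: power2_eq_square)
    also have "\<dots> \<le> 4^k * ((1/4)^k)\<^sup>2"
      by (intro mult_left_mono power_mono dn) auto
    also have "\<dots> = (1/4)^k" by (simp add: power2_eq_square power_one_over field_simps)
    finally show "(\<integral>\<^sup>+x. ennreal (4^k * (d k x)\<^sup>2) \<partial>lborel) \<le> ennreal ((1/4)^k)"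
      by (simp add: ennreal_leI)
  qed auto
  also have "\<dots> = ennreal (\<Sum>k. (1/4)^k)"
    by (rule suminf_ennreal2) (auto intro: summable_geometric)
  also have "\<dots> < \<infinity>" by simp
  finally have "AE x in lborel. (\<Sum>k. ennreal (4^k * (d k x)\<^sup>2)) \<noteq> \<infinity>"
    by (intro nn_integral_noteq_infinite) auto
  then have conv: "AE x in lborel. convergent (\<lambda>k. f (r k) x)"
  proof (eventually_elim)
    case (elim x)
    have s: "summable (\<lambda>k. 4^k * (d k x)\<^sup>2)"
      using elim by (intro summable_suminf_not_top) auto
    have "summable (\<lambda>k. d k x)"
    proof (rule summable_comparison_test)
      show "summable (\<lambda>k. 4^k * (d k x)\<^sup>2 + (1/4)^k)"
        by (intro summable_add s summable_geometric) simp
      have "norm (d k x) \<le> 4^k * (d k x)\<^sup>2 + (1/4)^k" for k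
      proof -
        \<comment> \<open>By the inequality between arithmetic and geometric mean, 2|d| is at most
          4^k d^2 + 4^-k, so summability of the weighted squares gives absolute summability of the
          increments.\<close>
        have "2 * (2^k * \<bar>d k x\<bar>) * (1/2)^k \<le> (2^k * \<bar>d k x\<bar>)\<^sup>2 + ((1/2)^k)\<^sup>2"
          by (rule sum_squares_bound)
        moreover have "(2^k)\<^sup>2 = (4::real)^k" "((1/2)^k)\<^sup>2 = (1/4::real)^k"
          by (simp_all add: power2_eq_square flip: power_mult_distrib)
        moreover have "2 * (2^k * \<bar>d k x\<bar>) * (1/2)^k = 2 * \<bar>d k x\<bar>" by (simp add: power_one_over)
        ultimately show ?thesis by (simp add: power_mult_distrib)
      qed
      then show "\<exists>N. \<forall>n\<ge>N. norm (d n x) \<le> 4^n * (d n x)\<^sup>2 + (1/4)^n" by blast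
    qed
    then have "convergent (\<lambda>n. \<Sum>k<n. d k x)" by (simp add: summable_iff_convergent)
    then have "convergent (\<lambda>n. f (r 0) x + (\<Sum>k<n. d k x))" by (intro convergent_add convergent_const)
    moreover have "f (r 0) x + (\<Sum>k<n. d k x) = f (r n) x" for n
      by (induction n) (auto simp: d_def)
    ultimately show ?case by simp
  qed
  define g where "g x = lim (\<lambda>k. f (r k) x)" for x
  have [measurable]: "g \<in> borel_measurable borel" unfolding g_def by measurable
  have lim: "AE x in lborel. (\<lambda>k. f (r k) x) \<longlonglongrightarrow> g x"
    using conv by eventually_elim (simp add: g_def convergent_LIMSEQ_iff)
  \<comment> \<open>Almost everywhere convergence holds only along the subsequence r; Fatou's lemma
    along it compares g with every f n, which then yields convergence in norm of the whole
    sequence.\<close>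
  have fatou: "(\<integral>\<^sup>+x. ennreal ((f n x - g x)\<^sup>2) \<partial>lborel) \<le> ennreal (e\<^sup>2)"
    if e: "e > 0" "\<And>m. m \<ge> n0 \<Longrightarrow> nm (\<lambda>x. f n x - f m x) \<le> e" for n n0 e
  proof -
    have "(\<integral>\<^sup>+x. ennreal ((f n x - g x)\<^sup>2) \<partial>lborel) = (\<integral>\<^sup>+x. liminf (\<lambda>k. ennreal ((f n x - f (r k) x)\<^sup>2)) \<partial>lborel)"
    proof (rule nn_integral_cong_AE)
      show "AE x in lborel. ennreal ((f n x - g x)\<^sup>2) = liminf (\<lambda>k. ennreal ((f n x - f (r k) x)\<^sup>2))"
        using lim
      proof eventually_elim
        case (elim x)
        have "(\<lambda>k. ennreal ((f n x - f (r k) x)\<^sup>2)) \<longlonglongrightarrow> ennreal ((f n x - g x)\<^sup>2)"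
          by (intro tendsto_intros elim)
        from lim_imp_Liminf[OF _ this] show ?case by simp
      qed
    qed
    also have "\<dots> \<le> liminf (\<lambda>k. \<integral>\<^sup>+x. ennreal ((f n x - f (r k) x)\<^sup>2) \<partial>lborel)"
      by (rule nn_integral_liminf) measurable
    also have "\<dots> \<le> liminf (\<lambda>k. ennreal (e\<^sup>2))"
    proof (rule Liminf_mono)
      show "\<forall>\<^sub>F k in sequentially. (\<integral>\<^sup>+x. ennreal ((f n x - f (r k) x)\<^sup>2) \<partial>lborel) \<le> ennreal (e\<^sup>2)"
      proof (rule eventually_sequentiallyI)
        fix k assume "k \<ge> n0"
        then have "r k \<ge> n0" using seq_suble[OF r_mono, of k] by linarith
        have "(\<integral>\<^sup>+x. ennreal ((f n x - f (r k) x)\<^sup>2) \<partial>lborel) = ennreal ((nm (\<lambda>x. f n x - f (r k) x))\<^sup>2)"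
          unfolding nm_square ip_def power2_eq_square[symmetric]
          by (rule nn_integral_eq_integral) (use L2_integrable_square[OF L2_diff[OF L2 L2]] in auto)
        also have "\<dots> \<le> ennreal (e\<^sup>2)"
          by (intro ennreal_leI power_mono e(2) \<open>r k \<ge> n0\<close>) auto
        finally show "(\<integral>\<^sup>+x. ennreal ((f n x - f (r k) x)\<^sup>2) \<partial>lborel) \<le> ennreal (e\<^sup>2)" .
      qed
    qed
    also have "\<dots> = ennreal (e\<^sup>2)" by (simp add: Liminf_const)
    finally show ?thesis .
  qed
  have ex: "\<exists>n0. \<forall>n\<ge>n0. (\<integral>\<^sup>+x. ennreal ((f n x - g x)\<^sup>2) \<partial>lborel) \<le> ennreal (e\<^sup>2)" if "e > 0" for e
    using Cauchy[OF that] fatou[OF that] by (meson less_imp_le)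
  have diffL2: "(\<lambda>x. f n x - g x) \<in> L2" if "(\<integral>\<^sup>+x. ennreal ((f n x - g x)\<^sup>2) \<partial>lborel) \<le> ennreal (e\<^sup>2)" for n e
    using le_less_trans[OF that ennreal_less_top] by (auto simp: L2_iff integrable_iff_bounded)
  obtain n0 where n0: "(\<integral>\<^sup>+x. ennreal ((f n0 x - g x)\<^sup>2) \<partial>lborel) \<le> ennreal (1\<^sup>2)"
    using ex[of 1] by auto
  have gL2: "g \<in> L2"
    using L2_diff[OF L2[of n0] diffL2[OF n0]] by simp
  moreover have "(\<lambda>n. nm (\<lambda>x. f n x - g x)) \<longlonglongrightarrow> 0"
  proof (rule LIMSEQ_I)
    fix e :: real assume "e > 0"
    obtain n0 where n0: "\<And>n. n \<ge> n0 \<Longrightarrow> (\<integral>\<^sup>+x. ennreal ((f n x - g x)\<^sup>2) \<partial>lborel) \<le> ennreal ((e/2)\<^sup>2)"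
      using ex[of "e/2"] \<open>e > 0\<close> by auto
    have "nm (\<lambda>x. f n x - g x) < e" if "n \<ge> n0" for n
    proof -
      have "(\<integral>\<^sup>+x. ennreal ((f n x - g x)\<^sup>2) \<partial>lborel) = ennreal ((nm (\<lambda>x. f n x - g x))\<^sup>2)"
        unfolding nm_square ip_def power2_eq_square[symmetric]
        by (rule nn_integral_eq_integral) (use L2_integrable_square[OF L2_diff[OF L2 gL2]] in auto)
      then have "(nm (\<lambda>x. f n x - g x))\<^sup>2 \<le> (e/2)\<^sup>2" using n0[OF that] by (simp add: ennreal_le_iff)
      then have "nm (\<lambda>x. f n x - g x) \<le> e / 2" by (rule power2_le_imp_le) (use \<open>e > 0\<close> in simp)
      then show ?thesis using \<open>e > 0\<close> by simp
    qed
    then show "\<exists>n0. \<forall>n\<ge>n0. norm (nm (\<lambda>x. f n x - g x) - 0) < e" by auto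
  qed
  ultimately show ?thesis by (rule that)
qed

lemma nm_tendsto:
  assumes "\<And>n. f n \<in> L2" "g \<in> L2" "(\<lambda>n. nm (\<lambda>x. f n x - g x)) \<longlonglongrightarrow> 0"
  shows "(\<lambda>n. nm (f n)) \<longlonglongrightarrow> nm g"
proof (rule LIM_zero_cancel, rule Lim_null_comparison[OF _ assms(3)])
  have "\<bar>nm (f n) - nm g\<bar> \<le> nm (\<lambda>x. f n x - g x)" for n
    using nm_triangle[OF L2_diff[OF assms(1,2)] assms(2), of n]
      nm_triangle[OF L2_diff[OF assms(2) assms(1)[of n]] assms(1)[of n]] nm_diff_commute[of "f n" g] by auto
  then show "\<forall>\<^sub>F n in sequentially. norm (nm (f n) - nm g) \<le> nm (\<lambda>x. f n x - g x)" by simp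
qed

lemma ip_tendsto_left:
  assumes "\<And>n. f n \<in> L2" "g \<in> L2" "h \<in> L2" "(\<lambda>n. nm (\<lambda>x. f n x - g x)) \<longlonglongrightarrow> 0"
  shows "(\<lambda>n. ip (f n) h) \<longlonglongrightarrow> ip g h"
proof (rule LIM_zero_cancel, rule Lim_null_comparison)
  show "(\<lambda>n. nm (\<lambda>x. f n x - g x) * nm h) \<longlonglongrightarrow> 0"
    using tendsto_mult_right[OF assms(4), of "nm h"] by simp
  show "\<forall>\<^sub>F n in sequentially. norm (ip (f n) h - ip g h) \<le> nm (\<lambda>x. f n x - g x) * nm h"
    using ip_Cauchy_Schwarz[OF L2_diff[OF assms(1,2)] assms(3)] assms by (simp add: ip_diff_left)
qed

lemma parallelogram:
  assumes "f \<in> L2" "g \<in> L2"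
  shows "(nm (\<lambda>x. f x - g x))\<^sup>2 = 2 * (nm f)\<^sup>2 + 2 * (nm g)\<^sup>2 - 4 * (nm (\<lambda>x. (1/2) * f x + (1/2) * g x))\<^sup>2"
proof -
  have "(\<lambda>x. (1/2) * f x + (1/2) * g x) = (\<lambda>x. (1/2) * (f x + 1 * g x))" by (auto simp: field_simps)
  then have "(nm (\<lambda>x. (1/2) * f x + (1/2) * g x))\<^sup>2 = (1/4) * ip (\<lambda>x. f x + 1 * g x) (\<lambda>x. f x + 1 * g x)"
    by (simp only: nm_square ip_scale_left ip_scale_right)
  then show ?thesis
    using ip_add_square[OF assms, of 1] ip_diff_square[OF assms] by (simp add: nm_square)
qed

text \<open>Near-minimisers of the norm on a decreasing sequence of midpoint-convex sets form a Cauchy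
  sequence. Constant sequences give orthogonal projections; tails of a bounded sequence give
  weak limits.\<close>

lemma min_norm_sequence:
  fixes W :: "nat \<Rightarrow> ('a::euclidean_space \<Rightarrow> real) set"
  assumes L2: "\<And>n. W n \<subseteq> L2" and dec: "\<And>m n. m \<le> n \<Longrightarrow> W n \<subseteq> W m"
    and convex: "\<And>n f g. f \<in> W n \<Longrightarrow> g \<in> W n \<Longrightarrow> (\<lambda>x. (1/2) * f x + (1/2) * g x) \<in> W n"
    and bound: "\<And>n. \<exists>f\<in>W n. nm f \<le> M"
  obtains h g where "\<And>n. h n \<in> W n" "g \<in> L2" "(\<lambda>n. nm (\<lambda>x. h n x - g x)) \<longlonglongrightarrow> 0"
    "\<And>n f. f \<in> W n \<Longrightarrow> (nm (h n))\<^sup>2 \<le> (nm f)\<^sup>2 + inverse (real (Suc n))"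
proof -
  define d where "d n = Inf ((\<lambda>f. (nm f)\<^sup>2) ` W n)" for n
  have bdd: "bdd_below ((\<lambda>f. (nm f)\<^sup>2) ` W n)" for n by (rule bdd_belowI[of _ 0]) auto
  have ne: "W n \<noteq> {}" for n using bound by auto
  have d_le: "d n \<le> (nm f)\<^sup>2" if "f \<in> W n" for n f
    unfolding d_def using that by (intro cInf_lower bdd) auto
  have M: "d n \<le> M\<^sup>2" for n
  proof -
    obtain f where "f \<in> W n" "nm f \<le> M" using bound by blast
    then show ?thesis using d_le[of f n] power_mono[of "nm f" M 2] by auto
  qed
  have d_mono: "incseq d"
    unfolding incseq_def d_def
    by (intro allI impI cInf_superset_mono image_mono dec bdd) (use ne in auto)
  have "\<exists>f\<in>W n. (nm f)\<^sup>2 < d n + inverse (real (Suc n))" for n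
  proof -
    have "d n < d n + inverse (real (Suc n))" by simp
    then have "\<exists>y\<in>(\<lambda>f. (nm f)\<^sup>2) ` W n. y < d n + inverse (real (Suc n))"
      unfolding d_def[of n] by (intro cInf_lessD) (use ne in auto)
    then show ?thesis by blast
  qed
  then obtain h where h: "\<And>n. h n \<in> W n" "\<And>n. (nm (h n))\<^sup>2 < d n + inverse (real (Suc n))" by metis
  have hL2: "h n \<in> L2" for n using h L2 by blast
  \<comment> \<open>The midpoint of h m and h n lies in W m, so its squared norm is at least d m;
    the parallelogram identity turns this into a bound for the distance.\<close>
  have est: "(nm (\<lambda>x. h m x - h n x))\<^sup>2 \<le> 2 * (d n - d m) + 4 * inverse (real (Suc m))" if "m \<le> n" for m n
  proof -
    have "h n \<in> W m" using h dec[OF that] by blast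
    then have "d m \<le> (nm (\<lambda>x. (1/2) * h m x + (1/2) * h n x))\<^sup>2"
      by (intro d_le convex h)
    moreover have "inverse (real (Suc n)) \<le> inverse (real (Suc m))" using that by simp
    moreover have "2 * x + 2 * y - 4 * z \<le> 2 * (e' - d') + 4 * i"
      if "d' \<le> z" "j \<le> i" "x < d' + i" "y < e' + j" for d' z j i x y e' :: real
      using that by argo
    ultimately show ?thesis
      unfolding parallelogram[OF hL2 hL2] using h(2)[of m] h(2)[of n] by blast
  qed
  \<comment> \<open>The infima increase because the sets shrink, and M^2 bounds them; convergence
    makes d n - d m small.\<close>
  obtain l where l: "d \<longlonglongrightarrow> l" by (rule incseq_convergent[OF d_mono, of "M\<^sup>2"]) (use M in auto)
  have Cauchy: "\<exists>n0. \<forall>m\<ge>n0. \<forall>n\<ge>n0. nm (\<lambda>x. h m x - h n x) < e" if e: "e > 0" for e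
  proof -
    have "eventually (\<lambda>n. d n > l - e\<^sup>2/8 \<and> inverse (real (Suc n)) < e\<^sup>2/8) sequentially"
      by (intro eventually_conj order_tendstoD[OF l] order_tendstoD(2)[OF LIMSEQ_inverse_real_of_nat]) (use e in auto)
    then obtain n0 where n0: "\<And>n. n \<ge> n0 \<Longrightarrow> d n > l - e\<^sup>2/8" "\<And>n. n \<ge> n0 \<Longrightarrow> inverse (real (Suc n)) < e\<^sup>2/8"
      unfolding eventually_sequentially by blast
    have arith: "x < c" if "e' \<le> l'" "x \<le> 2 * (e' - d') + 4 * i" "l' - c/8 < d'" "i < c/8" "0 < c"
      for x c l' d' e' i :: real using that by argo
    have *: "nm (\<lambda>x. h m x - h n x) < e" if "m \<ge> n0" "n \<ge> n0" "m \<le> n" for m n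
    proof -
      have "d n \<le> l" by (rule incseq_le[OF d_mono l])
      then have "(nm (\<lambda>x. h m x - h n x))\<^sup>2 < e\<^sup>2"
        by (rule arith[OF _ est[OF that(3)] n0(1)[OF that(1)] n0(2)[OF that(1)] zero_less_power[OF e]])
      then show ?thesis using e by (simp add: power2_less_imp_less)
    qed
    have "nm (\<lambda>x. h m x - h n x) < e" if "m \<ge> n0" "n \<ge> n0" for m n
      using *[OF that] *[OF that(2,1)] nm_diff_commute[of "h m" "h n"] by (metis nle_le)
    then show ?thesis by blast
  qed
  obtain g where g: "g \<in> L2" "(\<lambda>n. nm (\<lambda>x. h n x - g x)) \<longlonglongrightarrow> 0"
    using L2_complete[of h, OF hL2 Cauchy] by blast
  show ?thesis
  proof (rule that[OF h(1) g])
    fix n f assume "f \<in> W n"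
    then show "(nm (h n))\<^sup>2 \<le> (nm f)\<^sup>2 + inverse (real (Suc n))"
      using h(2)[of n] d_le[of f n] by linarith
  qed
qed

text \<open>The set W n consists of the functions whose pairings satisfy every error bound that
  holds for all f k with k >= n. It is convex, decreasing in n and contains f n. Near-minimisers of
  the norm on these sets converge strongly, and their pairings are squeezed to T. Thus a weak limit
  is produced from completeness alone.\<close>

lemma weak_limit:
  fixes f :: "nat \<Rightarrow> 'a::euclidean_space \<Rightarrow> real"
  assumes f: "\<And>n. f n \<in> L2" "\<And>n. nm (f n) \<le> M" and \<Phi>: "\<Phi> \<subseteq> L2"
    and conv: "\<And>\<phi>. \<phi> \<in> \<Phi> \<Longrightarrow> (\<lambda>n. ip (f n) \<phi>) \<longlonglongrightarrow> T \<phi>"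
  obtains g where "g \<in> L2" "\<And>\<phi>. \<phi> \<in> \<Phi> \<Longrightarrow> ip g \<phi> = T \<phi>"
proof -
  define W where "W n = {h\<in>L2. \<forall>\<phi>\<in>\<Phi>. \<forall>e. (\<forall>k\<ge>n. \<bar>ip (f k) \<phi> - T \<phi>\<bar> \<le> e) \<longrightarrow> \<bar>ip h \<phi> - T \<phi>\<bar> \<le> e}" for n
  have fW: "f n \<in> W n" for n by (auto simp: W_def f)
  obtain h g where h: "\<And>n. h n \<in> W n" "g \<in> L2" "(\<lambda>n. nm (\<lambda>x. h n x - g x)) \<longlonglongrightarrow> 0"
    "\<And>n f. f \<in> W n \<Longrightarrow> (nm (h n))\<^sup>2 \<le> (nm f)\<^sup>2 + inverse (real (Suc n))"
  proof (rule min_norm_sequence[of W M])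
    show "W n \<subseteq> L2" for n by (auto simp: W_def)
    show "W n \<subseteq> W m" if "m \<le> n" for m n using that by (fastforce simp: W_def)
    show "\<exists>f\<in>W n. nm f \<le> M" for n using fW f by blast
    show "(\<lambda>x. (1/2) * a x + (1/2) * b x) \<in> W n" if "a \<in> W n" "b \<in> W n" for n a b
    proof -
      have ab: "a \<in> L2" "b \<in> L2" using that by (auto simp: W_def)
      have "\<bar>ip (\<lambda>x. (1/2) * a x + (1/2) * b x) \<phi> - T \<phi>\<bar> \<le> e"
        if "\<phi> \<in> \<Phi>" "\<forall>k\<ge>n. \<bar>ip (f k) \<phi> - T \<phi>\<bar> \<le> e" for \<phi> e
      proof -
        have "\<bar>ip a \<phi> - T \<phi>\<bar> \<le> e" "\<bar>ip b \<phi> - T \<phi>\<bar> \<le> e"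
          using that \<open>a \<in> W n\<close> \<open>b \<in> W n\<close> by (auto simp: W_def)
        then show ?thesis
          using \<Phi> that(1) ab by (subst ip_lin_left) auto
      qed
      with L2_add[OF L2_scale[OF ab(1), of "1/2"] L2_scale[OF ab(2), of "1/2"]] show ?thesis unfolding W_def by blast
    qed
  qed blast
  have hL2: "h n \<in> L2" for n using h(1) by (auto simp: W_def)
  show ?thesis
  proof (rule that[OF h(2)])
    fix \<phi> assume p: "\<phi> \<in> \<Phi>"
    have "(\<lambda>n. ip (h n) \<phi>) \<longlonglongrightarrow> ip g \<phi>"
      by (rule ip_tendsto_left) (use h hL2 \<Phi> p in auto)
    moreover have "(\<lambda>n. ip (h n) \<phi>) \<longlonglongrightarrow> T \<phi>"
    proof (rule LIMSEQ_I)
      fix e :: real assume "e > 0"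
      then obtain n0 where "\<forall>n\<ge>n0. norm (ip (f n) \<phi> - T \<phi>) < e/2"
        using LIMSEQ_D[OF conv[OF p], of "e/2"] by auto
      then have "\<bar>ip (h n) \<phi> - T \<phi>\<bar> \<le> e/2" if "n \<ge> n0" for n
      proof -
        have "\<forall>k\<ge>n. \<bar>ip (f k) \<phi> - T \<phi>\<bar> \<le> e/2"
          using \<open>\<forall>n\<ge>n0. _ n\<close> that by (metis le_trans less_imp_le real_norm_def)
        then show ?thesis using h(1)[of n] p unfolding W_def by blast
      qed
      then show "\<exists>n0. \<forall>n\<ge>n0. norm (ip (h n) \<phi> - T \<phi>) < e" using \<open>e > 0\<close> by force
    qed
    ultimately show "ip g \<phi> = T \<phi>" by (rule LIMSEQ_unique)
  qed
qed

text \<open>This is the projection argument without closing the subspace: the strong limit g of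
  near-minimisers of the norm on u - S is orthogonal to S, so \<open>nm g = 0\<close>, and the
  near-minimisers themselves are the small differences u - \<phi>.\<close>

lemma dense_from_orthogonal:
  fixes S :: "('a::euclidean_space \<Rightarrow> real) set"
  assumes S: "S \<subseteq> L2" "(\<lambda>x. 0) \<in> S"
    and lin: "\<And>f g a b. f \<in> S \<Longrightarrow> g \<in> S \<Longrightarrow> (\<lambda>x. a * f x + b * g x) \<in> S"
    and orth: "\<And>g. g \<in> L2 \<Longrightarrow> (\<And>\<phi>. \<phi> \<in> S \<Longrightarrow> ip g \<phi> = 0) \<Longrightarrow> nm g = 0"
    and u: "u \<in> L2" and e: "e > 0"
  obtains \<phi> where "\<phi> \<in> S" "nm (\<lambda>x. u x - \<phi> x) < e"
proof -
  define W where "W = (\<lambda>\<phi> x. u x - \<phi> x) ` S"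
  have WL2: "W \<subseteq> L2" using S u by (auto simp: W_def intro!: L2_diff)
  obtain h g where h: "\<And>n. h n \<in> W" "g \<in> L2" "(\<lambda>n. nm (\<lambda>x. h n x - g x)) \<longlonglongrightarrow> 0"
     "\<And>n f. f \<in> W \<Longrightarrow> (nm (h n))\<^sup>2 \<le> (nm f)\<^sup>2 + inverse (real (Suc n))"
  proof (rule min_norm_sequence[of "\<lambda>n. W" "nm u"])
    show "\<exists>f\<in>W. nm f \<le> nm u"
      by (rule bexI[of _ u]) (use S in \<open>auto simp: W_def image_iff intro!: bexI[of _ "\<lambda>x. 0"]\<close>)
    show "(\<lambda>x. (1/2) * a x + (1/2) * b x) \<in> W" if ab: "a \<in> W" "b \<in> W" for a b
    proof -
      obtain p q where "p \<in> S" "q \<in> S" "a = (\<lambda>x. u x - p x)" "b = (\<lambda>x. u x - q x)"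
        using ab by (auto simp: W_def)
      then show ?thesis
        unfolding W_def image_iff
        by (intro bexI[of _ "\<lambda>x. (1/2) * p x + (1/2) * q x"] lin) (auto simp: field_simps)
    qed
  qed (use WL2 in auto)
  have hL2: "h n \<in> L2" for n using h(1) WL2 by blast
  have "ip g \<phi> = 0" if p: "\<phi> \<in> S" for \<phi>
  proof -
    have pL2: "\<phi> \<in> L2" using p S by blast
    have ineq: "0 \<le> 2 * t * ip g \<phi> + t\<^sup>2 * ip \<phi> \<phi>" for t
    proof -
      have "0 \<le> 2 * t * ip (h n) \<phi> + t\<^sup>2 * ip \<phi> \<phi> + inverse (real (Suc n))" for n
      proof -
        obtain q where q: "q \<in> S" "h n = (\<lambda>x. u x - q x)" using h(1)[of n] by (auto simp: W_def)
        have "(\<lambda>x. h n x + t * \<phi> x) \<in> W"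
          unfolding W_def image_iff using q
          by (intro bexI[of _ "\<lambda>x. 1 * q x + (- t) * \<phi> x"] lin p) auto
        from h(4)[OF this, of n] show ?thesis
          by (simp add: nm_square ip_add_square[OF hL2 pL2])
      qed
      moreover have "(\<lambda>n. 2 * t * ip (h n) \<phi> + t\<^sup>2 * ip \<phi> \<phi> + inverse (real (Suc n))) \<longlonglongrightarrow> 2 * t * ip g \<phi> + t\<^sup>2 * ip \<phi> \<phi> + 0"
        by (intro tendsto_intros ip_tendsto_left hL2 h pL2 LIMSEQ_inverse_real_of_nat)
      ultimately have "0 \<le> 2 * t * ip g \<phi> + t\<^sup>2 * ip \<phi> \<phi> + 0"
        by (intro LIMSEQ_le_const) auto
      then show ?thesis by simp
    qed
    show ?thesis
    proof (rule ccontr)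
      assume n: "ip g \<phi> \<noteq> 0"
      have c: "ip \<phi> \<phi> + 1 > 0" using ip_nonneg[of \<phi>] by linarith
      define b c where "b = ip g \<phi>" and "c = ip \<phi> \<phi>"
      \<comment> \<open>The minimising parameter would be b / c; adding 1 avoids a vanishing
        denominator and still makes the quadratic negative at -s.\<close>
      define s where "s = b / (c + 1)"
      have b: "b = s * (c + 1)" using c by (simp add: s_def c_def)
      have "2 * (- s) * b + (- s)\<^sup>2 * c = - (s\<^sup>2 * (c + 2))"
        unfolding b by (simp add: power2_eq_square algebra_simps)
      moreover have "s\<^sup>2 * (c + 2) > 0"
        using n b ip_nonneg[of \<phi>] by (auto simp: b_def c_def intro!: mult_pos_pos)
      ultimately show False using ineq[of "- s"] by (simp add: b_def c_def)
    qed
  qed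
  then have "nm g = 0" by (intro orth h)
  then have "(\<lambda>n. nm (h n)) \<longlonglongrightarrow> 0" using nm_tendsto[OF hL2 h(2,3)] by simp
  from order_tendstoD(2)[OF this e] obtain n where "nm (h n) < e" by (auto simp: eventually_sequentially)
  moreover obtain q where q: "q \<in> S" "h n = (\<lambda>x. u x - q x)" using h(1)[of n] by (auto simp: W_def)
  ultimately show ?thesis using that[of q] by simp
qed

section \<open>Translations, local integrability and difference quotients of test functions\<close>

lemma integral_translate: "(LINT x|lborel. f (x + h)) = (LINT x|lborel. f (x::'a::euclidean_space) :: real)"
proof (cases "f \<in> borel_measurable borel")
  case True
  have "(LINT x|lborel. f x) = (LINT x|distr lborel borel ((+) h). f x)" by (simp add: lborel_distr_plus)
  also have "\<dots> = (LINT x|lborel. f (h + x))" by (rule integral_distr) (use True in auto)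
  finally show ?thesis by (simp add: add.commute)
next
  \<comment> \<open>A nonmeasurable integrand has a nonmeasurable translate, and both integrals then
    have the default value 0.\<close>
  case False
  have "(\<lambda>x. f (x + h)) \<notin> borel_measurable borel"
  proof
    assume "(\<lambda>x. f (x + h)) \<in> borel_measurable borel"
    then have "(\<lambda>x. f ((x - h) + h)) \<in> borel_measurable borel" using measurable_compose[of "\<lambda>x. x - h" borel borel "\<lambda>x. f (x + h)" borel] by simp
    with False show False by simp
  qed
  then have "\<not> integrable lborel (\<lambda>x. f (x + h))" "\<not> integrable lborel f"
    using False by (auto dest: borel_measurable_integrable)
  then show ?thesis by (simp add: not_integrable_integral_eq)
qed

lemma integrable_translate:
  "integrable lborel f \<Longrightarrow> integrable lborel (\<lambda>x::'a::euclidean_space. f (x + h) :: real)"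
proof -
  assume f: "integrable lborel f"
  then have "integrable (distr lborel borel ((+) h)) f" by (simp add: lborel_distr_plus)
  then have "integrable lborel (\<lambda>x. f (h + x))" by (rule integrable_distr[rotated]) auto
  then show ?thesis by (simp add: add.commute)
qed

lemma L2_translate: "f \<in> L2 \<Longrightarrow> (\<lambda>x::'a::euclidean_space. f (x + h) :: real) \<in> L2"
  using integrable_translate[of "\<lambda>x. (f x)\<^sup>2" h] by (auto simp: L2_iff)

lemma ip_translate: "ip (\<lambda>x. f (x + h)) (\<lambda>x. g (x + h)) = ip f g"
  unfolding ip_def by (rule integral_translate)

lemma ip_translate_left: "ip (\<lambda>x. f (x + h)) g = ip f (\<lambda>x. g (x - h))"
  using ip_translate[of f h "\<lambda>x. g (x - h)"] by simp

lemma nm_translate: "nm (\<lambda>x. f (x + h)) = nm f"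
  by (simp add: nm_def ip_translate)

text \<open>The class in which pairings with test functions are defined: it contains
  \<open>L2\<close>, the integrable products of two \<open>L2\<close> functions, and the
  constants.\<close>

definition locint :: "('a::euclidean_space \<Rightarrow> real) \<Rightarrow> bool" where
  "locint u \<longleftrightarrow> u \<in> borel_measurable borel \<and> (\<forall>R. integrable lborel (\<lambda>x. indicator (cball 0 R) x * u x))"

lemma locint_measurable [measurable_dest]: "locint u \<Longrightarrow> u \<in> borel_measurable borel"
  by (simp add: locint_def)

lemma indicator_L2: "A \<in> sets borel \<Longrightarrow> bounded A \<Longrightarrow> (indicator A :: 'a::euclidean_space \<Rightarrow> real) \<in> L2"
proof -
  assume [measurable]: "A \<in> sets borel" and "bounded A"
  then have "emeasure lborel A < \<infinity>" by (intro emeasure_bounded_finite)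
  moreover have "(\<lambda>x. (indicator A x :: real)\<^sup>2) = indicator A" by (auto simp: indicator_def)
  ultimately show ?thesis by (auto simp: L2_iff)
qed

lemma L2_locint: "u \<in> L2 \<Longrightarrow> locint u"
  unfolding locint_def by (auto intro!: L2_integrable_mult indicator_L2)

lemma integrable_locint: "integrable lborel u \<Longrightarrow> locint u"
  unfolding locint_def
  by (auto intro!: Bochner_Integration.integrable_bound[of lborel u] simp: indicator_def)

lemma locint_const: "locint (\<lambda>x. c)"
  unfolding locint_def
proof (intro conjI allI)
  show "integrable lborel (\<lambda>x::'a. indicator (cball 0 R) x * c)" for R
    by (rule integrable_bounded_support[where B="\<bar>c\<bar>" and R=R]) (auto simp: indicator_def)
qed simp

lemma locint_mult_integrable:
  assumes u: "locint u" and [measurable]: "f \<in> borel_measurable borel"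
    and f: "\<And>x. \<bar>f x\<bar> \<le> B" "\<And>x. norm x > R \<Longrightarrow> f x = 0"
  shows "integrable lborel (\<lambda>x. u x * f x)"
proof (rule Bochner_Integration.integrable_bound)
  show "integrable lborel (\<lambda>x. B * (indicator (cball 0 R) x * u x))"
    using u by (simp add: locint_def)
  show "AE x in lborel. norm (u x * f x) \<le> norm (B * (indicator (cball 0 R) x * u x))"
  proof (intro AE_I2)
    fix x
    have "B \<ge> 0" using f(1)[of x] by linarith
    then show "norm (u x * f x) \<le> norm (B * (indicator (cball 0 R) x * u x))"
      using f(1)[of x] f(2)[of x] 
      by (cases "norm x > R") (auto simp: abs_mult mult.commute intro!: mult_right_mono)
  qed
qed (use u in measurable)

lemma locint_test_integrable: "locint u \<Longrightarrow> \<phi> \<in> test_functions \<Longrightarrow> integrable lborel (\<lambda>x. u x * \<phi> x)"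
proof -
  assume a: "locint u" "\<phi> \<in> test_functions"
  obtain B where "\<And>x. \<bar>\<phi> x\<bar> \<le> B" using test_bounded[OF a(2)] by blast
  moreover obtain R where "\<And>x. norm x > R \<Longrightarrow> \<phi> x = 0" using test_support[OF a(2)] by blast
  ultimately show ?thesis using locint_mult_integrable[OF a(1) test_measurable[OF a(2)]] by blast
qed

text \<open>Dominated convergence: the quotients of \<phi> are bounded by its Lipschitz constant
  times \<open>norm v\<close> and vanish off a fixed ball. Weak statements about derivatives of u
  are obtained by moving quotients onto \<phi> and passing to the limit here.\<close>

lemma difference_quotient_test:
  fixes u :: "real^'n::finite \<Rightarrow> real"
  assumes u: "locint u" and \<phi>: "\<phi> \<in> test_functions"
  shows "((\<lambda>t. (LINT x|lborel. u x * ((\<phi> (x + t *\<^sub>R v) - \<phi> x) / t))) \<longlongrightarrow>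
    (LINT x|lborel. u x * (\<Sum>i\<in>UNIV. v $ i * partial_deriv i \<phi> x))) (at 0)"
proof -
  note [measurable] = locint_measurable[OF u] test_measurable[OF \<phi>] test_measurable[OF test_partial[OF \<phi>]]
  obtain L where L: "L > 0" "\<And>x y. \<bar>\<phi> x - \<phi> y\<bar> \<le> L * norm (x - y)" using test_Lipschitz[OF \<phi>] by blast
  obtain R where R: "R > 0" "\<And>x. norm x > R \<Longrightarrow> \<phi> x = 0" using test_support[OF \<phi>] by blast
  let ?R = "R + norm v"
  \<comment> \<open>Restricting to |t| < 1 keeps the supports of all translates in the ball of
    radius ?R; the restriction is removed at the end because the interval is open around 0.\<close>
  have "((\<lambda>t. (LINT x|lborel. u x * ((\<phi> (x + t *\<^sub>R v) - \<phi> x) / t))) \<longlongrightarrow>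
    (LINT x|lborel. u x * (\<Sum>i\<in>UNIV. v $ i * partial_deriv i \<phi> x))) (at 0 within {-1<..<1})"
    unfolding tendsto_at_iff_sequentially o_def
  proof (intro allI impI)
    fix t :: "nat \<Rightarrow> real"
    assume t: "\<forall>i. t i \<in> {- 1<..<1} - {0}" "t \<longlonglongrightarrow> 0"
    show "(\<lambda>i. LINT x|lborel. u x * ((\<phi> (x + t i *\<^sub>R v) - \<phi> x) / t i)) \<longlonglongrightarrow>
      (LINT x|lborel. u x * (\<Sum>i\<in>UNIV. v $ i * partial_deriv i \<phi> x))"
    proof (rule integral_dominated_convergence)
      show "integrable lborel (\<lambda>x. (L * norm v) * \<bar>indicator (cball 0 ?R) x * u x\<bar>)"
        using u by (intro integrable_mult_right integrable_abs) (simp add: locint_def)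
      show "AE x in lborel. norm (u x * ((\<phi> (x + t k *\<^sub>R v) - \<phi> x) / t k)) \<le> L * norm v * \<bar>indicator (cball 0 ?R) x * u x\<bar>" for k
      proof (intro AE_I2)
        fix x
        have tk: "t k \<noteq> 0" "\<bar>t k\<bar> < 1" using t(1)[rule_format, of k] by (auto simp: abs_if)
        show "norm (u x * ((\<phi> (x + t k *\<^sub>R v) - \<phi> x) / t k)) \<le> L * norm v * \<bar>indicator (cball 0 ?R) x * u x\<bar>"
        proof (cases "norm x \<le> ?R")
          case True
          have "\<bar>\<phi> (x + t k *\<^sub>R v) - \<phi> x\<bar> \<le> L * (\<bar>t k\<bar> * norm v)"
            using L(2)[of "x + t k *\<^sub>R v" x] by simp
          then have "\<bar>(\<phi> (x + t k *\<^sub>R v) - \<phi> x) / t k\<bar> \<le> L * norm v"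
            using tk(1) by (simp add: field_simps)
          from mult_left_mono[OF this, of "\<bar>u x\<bar>"] show ?thesis
            using True by (simp add: abs_mult mult_ac)
        next
          case False
          have "norm (t k *\<^sub>R v) \<le> norm v" using tk(2) mult_right_mono[of "\<bar>t k\<bar>" 1 "norm v"] by simp
          then have "norm (x + t k *\<^sub>R v) > R" using False norm_diff_ineq[of x "t k *\<^sub>R v"] by linarith
          moreover have "norm x > R" using False norm_ge_zero[of v] by linarith
          ultimately show ?thesis using R(2) L(1) by simp
        qed
      qed
      show "AE x in lborel. (\<lambda>i. u x * ((\<phi> (x + t i *\<^sub>R v) - \<phi> x) / t i)) \<longlonglongrightarrow> u x * (\<Sum>i\<in>UNIV. v $ i * partial_deriv i \<phi> x)"
      proof (intro AE_I2 tendsto_mult tendsto_const)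
        fix x
        have "((\<lambda>s. x + s *\<^sub>R v) has_derivative (\<lambda>s. s *\<^sub>R v)) (at 0)"
          by (auto intro!: derivative_eq_intros)
        from has_derivative_compose[OF this smooth_has_derivative[OF test_smooth[OF \<phi>]]]
        have "((\<lambda>s. \<phi> (x + s *\<^sub>R v)) has_derivative (\<lambda>s. (\<Sum>i\<in>UNIV. v $ i * partial_deriv i \<phi> x) * s)) (at 0)"
          by (simp add: sum_distrib_left mult_ac)
        then have "((\<lambda>s. \<phi> (x + s *\<^sub>R v)) has_real_derivative (\<Sum>i\<in>UNIV. v $ i * partial_deriv i \<phi> x)) (at 0)"
          by (simp add: has_field_derivative_def)
        then have "((\<lambda>s. (\<phi> (x + s *\<^sub>R v) - \<phi> x) / s) \<longlongrightarrow> (\<Sum>i\<in>UNIV. v $ i * partial_deriv i \<phi> x)) (at 0)"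
          by (simp add: DERIV_def)
        moreover have "filterlim t (at 0) sequentially"
          using t by (auto simp: filterlim_at)
        ultimately show "(\<lambda>i. (\<phi> (x + t i *\<^sub>R v) - \<phi> x) / t i) \<longlonglongrightarrow> (\<Sum>i\<in>UNIV. v $ i * partial_deriv i \<phi> x)"
          by (rule filterlim_compose)
      qed
    qed measurable
  qed
  then show ?thesis by (subst (asm) at_within_open) auto
qed

text \<open>The previous limit with u = 1: translation invariance makes the integral of every
  difference quotient zero. Integration by parts for smooth functions is derived from this.\<close>

lemma integral_partial_deriv_test: "\<phi> \<in> test_functions \<Longrightarrow> (LINT x|lborel. partial_deriv i \<phi> x) = 0"
proof -
  assume \<phi>: "\<phi> \<in> test_functions"
  have "((\<lambda>t. (LINT x|lborel. 1 * ((\<phi> (x + t *\<^sub>R axis i 1) - \<phi> x) / t))) \<longlongrightarrow>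
    (LINT x|lborel. 1 * (\<Sum>j\<in>UNIV. axis i 1 $ j * partial_deriv j \<phi> x))) (at 0)"
    by (rule difference_quotient_test[OF locint_const \<phi>])
  moreover have "(LINT x|lborel. 1 * ((\<phi> (x + t *\<^sub>R axis i 1) - \<phi> x) / t)) = 0" for t
    by (simp add: integrable_translate[OF test_integrable[OF \<phi>]] test_integrable[OF \<phi>] integral_translate)
  ultimately have "((\<lambda>t::real. 0) \<longlongrightarrow> (LINT x|lborel. partial_deriv i \<phi> x)) (at 0)"
    by (simp only: sum_axis mult_1)
  then show ?thesis by (simp add: tendsto_const_iff)
qed

lemma test_integration_by_parts:
  assumes "\<phi> \<in> test_functions" "smooth \<psi>"
  shows "(LINT x|lborel. \<psi> x * partial_deriv i \<phi> x) = - (LINT x|lborel. partial_deriv i \<psi> x * \<phi> x)"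
proof -
  have "(LINT x|lborel. \<psi> x * partial_deriv i \<phi> x + partial_deriv i \<psi> x * \<phi> x) = 0"
    using integral_partial_deriv_test[OF test_mult[OF assms], of i]
    by (simp add: partial_deriv_smooth_mult assms test_smooth)
  moreover have "integrable lborel (\<lambda>x. \<psi> x * partial_deriv i \<phi> x)" "integrable lborel (\<lambda>x. partial_deriv i \<psi> x * \<phi> x)"
    using assms by (auto intro!: test_integrable test_mult test_partial)
  ultimately show ?thesis by simp
qed

section \<open>The fundamental lemma of the calculus of variations and density of test
  functions\<close>

definition boxbump :: "nat \<Rightarrow> real^'n::finite \<Rightarrow> real^'n \<Rightarrow> real^'n \<Rightarrow> real" where
  "boxbump n a b x = (\<Prod>i\<in>UNIV. eta 0 (real n * ((x $ i - a $ i) * (b $ i - x $ i))))"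

lemma eta_0_bounds: "0 \<le> eta 0 s" "eta 0 s \<le> 1" by (auto simp: eta_def)

lemma boxbump_bounds: "0 \<le> boxbump n a b x" "boxbump n a b x \<le> 1"
  unfolding boxbump_def by (auto intro!: prod_nonneg prod_le_1 eta_0_bounds)

lemma boxbump_test:
  assumes "\<And>i. a $ i \<le> b $ i"
  shows "boxbump n a b \<in> test_functions" and "x \<notin> box a b \<Longrightarrow> boxbump n a b x = 0"
proof -
  show out: "boxbump n a b x = 0" if "x \<notin> box a b" for x
  proof -
    obtain i where i: "x $ i \<le> a $ i \<or> b $ i \<le> x $ i"
      using \<open>x \<notin> box a b\<close> unfolding mem_box_cart by (meson not_le)
    then have "(x $ i - a $ i) * (b $ i - x $ i) \<le> 0"
      using assms[of i] by (auto simp: mult_le_0_iff)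
    then have "real n * ((x $ i - a $ i) * (b $ i - x $ i)) \<le> 0" by (simp add: mult_le_0_iff)
    then have "eta 0 (real n * ((x $ i - a $ i) * (b $ i - x $ i))) = 0" by (simp add: eta_def)
    then show ?thesis unfolding boxbump_def by (intro prod_zero) auto
  qed
  have "smooth (boxbump n a b)" unfolding boxbump_def by (intro smooth_prod smooth_eta smooth_mult smooth_diff) auto
  moreover have "{x. boxbump n a b x \<noteq> 0} \<subseteq> box a b" using out by blast
  ultimately show "boxbump n a b \<in> test_functions"
    unfolding test_functions_iff using bounded_box bounded_subset by blast
qed

text \<open>Inside the box each factor is exp(-1/(n s)) with a fixed s > 0 and tends to 1; outside,
  some factor is identically 0.\<close>

lemma boxbump_tendsto:
  assumes "\<And>i. a $ i \<le> b $ i"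
  shows "(\<lambda>n. boxbump n a b x) \<longlonglongrightarrow> indicator (box a b) x"
proof (cases "x \<in> box a b")
  case True
  have "(\<lambda>n. boxbump n a b x) \<longlonglongrightarrow> (\<Prod>i\<in>(UNIV::'a set). 1)"
    unfolding boxbump_def
  proof (intro tendsto_prod)
    fix i
    define s where "s = (x $ i - a $ i) * (b $ i - x $ i)"
    have s: "s > 0" using True by (auto simp: s_def mem_box_cart)
    have "(\<lambda>n. exp (- (inverse (real n) * inverse s))) \<longlonglongrightarrow> exp (- (0 * inverse s))"
      by (intro tendsto_intros lim_inverse_n)
    moreover have "eventually (\<lambda>n. exp (- (inverse (real n) * inverse s)) = eta 0 (real n * s)) sequentially"
      using eventually_gt_at_top[of 0] by eventually_elim (use s in \<open>auto simp: eta_def\<close>)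
    ultimately show "(\<lambda>n. eta 0 (real n * ((x $ i - a $ i) * (b $ i - x $ i)))) \<longlonglongrightarrow> 1"
      unfolding s_def[symmetric] by (simp add: tendsto_cong)
  qed
  with True show ?thesis by simp
qed (simp add: boxbump_test assms)

lemma integral_box_zero:
  fixes g :: "real^'n::finite \<Rightarrow> real"
  assumes g: "locint g" and z: "\<And>\<phi>. \<phi> \<in> test_functions \<Longrightarrow> (LINT x|lborel. g x * \<phi> x) = 0"
  shows "(LINT x|lborel. g x * indicator (box a b) x) = 0"
proof (cases "box a b = {}")
  case False
  then obtain y where "y \<in> box a b" by blast
  then have ab: "a $ i \<le> b $ i" for i
    unfolding mem_box_cart by (meson less_imp_le less_trans)
  note [measurable] = locint_measurable[OF g] test_measurable[OF boxbump_test(1)[OF ab]]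
  obtain R where R: "\<And>x. x \<in> box a b \<Longrightarrow> norm x \<le> R" using bounded_box[of a b] by (auto simp: bounded_iff)
  have "(\<lambda>n. LINT x|lborel. g x * boxbump n a b x) \<longlonglongrightarrow> (LINT x|lborel. g x * indicator (box a b) x)"
  proof (rule integral_dominated_convergence)
    show "integrable lborel (\<lambda>x. \<bar>g x * indicator (box a b) x\<bar>)"
      by (intro integrable_abs locint_mult_integrable[OF g, where B=1 and R=R])
        (use R in \<open>force simp: indicator_def\<close>)+
    show "AE x in lborel. (\<lambda>n. g x * boxbump n a b x) \<longlonglongrightarrow> g x * indicator (box a b) x"
      by (intro AE_I2 tendsto_intros boxbump_tendsto ab)
    show "AE x in lborel. norm (g x * boxbump n a b x) \<le> \<bar>g x * indicator (box a b) x\<bar>" for n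
    proof (intro AE_I2)
      fix x
      show "norm (g x * boxbump n a b x) \<le> \<bar>g x * indicator (box a b) x\<bar>"
        using boxbump_test(2)[OF ab, of x n] boxbump_bounds[of n a b x]
        by (cases "x \<in> box a b") (auto simp: abs_mult mult_left_le)
    qed
  qed measurable
  then show ?thesis using z[OF boxbump_test(1)[OF ab]] by (simp add: tendsto_const_iff)
qed simp

text \<open>The positive and the negative part of g are densities of two finite measures that agree
  on boxes, an intersection-stable generator; so the measures coincide, and densities are
  unique.\<close>

lemma AE_zero_if_boxes_zero:
  fixes g :: "real^'n::finite \<Rightarrow> real"
  assumes g: "integrable lborel g" and z: "\<And>a b. (LINT x|lborel. g x * indicator (box a b) x) = 0"
  shows "AE x in lborel. g x = 0"
proof -
  note [measurable] = borel_measurable_integrable[OF g]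
  let ?E = "range (\<lambda>(a, b). box a b :: (real^'n) set)"
  have fin: "(\<integral>\<^sup>+x. ennreal (f x) \<partial>lborel) < \<infinity>" if "f \<in> borel_measurable borel" "\<And>x. f x \<le> \<bar>g x\<bar>" for f
  proof -
    have "(\<integral>\<^sup>+x. ennreal (f x) \<partial>lborel) \<le> (\<integral>\<^sup>+x. ennreal (norm (g x)) \<partial>lborel)"
      using that by (intro nn_integral_mono ennreal_leI) auto
    then show ?thesis using g by (auto simp: integrable_iff_bounded)
  qed
  have "density lborel (\<lambda>x. ennreal (g x)) = density lborel (\<lambda>x. ennreal (- g x))"
  proof (rule measure_eqI_generator_eq[where E="?E" and \<Omega>=UNIV and A="\<lambda>n. box (\<chi> i. - real n) (\<chi> i. real n)"])
    show "Int_stable ?E" by (auto simp: Int_stable_def box_Int_box)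
    show "sets (density lborel (\<lambda>x. ennreal (g x))) = sigma_sets UNIV ?E"
      "sets (density lborel (\<lambda>x. ennreal (- g x))) = sigma_sets UNIV ?E"
      by (simp_all add: borel_eq_box)
    show "(\<Union>n. box (\<chi> i. - real n) (\<chi> i. real n) :: (real^'n) set) = UNIV"
    proof -
      have "\<exists>n. x \<in> box (\<chi> i. - real n) (\<chi> i. real n)" for x :: "real^'n"
      proof -
        obtain n where n: "norm x < real n" using reals_Archimedean2 by blast
        have "\<bar>x $ i\<bar> < real n" for i using component_le_norm_cart[of x i] n by linarith
        then show ?thesis by (intro exI[of _ n]) (simp add: mem_box_cart abs_less_iff minus_less_iff)
      qed
      then show ?thesis by auto
    qed
    show "emeasure (density lborel (\<lambda>x. ennreal (g x))) (box (\<chi> i. - real n) (\<chi> i. real n)) \<noteq> \<infinity>" for n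
    proof -
      have "emeasure (density lborel (\<lambda>x. ennreal (g x))) (box (\<chi> i. - real n) (\<chi> i. real n)) \<le> (\<integral>\<^sup>+x. ennreal (g x) \<partial>lborel)"
        by (simp add: emeasure_density indicator_def nn_integral_mono)
      also have "\<dots> < \<infinity>" by (rule fin) auto
      finally show ?thesis by simp
    qed
    fix X assume "X \<in> ?E"
    then obtain a b where X: "X = box a b" by auto
    have pos: "integrable lborel (\<lambda>x. g x * indicator X x)"
      using integrable_mult_indicator[OF _ g, of X] by (simp add: X mult.commute)
    have "(\<integral>\<^sup>+x. ennreal (g x) * indicator X x \<partial>lborel) = (\<integral>\<^sup>+x. ennreal (g x * indicator X x) \<partial>lborel)"
      "(\<integral>\<^sup>+x. ennreal (- g x) * indicator X x \<partial>lborel) = (\<integral>\<^sup>+x. ennreal (- (g x * indicator X x)) \<partial>lborel)"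
      by (auto intro!: nn_integral_cong simp: indicator_def)
    moreover have "(\<integral>\<^sup>+x. ennreal (g x * indicator X x) \<partial>lborel) = (\<integral>\<^sup>+x. ennreal (- (g x * indicator X x)) \<partial>lborel)"
    proof -
      have A: "(\<integral>\<^sup>+x. ennreal (g x * indicator X x) \<partial>lborel) < \<infinity>"
        by (rule fin) (auto simp: X indicator_def)
      have B: "(\<integral>\<^sup>+x. ennreal (- (g x * indicator X x)) \<partial>lborel) < \<infinity>"
        by (rule fin) (auto simp: X indicator_def)
      have "enn2real (\<integral>\<^sup>+x. ennreal (g x * indicator X x) \<partial>lborel) = enn2real (\<integral>\<^sup>+x. ennreal (- (g x * indicator X x)) \<partial>lborel)"
        using z[of a b] real_lebesgue_integral_def[OF pos] by (simp add: X)
      then show ?thesis using ennreal_enn2real[of "\<integral>\<^sup>+x. ennreal (g x * indicator X x) \<partial>lborel"]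
        ennreal_enn2real[of "\<integral>\<^sup>+x. ennreal (- (g x * indicator X x)) \<partial>lborel"] A B by simp
    qed
    ultimately show "emeasure (density lborel (\<lambda>x. ennreal (g x))) X = emeasure (density lborel (\<lambda>x. ennreal (- g x))) X"
      by (simp add: emeasure_density X)
  qed auto
  then have "AE x in lborel. ennreal (g x) = ennreal (- g x)"
    by (subst (asm) finite_density_unique) (use fin[of g] in \<open>auto simp: less_top[symmetric]\<close>)
  \<comment> \<open>Since \<open>ennreal\<close> sends negative reals to 0, the equation says that
    the positive and negative parts of g x agree, which forces g x = 0.\<close>
  then show ?thesis
  proof eventually_elim
    case (elim x)
    show ?case
    proof (cases "g x > 0")
      case True then show ?thesis using elim by (simp add: ennreal_neg)
    next
      case False then show ?thesis using elim by (simp add: ennreal_neg not_less)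
    qed
  qed
qed

lemma AE_zero_if_test_zero:
  fixes g :: "real^'n::finite \<Rightarrow> real"
  assumes g: "locint g" and z: "\<And>\<phi>. \<phi> \<in> test_functions \<Longrightarrow> (LINT x|lborel. g x * \<phi> x) = 0"
  shows "AE x in lborel. g x = 0"
proof -
  let ?B = "\<lambda>n::nat. box (\<chi> i. - real n) (\<chi> i. real n) :: (real^'n) set"
  note [measurable] = locint_measurable[OF g]
  have "AE x in lborel. g x * indicator (?B n) x = 0" for n
  proof (rule AE_zero_if_boxes_zero)
    obtain R where R: "\<And>x. x \<in> ?B n \<Longrightarrow> norm x \<le> R" using bounded_box by (metis bounded_iff)
    show "integrable lborel (\<lambda>x. g x * indicator (?B n) x)"
      by (intro locint_mult_integrable[OF g, where B=1 and R=R])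
        (use R in \<open>force simp: indicator_def\<close>)+
    fix a b :: "real^'n"
    obtain c d :: "real^'n" where cd: "?B n \<inter> box a b = box c d" by (simp add: box_Int_box)
    have "(LINT x|lborel. g x * indicator (?B n) x * indicator (box a b) x) = (LINT x|lborel. g x * indicator (box c d) x)"
      by (simp add: mult.assoc indicator_inter_arith[symmetric] cd)
    also have "\<dots> = 0" by (rule integral_box_zero[OF g z])
    finally show "(LINT x|lborel. g x * indicator (?B n) x * indicator (box a b) x) = 0" .
  qed
  then have "AE x in lborel. \<forall>n. g x * indicator (?B n) x = 0" unfolding AE_all_countable by blast
  then show ?thesis
  proof eventually_elim
    case (elim x)
    obtain n where n: "norm x < real n" using reals_Archimedean2 by blast
    have "\<bar>x $ i\<bar> < real n" for i using component_le_norm_cart[of x i] n by linarith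
    then have "x \<in> ?B n" by (simp add: mem_box_cart abs_less_iff minus_less_iff)
    with elim show ?case by (auto dest: spec[of _ n])
  qed
qed

lemma nm_zero_iff: "f \<in> L2 \<Longrightarrow> nm f = 0 \<longleftrightarrow> (AE x in lborel. f x = 0)"
  using integral_nonneg_eq_0_iff_AE[OF L2_integrable_square, of f]
  by (simp add: nm_def ip_def flip: power2_eq_square)

lemma ip_cong_AE:
  assumes "AE x in lborel. f x = f' x" "f \<in> borel_measurable borel" "f' \<in> borel_measurable borel" "g \<in> borel_measurable borel"
  shows "ip f g = ip f' g"
  unfolding ip_def by (rule integral_cong_AE) (use assms in auto)

text \<open>Mollification is avoided: a function orthogonal to all test functions vanishes by the
  fundamental lemma, and \<open>dense_from_orthogonal\<close> does the rest.\<close>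

lemma test_dense:
  fixes u :: "real^'n::finite \<Rightarrow> real"
  assumes "u \<in> L2" "e > 0"
  obtains \<phi> where "\<phi> \<in> test_functions" "nm (\<lambda>x. u x - \<phi> x) < e"
proof (rule dense_from_orthogonal[of test_functions u e])
  show "nm g = 0" if "g \<in> L2" "\<And>\<phi>. \<phi> \<in> test_functions \<Longrightarrow> ip g \<phi> = 0" for g :: "real^'n \<Rightarrow> real"
    using AE_zero_if_test_zero[OF L2_locint[OF that(1)]] that by (simp add: nm_zero_iff ip_def)
  show "(\<lambda>x. a * f x + b * g x) \<in> test_functions" if "f \<in> test_functions" "g \<in> test_functions"
    for f g :: "real^'n \<Rightarrow> real" and a b
    by (intro test_add test_scale that)
qed (use assms test_L2 test_zero that in auto)

lemma test_dense_seq: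
  fixes u :: "real^'n::finite \<Rightarrow> real"
  assumes "u \<in> L2"
  obtains \<phi> where "\<And>n. \<phi> n \<in> test_functions" "(\<lambda>n. nm (\<lambda>x. \<phi> n x - u x)) \<longlonglongrightarrow> 0"
proof -
  have "\<exists>\<phi>\<in>test_functions. nm (\<lambda>x. u x - \<phi> x) < inverse (real (Suc n))" for n
    using test_dense[OF assms, of "inverse (real (Suc n))"] by (metis inverse_positive_iff_positive of_nat_0_less_iff zero_less_Suc)
  then obtain \<phi> where \<phi>: "\<And>n. \<phi> n \<in> test_functions" "\<And>n. nm (\<lambda>x. u x - \<phi> n x) < inverse (real (Suc n))" by metis
  show ?thesis
  proof (rule that[of \<phi>, OF \<phi>(1)])
    have "norm (nm (\<lambda>x. \<phi> n x - u x)) \<le> inverse (real (Suc n))" for n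
      using \<phi>(2)[of n] nm_diff_commute[of u "\<phi> n"] by simp
    then show "(\<lambda>n. nm (\<lambda>x. \<phi> n x - u x)) \<longlonglongrightarrow> 0"
      by (intro Lim_null_comparison[OF _ LIMSEQ_inverse_real_of_nat] always_eventually allI)
  qed
qed

lemma ip_tendsto_right:
  assumes "\<And>n. f n \<in> L2" "g \<in> L2" "h \<in> L2" "(\<lambda>n. nm (\<lambda>x. f n x - g x)) \<longlonglongrightarrow> 0"
  shows "(\<lambda>n. ip h (f n)) \<longlonglongrightarrow> ip h g"
  using ip_tendsto_left[OF assms] by (simp add: ip_commute)

text \<open>Test functions tending to f itself turn the bound on pairings into
  \<open>nm f * nm f \<le> C * nm f\<close>.\<close>

lemma nm_le_dual:
  fixes f :: "real^'n::finite \<Rightarrow> real"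
  assumes f: "f \<in> L2" and C: "\<And>\<phi>. \<phi> \<in> test_functions \<Longrightarrow> \<bar>ip f \<phi>\<bar> \<le> C * nm \<phi>"
    and "C \<ge> 0"
  shows "nm f \<le> C"
proof -
  obtain \<phi> where \<phi>: "\<And>n. \<phi> n \<in> test_functions" "(\<lambda>n. nm (\<lambda>x. \<phi> n x - f x)) \<longlonglongrightarrow> 0"
    using test_dense_seq[OF f] by blast
  have L: "\<phi> n \<in> L2" for n using \<phi> test_L2 by blast
  have "(\<lambda>n. ip f (\<phi> n)) \<longlonglongrightarrow> ip f f" by (rule ip_tendsto_right[OF L f f \<phi>(2)])
  moreover have "(\<lambda>n. C * nm (\<phi> n)) \<longlonglongrightarrow> C * nm f" by (intro tendsto_intros nm_tendsto[OF L f \<phi>(2)])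
  moreover have "ip f (\<phi> n) \<le> C * nm (\<phi> n)" for n using C[OF \<phi>(1), of n] by linarith
  ultimately have "ip f f \<le> C * nm f" by (intro LIMSEQ_le) auto
  then have *: "nm f * nm f \<le> C * nm f" by (simp add: power2_eq_square flip: nm_square)
  show ?thesis
  proof (cases "nm f = 0")
    case True
    then show ?thesis using \<open>C \<ge> 0\<close> by simp
  next
    case False
    then show ?thesis using * nm_nonneg[of f] by (simp add: mult_le_cancel_right)
  qed
qed

lemma weak_conv_L2:
  fixes f :: "nat \<Rightarrow> real^'n::finite \<Rightarrow> real"
  assumes f: "\<And>n. f n \<in> L2" "\<And>n. nm (f n) \<le> M" and g: "g \<in> L2"
    and conv: "\<And>\<phi>. \<phi> \<in> test_functions \<Longrightarrow> (\<lambda>n. ip (f n) \<phi>) \<longlonglongrightarrow> ip g \<phi>"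
    and \<psi>: "\<psi> \<in> L2"
  shows "(\<lambda>n. ip (f n) \<psi>) \<longlonglongrightarrow> ip g \<psi>"
proof (rule LIMSEQ_I)
  fix e :: real assume e: "e > 0"
  define C where "C = \<bar>M\<bar> + nm g + 1"
  have C: "C > 0" unfolding C_def using nm_nonneg[of g] by linarith
  obtain \<phi> where \<phi>: "\<phi> \<in> test_functions" "nm (\<lambda>x. \<psi> x - \<phi> x) < e / (2 * C)"
    using test_dense[OF \<psi>, of "e / (2 * C)"] e C by auto
  note L = test_L2[OF \<phi>(1)]
  obtain N where N: "\<And>n. n \<ge> N \<Longrightarrow> \<bar>ip (f n) \<phi> - ip g \<phi>\<bar> < e / 2"
    using LIMSEQ_D[OF conv[OF \<phi>(1)], of "e/2"] e by auto
  have "\<bar>ip (f n) \<psi> - ip g \<psi>\<bar> < e" if "n \<ge> N" for n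
  proof -
    have "ip (f n) \<psi> - ip g \<psi> = (ip (f n) (\<lambda>x. \<psi> x - \<phi> x) - ip g (\<lambda>x. \<psi> x - \<phi> x)) + (ip (f n) \<phi> - ip g \<phi>)"
      by (simp add: ip_diff_right f g \<psi> L)
    moreover have "\<bar>ip (f n) (\<lambda>x. \<psi> x - \<phi> x)\<bar> \<le> \<bar>M\<bar> * nm (\<lambda>x. \<psi> x - \<phi> x)"
      by (rule order_trans[OF ip_Cauchy_Schwarz[OF f(1) L2_diff[OF \<psi> L]] mult_right_mono])
        (use f(2)[of n] in auto)
    moreover have "\<bar>ip g (\<lambda>x. \<psi> x - \<phi> x)\<bar> \<le> nm g * nm (\<lambda>x. \<psi> x - \<phi> x)"
      by (rule ip_Cauchy_Schwarz[OF g L2_diff[OF \<psi> L]])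
    moreover have "\<bar>M\<bar> * nm (\<lambda>x. \<psi> x - \<phi> x) + nm g * nm (\<lambda>x. \<psi> x - \<phi> x) \<le> e / 2"
    proof -
      have "(\<bar>M\<bar> + nm g) * nm (\<lambda>x. \<psi> x - \<phi> x) \<le> C * (e / (2 * C))"
        using \<phi>(2) by (intro mult_mono) (auto simp: C_def)
      also have "C * (e / (2 * C)) = e / 2" using C by simp
      finally show ?thesis by (simp add: distrib_right)
    qed
    ultimately show ?thesis using N[OF that] by argo
  qed
  then show "\<exists>no. \<forall>n\<ge>no. norm (ip (f n) \<psi> - ip g \<psi>) < e" by auto
qed

text \<open>Used for products of a weakly convergent difference quotient with a strongly convergent
  translate.\<close>

lemma weak_strong_tendsto:
  assumes f: "\<And>n. f n \<in> L2" "\<And>n. nm (f n) \<le> M"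
    and weak: "(\<lambda>n. ip (f n) \<psi>) \<longlonglongrightarrow> l"
    and \<psi>: "\<psi> \<in> L2" "\<And>n. \<psi>' n \<in> L2" "(\<lambda>n. nm (\<lambda>x. \<psi>' n x - \<psi> x)) \<longlonglongrightarrow> 0"
  shows "(\<lambda>n. ip (f n) (\<psi>' n)) \<longlonglongrightarrow> l"
proof -
  have "(\<lambda>n. ip (f n) (\<lambda>x. \<psi>' n x - \<psi> x)) \<longlonglongrightarrow> 0"
  proof (rule Lim_null_comparison)
    show "(\<lambda>n. M * nm (\<lambda>x. \<psi>' n x - \<psi> x)) \<longlonglongrightarrow> 0"
      using tendsto_mult_left[OF \<psi>(3), of M] by simp
    have "\<bar>ip (f n) (\<lambda>x. \<psi>' n x - \<psi> x)\<bar> \<le> M * nm (\<lambda>x. \<psi>' n x - \<psi> x)" for n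
      by (rule order_trans[OF ip_Cauchy_Schwarz[OF f(1) L2_diff[OF \<psi>(2,1)]] mult_right_mono]) (use f in auto)
    then show "\<forall>\<^sub>F n in sequentially. norm (ip (f n) (\<lambda>x. \<psi>' n x - \<psi> x)) \<le> M * nm (\<lambda>x. \<psi>' n x - \<psi> x)" by simp
  qed
  from tendsto_add[OF this weak] show ?thesis by (simp add: ip_diff_right f \<psi>)
qed

section \<open>Weak derivatives\<close>

text \<open>One component of \<open>is_weak_grad\<close>, but without tying the functions to
  \<open>L2\<close>: it is also applied to products of two \<open>L2\<close> functions, which are
  merely integrable.\<close>

definition wd :: "'n::finite \<Rightarrow> (real^'n \<Rightarrow> real) \<Rightarrow> (real^'n \<Rightarrow> real) \<Rightarrow> bool" where
  "wd i u g \<longleftrightarrow> (\<forall>\<phi>\<in>test_functions. (LINT x|lborel. u x * partial_deriv i \<phi> x) = - (LINT x|lborel. g x * \<phi> x))"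

lemma wdD: "wd i u g \<Longrightarrow> \<phi> \<in> test_functions \<Longrightarrow> (LINT x|lborel. u x * partial_deriv i \<phi> x) = - (LINT x|lborel. g x * \<phi> x)"
  by (simp add: wd_def)

lemma wd_add:
  assumes "locint u" "locint v" "locint g" "locint h" "wd i u g" "wd i v h"
  shows "wd i (\<lambda>x. u x + v x) (\<lambda>x. g x + h x)"
  unfolding wd_def
proof
  fix \<phi> :: "real^'a \<Rightarrow> real" assume p: "\<phi> \<in> test_functions"
  then show "(LINT x|lborel. (u x + v x) * partial_deriv i \<phi> x) = - (LINT x|lborel. (g x + h x) * \<phi> x)"
    using wdD[OF assms(5) p] wdD[OF assms(6) p]
    by (simp add: distrib_right locint_test_integrable assms test_partial)
qed

lemma wd_scale: "wd i u g \<Longrightarrow> wd i (\<lambda>x. c * u x) (\<lambda>x. c * g x)"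
  by (auto simp: wd_def mult.assoc)

lemma wd_translate:
  assumes "wd i u g"
  shows "wd i (\<lambda>x. u (x + h)) (\<lambda>x. g (x + h))"
  unfolding wd_def
proof
  fix \<phi> :: "real^'a \<Rightarrow> real" assume p: "\<phi> \<in> test_functions"
  define \<psi> where "\<psi> x = \<phi> (1 *\<^sub>R x + (- h))" for x
  have \<psi>: "\<psi> \<in> test_functions" unfolding \<psi>_def by (rule test_affine[OF p]) simp
  have "partial_deriv i \<psi> = (\<lambda>x. 1 * partial_deriv i \<phi> (1 *\<^sub>R x + (- h)))"
    unfolding \<psi>_def by (rule partial_deriv_affine[OF test_smooth[OF p]])
  with wdD[OF assms \<psi>] integral_translate[of "\<lambda>x. u x * partial_deriv i \<psi> x" h] integral_translate[of "\<lambda>x. g x * \<psi> x" h]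
  show "(LINT x|lborel. u (x + h) * partial_deriv i \<phi> x) = - (LINT x|lborel. g (x + h) * \<phi> x)"
    by (simp add: \<psi>_def)
qed

lemma wd_unique:
  assumes "locint g" "locint h" "wd i u g" "wd i u h"
  shows "AE x in lborel. g x = h x"
proof -
  have l: "locint (\<lambda>x. g x - h x)"
    using assms(1,2) by (auto simp: locint_def right_diff_distrib)
  have "AE x in lborel. g x - h x = 0"
  proof (rule AE_zero_if_test_zero[OF l])
    fix \<phi> :: "real^'a \<Rightarrow> real" assume p: "\<phi> \<in> test_functions"
    then show "(LINT x|lborel. (g x - h x) * \<phi> x) = 0"
      using wdD[OF assms(3) p] wdD[OF assms(4) p]
      by (simp add: left_diff_distrib locint_test_integrable assms)
  qed
  then show ?thesis by simp
qed

lemma wd_smooth_mult: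
  assumes \<eta>: "smooth \<eta>" and u: "locint u" "locint g" "wd i u g"
  shows "wd i (\<lambda>x. \<eta> x * u x) (\<lambda>x. partial_deriv i \<eta> x * u x + \<eta> x * g x)"
  unfolding wd_def
proof
  fix \<phi> :: "real^'a \<Rightarrow> real" assume p: "\<phi> \<in> test_functions"
  have t: "(\<lambda>x. \<eta> x * \<phi> x) \<in> test_functions" "(\<lambda>x. partial_deriv i \<eta> x * \<phi> x) \<in> test_functions"
     "(\<lambda>x. \<eta> x * partial_deriv i \<phi> x) \<in> test_functions"
    using p \<eta> by (auto intro!: test_mult test_partial)
  have "(LINT x|lborel. u x * (\<eta> x * partial_deriv i \<phi> x)) + (LINT x|lborel. u x * (partial_deriv i \<eta> x * \<phi> x)) = - (LINT x|lborel. g x * (\<eta> x * \<phi> x))"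
    using wdD[OF u(3) t(1)] locint_test_integrable[OF u(1) t(2)] locint_test_integrable[OF u(1) t(3)]
    by (simp add: partial_deriv_smooth_mult \<eta> test_smooth[OF p] distrib_left)
  moreover have "(LINT x|lborel. (partial_deriv i \<eta> x * u x + \<eta> x * g x) * \<phi> x)
    = (LINT x|lborel. u x * (partial_deriv i \<eta> x * \<phi> x)) + (LINT x|lborel. g x * (\<eta> x * \<phi> x))"
    using locint_test_integrable[OF u(1) t(2)] locint_test_integrable[OF u(2) t(1)]
    by (subst Bochner_Integration.integral_add[symmetric]) (auto simp: algebra_simps)
  moreover have "(LINT x|lborel. \<eta> x * u x * partial_deriv i \<phi> x) = (LINT x|lborel. u x * (\<eta> x * partial_deriv i \<phi> x))"
    by (simp add: mult_ac)
  ultimately show "(LINT x|lborel. \<eta> x * u x * partial_deriv i \<phi> x) =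
        - (LINT x|lborel. (partial_deriv i \<eta> x * u x + \<eta> x * g x) * \<phi> x)" by linarith
qed

lemma wd_test: "\<eta> \<in> test_functions \<Longrightarrow> wd i \<eta> (partial_deriv i \<eta>)"
  by (simp add: wd_def test_integration_by_parts test_smooth)

text \<open>Duality with test functions: \<open>s \<mapsto> \<integral> u(x) \<phi>(x - s h) dx\<close> has derivative
  \<open>\<integral> G(x) \<phi>(x - s h) dx\<close>.\<close>

lemma nm_translate_diff_le:
  fixes u :: "real^'n::finite \<Rightarrow> real"
  assumes u: "u \<in> L2" and G: "G \<in> L2"
    and wd: "\<And>\<phi>. \<phi> \<in> test_functions \<Longrightarrow>
      (LINT x|lborel. u x * (\<Sum>i\<in>UNIV. h $ i * partial_deriv i \<phi> x)) = - (LINT x|lborel. G x * \<phi> x)"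
  shows "nm (\<lambda>x. u (x + h) - u x) \<le> nm G"
proof (rule nm_le_dual)
  show "(\<lambda>x. u (x + h) - u x) \<in> L2" by (intro L2_diff L2_translate u)
  fix \<phi> :: "real^'n \<Rightarrow> real" assume p: "\<phi> \<in> test_functions"
  define ps where "ps s x = \<phi> (1 *\<^sub>R x + (- (s *\<^sub>R h)))" for s x
  have ps: "ps s \<in> test_functions" for s unfolding ps_def by (rule test_affine[OF p]) simp
  define m where "m s = ip u (ps s)" for s
  have "(m has_real_derivative ip G (ps s)) (at s)" for s
  proof -
    have "((\<lambda>t. (LINT x|lborel. u x * ((ps s (x + t *\<^sub>R (- h)) - ps s x) / t))) \<longlongrightarrow>
      (LINT x|lborel. u x * (\<Sum>i\<in>UNIV. (- h) $ i * partial_deriv i (ps s) x))) (at 0)"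
      by (rule difference_quotient_test[OF L2_locint[OF u] ps])
    moreover have "(LINT x|lborel. u x * (\<Sum>i\<in>UNIV. (- h) $ i * partial_deriv i (ps s) x)) = ip G (ps s)"
      using wd[OF ps, of s] by (simp add: ip_def sum_negf)
    moreover have "(LINT x|lborel. u x * ((ps s (x + t *\<^sub>R (- h)) - ps s x) / t)) = (m (s + t) - m s) / t" for t
    proof -
      have "ps s (x + t *\<^sub>R (- h)) = ps (s + t) x" for x by (simp add: ps_def algebra_simps)
      moreover have "integrable lborel (\<lambda>x. u x * ps s x)" for s
        by (intro L2_integrable_mult u test_L2 ps)
      ultimately show ?thesis
        by (simp add: m_def ip_def right_diff_distrib flip: times_divide_eq_right)
          (simp add: diff_divide_distrib right_diff_distrib)
    qed
    ultimately show ?thesis by (simp only: DERIV_def)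
  qed
  \<comment> \<open>The mean value theorem on [0,1] gives one intermediate translate, whose norm is
    that of \<phi> by translation invariance; no integral over s is formed.\<close>
  then obtain z where z: "m 1 - m 0 = (1 - 0) * ip G (ps z)"
    using MVT2[of 0 1 m "\<lambda>s. ip G (ps s)"] by auto
  have "ip (\<lambda>x. u (x + h) - u x) \<phi> = m 1 - m 0"
    by (simp add: ip_diff_left L2_translate u test_L2 p ip_translate_left m_def ps_def[abs_def])
  also have "\<bar>\<dots>\<bar> \<le> nm G * nm (ps z)"
    unfolding z using ip_Cauchy_Schwarz[OF G test_L2[OF ps[of z]]] by simp
  also have "nm (ps z) = nm \<phi>" using nm_translate[of \<phi> "- (z *\<^sub>R h)"] by (simp add: ps_def[abs_def])
  finally show "\<bar>ip (\<lambda>x. u (x + h) - u x) \<phi>\<bar> \<le> nm G * nm \<phi>" .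
qed simp

lemma nm_translate_axis_le:
  fixes u :: "real^'n::finite \<Rightarrow> real"
  assumes u: "u \<in> L2" and g: "g \<in> L2" "wd i u g"
  shows "nm (\<lambda>x. u (x + t *\<^sub>R axis i 1) - u x) \<le> \<bar>t\<bar> * nm g"
proof -
  have "nm (\<lambda>x. u (x + t *\<^sub>R axis i 1) - u x) \<le> nm (\<lambda>x. t * g x)"
  proof (rule nm_translate_diff_le[OF u L2_scale[OF g(1)]])
    fix \<phi> :: "real^'n \<Rightarrow> real" assume p: "\<phi> \<in> test_functions"
    have "(\<Sum>j\<in>UNIV. (t *\<^sub>R axis i 1) $ j * partial_deriv j \<phi> x) = t * partial_deriv i \<phi> x" for x
      using sum_axis[of i t "\<lambda>j. partial_deriv j \<phi> x"] by (simp add: axis_def if_distrib cong: if_cong)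
    then show "(LINT x|lborel. u x * (\<Sum>j\<in>UNIV. (t *\<^sub>R axis i 1) $ j * partial_deriv j \<phi> x)) = - (LINT x|lborel. t * g x * \<phi> x)"
      using wdD[OF g(2) p] by (simp add: mult_ac)
  qed
  then show ?thesis by (simp add: nm_scale)
qed

lemma nm_translate_le:
  fixes u :: "real^'n::finite \<Rightarrow> real"
  assumes u: "u \<in> L2" and g: "\<And>i. g i \<in> L2" "\<And>i. wd i u (g i)"
  shows "nm (\<lambda>x. u (x + h) - u x) \<le> norm h * (\<Sum>i\<in>UNIV. nm (g i))"
proof -
  have "nm (\<lambda>x. u (x + h) - u x) \<le> nm (\<lambda>x. \<Sum>i\<in>UNIV. h $ i * g i x)"
  proof (rule nm_translate_diff_le[OF u L2_sum[OF L2_scale[OF g(1)]]])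
    fix \<phi> :: "real^'n \<Rightarrow> real" assume p: "\<phi> \<in> test_functions"
    have "(LINT x|lborel. u x * (\<Sum>i\<in>UNIV. h $ i * partial_deriv i \<phi> x)) = (\<Sum>i\<in>UNIV. h $ i * (LINT x|lborel. u x * partial_deriv i \<phi> x))"
    proof -
      have "u x * (\<Sum>i\<in>UNIV. h $ i * partial_deriv i \<phi> x) = (\<Sum>i\<in>UNIV. h $ i * (u x * partial_deriv i \<phi> x))" for x
        by (simp add: sum_distrib_left mult_ac)
      then show ?thesis
        using L2_integrable_mult[OF u test_L2[OF test_partial[OF p]]] by simp
    qed
    also have "\<dots> = - (\<Sum>i\<in>UNIV. h $ i * (LINT x|lborel. g i x * \<phi> x))"
      by (simp add: wdD[OF g(2) p] sum_negf)
    also have "\<dots> = - (LINT x|lborel. (\<Sum>i\<in>UNIV. h $ i * g i x) * \<phi> x)"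
      using L2_integrable_mult[OF g(1) test_L2[OF p]]
      by (simp add: sum_distrib_right mult.assoc Bochner_Integration.integral_sum)
    finally show "(LINT x|lborel. u x * (\<Sum>i\<in>UNIV. h $ i * partial_deriv i \<phi> x)) = - (LINT x|lborel. (\<Sum>i\<in>UNIV. h $ i * g i x) * \<phi> x)" .
  qed
  also have "\<dots> \<le> (\<Sum>i\<in>UNIV. nm (\<lambda>x. h $ i * g i x))"
  proof -
    have "nm (\<lambda>x. \<Sum>i\<in>J. h $ i * g i x) \<le> (\<Sum>i\<in>J. nm (\<lambda>x. h $ i * g i x))" if "finite J" for J
      using that
    proof induction
      case (insert i J)
      then show ?case
        using nm_triangle[OF L2_scale[OF g(1)[of i], of "h $ i"] L2_sum[of J "\<lambda>i x. h $ i * g i x"]] L2_scale[OF g(1)] by simp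
    qed (simp add: nm_def ip_def)
    then show ?thesis by simp
  qed
  also have "\<dots> \<le> (\<Sum>i\<in>UNIV. norm h * nm (g i))"
    unfolding nm_scale by (intro sum_mono mult_right_mono component_le_norm_cart) auto
  finally show ?thesis by (simp add: sum_distrib_left)
qed

text \<open>The quotients are bounded by \<open>nm g\<close> through the translation estimate.
  Against a test function the quotient moves to \<phi>, and density of test functions extends the
  convergence to all of \<open>L2\<close>.\<close>

lemma difference_quotient_weak:
  fixes u :: "real^'n::finite \<Rightarrow> real"
  assumes u: "u \<in> L2" and g: "g \<in> L2" "wd i u g" and t: "\<And>n. t n \<noteq> 0" "t \<longlonglongrightarrow> 0"
  defines "d \<equiv> \<lambda>n x. (u (x + t n *\<^sub>R axis i 1) - u x) / t n"
  shows "d n \<in> L2" "nm (d n) \<le> nm g" "\<psi> \<in> L2 \<Longrightarrow> (\<lambda>n. ip (d n) \<psi>) \<longlonglongrightarrow> ip g \<psi>"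
proof -
  have d_eq: "d n = (\<lambda>x. inverse (t n) * (u (x + t n *\<^sub>R axis i 1) - u x))" for n
    by (simp add: d_def divide_inverse mult.commute)
  show dL: "d n \<in> L2" for n unfolding d_eq by (intro L2_scale L2_diff L2_translate u)
  show dn: "nm (d n) \<le> nm g" for n
    using nm_translate_axis_le[OF u g, of "t n"] t(1)[of n] unfolding d_eq nm_scale by (simp add: field_simps)
  show "(\<lambda>n. ip (d n) \<psi>) \<longlonglongrightarrow> ip g \<psi>" if \<psi>: "\<psi> \<in> L2"
  proof (rule weak_conv_L2[OF dL dn g(1) _ \<psi>])
    fix \<phi> :: "real^'n \<Rightarrow> real" assume p: "\<phi> \<in> test_functions"
    have "((\<lambda>s. (LINT x|lborel. u x * ((\<phi> (x + s *\<^sub>R (- axis i 1)) - \<phi> x) / s))) \<longlongrightarrow>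
      (LINT x|lborel. u x * (\<Sum>j\<in>UNIV. (- axis i 1) $ j * partial_deriv j \<phi> x))) (at 0)"
      by (rule difference_quotient_test[OF L2_locint[OF u] p])
    moreover have "filterlim t (at 0) sequentially" using t by (auto simp: filterlim_at)
    ultimately have "(\<lambda>n. (LINT x|lborel. u x * ((\<phi> (x + t n *\<^sub>R (- axis i 1)) - \<phi> x) / t n))) \<longlonglongrightarrow>
      (LINT x|lborel. u x * (\<Sum>j\<in>UNIV. (- axis i 1) $ j * partial_deriv j \<phi> x))"
      by (rule filterlim_compose)
    moreover have "(LINT x|lborel. u x * (\<Sum>j\<in>UNIV. (- axis i 1) $ j * partial_deriv j \<phi> x)) = ip g \<phi>"
      using wdD[OF g(2) p] by (simp add: sum_negf sum_axis ip_def)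
    moreover have "(LINT x|lborel. u x * ((\<phi> (x + t n *\<^sub>R (- axis i 1)) - \<phi> x) / t n)) = ip (d n) \<phi>" for n
    proof -
      have "ip (\<lambda>x. u (x + t n *\<^sub>R axis i 1)) \<phi> = ip u (\<lambda>x. \<phi> (x - t n *\<^sub>R axis i 1))" by (rule ip_translate_left)
      moreover have "ip (d n) \<phi> = inverse (t n) * (ip (\<lambda>x. u (x + t n *\<^sub>R axis i 1)) \<phi> - ip u \<phi>)"
        unfolding d_eq ip_scale_left by (simp add: ip_diff_left L2_translate u test_L2 p)
      moreover have "ip u (\<lambda>x. (\<phi> (x + - (t n *\<^sub>R axis i 1)) - \<phi> x)) = ip u (\<lambda>x. \<phi> (x + - (t n *\<^sub>R axis i 1))) - ip u \<phi>"
        by (intro ip_diff_right u test_L2 p L2_translate)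
      moreover have "(LINT x|lborel. u x * ((\<phi> (x + t n *\<^sub>R (- axis i 1)) - \<phi> x) / t n)) = inverse (t n) * ip u (\<lambda>x. (\<phi> (x + - (t n *\<^sub>R axis i 1)) - \<phi> x))"
        unfolding ip_scale_right[symmetric] by (simp add: ip_def divide_inverse mult_ac)
      ultimately show ?thesis by simp
    qed
    ultimately show "(\<lambda>n. ip (d n) \<phi>) \<longlonglongrightarrow> ip g \<phi>" by simp
  qed
qed

text \<open>No approximation by smooth functions is made. The discrete product rule splits the
  quotient of u v into two terms, each the quotient of one factor, converging weakly, paired with a
  strongly convergent function.\<close>

lemma wd_mult:
  fixes u v :: "real^'n::finite \<Rightarrow> real"
  assumes u: "u \<in> L2" "u' \<in> L2" "wd i u u'" and v: "v \<in> L2" "v' \<in> L2" "wd i v v'"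
  shows "wd i (\<lambda>x. u x * v x) (\<lambda>x. u' x * v x + u x * v' x)"
  unfolding wd_def
proof
  fix \<phi> :: "real^'n \<Rightarrow> real" assume p: "\<phi> \<in> test_functions"
  obtain B where B: "B > 0" "\<And>x. \<bar>\<phi> x\<bar> \<le> B" using test_bounded[OF p] by blast
  note [measurable] = test_measurable[OF p]
  define t where "t n = inverse (real (Suc n))" for n
  have t: "t n \<noteq> 0" "t \<longlonglongrightarrow> 0" for n using LIMSEQ_inverse_real_of_nat by (auto simp: t_def[abs_def])
  let ?\<tau> = "\<lambda>n f x. f (x + t n *\<^sub>R axis i 1)"
  let ?d = "\<lambda>f n x. (?\<tau> n f x - f x) / t n"
  have \<phi>mult: "(\<lambda>x. \<phi> x * f x) \<in> L2" if "f \<in> L2" for f by (rule L2_bounded_mult[OF that _ B(2)]) simp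
  have 1: "(\<lambda>n. ip (?d v n) (\<lambda>x. \<phi> x * u x)) \<longlonglongrightarrow> ip v' (\<lambda>x. \<phi> x * u x)"
    by (rule difference_quotient_weak[OF v t]) (intro \<phi>mult u)
  have tr0: "(\<lambda>n. nm (\<lambda>x. ?\<tau> n v x - v x)) \<longlonglongrightarrow> 0"
  proof (rule Lim_null_comparison)
    show "(\<lambda>n. \<bar>t n\<bar> * nm v') \<longlonglongrightarrow> 0" using tendsto_mult_right[OF tendsto_rabs[OF t(2)], of "nm v'"] by simp
  qed (use nm_translate_axis_le[OF v] in simp)
  have 2: "(\<lambda>n. ip (?d u n) (\<lambda>x. \<phi> x * ?\<tau> n v x)) \<longlonglongrightarrow> ip u' (\<lambda>x. \<phi> x * v x)"
  proof (rule weak_strong_tendsto[OF difference_quotient_weak(1,2)[OF u t]])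
    show "(\<lambda>n. ip (?d u n) (\<lambda>x. \<phi> x * v x)) \<longlonglongrightarrow> ip u' (\<lambda>x. \<phi> x * v x)"
      by (rule difference_quotient_weak[OF u t]) (intro \<phi>mult v)
    show "(\<lambda>x. \<phi> x * v x) \<in> L2" "\<And>n. (\<lambda>x. \<phi> x * ?\<tau> n v x) \<in> L2" by (intro \<phi>mult v L2_translate)+
    show "(\<lambda>n. nm (\<lambda>x. \<phi> x * ?\<tau> n v x - \<phi> x * v x)) \<longlonglongrightarrow> 0"
    proof (rule Lim_null_comparison)
      show "(\<lambda>n. B * nm (\<lambda>x. ?\<tau> n v x - v x)) \<longlonglongrightarrow> 0" using tendsto_mult_left[OF tr0, of B] by simp
      show "\<forall>\<^sub>F n in sequentially. norm (nm (\<lambda>x. \<phi> x * ?\<tau> n v x - \<phi> x * v x)) \<le> B * nm (\<lambda>x. ?\<tau> n v x - v x)"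
        using nm_mult_bounded[OF L2_diff[OF L2_translate[OF v(1)] v(1)] _ B(2)] B(1)
        by (simp add: right_diff_distrib)
    qed
  qed
  have uv: "integrable lborel (\<lambda>x. u x * v x)" by (rule L2_integrable_mult[OF u(1) v(1)])
  have "((\<lambda>s. (LINT x|lborel. (u x * v x) * ((\<phi> (x + s *\<^sub>R (- axis i 1)) - \<phi> x) / s))) \<longlongrightarrow>
      (LINT x|lborel. (u x * v x) * (\<Sum>j\<in>UNIV. (- axis i 1) $ j * partial_deriv j \<phi> x))) (at 0)"
    by (rule difference_quotient_test[OF integrable_locint[OF uv] p])
  moreover have "filterlim t (at 0) sequentially" using t by (auto simp: filterlim_at)
  ultimately have "(\<lambda>n. (LINT x|lborel. (u x * v x) * ((\<phi> (x + t n *\<^sub>R (- axis i 1)) - \<phi> x) / t n))) \<longlonglongrightarrow>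
      (LINT x|lborel. (u x * v x) * (\<Sum>j\<in>UNIV. (- axis i 1) $ j * partial_deriv j \<phi> x))"
    by (rule filterlim_compose)
  moreover have "(LINT x|lborel. (u x * v x) * (\<Sum>j\<in>UNIV. (- axis i 1) $ j * partial_deriv j \<phi> x)) = - (LINT x|lborel. (u x * v x) * partial_deriv i \<phi> x)"
    by (simp add: sum_negf sum_axis)
  \<comment> \<open>The discrete product rule in the form (quotient of u) times (translate of v)
    plus (quotient of v) times u.\<close>
  moreover have "(LINT x|lborel. (u x * v x) * ((\<phi> (x + t n *\<^sub>R (- axis i 1)) - \<phi> x) / t n)) = ip (?d u n) (\<lambda>x. \<phi> x * ?\<tau> n v x) + ip (?d v n) (\<lambda>x. \<phi> x * u x)" for n
  proof -
    let ?h = "t n *\<^sub>R axis i 1 :: real^'n"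
    have i1: "integrable lborel (\<lambda>x. (u x * v x) * \<phi> (x - ?h))" "integrable lborel (\<lambda>x. (u x * v x) * \<phi> x)"
      using locint_test_integrable[OF integrable_locint[OF uv] p]
        locint_test_integrable[OF integrable_locint[OF uv] test_affine[OF p, of 1 "- ?h"]] by auto
    have "(LINT x|lborel. (u x * v x) * ((\<phi> (x + t n *\<^sub>R (- axis i 1)) - \<phi> x) / t n))
      = (LINT x|lborel. ((u x * v x) * \<phi> (x - ?h) - (u x * v x) * \<phi> x) / t n)"
      by (simp add: right_diff_distrib)
    also have "\<dots> = ((LINT x|lborel. (u x * v x) * \<phi> (x - ?h)) - (LINT x|lborel. (u x * v x) * \<phi> x)) / t n"
      using i1 by simp
    also have "(LINT x|lborel. (u x * v x) * \<phi> (x - ?h)) = (LINT x|lborel. (?\<tau> n u x * ?\<tau> n v x) * \<phi> x)"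
      using integral_translate[of "\<lambda>x. (u x * v x) * \<phi> (x - ?h)" ?h] by simp
    also have "((LINT x|lborel. (?\<tau> n u x * ?\<tau> n v x) * \<phi> x) - (LINT x|lborel. (u x * v x) * \<phi> x)) / t n
      = (LINT x|lborel. ((?\<tau> n u x * ?\<tau> n v x) * \<phi> x - (u x * v x) * \<phi> x) / t n)"
      using i1(2) integrable_translate[OF i1(1), of ?h] by simp
    also have "\<dots> = (LINT x|lborel. ?d u n x * (\<phi> x * ?\<tau> n v x) + ?d v n x * (\<phi> x * u x))"
      using t(1)[of n] by (intro Bochner_Integration.integral_cong) (auto simp: field_simps)
    also have "\<dots> = ip (?d u n) (\<lambda>x. \<phi> x * ?\<tau> n v x) + ip (?d v n) (\<lambda>x. \<phi> x * u x)"
      unfolding ip_def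
      by (intro Bochner_Integration.integral_add L2_integrable_mult difference_quotient_weak(1)[OF u t] difference_quotient_weak(1)[OF v t] \<phi>mult u v L2_translate)
    finally show ?thesis .
  qed
  ultimately have "(\<lambda>n. ip (?d u n) (\<lambda>x. \<phi> x * ?\<tau> n v x) + ip (?d v n) (\<lambda>x. \<phi> x * u x)) \<longlonglongrightarrow> - (LINT x|lborel. (u x * v x) * partial_deriv i \<phi> x)"
    by simp
  from LIMSEQ_unique[OF this tendsto_add[OF 2 1]]
  have "- (LINT x|lborel. (u x * v x) * partial_deriv i \<phi> x) = ip u' (\<lambda>x. \<phi> x * v x) + ip v' (\<lambda>x. \<phi> x * u x)" .
  also have "\<dots> = (LINT x|lborel. u' x * (\<phi> x * v x) + v' x * (\<phi> x * u x))"
    unfolding ip_def by (intro Bochner_Integration.integral_add[symmetric] L2_integrable_mult \<phi>mult u v)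
  finally show "(LINT x|lborel. u x * v x * partial_deriv i \<phi> x) = - (LINT x|lborel. (u' x * v x + u x * v' x) * \<phi> x)"
    by (simp add: algebra_simps)
qed

section \<open>The space H1, its weak gradient and the Dirichlet form\<close>

lemma L2_vec_iff:
  fixes g :: "real^'n::finite \<Rightarrow> real^'n"
  shows "g \<in> L2 \<longleftrightarrow> (\<forall>i. (\<lambda>x. g x $ i) \<in> L2)"
proof
  assume g: "g \<in> L2"
  then have [measurable]: "g \<in> borel_measurable borel" by (simp add: L2_def)
  show "\<forall>i. (\<lambda>x. g x $ i) \<in> L2"
  proof
    fix i
    have "(\<lambda>v::real^'n. v $ i) \<in> borel_measurable borel"
      by (intro borel_measurable_continuous_onI continuous_intros)
    then have m: "(\<lambda>x. g x $ i) \<in> borel_measurable borel" by (rule measurable_compose[rotated]) simp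
    have "integrable lborel (\<lambda>x. (g x $ i)\<^sup>2)"
    proof (rule Bochner_Integration.integrable_bound)
      show "integrable lborel (\<lambda>x. (norm (g x))\<^sup>2)" using g by (simp add: L2_def)
      have "(g x $ i)\<^sup>2 \<le> (norm (g x))\<^sup>2" for x
        using component_le_norm_cart[of "g x" i] by (simp add: abs_le_square_iff[symmetric])
      then show "AE x in lborel. norm ((g x $ i)\<^sup>2) \<le> norm ((norm (g x))\<^sup>2)" by simp
    qed (use m in measurable)
    with m show "(\<lambda>x. g x $ i) \<in> L2" by (simp add: L2_iff)
  qed
next
  assume g: "\<forall>i. (\<lambda>x. g x $ i) \<in> L2"
  have "g = (\<lambda>x. \<Sum>i\<in>UNIV. (g x $ i) *\<^sub>R axis i 1)"
    using basis_expansion[of "g _"] by (auto simp: scalar_mult_eq_scaleR)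
  moreover have "(\<lambda>x. \<Sum>i\<in>UNIV. (g x $ i) *\<^sub>R axis i (1::real)) \<in> borel_measurable borel"
    using g[THEN spec, THEN L2_measurable] by (intro borel_measurable_sum borel_measurable_scaleR) auto
  ultimately have "g \<in> borel_measurable borel" by simp
  moreover have "(norm (g x))\<^sup>2 = (\<Sum>i\<in>UNIV. (g x $ i)\<^sup>2)" for x
    by (simp add: norm_eq_sqrt_inner inner_vec_def power2_eq_square sum_nonneg)
  ultimately show "g \<in> L2"
    using g L2_integrable_square by (auto simp: L2_def)
qed

lemma is_weak_grad_iff: "is_weak_grad u g \<longleftrightarrow> (\<forall>i. wd i u (\<lambda>x. g x $ i))"
  by (auto simp: is_weak_grad_def wd_def)

lemma H1I:
  assumes "u \<in> L2" "\<And>i. g i \<in> L2" "\<And>i. wd i u (g i)"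
  shows "u \<in> H1"
proof -
  have "(\<lambda>x. \<chi> i. g i x) \<in> L2" using assms(2) by (simp add: L2_vec_iff)
  moreover have "is_weak_grad u (\<lambda>x. \<chi> i. g i x)" using assms(3) by (simp add: is_weak_grad_iff)
  ultimately show ?thesis using assms(1) by (auto simp: H1_def)
qed

definition pd :: "(real^'n::finite \<Rightarrow> real) \<Rightarrow> 'n \<Rightarrow> real^'n \<Rightarrow> real" where
  "pd u i x = weak_grad u x $ i"

lemma weak_grad_props:
  assumes "u \<in> H1"
  shows "weak_grad u \<in> L2" "is_weak_grad u (weak_grad u)"
proof -
  have "\<exists>g. g \<in> L2 \<and> is_weak_grad u g" using assms by (auto simp: H1_def)
  from someI_ex[OF this] show "weak_grad u \<in> L2" "is_weak_grad u (weak_grad u)"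
    by (auto simp: weak_grad_def)
qed

lemma H1_L2: "u \<in> H1 \<Longrightarrow> u \<in> L2" by (simp add: H1_def)

lemma pd_L2: "u \<in> H1 \<Longrightarrow> pd u i \<in> L2"
  using weak_grad_props(1)[of u] by (simp add: L2_vec_iff pd_def[abs_def])

lemma pd_wd: "u \<in> H1 \<Longrightarrow> wd i u (pd u i)"
  using weak_grad_props(2)[of u] by (simp add: is_weak_grad_iff pd_def[abs_def])

lemma pd_AE:
  assumes "u \<in> H1" "g \<in> L2" "wd i u g"
  shows "AE x in lborel. pd u i x = g x"
  by (rule wd_unique[OF L2_locint L2_locint pd_wd]) (use assms pd_L2 in auto)

text \<open>The gradient is an arbitrary choice among almost everywhere equal functions. Through
  this rule any explicitly known weak derivative may replace \<open>pd u i\<close> in an inner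
  product.\<close>

lemma ip_pd_left:
  assumes "u \<in> H1" "g \<in> L2" "wd i u g" "h \<in> L2"
  shows "ip (pd u i) h = ip g h"
  using assms by (intro ip_cong_AE[OF pd_AE] L2_measurable pd_L2) auto

definition dip :: "(real^'n::finite \<Rightarrow> real) \<Rightarrow> (real^'n \<Rightarrow> real) \<Rightarrow> real" where
  "dip u v = (LINT x|lborel. weak_grad u x \<bullet> weak_grad v x)"

lemma dip_eq:
  assumes "u \<in> H1" "v \<in> H1"
  shows "dip u v = (\<Sum>i\<in>UNIV. ip (pd u i) (pd v i))"
  using L2_integrable_mult[OF pd_L2[OF assms(1)] pd_L2[OF assms(2)]]
  by (simp add: dip_def inner_vec_def ip_def flip: pd_def)

lemma dip_wd:
  assumes u: "u \<in> H1" and g: "\<And>i. g i \<in> L2" "\<And>i. wd i u (g i)"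
    and v: "v \<in> H1" and h: "\<And>i. h i \<in> L2" "\<And>i. wd i v (h i)"
  shows "dip u v = (\<Sum>i\<in>UNIV. ip (g i) (h i))"
proof -
  have "ip (pd u i) (pd v i) = ip (g i) (h i)" for i
    using ip_pd_left[OF u g pd_L2[OF v], of i i] ip_pd_left[OF v h g(1), of i i] by (simp add: ip_commute)
  then show ?thesis by (simp add: dip_eq u v)
qed

lemma dirichlet_dip: "dirichlet u = dip u u"
  by (simp add: dirichlet_def dip_def power2_norm_eq_inner)

lemma dirichlet_eq: "u \<in> H1 \<Longrightarrow> dirichlet u = (\<Sum>i\<in>UNIV. (nm (pd u i))\<^sup>2)"
  by (simp add: dirichlet_dip dip_eq nm_square)

lemma dirichlet_nonneg: "dirichlet u \<ge> 0"
  by (simp add: dirichlet_def)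

lemma mass_ip: "mass u = ip u u"
  by (simp add: mass_def ip_def power2_eq_square)

lemma mass_nm: "mass u = (nm u)\<^sup>2"
  by (simp add: mass_ip nm_square)

lemma mass_nonneg: "mass u \<ge> 0"
  by (simp add: mass_nm)

lemma dip_commute: "dip u v = dip v u"
  by (simp add: dip_def inner_commute)

lemma wd_add_L2:
  assumes "u \<in> L2" "v \<in> L2" "g \<in> L2" "h \<in> L2" "wd i u g" "wd i v h"
  shows "wd i (\<lambda>x. u x + v x) (\<lambda>x. g x + h x)"
  by (rule wd_add) (use assms L2_locint in auto)

lemma H1_lin:
  assumes "u \<in> H1" "v \<in> H1"
  shows "(\<lambda>x. a * u x + b * v x) \<in> H1" and "wd i (\<lambda>x. a * u x + b * v x) (\<lambda>x. a * pd u i x + b * pd v i x)"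
proof -
  show *: "wd i (\<lambda>x. a * u x + b * v x) (\<lambda>x. a * pd u i x + b * pd v i x)" for i
    using assms by (intro wd_add_L2 wd_scale pd_wd L2_scale pd_L2 H1_L2)
  show "(\<lambda>x. a * u x + b * v x) \<in> H1"
    by (rule H1I[OF L2_add[OF L2_scale[OF H1_L2[OF assms(1)]] L2_scale[OF H1_L2[OF assms(2)]]]
        L2_add[OF L2_scale[OF pd_L2[OF assms(1)]] L2_scale[OF pd_L2[OF assms(2)]]] *])
qed

lemma H1_scale: "u \<in> H1 \<Longrightarrow> (\<lambda>x. a * u x) \<in> H1"
  using H1_lin(1)[of u u a 0] by simp

lemma H1_diff: "u \<in> H1 \<Longrightarrow> v \<in> H1 \<Longrightarrow> (\<lambda>x. u x - v x) \<in> H1"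
  using H1_lin(1)[of u v 1 "-1"] by simp

lemma dip_lin_left:
  assumes "u \<in> H1" "v \<in> H1" "w \<in> H1"
  shows "dip (\<lambda>x. a * u x + b * v x) w = a * dip u w + b * dip v w"
proof -
  have "dip (\<lambda>x. a * u x + b * v x) w = (\<Sum>i\<in>UNIV. ip (\<lambda>x. a * pd u i x + b * pd v i x) (pd w i))"
    by (rule dip_wd[OF H1_lin(1)[OF assms(1,2)] L2_add[OF L2_scale[OF pd_L2[OF assms(1)]] L2_scale[OF pd_L2[OF assms(2)]]]
        H1_lin(2)[OF assms(1,2)] assms(3) pd_L2[OF assms(3)] pd_wd[OF assms(3)]])
  also have "\<dots> = a * dip u w + b * dip v w"
    using assms by (simp add: ip_lin_left pd_L2 dip_eq sum.distrib sum_distrib_left)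
  finally show ?thesis .
qed

lemma dip_scale: "u \<in> H1 \<Longrightarrow> w \<in> H1 \<Longrightarrow> dip (\<lambda>x. a * u x) w = a * dip u w"
  using dip_lin_left[of u u w a 0] by simp

lemma dip_diff: "u \<in> H1 \<Longrightarrow> v \<in> H1 \<Longrightarrow> w \<in> H1 \<Longrightarrow> dip (\<lambda>x. u x - v x) w = dip u w - dip v w"
  using dip_lin_left[of u v w 1 "-1"] by simp

lemma dirichlet_scale: "u \<in> H1 \<Longrightarrow> dirichlet (\<lambda>x. a * u x) = a\<^sup>2 * dirichlet u"
  using dip_scale[of u "\<lambda>x. a * u x" a] dip_scale[of u u a]
  by (simp add: dirichlet_dip H1_scale dip_commute[of u "\<lambda>x. a * u x"] power2_eq_square)

lemma mass_scale: "mass (\<lambda>x. a * u x) = a\<^sup>2 * mass u"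
  by (simp add: mass_ip ip_scale_left ip_scale_right power2_eq_square)

lemma dirichlet_add:
  assumes "u \<in> H1" "v \<in> H1"
  shows "dirichlet (\<lambda>x. u x + t * v x) = dirichlet u + 2 * t * dip u v + t\<^sup>2 * dirichlet v"
proof -
  have *: "(\<lambda>x. u x + t * v x) = (\<lambda>x. 1 * u x + t * v x)" by simp
  have h: "(\<lambda>x. 1 * u x + t * v x) \<in> H1" using assms by (rule H1_lin)
  have "dirichlet (\<lambda>x. 1 * u x + t * v x) = 1 * dip u (\<lambda>x. 1 * u x + t * v x) + t * dip v (\<lambda>x. 1 * u x + t * v x)"
    unfolding dirichlet_dip by (rule dip_lin_left[OF assms h])
  also have "dip u (\<lambda>x. 1 * u x + t * v x) = 1 * dip u u + t * dip v u"
    by (subst dip_commute) (rule dip_lin_left[OF assms assms(1)])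
  also have "dip v (\<lambda>x. 1 * u x + t * v x) = 1 * dip u v + t * dip v v"
    by (subst dip_commute) (rule dip_lin_left[OF assms assms(2)])
  finally show ?thesis
    unfolding * by (simp add: dirichlet_dip dip_commute[of v u] power2_eq_square algebra_simps)
qed

lemma mass_add:
  assumes "u \<in> L2" "v \<in> L2"
  shows "mass (\<lambda>x. u x + t * v x) = mass u + 2 * t * ip u v + t\<^sup>2 * mass v"
  using ip_add_square[OF assms] by (simp add: mass_ip)

lemma H1_translate:
  assumes "u \<in> H1"
  shows "(\<lambda>x. u (x + h)) \<in> H1" "(\<lambda>x. pd u i (x + h)) \<in> L2" "wd i (\<lambda>x. u (x + h)) (\<lambda>x. pd u i (x + h))"
proof -
  show *: "(\<lambda>x. pd u i (x + h)) \<in> L2" "wd i (\<lambda>x. u (x + h)) (\<lambda>x. pd u i (x + h))" for i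
    by (rule L2_translate[OF pd_L2[OF assms]], rule wd_translate[OF pd_wd[OF assms]])
  show "(\<lambda>x. u (x + h)) \<in> H1" by (rule H1I[OF L2_translate[OF H1_L2[OF assms]] *])
qed

lemma dip_translate:
  assumes "u \<in> H1" "v \<in> H1"
  shows "dip (\<lambda>x. u (x + h)) (\<lambda>x. v (x + h)) = dip u v"
  by (subst dip_wd[OF H1_translate[OF assms(1)] H1_translate[OF assms(2)]]) (simp add: dip_eq ip_translate assms)

lemma dirichlet_translate: "u \<in> H1 \<Longrightarrow> dirichlet (\<lambda>x. u (x + h)) = dirichlet u"
  by (simp add: dirichlet_dip dip_translate)

lemma mass_translate: "mass (\<lambda>x. u (x + h)) = mass u"
  by (simp add: mass_ip ip_translate)

lemma test_H1: "\<phi> \<in> test_functions \<Longrightarrow> \<phi> \<in> H1"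
  by (rule H1I[of _ "\<lambda>i. partial_deriv i \<phi>"]) (auto intro: test_L2 test_partial wd_test)

section \<open>Behaviour under dilations, amplitudes and translations\<close>

lemma integral_dilate:
  fixes f :: "real^'n::finite \<Rightarrow> real"
  assumes t: "t > 0"
  shows "(LINT x|lborel. f (t *\<^sub>R x)) = (LINT x|lborel. f x) / t ^ CARD('n)"
proof (cases "f \<in> borel_measurable borel")
  case True
  note [measurable] = True
  have "(LINT x|lborel. f x) = (LINT x|density (distr lborel borel (\<lambda>x. 0 + t *\<^sub>R x)) (\<lambda>_. ennreal (\<bar>t\<bar> ^ DIM(real^'n))). f x)"
    using t by (subst lborel_affine[of t 0]) (auto simp: ennreal_power)
  also have "\<dots> = (LINT x|distr lborel borel (\<lambda>x. 0 + t *\<^sub>R x). (\<bar>t\<bar> ^ DIM(real^'n)) *\<^sub>R f x)"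
    by (rule integral_density) auto
  also have "\<dots> = (LINT x|lborel. (\<bar>t\<bar> ^ DIM(real^'n)) *\<^sub>R f (0 + t *\<^sub>R x))"
    by (rule integral_distr) auto
  also have "\<dots> = t ^ CARD('n) * (LINT x|lborel. f (t *\<^sub>R x))"
    using t by simp
  finally show ?thesis using t by simp
next
  case False
  have "(\<lambda>x. f (t *\<^sub>R x)) \<notin> borel_measurable borel"
  proof
    assume "(\<lambda>x. f (t *\<^sub>R x)) \<in> borel_measurable borel"
    then have "(\<lambda>x. f (t *\<^sub>R (inverse t *\<^sub>R x))) \<in> borel_measurable borel"
      by (rule measurable_compose[rotated]) auto
    with False t show False by simp
  qed
  then have "\<not> integrable lborel (\<lambda>x. f (t *\<^sub>R x))" "\<not> integrable lborel f"
    using False by (auto dest: borel_measurable_integrable)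
  then show ?thesis by (simp add: not_integrable_integral_eq)
qed

lemma integrable_dilate:
  fixes f :: "real^'n::finite \<Rightarrow> real"
  assumes t: "t > 0" and f: "integrable lborel f"
  shows "integrable lborel (\<lambda>x. f (t *\<^sub>R x))"
proof -
  note [measurable] = borel_measurable_integrable[OF f]
  have "integrable (density (distr lborel borel (\<lambda>x. 0 + t *\<^sub>R x)) (\<lambda>_. ennreal (\<bar>t\<bar> ^ DIM(real^'n)))) f"
    using t f lborel_affine[of t "0 :: real^'n"] by (auto simp: ennreal_power)
  then have "integrable (distr lborel borel (\<lambda>x. 0 + t *\<^sub>R x)) (\<lambda>x. (\<bar>t\<bar> ^ DIM(real^'n)) *\<^sub>R f x)"
    by (subst (asm) integrable_density) auto
  then have "integrable lborel (\<lambda>x. (\<bar>t\<bar> ^ DIM(real^'n)) *\<^sub>R f (0 + t *\<^sub>R x))"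
    by (rule integrable_distr[rotated]) auto
  then show ?thesis using t by simp
qed

lemma L2_dilate:
  fixes u :: "real^'n::finite \<Rightarrow> real"
  assumes "t > 0" "u \<in> L2"
  shows "(\<lambda>x. u (t *\<^sub>R x)) \<in> L2"
  using assms integrable_dilate[OF assms(1), of "\<lambda>x. (u x)\<^sup>2"]
  by (auto simp: L2_iff)

lemma ip_dilate:
  fixes u v :: "real^'n::finite \<Rightarrow> real"
  assumes "t > 0"
  shows "ip (\<lambda>x. u (t *\<^sub>R x)) (\<lambda>x. v (t *\<^sub>R x)) = ip u v / t ^ CARD('n)"
  unfolding ip_def by (rule integral_dilate[OF assms])

lemma wd_dilate:
  fixes u :: "real^'n::finite \<Rightarrow> real"
  assumes t: "t > 0" and wd: "wd i u g"
  shows "wd i (\<lambda>x. u (t *\<^sub>R x)) (\<lambda>x. t * g (t *\<^sub>R x))"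
  unfolding wd_def
proof
  fix \<phi> :: "real^'n \<Rightarrow> real" assume p: "\<phi> \<in> test_functions"
  define \<psi> where "\<psi> x = \<phi> (inverse t *\<^sub>R x + 0)" for x
  have \<psi>: "\<psi> \<in> test_functions" unfolding \<psi>_def by (rule test_affine[OF p]) (use t in simp)
  have "partial_deriv i \<psi> = (\<lambda>x. inverse t * partial_deriv i \<phi> (inverse t *\<^sub>R x + 0))"
    unfolding \<psi>_def by (rule partial_deriv_affine[OF test_smooth[OF p]])
  then have e1: "u (t *\<^sub>R x) * partial_deriv i \<phi> x = t * (u (t *\<^sub>R x) * partial_deriv i \<psi> (t *\<^sub>R x))" for x
    using t by simp
  have e2: "t * g (t *\<^sub>R x) * \<phi> x = t * (g (t *\<^sub>R x) * \<psi> (t *\<^sub>R x))" for x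
    using t by (simp add: \<psi>_def)
  show "(LINT x|lborel. u (t *\<^sub>R x) * partial_deriv i \<phi> x) = - (LINT x|lborel. t * g (t *\<^sub>R x) * \<phi> x)"
    unfolding e1 e2 using wdD[OF wd \<psi>] integral_dilate[OF t, of "\<lambda>x. u x * partial_deriv i \<psi> x"]
      integral_dilate[OF t, of "\<lambda>x. g x * \<psi> x"] by simp
qed

lemma H1_dilate:
  fixes u :: "real^'n::finite \<Rightarrow> real"
  assumes t: "t > 0" and u: "u \<in> H1"
  shows "(\<lambda>x. u (t *\<^sub>R x)) \<in> H1" "mass (\<lambda>x. u (t *\<^sub>R x)) = mass u / t ^ CARD('n)"
    "dirichlet (\<lambda>x. u (t *\<^sub>R x)) = t\<^sup>2 * dirichlet u / t ^ CARD('n)"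
proof -
  have wd: "wd i (\<lambda>x. u (t *\<^sub>R x)) (\<lambda>x. t * pd u i (t *\<^sub>R x))" for i by (intro wd_dilate t pd_wd u)
  have L: "(\<lambda>x. t * pd u i (t *\<^sub>R x)) \<in> L2" for i by (intro L2_scale L2_dilate t pd_L2 u)
  show H: "(\<lambda>x. u (t *\<^sub>R x)) \<in> H1" by (rule H1I[OF L2_dilate[OF t H1_L2[OF u]] L wd])
  show "mass (\<lambda>x. u (t *\<^sub>R x)) = mass u / t ^ CARD('n)" by (simp add: mass_ip ip_dilate t)
  show "dirichlet (\<lambda>x. u (t *\<^sub>R x)) = t\<^sup>2 * dirichlet u / t ^ CARD('n)"
    unfolding dirichlet_dip dip_wd[OF H L wd H L wd]
    using ip_dilate[OF t, of "pd u _" "pd u _"] u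
    by (simp add: ip_scale_left ip_scale_right dip_eq sum_distrib_left sum_divide_distrib power2_eq_square mult.assoc)
qed

text \<open>No integrability is involved here or in the two rules below: the laws for scaling,
  translation and dilation of integrals also hold when a divergent integral has the value 0.\<close>

lemma D_scale: "D \<gamma> (\<lambda>x. s * u x) = s ^ 4 * D \<gamma> u"
proof -
  have "\<bar>s * u x\<bar>\<^sup>2 * \<bar>s * u y\<bar>\<^sup>2 / norm (x - y) powr \<gamma> = s ^ 4 * (\<bar>u x\<bar>\<^sup>2 * \<bar>u y\<bar>\<^sup>2 / norm (x - y) powr \<gamma>)" for x y
    by (simp add: power_mult_distrib power4_eq_xxxx power2_eq_square)
  then have "D \<gamma> (\<lambda>x. s * u x) = (LINT x|lborel. LINT y|lborel. s ^ 4 * (\<bar>u x\<bar>\<^sup>2 * \<bar>u y\<bar>\<^sup>2 / norm (x - y) powr \<gamma>))"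
    unfolding D_def by (intro Bochner_Integration.integral_cong refl)
  then show ?thesis by (simp only: D_def integral_mult_right_zero)
qed

lemma D_translate: "D \<gamma> (\<lambda>x. u (x + h)) = D \<gamma> u"
proof -
  have "(LINT y|lborel. \<bar>u (x + h)\<bar>\<^sup>2 * \<bar>u (y + h)\<bar>\<^sup>2 / norm (x - y) powr \<gamma>)
    = (LINT y|lborel. \<bar>u (x + h)\<bar>\<^sup>2 * \<bar>u y\<bar>\<^sup>2 / norm ((x + h) - y) powr \<gamma>)" for x
    using integral_translate[of "\<lambda>y. \<bar>u (x + h)\<bar>\<^sup>2 * \<bar>u y\<bar>\<^sup>2 / norm ((x + h) - y) powr \<gamma>" h] by simp
  then show ?thesis
    using integral_translate[of "\<lambda>x. LINT y|lborel. \<bar>u x\<bar>\<^sup>2 * \<bar>u y\<bar>\<^sup>2 / norm (x - y) powr \<gamma>" h] by (simp add: D_def)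
qed

lemma D_dilate:
  fixes u :: "real^'n::finite \<Rightarrow> real"
  assumes t: "t > 0"
  shows "D \<gamma> (\<lambda>x. u (t *\<^sub>R x)) = t powr \<gamma> * D \<gamma> u / (t ^ CARD('n))\<^sup>2"
proof -
  have "\<bar>u (t *\<^sub>R x)\<bar>\<^sup>2 * \<bar>u (t *\<^sub>R y)\<bar>\<^sup>2 / norm (x - y) powr \<gamma> =
    t powr \<gamma> * (\<bar>u (t *\<^sub>R x)\<bar>\<^sup>2 * \<bar>u (t *\<^sub>R y)\<bar>\<^sup>2 / norm (t *\<^sub>R x - t *\<^sub>R y) powr \<gamma>)" for x y
  proof -
    have "norm (t *\<^sub>R x - t *\<^sub>R y) = t * norm (x - y)" using t by (simp flip: scaleR_diff_right)
    then show ?thesis using t by (simp add: powr_mult)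
  qed
  then have "D \<gamma> (\<lambda>x. u (t *\<^sub>R x)) = (LINT x|lborel. LINT y|lborel. t powr \<gamma> * (\<bar>u (t *\<^sub>R x)\<bar>\<^sup>2 * \<bar>u (t *\<^sub>R y)\<bar>\<^sup>2 / norm (t *\<^sub>R x - t *\<^sub>R y) powr \<gamma>))"
    unfolding D_def by (intro Bochner_Integration.integral_cong refl)
  also have "\<dots> = (LINT x|lborel. t powr \<gamma> * ((LINT y|lborel. \<bar>u (t *\<^sub>R x)\<bar>\<^sup>2 * \<bar>u y\<bar>\<^sup>2 / norm (t *\<^sub>R x - y) powr \<gamma>) / t ^ CARD('n)))"
  proof (rule Bochner_Integration.integral_cong[OF refl])
    fix x
    show "(LINT y|lborel. t powr \<gamma> * (\<bar>u (t *\<^sub>R x)\<bar>\<^sup>2 * \<bar>u (t *\<^sub>R y)\<bar>\<^sup>2 / norm (t *\<^sub>R x - t *\<^sub>R y) powr \<gamma>)) =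
      t powr \<gamma> * ((LINT y|lborel. \<bar>u (t *\<^sub>R x)\<bar>\<^sup>2 * \<bar>u y\<bar>\<^sup>2 / norm (t *\<^sub>R x - y) powr \<gamma>) / t ^ CARD('n))"
      unfolding integral_dilate[OF t, of "\<lambda>y. \<bar>u (t *\<^sub>R x)\<bar>\<^sup>2 * \<bar>u y\<bar>\<^sup>2 / norm (t *\<^sub>R x - y) powr \<gamma>", symmetric]
      by (rule integral_mult_right_zero)
  qed
  also have "\<dots> = (LINT x|lborel. t powr \<gamma> * ((LINT y|lborel. \<bar>u x\<bar>\<^sup>2 * \<bar>u y\<bar>\<^sup>2 / norm (x - y) powr \<gamma>) / t ^ CARD('n))) / t ^ CARD('n)"
    by (rule integral_dilate[OF t])
  also have "\<dots> = t powr \<gamma> * D \<gamma> u / (t ^ CARD('n))\<^sup>2"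
    by (simp add: D_def power2_eq_square mult_ac)
  finally show ?thesis .
qed

text \<open>Weights that are powers of a regularised distance are smooth and bounded but not
  compactly supported. Cutting \<eta> off with rescaled bumps costs a derivative of size at most
  C/(1+n), which disappears in the limit because w is integrable.\<close>

lemma wd_bounded_smooth:
  fixes w :: "real^'n::finite \<Rightarrow> real"
  assumes w: "integrable lborel w" "integrable lborel g" "wd i w g" and \<eta>: "smooth \<eta>"
    and B: "\<And>x. \<bar>\<eta> x\<bar> \<le> B" "\<And>x. \<bar>partial_deriv i \<eta> x\<bar> \<le> B"
  shows "(LINT x|lborel. w x * partial_deriv i \<eta> x) = - (LINT x|lborel. g x * \<eta> x)"
proof -
  note [measurable] = borel_measurable_integrable[OF w(1)] borel_measurable_integrable[OF w(2)]
    smooth_measurable[OF \<eta>] smooth_measurable[OF smooth_partial[OF \<eta>]]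
    smooth_measurable[OF test_smooth[OF bump_test]] smooth_measurable[OF smooth_partial[OF test_smooth[OF bump_test]]]
  let ?c = "\<lambda>n x. bump (x /\<^sub>R (1 + real n)) :: real"
  obtain C where C: "C > 0" "\<And>x::real^'n. \<bar>partial_deriv i bump x\<bar> \<le> C"
    using test_bounded[OF test_partial[OF bump_test]] by blast
  have B0: "B \<ge> 0" using B(1)[of 0] by linarith
  have pc: "partial_deriv i (?c n) x = inverse (1 + real n) * partial_deriv i bump (x /\<^sub>R (1 + real n))" for n x
    using partial_deriv_affine[OF test_smooth[OF bump_test], of i "inverse (1 + real n)" 0] by simp
  have sc: "smooth (?c n)" for n by (rule test_smooth[OF bump_scaled])
  have 1: "(\<lambda>n. LINT x|lborel. w x * (\<eta> x * partial_deriv i (?c n) x + partial_deriv i \<eta> x * ?c n x)) \<longlonglongrightarrow>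
      (LINT x|lborel. w x * (\<eta> x * 0 + partial_deriv i \<eta> x * 1))"
  proof (rule integral_dominated_convergence[where w="\<lambda>x. (B * C + B) * \<bar>w x\<bar>"])
    show "AE x in lborel. (\<lambda>n. w x * (\<eta> x * partial_deriv i (?c n) x + partial_deriv i \<eta> x * ?c n x)) \<longlonglongrightarrow> w x * (\<eta> x * 0 + partial_deriv i \<eta> x * 1)"
    proof (intro AE_I2 tendsto_intros bump_tendsto)
      fix x
      have "(\<lambda>n. inverse (1 + real n) * C) \<longlonglongrightarrow> 0 * C"
        by (intro tendsto_intros) (use LIMSEQ_inverse_real_of_nat in \<open>simp add: add.commute\<close>)
      then have "(\<lambda>n. inverse (1 + real n) * C) \<longlonglongrightarrow> 0" by simp
      then show "(\<lambda>n. partial_deriv i (?c n) x) \<longlonglongrightarrow> 0"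
        by (rule Lim_null_comparison[rotated])
          (auto simp: pc abs_mult intro!: always_eventually mult_left_mono C)
    qed
    show "AE x in lborel. norm (w x * (\<eta> x * partial_deriv i (?c n) x + partial_deriv i \<eta> x * ?c n x)) \<le> (B * C + B) * \<bar>w x\<bar>" for n
    proof (intro AE_I2)
      fix x
      have "\<bar>partial_deriv i (?c n) x\<bar> \<le> 1 * C"
        unfolding pc abs_mult by (intro mult_mono C) (auto simp: field_simps)
      then have "\<bar>\<eta> x * partial_deriv i (?c n) x\<bar> \<le> B * C"
        unfolding abs_mult by (intro mult_mono B) (use B0 in auto)
      moreover have "\<bar>partial_deriv i \<eta> x * ?c n x\<bar> \<le> B * 1"
        unfolding abs_mult using bump_bounds[of "x /\<^sub>R (1 + real n)"] by (intro mult_mono B) (use B0 in auto)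
      ultimately have "\<bar>\<eta> x * partial_deriv i (?c n) x + partial_deriv i \<eta> x * ?c n x\<bar> \<le> B * C + B"
        by linarith
      from mult_left_mono[OF this, of "\<bar>w x\<bar>"]
      show "norm (w x * (\<eta> x * partial_deriv i (?c n) x + partial_deriv i \<eta> x * ?c n x)) \<le> (B * C + B) * \<bar>w x\<bar>"
        by (simp add: abs_mult mult.commute)
    qed
    show "integrable lborel (\<lambda>x. (B * C + B) * \<bar>w x\<bar>)" using w(1) by auto
  qed (auto simp: pc)
  have 2: "(\<lambda>n. LINT x|lborel. g x * (\<eta> x * ?c n x)) \<longlonglongrightarrow> (LINT x|lborel. g x * (\<eta> x * 1))"
  proof (rule integral_dominated_convergence[where w="\<lambda>x. B * \<bar>g x\<bar>"])
    show "AE x in lborel. (\<lambda>n. g x * (\<eta> x * ?c n x)) \<longlonglongrightarrow> g x * (\<eta> x * 1)"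
      by (intro AE_I2 tendsto_intros bump_tendsto)
    show "AE x in lborel. norm (g x * (\<eta> x * ?c n x)) \<le> B * \<bar>g x\<bar>" for n
    proof (intro AE_I2)
      fix x
      have "\<bar>\<eta> x * ?c n x\<bar> \<le> B * 1"
        unfolding abs_mult using bump_bounds[of "x /\<^sub>R (1 + real n)"] by (intro mult_mono B) (use B0 in auto)
      from mult_left_mono[OF this, of "\<bar>g x\<bar>"] show "norm (g x * (\<eta> x * ?c n x)) \<le> B * \<bar>g x\<bar>"
        by (simp add: abs_mult mult.commute)
    qed
    show "integrable lborel (\<lambda>x. B * \<bar>g x\<bar>)" using w(2) by auto
  qed auto
  have "(LINT x|lborel. w x * (\<eta> x * partial_deriv i (?c n) x + partial_deriv i \<eta> x * ?c n x)) = - (LINT x|lborel. g x * (\<eta> x * ?c n x))" for n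
    using wdD[OF w(3) test_mult[OF bump_scaled \<eta>], of n]
    by (simp add: partial_deriv_smooth_mult[OF \<eta> sc])
  with 1 tendsto_minus[OF 2] show ?thesis using LIMSEQ_unique by fastforce
qed

definition gn :: "(real^'n::finite \<Rightarrow> real) \<Rightarrow> real^'n \<Rightarrow> real" where
  "gn u x = norm (weak_grad u x)"

lemma gn_L2: "u \<in> H1 \<Longrightarrow> gn u \<in> L2"
  using weak_grad_props(1)[of u] by (auto simp: gn_def[abs_def] L2_def)

lemma gn_nonneg [simp]: "gn u x \<ge> 0" by (simp add: gn_def)

lemma ip_gn: "ip (gn u) (gn u) = dirichlet u"
  by (simp add: ip_def gn_def dirichlet_def power2_eq_square)

lemma nm_gn: "nm (gn u) = sqrt (dirichlet u)" by (simp add: nm_def ip_gn)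

lemma u_square_wd:
  assumes "u \<in> H1"
  shows "integrable lborel (\<lambda>x. u x * u x)" "integrable lborel (\<lambda>x. 2 * (u x * pd u i x))"
    "wd i (\<lambda>x. u x * u x) (\<lambda>x. 2 * (u x * pd u i x))"
proof -
  show "integrable lborel (\<lambda>x. u x * u x)" "integrable lborel (\<lambda>x. 2 * (u x * pd u i x))"
    using assms by (auto intro!: L2_integrable_mult H1_L2 pd_L2)
  show "wd i (\<lambda>x. u x * u x) (\<lambda>x. 2 * (u x * pd u i x))"
    using wd_mult[OF H1_L2 pd_L2 pd_wd H1_L2 pd_L2 pd_wd, OF assms assms assms assms assms assms, of i] by (simp add: mult.commute)
qed

section \<open>Hardy's inequality\<close>

text \<open>The squared distance to a, lifted by \<delta> so that all real powers are smooth;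
  \<open>rq a \<delta> x powr (-s/2)\<close> regularises |x - a|^(-s).\<close>

definition rq :: "real^'n::finite \<Rightarrow> real \<Rightarrow> real^'n \<Rightarrow> real" where
  "rq a \<delta> x = (norm (x - a))\<^sup>2 + \<delta>"

lemma rq_smooth: "smooth (rq a \<delta>)" and rq_partial: "partial_deriv i (rq a \<delta>) x = 2 * (x $ i - a $ i)"
proof -
  have eq: "rq a \<delta> = (\<lambda>x. (\<Sum>j\<in>UNIV. (x $ j - a $ j) * (x $ j - a $ j)) + \<delta>)"
    by (auto simp: rq_def norm_eq_sqrt_inner inner_vec_def sum_nonneg)
  show "smooth (rq a \<delta>)" unfolding eq by (intro smooth_add smooth_sum smooth_mult smooth_diff) auto
  have "((\<lambda>x. (x - a) \<bullet> (x - a) + \<delta>) has_derivative (\<lambda>h. (x - a) \<bullet> h + h \<bullet> (x - a))) (at x)"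
    by (auto intro!: derivative_eq_intros)
  then have "(rq a \<delta> has_derivative (\<lambda>h. (x - a) \<bullet> h + h \<bullet> (x - a))) (at x)"
    by (simp add: rq_def[abs_def] power2_norm_eq_inner)
  from partial_deriv_eq[OF this] show "partial_deriv i (rq a \<delta>) x = 2 * (x $ i - a $ i)"
    by (simp add: inner_axis inner_axis')
qed

lemma rq_pos: "\<delta> > 0 \<Longrightarrow> rq a \<delta> x > 0" by (simp add: rq_def add_nonneg_pos)

lemma rq_powr:
  assumes "\<delta> > 0"
  shows "smooth (\<lambda>x. rq a \<delta> x powr p)"
    "partial_deriv i (\<lambda>x. rq a \<delta> x powr p) x = 2 * p * (x $ i - a $ i) * rq a \<delta> x powr (p - 1)"
proof -
  show "smooth (\<lambda>x. rq a \<delta> x powr p)" by (intro smooth_powr rq_smooth rq_pos assms)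
  have "((\<lambda>s. s powr p) has_real_derivative p * rq a \<delta> x powr (p - 1)) (at (rq a \<delta> x))"
    using rq_pos[OF assms] by (auto intro!: derivative_eq_intros)
  from partial_deriv_comp_real(2)[OF this rq_smooth]
  show "partial_deriv i (\<lambda>x. rq a \<delta> x powr p) x = 2 * p * (x $ i - a $ i) * rq a \<delta> x powr (p - 1)"
    by (simp add: rq_partial)
qed

lemma rq_ge: "\<delta> > 0 \<Longrightarrow> \<delta> \<le> rq a \<delta> x" "\<delta> > 0 \<Longrightarrow> norm (x - a) \<le> rq a \<delta> x powr (1/2)"
proof -
  assume d: "\<delta> > 0"
  show "\<delta> \<le> rq a \<delta> x" by (simp add: rq_def)
  have "norm (x - a) = sqrt ((norm (x - a))\<^sup>2)" by simp
  also have "\<dots> \<le> sqrt (rq a \<delta> x)" using d unfolding rq_def by (intro real_sqrt_le_mono) simp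
  finally show "norm (x - a) \<le> rq a \<delta> x powr (1/2)" using rq_pos[OF d, of a x] by (simp add: powr_half_sqrt)
qed

text \<open>Integration by parts against the vector field \<open>(x - a) (|x - a|\<^sup>2 + \<delta>)^(-s/2)\<close>, whose divergence is
  at least \<open>N - s\<close> times \<open>(|x - a|\<^sup>2 + \<delta>)^(-s/2)\<close>.\<close>

lemma regularised_hardy:
  fixes u :: "real^'n::finite \<Rightarrow> real"
  assumes u: "u \<in> H1" and \<delta>: "\<delta> > 0" and s: "1 \<le> s"
  shows "(real CARD('n) - s) * (LINT x|lborel. (u x * u x) * rq a \<delta> x powr (-s/2))
    \<le> 2 * (LINT x|lborel. (\<bar>u x\<bar> * gn u x) * rq a \<delta> x powr ((1-s)/2))"
proof -
  define q where "q = rq a \<delta>"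
  have qpos: "q x > 0" and q\<delta>: "\<delta> \<le> q x" for x using rq_pos[OF \<delta>] rq_ge[OF \<delta>] by (auto simp: q_def)
  have pb: "q x powr (-p) \<le> \<delta> powr (-p)" if "p \<ge> 0" for p x
    using that \<delta> q\<delta>[of x] by (intro powr_mono2') auto
  define \<eta> where "\<eta> i x = (x $ i - a $ i) * q x powr (-s/2)" for i x
  have \<eta>s: "smooth (\<eta> i)" for i
    unfolding \<eta>_def q_def by (intro smooth_mult smooth_diff rq_powr \<delta>) auto
  have pd\<eta>: "partial_deriv i (\<eta> i) x = q x powr (-s/2) - s * (x $ i - a $ i)\<^sup>2 * q x powr (-s/2 - 1)" for i x
  proof -
    have "partial_deriv i (\<lambda>x. x $ i - a $ i) x = 1"
      by (subst partial_deriv_eq[OF has_derivative_diff[OF has_derivative_coord has_derivative_const]]) (simp add: axis_def)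
    moreover have "smooth (\<lambda>x. x $ i - a $ i)" by auto
    ultimately show ?thesis
      unfolding \<eta>_def q_def using rq_powr(1)[OF \<delta>]
      by (subst partial_deriv_smooth_mult) (auto simp: rq_powr(2)[OF \<delta>] power2_eq_square algebra_simps)
  qed
  have comp: "\<bar>x $ i - a $ i\<bar> \<le> q x powr (1/2)" for x i
    using component_le_norm_cart[of "x - a" i] rq_ge(2)[OF \<delta>, of x a] by (simp add: q_def)
  \<comment> \<open>The field grows at most like the power (1 - s)/2 of q; s >= 1 is what keeps it
    bounded.\<close>
  have \<eta>b: "\<bar>\<eta> i x\<bar> \<le> \<delta> powr (-((s-1)/2))" for i x
  proof -
    have "\<bar>\<eta> i x\<bar> \<le> q x powr (1/2) * q x powr (-s/2)"
      unfolding \<eta>_def abs_mult using comp[of x i] by (intro mult_mono) auto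
    also have "\<dots> = q x powr (1/2 + -s/2)" by (simp only: powr_add)
    also have "1/2 + -s/2 = -((s-1)/2)" by (simp add: field_simps)
    also have "q x powr (-((s-1)/2)) \<le> \<delta> powr (-((s-1)/2))" by (rule pb) (use s in simp)
    finally show ?thesis .
  qed
  have pd\<eta>b: "\<bar>partial_deriv i (\<eta> i) x\<bar> \<le> (1 + s) * \<delta> powr (-s/2)" for i x
  proof -
    have "(x $ i - a $ i)\<^sup>2 * q x powr (-s/2 - 1) \<le> q x * q x powr (-s/2 - 1)"
    proof (rule mult_right_mono)
      have "(x $ i - a $ i)\<^sup>2 \<le> (q x powr (1/2))\<^sup>2" using comp[of x i] by (simp add: abs_le_square_iff[symmetric])
      also have "\<dots> = q x" using qpos[of x] by (simp add: powr_half_sqrt)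
      finally show "(x $ i - a $ i)\<^sup>2 \<le> q x" .
    qed simp
    also have "\<dots> = q x powr (-s/2)" using qpos[of x] by (simp add: powr_diff)
    finally have "s * ((x $ i - a $ i)\<^sup>2 * q x powr (-s/2 - 1)) \<le> s * q x powr (-s/2)"
      by (rule mult_left_mono) (use s in simp)
    moreover have "0 \<le> s * ((x $ i - a $ i)\<^sup>2 * q x powr (-s/2 - 1))" using s by simp
    moreover have "0 \<le> q x powr (-s/2)" "q x powr (-s/2) \<le> \<delta> powr (-s/2)" using pb[of "s/2" x] s by auto
    moreover have "s * q x powr (-s/2) \<le> s * \<delta> powr (-s/2)" using calculation(4) s by (intro mult_left_mono) auto
    ultimately show ?thesis unfolding pd\<eta> by (simp only: distrib_right mult_1 mult.assoc)
  qed
  have qm [measurable]: "q \<in> borel_measurable borel" using smooth_measurable[OF rq_smooth] by (simp add: q_def)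
  have intb: "integrable lborel (\<lambda>x. f x * h x)"
    if "integrable lborel f" "h \<in> borel_measurable borel" "\<And>x. \<bar>h x\<bar> \<le> B" for f h :: "real^'n \<Rightarrow> real" and B
  proof (rule Bochner_Integration.integrable_bound[where f="\<lambda>x. B * f x"])
    show "AE x in lborel. norm (f x * h x) \<le> norm (B * f x)"
    proof (intro AE_I2)
      fix x show "norm (f x * h x) \<le> norm (B * f x)"
        using mult_left_mono[OF that(3)[of x], of "\<bar>f x\<bar>"] mult_left_mono[OF abs_ge_self[of B], of "\<bar>f x\<bar>"]
        by (simp add: abs_mult mult.commute)
    qed
  qed (use that in \<open>auto dest: borel_measurable_integrable\<close>)
  note usq = u_square_wd[OF u]
  have e1: "(LINT x|lborel. (u x * u x) * partial_deriv i (\<eta> i) x) = - (LINT x|lborel. (2 * (u x * pd u i x)) * \<eta> i x)" for i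
    by (rule wd_bounded_smooth[OF usq \<eta>s, where B="max (\<delta> powr (-((s-1)/2))) ((1 + s) * \<delta> powr (-s/2))"])
      (use \<eta>b pd\<eta>b in \<open>auto simp: le_max_iff_disj\<close>)
  have i1: "integrable lborel (\<lambda>x. (u x * u x) * partial_deriv i (\<eta> i) x)" for i
    by (rule intb[OF usq(1) smooth_measurable[OF smooth_partial[OF \<eta>s]] pd\<eta>b])
  have i2: "integrable lborel (\<lambda>x. (2 * (u x * pd u i x)) * \<eta> i x)" for i
    by (rule intb[OF usq(2) smooth_measurable[OF \<eta>s] \<eta>b])
  have "(real CARD('n) - s) * (LINT x|lborel. (u x * u x) * q x powr (-s/2)) = (LINT x|lborel. (real CARD('n) - s) * ((u x * u x) * q x powr (-s/2)))"
    by simp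
  also have "\<dots> \<le> (LINT x|lborel. (\<Sum>i\<in>UNIV. (u x * u x) * partial_deriv i (\<eta> i) x))"
  proof (rule integral_mono)
    have "integrable lborel (\<lambda>x. (u x * u x) * q x powr (-s/2))"
      by (rule intb[OF usq(1), where B="\<delta> powr (-s/2)"]) (use pb[of "s/2"] s in auto)
    then show "integrable lborel (\<lambda>x. (real CARD('n) - s) * ((u x * u x) * q x powr (-s/2)))" by simp
    show "integrable lborel (\<lambda>x. \<Sum>i\<in>UNIV. (u x * u x) * partial_deriv i (\<eta> i) x)" using i1 by auto
    fix x
    \<comment> \<open>The divergence is N q^(-s/2) - s |x-a|^2 q^(-s/2-1), and |x-a|^2 <= q bounds
      the subtracted term by s q^(-s/2).\<close>
    have "(\<Sum>i\<in>UNIV. (x $ i - a $ i)\<^sup>2) = (norm (x - a))\<^sup>2"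
      by (simp add: norm_eq_sqrt_inner inner_vec_def sum_nonneg power2_eq_square)
    then have "(\<Sum>i\<in>UNIV. partial_deriv i (\<eta> i) x) = real CARD('n) * q x powr (-s/2) - s * ((norm (x - a))\<^sup>2 * q x powr (-s/2 - 1))"
      unfolding pd\<eta> by (simp add: sum_subtractf sum_distrib_left[symmetric] sum_distrib_right[symmetric] mult.assoc)
    moreover have "(norm (x - a))\<^sup>2 * q x powr (-s/2 - 1) \<le> q x * q x powr (-s/2 - 1)"
      using \<delta> by (intro mult_right_mono) (auto simp: q_def rq_def)
    moreover have "q x * q x powr (-s/2 - 1) = q x powr (-s/2)" using qpos[of x] by (simp add: powr_diff)
    moreover have "s * ((norm (x - a))\<^sup>2 * q x powr (-s/2 - 1)) \<le> s * q x powr (-s/2)"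
      using calculation(2,3) s by (intro mult_left_mono) auto
    ultimately have "(real CARD('n) - s) * q x powr (-s/2) \<le> (\<Sum>i\<in>UNIV. partial_deriv i (\<eta> i) x)"
      by (simp add: left_diff_distrib)
    from mult_left_mono[OF this, of "u x * u x"]
    show "(real CARD('n) - s) * ((u x * u x) * q x powr (-s/2)) \<le> (\<Sum>i\<in>UNIV. (u x * u x) * partial_deriv i (\<eta> i) x)"
      by (simp add: sum_distrib_left mult_ac)
  qed
  also have "\<dots> = (\<Sum>i\<in>UNIV. LINT x|lborel. (u x * u x) * partial_deriv i (\<eta> i) x)"
    using i1 by simp
  also have "\<dots> = - (LINT x|lborel. (\<Sum>i\<in>UNIV. (2 * (u x * pd u i x)) * \<eta> i x))"
    unfolding e1 using i2 by (simp add: sum_negf)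
  also have "\<dots> = (LINT x|lborel. - (\<Sum>i\<in>UNIV. (2 * (u x * pd u i x)) * \<eta> i x))" by simp
  also have "\<dots> \<le> (LINT x|lborel. 2 * ((\<bar>u x\<bar> * gn u x) * q x powr ((1-s)/2)))"
  proof (rule integral_mono)
    show "integrable lborel (\<lambda>x. - (\<Sum>i\<in>UNIV. (2 * (u x * pd u i x)) * \<eta> i x))" using i2 by auto
    have "integrable lborel (\<lambda>x. (\<bar>u x\<bar> * gn u x) * q x powr ((1-s)/2))"
      by (rule intb[OF L2_integrable_mult[OF L2_abs[OF H1_L2[OF u]] gn_L2[OF u]], where B="\<delta> powr (-((s-1)/2))"])
        (use pb[of "(s-1)/2"] s in \<open>auto simp: minus_divide_left\<close>)
    then show "integrable lborel (\<lambda>x. 2 * ((\<bar>u x\<bar> * gn u x) * q x powr ((1-s)/2)))" by simp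
    fix x
    have "(\<Sum>i\<in>UNIV. pd u i x * (x $ i - a $ i)) = weak_grad u x \<bullet> (x - a)"
      by (simp add: inner_vec_def pd_def)
    also have "\<bar>\<dots>\<bar> \<le> gn u x * norm (x - a)" unfolding gn_def by (rule Cauchy_Schwarz_ineq2)
    also have "\<dots> \<le> gn u x * q x powr (1/2)" using rq_ge(2)[OF \<delta>] by (intro mult_left_mono) (auto simp: q_def)
    finally have *: "\<bar>\<Sum>i\<in>UNIV. pd u i x * (x $ i - a $ i)\<bar> \<le> gn u x * q x powr (1/2)" .
    have "- (\<Sum>i\<in>UNIV. (2 * (u x * pd u i x)) * \<eta> i x) = 2 * (- u x) * q x powr (-s/2) * (\<Sum>i\<in>UNIV. pd u i x * (x $ i - a $ i))"
      by (simp add: \<eta>_def sum_distrib_left mult_ac sum_negf[symmetric])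
    also have "\<dots> \<le> \<bar>2 * (- u x) * q x powr (-s/2) * (\<Sum>i\<in>UNIV. pd u i x * (x $ i - a $ i))\<bar>" by (rule abs_ge_self)
    also have "\<dots> = (2 * \<bar>u x\<bar> * q x powr (-s/2)) * \<bar>\<Sum>i\<in>UNIV. pd u i x * (x $ i - a $ i)\<bar>" by (simp add: abs_mult)
    also have "\<dots> \<le> (2 * \<bar>u x\<bar> * q x powr (-s/2)) * (gn u x * q x powr (1/2))"
      by (rule mult_left_mono[OF *]) simp
    also have "\<dots> = 2 * (\<bar>u x\<bar> * gn u x) * (q x powr (-s/2) * q x powr (1/2))" by simp
    also have "q x powr (-s/2) * q x powr (1/2) = q x powr ((1-s)/2)"
      by (simp add: powr_add[symmetric] diff_divide_distrib)
    finally show "- (\<Sum>i\<in>UNIV. (2 * (u x * pd u i x)) * \<eta> i x) \<le> 2 * ((\<bar>u x\<bar> * gn u x) * q x powr ((1-s)/2))" by simp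
  qed
  also have "\<dots> = 2 * (LINT x|lborel. (\<bar>u x\<bar> * gn u x) * q x powr ((1-s)/2))" by simp
  finally show ?thesis by (simp add: q_def)
qed

text \<open>With \<open>powr\<close> the kernel is 0 at the origin, and so is the quotient by
  \<open>norm (x - y) powr \<gamma>\<close> in \<open>D\<close> on the diagonal; the two forms
  therefore agree pointwise.\<close>

definition ker :: "real \<Rightarrow> real^'n::finite \<Rightarrow> real" where
  "ker \<gamma> z = norm z powr (- \<gamma>)"

lemma ker_nonneg [simp]: "ker \<gamma> z \<ge> 0" by (simp add: ker_def)

lemma ker_commute: "ker \<gamma> (x - y) = ker \<gamma> (y - x)" by (simp add: ker_def norm_minus_commute)

lemma ker_measurable [measurable]: "ker \<gamma> \<in> borel_measurable borel"
  unfolding ker_def by measurable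

lemma ker_rq: "x \<noteq> a \<Longrightarrow> ker \<gamma> (a - x) = ((norm (x - a))\<^sup>2) powr (-\<gamma>/2)"
  by (simp add: ker_def norm_minus_commute powr_powr flip: powr_numeral)

lemma ker_le_liminf:
  assumes "\<gamma> \<ge> 0"
  shows "(\<lambda>n. rq a (inverse (real (Suc n))) x powr (-\<gamma>/2)) \<longlonglongrightarrow> ker \<gamma> (a - x) \<or> x = a"
    and "x \<noteq> a \<Longrightarrow> \<delta> > 0 \<Longrightarrow> rq a \<delta> x powr (-\<gamma>/2) \<le> ker \<gamma> (a - x)"
proof -
  show "(\<lambda>n. rq a (inverse (real (Suc n))) x powr (-\<gamma>/2)) \<longlonglongrightarrow> ker \<gamma> (a - x) \<or> x = a"
  proof (cases "x = a")
    case False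
    have "(\<lambda>n. ((norm (x - a))\<^sup>2 + inverse (real (Suc n))) powr (-\<gamma>/2)) \<longlonglongrightarrow> ((norm (x - a))\<^sup>2 + 0) powr (-\<gamma>/2)"
      by (intro tendsto_intros LIMSEQ_inverse_real_of_nat) (use False in auto)
    then show ?thesis using False by (simp add: rq_def ker_rq)
  qed simp
  show "rq a \<delta> x powr (-\<gamma>/2) \<le> ker \<gamma> (a - x)" if "x \<noteq> a" "\<delta> > 0"
    unfolding ker_rq[OF that(1)] rq_def using that assms by (intro powr_mono2') auto
qed

text \<open>Bounds that are uniform in \<delta> pass to the singular kernel without knowing
  beforehand that the limit is integrable; hence the formulation with nonnegative integrals.\<close>

lemma ker_Fatou:
  assumes f[measurable]: "f \<in> borel_measurable borel" "\<And>x. f x \<ge> 0" and \<gamma>: "\<gamma> \<ge> 0"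
    and b: "\<And>\<delta>. \<delta> > 0 \<Longrightarrow> (\<integral>\<^sup>+x. ennreal (f x * rq a \<delta> x powr (-\<gamma>/2)) \<partial>lborel) \<le> C"
  shows "(\<integral>\<^sup>+x. ennreal (f x * ker \<gamma> (a - x)) \<partial>lborel) \<le> C"
proof -
  let ?\<delta> = "\<lambda>n. inverse (real (Suc n))"
  have [measurable]: "rq a \<delta> \<in> borel_measurable borel" for \<delta> by (rule smooth_measurable[OF rq_smooth])
  have "(\<integral>\<^sup>+x. ennreal (f x * ker \<gamma> (a - x)) \<partial>lborel) \<le> (\<integral>\<^sup>+x. liminf (\<lambda>n. ennreal (f x * rq a (?\<delta> n) x powr (-\<gamma>/2))) \<partial>lborel)"
  proof (rule nn_integral_mono)
    fix x
    show "ennreal (f x * ker \<gamma> (a - x)) \<le> liminf (\<lambda>n. ennreal (f x * rq a (?\<delta> n) x powr (-\<gamma>/2)))"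
    \<comment> \<open>At x = a the regularised weights need not converge to the kernel, but there
      the kernel has the value 0 and the inequality is trivial.\<close>
    proof (cases "x = a")
      case False
      then have "(\<lambda>n. ennreal (f x * rq a (?\<delta> n) x powr (-\<gamma>/2))) \<longlonglongrightarrow> ennreal (f x * ker \<gamma> (a - x))"
        using ker_le_liminf(1)[OF \<gamma>, of a x] by (intro tendsto_intros) auto
      from lim_imp_Liminf[OF _ this] show ?thesis by simp
    qed (simp add: ker_def)
  qed
  also have "\<dots> \<le> liminf (\<lambda>n. \<integral>\<^sup>+x. ennreal (f x * rq a (?\<delta> n) x powr (-\<gamma>/2)) \<partial>lborel)"
    by (rule nn_integral_liminf) measurable
  also have "\<dots> \<le> liminf (\<lambda>n::nat. C)"
    by (intro Liminf_mono always_eventually allI b) simp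
  also have "\<dots> = C" by (simp add: Liminf_const)
  finally show ?thesis .
qed

text \<open>The limit \<delta> to 0 of \<open>regularised_hardy\<close>. The singularity drops by
  one at the price of replacing a factor u by its gradient; this works for every exponent below the
  dimension, also above 2.\<close>

lemma nn_integral_weighted_hardy:
  fixes u :: "real^'n::finite \<Rightarrow> real"
  assumes u: "u \<in> H1" and s: "1 \<le> s" "s < real CARD('n)"
  shows "(\<integral>\<^sup>+x. ennreal ((u x * u x) * ker s (a - x)) \<partial>lborel)
    \<le> ennreal (2 / (real CARD('n) - s)) * (\<integral>\<^sup>+x. ennreal ((\<bar>u x\<bar> * gn u x) * ker (s - 1) (a - x)) \<partial>lborel)"
proof (rule ker_Fatou)
  note [measurable] = L2_measurable[OF H1_L2[OF u]] L2_measurable[OF gn_L2[OF u]]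
  show "(\<lambda>x. u x * u x) \<in> borel_measurable borel" by measurable
  fix \<delta> :: real assume \<delta>: "\<delta> > 0"
  have [measurable]: "rq a \<delta> \<in> borel_measurable borel" by (rule smooth_measurable[OF rq_smooth])
  have bd: "rq a \<delta> x powr (-p) \<le> \<delta> powr (-p)" if "p \<ge> 0" for p x
    using that \<delta> rq_ge(1)[OF \<delta>, of a x] by (intro powr_mono2') auto
  have int1: "integrable lborel (\<lambda>x. (u x * u x) * rq a \<delta> x powr (-s/2))"
  proof (rule Bochner_Integration.integrable_bound[where f="\<lambda>x. \<delta> powr (-s/2) * (u x * u x)"])
    show "AE x in lborel. norm ((u x * u x) * rq a \<delta> x powr (-s/2)) \<le> norm (\<delta> powr (-s/2) * (u x * u x))"
      using bd[of "s/2"] s by (auto simp: abs_mult mult.commute[of "_ powr _"] intro!: mult_left_mono)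
  qed (use u_square_wd(1)[OF u] in auto)
  have int2: "integrable lborel (\<lambda>x. (\<bar>u x\<bar> * gn u x) * rq a \<delta> x powr ((1-s)/2))"
  proof (rule Bochner_Integration.integrable_bound[where f="\<lambda>x. \<delta> powr (-((s-1)/2)) * (\<bar>u x\<bar> * gn u x)"])
    show "AE x in lborel. norm ((\<bar>u x\<bar> * gn u x) * rq a \<delta> x powr ((1-s)/2)) \<le> norm (\<delta> powr (-((s-1)/2)) * (\<bar>u x\<bar> * gn u x))"
      using bd[of "(s-1)/2"] s by (auto simp: abs_mult mult.commute[of "_ powr _"] minus_divide_left intro!: mult_left_mono)
  qed (use L2_integrable_mult[OF L2_abs[OF H1_L2[OF u]] gn_L2[OF u]] in auto)
  have "(\<integral>\<^sup>+x. ennreal ((u x * u x) * rq a \<delta> x powr (-s/2)) \<partial>lborel) = ennreal (LINT x|lborel. (u x * u x) * rq a \<delta> x powr (-s/2))"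
    by (rule nn_integral_eq_integral[OF int1]) auto
  also have "\<dots> \<le> ennreal ((2 / (real CARD('n) - s)) * (LINT x|lborel. (\<bar>u x\<bar> * gn u x) * rq a \<delta> x powr ((1-s)/2)))"
    using regularised_hardy[OF u \<delta> s(1), of a] s(2) by (intro ennreal_leI) (simp add: field_simps)
  also have "\<dots> = ennreal (2 / (real CARD('n) - s)) * ennreal (LINT x|lborel. (\<bar>u x\<bar> * gn u x) * rq a \<delta> x powr ((1-s)/2))"
    using s(2) by (subst ennreal_mult) (auto intro!: integral_nonneg)
  also have "ennreal (LINT x|lborel. (\<bar>u x\<bar> * gn u x) * rq a \<delta> x powr ((1-s)/2)) = (\<integral>\<^sup>+x. ennreal ((\<bar>u x\<bar> * gn u x) * rq a \<delta> x powr ((1-s)/2)) \<partial>lborel)"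
    by (rule nn_integral_eq_integral[OF int2, symmetric]) auto
  also have "\<dots> \<le> (\<integral>\<^sup>+x. ennreal ((\<bar>u x\<bar> * gn u x) * ker (s - 1) (a - x)) \<partial>lborel)"
  proof (rule nn_integral_mono_AE)
    show "AE x in lborel. ennreal ((\<bar>u x\<bar> * gn u x) * rq a \<delta> x powr ((1-s)/2)) \<le> ennreal ((\<bar>u x\<bar> * gn u x) * ker (s - 1) (a - x))"
      using AE_lborel_singleton[of a]
    proof eventually_elim
      case (elim x)
      then show ?case
        using ker_le_liminf(2)[of "s - 1" x a \<delta>] s \<delta> by (intro ennreal_leI mult_left_mono) auto
    qed
  qed
  finally show "(\<integral>\<^sup>+x. ennreal ((u x * u x) * rq a \<delta> x powr (-s/2)) \<partial>lborel) \<le>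
    ennreal (2 / (real CARD('n) - s)) * (\<integral>\<^sup>+x. ennreal ((\<bar>u x\<bar> * gn u x) * ker (s - 1) (a - x)) \<partial>lborel)"
    by (simp add: mult_left_mono)
qed (use s in auto)

text \<open>For s = 2 the right side of \<open>regularised_hardy\<close> is the inner product of f =
  q^(-1/2)|u| with |grad u|, so Cauchy-Schwarz gives (N-2) |f|^2 <= 2 |f| |grad u|. Cancelling |f|
  is legitimate because the regularisation makes it finite. From N >= 3 only N - 2 >= 1 is used,
  which yields the constant 4.\<close>

lemma nn_integral_hardy:
  fixes u :: "real^'n::finite \<Rightarrow> real"
  assumes u: "u \<in> H1" and N: "CARD('n) \<ge> 3"
  shows "(\<integral>\<^sup>+x. ennreal ((u x * u x) * ker 2 (a - x)) \<partial>lborel) \<le> ennreal (4 * dirichlet u)"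
proof (rule ker_Fatou)
  note [measurable] = L2_measurable[OF H1_L2[OF u]] L2_measurable[OF gn_L2[OF u]]
  show "(\<lambda>x. u x * u x) \<in> borel_measurable borel" by measurable
  fix \<delta> :: real assume \<delta>: "\<delta> > 0"
  have [measurable]: "rq a \<delta> \<in> borel_measurable borel" by (rule smooth_measurable[OF rq_smooth])
  have bd: "rq a \<delta> x powr (-1/2) \<le> \<delta> powr (-1/2)" for x
    using \<delta> rq_ge(1)[OF \<delta>, of a x] by (intro powr_mono2') auto
  define f where "f x = rq a \<delta> x powr (-1/2) * \<bar>u x\<bar>" for x
  have f: "f \<in> L2" unfolding f_def
    by (rule L2_bounded_mult[OF L2_abs[OF H1_L2[OF u]], where B="\<delta> powr (-1/2)"]) (use bd in auto)
  have sq: "f x * f x = (u x * u x) * rq a \<delta> x powr (-2/2)" for x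
  proof -
    have "rq a \<delta> x powr (-1/2) * rq a \<delta> x powr (-1/2) = rq a \<delta> x powr (-2/2)" by (simp add: powr_add[symmetric])
    then show ?thesis unfolding f_def by (simp add: mult_ac abs_mult_self flip: mult.assoc)
  qed
  have "(real CARD('n) - 2) * (LINT x|lborel. (u x * u x) * rq a \<delta> x powr (-2/2)) \<le> 2 * (LINT x|lborel. (\<bar>u x\<bar> * gn u x) * rq a \<delta> x powr ((1-2)/2))"
    by (rule regularised_hardy[OF u \<delta>]) simp
  then have "(real CARD('n) - 2) * ip f f \<le> 2 * ip f (gn u)"
    by (simp add: ip_def sq) (simp add: f_def mult_ac)
  moreover have "1 * ip f f \<le> (real CARD('n) - 2) * ip f f" using N by (intro mult_right_mono ip_nonneg) linarith
  moreover have "ip f (gn u) \<le> nm f * nm (gn u)" using ip_Cauchy_Schwarz[OF f gn_L2[OF u]] by linarith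
  ultimately have "nm f * nm f \<le> 2 * (nm f * nm (gn u))" by (simp only: nm_square[symmetric] power2_eq_square)
  then have "nm f * nm f \<le> (2 * nm (gn u)) * nm f" by (simp add: mult_ac)
  then have "nm f \<le> 2 * nm (gn u)"
    using nm_nonneg[of f] nm_nonneg[of "gn u"] by (cases "nm f = 0") (auto simp: mult_le_cancel_right)
  then have "(nm f)\<^sup>2 \<le> (2 * nm (gn u))\<^sup>2" by (intro power_mono) auto
  then have "ip f f \<le> 4 * dirichlet u"
    by (simp add: power_mult_distrib nm_square ip_gn)
  moreover have "(\<integral>\<^sup>+x. ennreal ((u x * u x) * rq a \<delta> x powr (-2/2)) \<partial>lborel) = ennreal (ip f f)"
    unfolding ip_def sq[symmetric] by (rule nn_integral_eq_integral[OF L2_integrable_mult[OF f f]]) auto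
  ultimately show "(\<integral>\<^sup>+x. ennreal ((u x * u x) * rq a \<delta> x powr (-2/2)) \<partial>lborel) \<le> ennreal (4 * dirichlet u)"
    by (simp add: ennreal_leI)
qed auto

section \<open>Riesz potentials\<close>

text \<open>Integrable functions whose absolute potential is uniformly bounded. For these Fubini and
  bilinearity of \<open>I\<close> hold, and by \<open>PB_mult\<close> every product of two H1
  functions belongs to the class for exponents in [0,2].\<close>

definition PB :: "real \<Rightarrow> (real^'n::finite \<Rightarrow> real) \<Rightarrow> bool" where
  "PB \<gamma> f \<longleftrightarrow> integrable lborel f \<and> (\<exists>M. \<forall>x. (\<integral>\<^sup>+y. ennreal (\<bar>f y\<bar> * ker \<gamma> (x - y)) \<partial>lborel) \<le> ennreal M)"

definition pot :: "real \<Rightarrow> (real^'n::finite \<Rightarrow> real) \<Rightarrow> real^'n \<Rightarrow> real" where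
  "pot \<gamma> f x = (LINT y|lborel. ker \<gamma> (x - y) * f y)"

text \<open>The bilinear form behind the quartic functional: \<open>D \<gamma> u\<close> is its
  value at the pair u^2, u^2.\<close>

definition I :: "real \<Rightarrow> (real^'n::finite \<Rightarrow> real) \<Rightarrow> (real^'n \<Rightarrow> real) \<Rightarrow> real" where
  "I \<gamma> f g = (LINT x|lborel. f x * pot \<gamma> g x)"

lemma PB_integrable: "PB \<gamma> f \<Longrightarrow> integrable lborel f" by (simp add: PB_def)

lemma PB_measurable [measurable_dest]: "PB \<gamma> f \<Longrightarrow> f \<in> borel_measurable borel"
  using borel_measurable_integrable[of lborel f] by (simp add: PB_def)

lemma PB_bound:
  assumes "PB \<gamma> f"
  obtains M where "M \<ge> 0" "\<And>x. (\<integral>\<^sup>+y. ennreal (\<bar>f y\<bar> * ker \<gamma> (x - y)) \<partial>lborel) \<le> ennreal M"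
proof -
  obtain M where M: "\<And>x. (\<integral>\<^sup>+y. ennreal (\<bar>f y\<bar> * ker \<gamma> (x - y)) \<partial>lborel) \<le> ennreal M"
    using assms by (auto simp: PB_def)
  show ?thesis
  proof (rule that[of "max M 0"])
    show "(\<integral>\<^sup>+y. ennreal (\<bar>f y\<bar> * ker \<gamma> (x - y)) \<partial>lborel) \<le> ennreal (max M 0)" for x
      by (rule order_trans[OF M ennreal_leI]) simp
  qed simp
qed

lemma pot_abs_le_nn:
  assumes [measurable]: "f \<in> borel_measurable borel" and M: "(\<integral>\<^sup>+y. ennreal (\<bar>f y\<bar> * ker \<gamma> (x - y)) \<partial>lborel) \<le> ennreal M" "M \<ge> 0"
  shows "integrable lborel (\<lambda>y. ker \<gamma> (x - y) * f y)" "\<bar>pot \<gamma> f x\<bar> \<le> M"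
proof -
  have eq: "(\<integral>\<^sup>+y. ennreal (norm (ker \<gamma> (x - y) * f y)) \<partial>lborel) = (\<integral>\<^sup>+y. ennreal (\<bar>f y\<bar> * ker \<gamma> (x - y)) \<partial>lborel)"
    by (simp add: abs_mult mult.commute)
  show "integrable lborel (\<lambda>y. ker \<gamma> (x - y) * f y)"
    unfolding integrable_iff_bounded eq using le_less_trans[OF M(1)] by simp
  have "ennreal (norm (pot \<gamma> f x)) \<le> (\<integral>\<^sup>+y. ennreal (norm (ker \<gamma> (x - y) * f y)) \<partial>lborel)"
    unfolding pot_def by (rule integral_norm_bound_ennreal) fact
  also have "\<dots> \<le> ennreal M" unfolding eq by (rule M)
  finally show "\<bar>pot \<gamma> f x\<bar> \<le> M" using M(2) by (simp add: ennreal_le_iff)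
qed

lemma PB_pot_integrable: "PB \<gamma> f \<Longrightarrow> integrable lborel (\<lambda>y. ker \<gamma> (x - y) * f y)"
proof -
  assume f: "PB \<gamma> f"
  obtain M where "M \<ge> 0" "\<And>x. (\<integral>\<^sup>+y. ennreal (\<bar>f y\<bar> * ker \<gamma> (x - y)) \<partial>lborel) \<le> ennreal M"
    using PB_bound[OF f] by blast
  from pot_abs_le_nn(1)[OF PB_measurable[OF f] this(2) this(1)] show ?thesis .
qed

lemma pot_bounded:
  assumes "PB \<gamma> f"
  obtains M where "M \<ge> 0" "\<And>x. \<bar>pot \<gamma> f x\<bar> \<le> M"
  using PB_bound[OF assms] pot_abs_le_nn(2)[OF PB_measurable[OF assms]] by metis

lemma pot_measurable: "f \<in> borel_measurable borel \<Longrightarrow> pot \<gamma> f \<in> borel_measurable borel"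
proof -
  assume [measurable]: "f \<in> borel_measurable borel"
  have "(\<lambda>x. LINT y|lborel. ker \<gamma> (x - y) * f y) \<in> borel_measurable lborel"
    by (rule lborel.borel_measurable_lebesgue_integral) measurable
  then show ?thesis by (simp add: pot_def[abs_def])
qed

lemma I_integrable:
  assumes "integrable lborel f" "PB \<gamma> g"
  shows "integrable lborel (\<lambda>x. f x * pot \<gamma> g x)"
proof -
  obtain M where M: "M \<ge> 0" "\<And>x. \<bar>pot \<gamma> g x\<bar> \<le> M" using pot_bounded[OF assms(2)] by blast
  note [measurable] = pot_measurable[OF PB_measurable[OF assms(2)]] borel_measurable_integrable[OF assms(1)]
  show ?thesis
  proof (rule Bochner_Integration.integrable_bound[where f="\<lambda>x. M * f x"])
    show "AE x in lborel. norm (f x * pot \<gamma> g x) \<le> norm (M * f x)"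
      using M by (auto simp: abs_mult mult.commute[of M] intro!: mult_left_mono)
  qed (use assms in auto)
qed

lemma I_add_left: "integrable lborel f \<Longrightarrow> integrable lborel f' \<Longrightarrow> PB \<gamma> g \<Longrightarrow> I \<gamma> (\<lambda>x. f x + f' x) g = I \<gamma> f g + I \<gamma> f' g"
  by (simp add: I_def distrib_right I_integrable)

lemma I_scale_left: "I \<gamma> (\<lambda>x. c * f x) g = c * I \<gamma> f g"
  by (simp add: I_def mult.assoc)

text \<open>An integrable f against a bounded absolute potential: this one bound justifies the
  Fubini arguments for the singular kernel.\<close>

lemma I_pair_integrable:
  assumes f: "integrable lborel f" and g: "PB \<gamma> g"
  shows "integrable (lborel \<Otimes>\<^sub>M lborel) (\<lambda>(x, y). f x * (ker \<gamma> (x - y) * g y))"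
proof -
  note [measurable] = PB_measurable[OF g] borel_measurable_integrable[OF f]
  obtain M where M: "M \<ge> 0" "\<And>x. (\<integral>\<^sup>+y. ennreal (\<bar>g y\<bar> * ker \<gamma> (x - y)) \<partial>lborel) \<le> ennreal M"
    using PB_bound[OF g] by blast
  have "(\<integral>\<^sup>+p. ennreal (norm (case p of (x, y) \<Rightarrow> f x * (ker \<gamma> (x - y) * g y))) \<partial>(lborel \<Otimes>\<^sub>M lborel))
    = (\<integral>\<^sup>+x. \<integral>\<^sup>+y. ennreal \<bar>f x\<bar> * ennreal (\<bar>g y\<bar> * ker \<gamma> (x - y)) \<partial>lborel \<partial>lborel)"
    by (subst lborel.nn_integral_fst[symmetric]) (auto simp: abs_mult ennreal_mult[symmetric] mult_ac)
  also have "\<dots> = (\<integral>\<^sup>+x. ennreal \<bar>f x\<bar> * (\<integral>\<^sup>+y. ennreal (\<bar>g y\<bar> * ker \<gamma> (x - y)) \<partial>lborel) \<partial>lborel)"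
    by (simp add: nn_integral_cmult)
  also have "\<dots> \<le> (\<integral>\<^sup>+x. ennreal \<bar>f x\<bar> * ennreal M \<partial>lborel)"
    by (intro nn_integral_mono mult_left_mono M) auto
  also have "\<dots> = (\<integral>\<^sup>+x. ennreal \<bar>f x\<bar> \<partial>lborel) * ennreal M" by (simp add: nn_integral_multc)
  also have "\<dots> < \<infinity>" using f by (auto simp: integrable_iff_bounded ennreal_mult_less_top)
  finally show ?thesis by (simp add: integrable_iff_bounded)
qed

lemma I_commute:
  assumes f: "PB \<gamma> f" and g: "PB \<gamma> g"
  shows "I \<gamma> f g = I \<gamma> g f"
proof -
  have "I \<gamma> f g = (LINT x|lborel. LINT y|lborel. f x * (ker \<gamma> (x - y) * g y))"
    by (simp add: I_def pot_def)
  also have "\<dots> = (LINT y|lborel. LINT x|lborel. f x * (ker \<gamma> (x - y) * g y))"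
    using lborel_pair.Fubini_integral[OF I_pair_integrable[OF PB_integrable[OF f] g]] by simp
  also have "\<dots> = (LINT y|lborel. g y * (LINT x|lborel. ker \<gamma> (y - x) * f x))"
    by (simp add: ker_commute[of \<gamma> _ "_::real^'a"] mult_ac flip: integral_mult_right_zero)
  finally show ?thesis by (simp add: I_def pot_def)
qed

lemma I_nn:
  assumes f: "integrable lborel f" "\<And>x. f x \<ge> 0" and g: "PB \<gamma> g" "\<And>x. g x \<ge> 0"
  shows "ennreal (I \<gamma> f g) = (\<integral>\<^sup>+x. \<integral>\<^sup>+y. ennreal (f x * (ker \<gamma> (x - y) * g y)) \<partial>lborel \<partial>lborel)" "I \<gamma> f g \<ge> 0"
proof -
  have pot: "ennreal (pot \<gamma> g x) = (\<integral>\<^sup>+y. ennreal (ker \<gamma> (x - y) * g y) \<partial>lborel)" for x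
    unfolding pot_def by (rule nn_integral_eq_integral[symmetric]) (use PB_pot_integrable[OF g(1)] g(2) in auto)
  have pot0: "pot \<gamma> g x \<ge> 0" for x unfolding pot_def using g(2) by (intro Bochner_Integration.integral_nonneg) auto
  show "I \<gamma> f g \<ge> 0" unfolding I_def using f(2) pot0 by (intro Bochner_Integration.integral_nonneg) auto
  note [measurable] = PB_measurable[OF g(1)]
  have "ennreal (I \<gamma> f g) = (\<integral>\<^sup>+x. ennreal (f x * pot \<gamma> g x) \<partial>lborel)"
    unfolding I_def by (rule nn_integral_eq_integral[symmetric]) (use I_integrable[OF f(1) g(1)] f(2) pot0 in auto)
  also have "\<dots> = (\<integral>\<^sup>+x. \<integral>\<^sup>+y. ennreal (f x * (ker \<gamma> (x - y) * g y)) \<partial>lborel \<partial>lborel)"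
    using f(2) g(2) pot0 by (simp add: ennreal_mult pot nn_integral_cmult)
  finally show "ennreal (I \<gamma> f g) = (\<integral>\<^sup>+x. \<integral>\<^sup>+y. ennreal (f x * (ker \<gamma> (x - y) * g y)) \<partial>lborel \<partial>lborel)" .
qed

lemma PB_dominated:
  assumes g: "PB \<gamma> g" and [measurable]: "f \<in> borel_measurable borel" and le: "\<And>x. \<bar>f x\<bar> \<le> \<bar>g x\<bar>"
  shows "PB \<gamma> f"
  unfolding PB_def
proof
  show "integrable lborel f"
    by (rule Bochner_Integration.integrable_bound[OF PB_integrable[OF g]]) (use le in auto)
  obtain M where M: "\<And>x. (\<integral>\<^sup>+y. ennreal (\<bar>g y\<bar> * ker \<gamma> (x - y)) \<partial>lborel) \<le> ennreal M"
    using PB_bound[OF g] by blast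
  have "(\<integral>\<^sup>+y. ennreal (\<bar>f y\<bar> * ker \<gamma> (x - y)) \<partial>lborel) \<le> (\<integral>\<^sup>+y. ennreal (\<bar>g y\<bar> * ker \<gamma> (x - y)) \<partial>lborel)" for x
    by (intro nn_integral_mono ennreal_leI mult_right_mono le) simp
  from order_trans[OF this M] show "\<exists>M. \<forall>x. (\<integral>\<^sup>+y. ennreal (\<bar>f y\<bar> * ker \<gamma> (x - y)) \<partial>lborel) \<le> ennreal M" by blast
qed

lemma PB_add:
  assumes f: "PB \<gamma> f" and g: "PB \<gamma> g"
  shows "PB \<gamma> (\<lambda>x. f x + g x)"
  unfolding PB_def
proof
  note [measurable] = PB_measurable[OF f] PB_measurable[OF g]
  show "integrable lborel (\<lambda>x. f x + g x)" using f g by (simp add: PB_integrable)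
  obtain M where M: "M \<ge> 0" "\<And>x. (\<integral>\<^sup>+y. ennreal (\<bar>f y\<bar> * ker \<gamma> (x - y)) \<partial>lborel) \<le> ennreal M"
    using PB_bound[OF f] by blast
  obtain M' where M': "M' \<ge> 0" "\<And>x. (\<integral>\<^sup>+y. ennreal (\<bar>g y\<bar> * ker \<gamma> (x - y)) \<partial>lborel) \<le> ennreal M'"
    using PB_bound[OF g] by blast
  have "(\<integral>\<^sup>+y. ennreal (\<bar>f y + g y\<bar> * ker \<gamma> (x - y)) \<partial>lborel) \<le> ennreal (M + M')" for x
  proof -
    have "(\<integral>\<^sup>+y. ennreal (\<bar>f y + g y\<bar> * ker \<gamma> (x - y)) \<partial>lborel)
      \<le> (\<integral>\<^sup>+y. ennreal (\<bar>f y\<bar> * ker \<gamma> (x - y)) + ennreal (\<bar>g y\<bar> * ker \<gamma> (x - y)) \<partial>lborel)"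
      by (intro nn_integral_mono)
        (auto simp: distrib_right[symmetric] ennreal_plus[symmetric] simp del: ennreal_plus intro!: ennreal_leI mult_right_mono)
    also have "\<dots> \<le> ennreal M + ennreal M'"
      by (subst nn_integral_add) (auto intro!: add_mono M M')
    finally show ?thesis using M M' by simp
  qed
  then show "\<exists>M. \<forall>x. (\<integral>\<^sup>+y. ennreal (\<bar>f y + g y\<bar> * ker \<gamma> (x - y)) \<partial>lborel) \<le> ennreal M" by blast
qed

lemma PB_scale:
  assumes f: "PB \<gamma> f"
  shows "PB \<gamma> (\<lambda>x. c * f x)"
  unfolding PB_def
proof
  note [measurable] = PB_measurable[OF f]
  show "integrable lborel (\<lambda>x. c * f x)" using f by (simp add: PB_integrable)
  obtain M where M: "M \<ge> 0" "\<And>x. (\<integral>\<^sup>+y. ennreal (\<bar>f y\<bar> * ker \<gamma> (x - y)) \<partial>lborel) \<le> ennreal M"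
    using PB_bound[OF f] by blast
  have "(\<integral>\<^sup>+y. ennreal (\<bar>c * f y\<bar> * ker \<gamma> (x - y)) \<partial>lborel) \<le> ennreal (\<bar>c\<bar> * M)" for x
  proof -
    have "(\<integral>\<^sup>+y. ennreal (\<bar>c * f y\<bar> * ker \<gamma> (x - y)) \<partial>lborel) = ennreal \<bar>c\<bar> * (\<integral>\<^sup>+y. ennreal (\<bar>f y\<bar> * ker \<gamma> (x - y)) \<partial>lborel)"
      by (subst nn_integral_cmult[symmetric]) (auto simp: abs_mult ennreal_mult[symmetric] mult.assoc)
    also have "\<dots> \<le> ennreal \<bar>c\<bar> * ennreal M" by (intro mult_left_mono M) simp
    finally show ?thesis using M by (simp add: ennreal_mult)
  qed
  then show "\<exists>M. \<forall>x. (\<integral>\<^sup>+y. ennreal (\<bar>c * f y\<bar> * ker \<gamma> (x - y)) \<partial>lborel) \<le> ennreal M" by blast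
qed

lemma ker_le_interpolate:
  assumes "0 \<le> \<gamma>" "\<gamma> \<le> 2"
  shows "ker \<gamma> z \<le> 1 + ker 2 z"
proof (cases "z = 0")
  case False
  then have n: "norm z > 0" by simp
  show ?thesis
  proof (cases "norm z \<ge> 1")
    case True
    then have "norm z powr (- \<gamma>) \<le> norm z powr 0" using assms by (intro powr_mono) auto
    then show ?thesis using n by (simp add: ker_def add_increasing2)
  next
    case F: False
    then have "norm z powr (- \<gamma>) \<le> norm z powr (-2)" using assms n by (intro powr_mono') auto
    then show ?thesis by (simp add: ker_def)
  qed
qed (simp add: ker_def)

text \<open>The kernel is at most 1 plus the kernel of exponent 2; the first part contributes the
  mass and the second is Hardy's inequality centred at x. The bound does not depend on x.\<close>

lemma nn_pot_square_le:
  fixes u :: "real^'n::finite \<Rightarrow> real"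
  assumes u: "u \<in> H1" and N: "CARD('n) \<ge> 3" and \<gamma>: "0 \<le> \<gamma>" "\<gamma> \<le> 2"
  shows "(\<integral>\<^sup>+y. ennreal ((u y * u y) * ker \<gamma> (x - y)) \<partial>lborel) \<le> ennreal (mass u + 4 * dirichlet u)"
proof -
  note [measurable] = L2_measurable[OF H1_L2[OF u]]
  have "(\<integral>\<^sup>+y. ennreal ((u y * u y) * ker \<gamma> (x - y)) \<partial>lborel)
    \<le> (\<integral>\<^sup>+y. ennreal (u y * u y) + ennreal ((u y * u y) * ker 2 (x - y)) \<partial>lborel)"
  proof (rule nn_integral_mono)
    fix y
    have "(u y * u y) * ker \<gamma> (x - y) \<le> (u y * u y) * (1 + ker 2 (x - y))"
      by (intro mult_left_mono ker_le_interpolate \<gamma>) auto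
    then show "ennreal ((u y * u y) * ker \<gamma> (x - y)) \<le> ennreal (u y * u y) + ennreal ((u y * u y) * ker 2 (x - y))"
      by (simp add: distrib_left ennreal_leI flip: ennreal_plus)
  qed
  also have "\<dots> = (\<integral>\<^sup>+y. ennreal (u y * u y) \<partial>lborel) + (\<integral>\<^sup>+y. ennreal ((u y * u y) * ker 2 (x - y)) \<partial>lborel)"
    by (rule nn_integral_add) measurable
  also have "(\<integral>\<^sup>+y. ennreal (u y * u y) \<partial>lborel) = ennreal (mass u)"
    unfolding mass_ip ip_def by (rule nn_integral_eq_integral[OF u_square_wd(1)[OF u]]) simp
  also have "ennreal (mass u) + (\<integral>\<^sup>+y. ennreal ((u y * u y) * ker 2 (x - y)) \<partial>lborel) \<le> ennreal (mass u) + ennreal (4 * dirichlet u)"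
    by (intro add_left_mono nn_integral_hardy u N)
  finally show ?thesis by (simp add: mass_nonneg dirichlet_nonneg)
qed

lemma PB_square:
  fixes u :: "real^'n::finite \<Rightarrow> real"
  assumes "u \<in> H1" "CARD('n) \<ge> 3" "0 \<le> \<gamma>" "\<gamma> \<le> 2"
  shows "PB \<gamma> (\<lambda>x. u x * u x)"
  using nn_pot_square_le[OF assms] u_square_wd(1)[OF assms(1)] by (auto simp: PB_def)

lemma PB_mult:
  fixes u v :: "real^'n::finite \<Rightarrow> real"
  assumes u: "u \<in> H1" and v: "v \<in> H1" and N: "CARD('n) \<ge> 3" and \<gamma>: "0 \<le> \<gamma>" "\<gamma> \<le> 2"
  shows "PB \<gamma> (\<lambda>x. u x * v x)"
proof (rule PB_dominated)
  show "PB \<gamma> (\<lambda>x. u x * u x + v x * v x)" by (intro PB_add PB_square u v N \<gamma>)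
  show "(\<lambda>x. u x * v x) \<in> borel_measurable borel"
    using L2_measurable[OF H1_L2[OF u]] L2_measurable[OF H1_L2[OF v]] by measurable
  fix x
  have "2 * \<bar>u x\<bar> * \<bar>v x\<bar> \<le> (u x * u x) + (v x * v x)"
    using sum_squares_bound[of "\<bar>u x\<bar>" "\<bar>v x\<bar>"] by (simp add: power2_eq_square)
  moreover have "0 \<le> \<bar>u x\<bar> * \<bar>v x\<bar>" by simp
  ultimately have "\<bar>u x\<bar> * \<bar>v x\<bar> \<le> (u x * u x) + (v x * v x)" by linarith
  then show "\<bar>u x * v x\<bar> \<le> \<bar>u x * u x + v x * v x\<bar>" by (simp add: abs_mult)
qed

lemma pot_square_bounds:
  fixes u :: "real^'n::finite \<Rightarrow> real"
  assumes "u \<in> H1" "CARD('n) \<ge> 3" "0 \<le> \<gamma>" "\<gamma> \<le> 2"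
  shows "\<bar>pot \<gamma> (\<lambda>x. u x * u x) x\<bar> \<le> mass u + 4 * dirichlet u"
  using nn_pot_square_le[OF assms, of x] PB_measurable[OF PB_square[OF assms]]
  by (intro pot_abs_le_nn(2)) (auto simp: mass_nonneg dirichlet_nonneg)

lemma D_I: "D \<gamma> u = I \<gamma> (\<lambda>x. u x * u x) (\<lambda>x. u x * u x)"
proof -
  have "\<bar>u x\<bar>\<^sup>2 * \<bar>u y\<bar>\<^sup>2 / norm (x - y) powr \<gamma> = (u x * u x) * (ker \<gamma> (x - y) * (u y * u y))" for x y
    by (simp add: ker_def power2_eq_square powr_minus_divide)
  then show ?thesis by (simp add: D_def I_def pot_def)
qed

lemma riesz_conv_pot: "riesz_conv \<gamma> u = pot \<gamma> (\<lambda>x. u x * u x)"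
  by (simp add: fun_eq_iff riesz_conv_def pot_def ker_def power2_eq_square)

lemma D_nonneg:
  fixes u :: "real^'n::finite \<Rightarrow> real"
  assumes "u \<in> H1" "CARD('n) \<ge> 3" "0 \<le> \<gamma>" "\<gamma> \<le> 2"
  shows "D \<gamma> u \<ge> 0"
  unfolding D_I by (rule I_nn(2)) (use PB_square[OF assms] in \<open>auto intro: PB_integrable\<close>)

lemma I_add_right: "PB \<gamma> g \<Longrightarrow> PB \<gamma> f \<Longrightarrow> PB \<gamma> f' \<Longrightarrow> I \<gamma> g (\<lambda>x. f x + f' x) = I \<gamma> g f + I \<gamma> g f'"
  by (simp add: I_commute[of \<gamma> g] PB_add I_add_left PB_integrable)

text \<open>An exact polynomial in t. At t = 1 it separates the mixed terms in the Brezis-Lieb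
  splitting; its linear coefficient is the first variation.\<close>

lemma D_expand:
  fixes u v :: "real^'n::finite \<Rightarrow> real"
  assumes u: "u \<in> H1" and v: "v \<in> H1" and N: "CARD('n) \<ge> 3" and \<gamma>: "0 \<le> \<gamma>" "\<gamma> \<le> 2"
  defines "U \<equiv> \<lambda>x. u x * u x" and "X \<equiv> \<lambda>x. u x * v x" and "V \<equiv> \<lambda>x. v x * v x"
  shows "D \<gamma> (\<lambda>x. u x + t * v x) = D \<gamma> u + 4 * t * I \<gamma> U X + t\<^sup>2 * (4 * I \<gamma> X X + 2 * I \<gamma> U V)
    + 4 * t ^ 3 * I \<gamma> X V + t ^ 4 * D \<gamma> v"
proof -
  have P: "PB \<gamma> U" "PB \<gamma> X" "PB \<gamma> V" unfolding U_def X_def V_def by (intro PB_mult u v N \<gamma>)+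
  define R where "R x = 2 * t * X x + t\<^sup>2 * V x" for x
  have PR: "PB \<gamma> R" unfolding R_def by (intro PB_add PB_scale P)
  have e: "(u x + t * v x) * (u x + t * v x) = U x + R x" for x
    by (simp add: U_def R_def X_def V_def algebra_simps power2_eq_square)
  have IR: "I \<gamma> R g = 2 * t * I \<gamma> X g + t\<^sup>2 * I \<gamma> V g" if "PB \<gamma> g" for g
    using I_add_left[of "\<lambda>x. 2 * t * X x" "\<lambda>x. t\<^sup>2 * V x" \<gamma> g] P[THEN PB_integrable] that
    unfolding R_def[abs_def] by (simp only: I_scale_left integrable_mult_right)
  have IR': "I \<gamma> g R = 2 * t * I \<gamma> g X + t\<^sup>2 * I \<gamma> g V" if "PB \<gamma> g" for g
    using IR[OF that] I_commute[OF that PR] I_commute[OF that P(2)] I_commute[OF that P(3)] by simp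
  have "D \<gamma> (\<lambda>x. u x + t * v x) = I \<gamma> (\<lambda>x. U x + R x) (\<lambda>x. U x + R x)"
    by (simp add: D_I e)
  also have "\<dots> = I \<gamma> U U + I \<gamma> U R + (I \<gamma> R U + I \<gamma> R R)"
    using P PR by (simp add: I_add_left I_add_right PB_add PB_integrable)
  also have "\<dots> = I \<gamma> U U + 4 * t * I \<gamma> U X + t\<^sup>2 * (4 * I \<gamma> X X + 2 * I \<gamma> U V) + 4 * t ^ 3 * I \<gamma> X V + t ^ 4 * I \<gamma> V V"
    using I_commute[OF P(2,1)] I_commute[OF P(3,1)] I_commute[OF P(3,2)]
    by (simp add: IR IR' P PR algebra_simps power2_eq_square power3_eq_cube power4_eq_xxxx)
  finally show ?thesis by (simp add: D_I U_def V_def)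
qed

section \<open>Local mass, splittings of the kernel, and interaction with a function that leaves
  every ball\<close>

definition Mh :: "(real^'n::finite \<Rightarrow> real) \<Rightarrow> real" where
  "Mh u = mass u + 4 * dirichlet u"

lemma Mh_nonneg [simp]: "Mh u \<ge> 0" by (simp add: Mh_def mass_nonneg dirichlet_nonneg)

text \<open>The mass inside a ball, as in the concentration function of Lions. Both nonvanishing and
  strong convergence on balls are expressed through it.\<close>

definition loc :: "real \<Rightarrow> (real^'n::finite \<Rightarrow> real) \<Rightarrow> real^'n \<Rightarrow> real" where
  "loc R w x = (LINT y|lborel. (if norm (x - y) \<le> R then w y * w y else 0))"

lemma loc_integrable: "(w :: real^'n::finite \<Rightarrow> real) \<in> L2 \<Longrightarrow> integrable lborel (\<lambda>y. if norm (x - y) \<le> R then w y * w y else 0)"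
proof -
  assume w: "w \<in> L2"
  note [measurable] = L2_measurable[OF w]
  show ?thesis by (rule Bochner_Integration.integrable_bound[OF L2_integrable_mult[OF w w]]) auto
qed

lemma loc_bounds: "w \<in> L2 \<Longrightarrow> 0 \<le> loc R w x" "w \<in> L2 \<Longrightarrow> loc R w x \<le> mass w"
  unfolding loc_def mass_ip ip_def
  by (auto intro!: integral_mono Bochner_Integration.integral_nonneg loc_integrable L2_integrable_mult)

text \<open>Vanishing of the local mass around the origin for all radii thereby implies it around
  every point.\<close>

lemma loc_le_center:
  assumes "w \<in> L2"
  shows "loc R w x \<le> loc (R + norm x) w 0"
  unfolding loc_def
proof (rule integral_mono[OF loc_integrable[OF assms] loc_integrable[OF assms]])
  fix y
  show "(if norm (x - y) \<le> R then w y * w y else 0) \<le> (if norm (0 - y) \<le> R + norm x then w y * w y else 0)"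
    using norm_triangle_ineq4[of x "x - y"] by auto
qed

lemma loc_measurable: "w \<in> L2 \<Longrightarrow> loc R w \<in> borel_measurable borel"
proof -
  assume "w \<in> L2"
  note [measurable] = L2_measurable[OF this]
  have "(\<lambda>x. LINT y|lborel. (if norm (x - y) \<le> R then w y * w y else 0)) \<in> borel_measurable lborel"
    by (rule lborel.borel_measurable_lebesgue_integral) measurable
  then show ?thesis by (simp add: loc_def[abs_def])
qed

lemma nn_square: "w \<in> L2 \<Longrightarrow> (\<integral>\<^sup>+y. ennreal (w y * w y) \<partial>lborel) = ennreal (mass w)"
  unfolding mass_ip ip_def by (rule nn_integral_eq_integral[OF L2_integrable_mult]) auto

text \<open>Hardy's inequality for the exponent \<open>5/2\<close> in one variable leaves the exponent \<open>3/2\<close>, which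
  Hardy's inequality in the other variable controls.\<close>

lemma nn_five_halves:
  fixes u w :: "real^'n::finite \<Rightarrow> real"
  assumes u: "u \<in> H1" and w: "w \<in> H1" and N: "CARD('n) \<ge> 3"
  shows "(\<integral>\<^sup>+x. \<integral>\<^sup>+y. ennreal ((u x * u x) * (ker (5/2) (x - y) * (w y * w y))) \<partial>lborel \<partial>lborel)
    \<le> ennreal (4 * Mh u * (nm w * sqrt (dirichlet w)))"
proof -
  note [measurable] = L2_measurable[OF H1_L2[OF u]] L2_measurable[OF H1_L2[OF w]] L2_measurable[OF gn_L2[OF w]]
  have "(\<integral>\<^sup>+x. \<integral>\<^sup>+y. ennreal ((u x * u x) * (ker (5/2) (x - y) * (w y * w y))) \<partial>lborel \<partial>lborel)
    = (\<integral>\<^sup>+x. ennreal (u x * u x) * (\<integral>\<^sup>+y. ennreal ((w y * w y) * ker (5/2) (x - y)) \<partial>lborel) \<partial>lborel)"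
  proof -
    have "ennreal ((u x * u x) * (ker (5/2) (x - y) * (w y * w y))) = ennreal (u x * u x) * ennreal ((w y * w y) * ker (5/2) (x - y))" for x y
      by (subst ennreal_mult'[symmetric]) (auto simp: mult_ac)
    then show ?thesis by (simp add: nn_integral_cmult)
  qed
  also have "\<dots> \<le> (\<integral>\<^sup>+x. ennreal (u x * u x) * (ennreal 4 * (\<integral>\<^sup>+y. ennreal ((\<bar>w y\<bar> * gn w y) * ker (3/2) (x - y)) \<partial>lborel)) \<partial>lborel)"
  proof (intro nn_integral_mono mult_left_mono)
    fix x
    have "(\<integral>\<^sup>+y. ennreal ((w y * w y) * ker (5/2) (x - y)) \<partial>lborel)
      \<le> ennreal (2 / (real CARD('n) - 5/2)) * (\<integral>\<^sup>+y. ennreal ((\<bar>w y\<bar> * gn w y) * ker (5/2 - 1) (x - y)) \<partial>lborel)"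
      by (rule nn_integral_weighted_hardy[OF w]) (use N in auto)
    also have "\<dots> \<le> ennreal 4 * (\<integral>\<^sup>+y. ennreal ((\<bar>w y\<bar> * gn w y) * ker (3/2) (x - y)) \<partial>lborel)"
    \<comment> \<open>With N >= 3 the constant 2 / (N - 5/2) is at most 4.\<close>
    proof (rule mult_mono)
      have "real CARD('n) \<ge> 3" using N by simp
      then show "ennreal (2 / (real CARD('n) - 5/2)) \<le> ennreal 4" by (intro ennreal_leI) (simp add: field_simps)
    qed auto
    finally show "(\<integral>\<^sup>+y. ennreal ((w y * w y) * ker (5/2) (x - y)) \<partial>lborel)
      \<le> ennreal 4 * (\<integral>\<^sup>+y. ennreal ((\<bar>w y\<bar> * gn w y) * ker (3/2) (x - y)) \<partial>lborel)" .
  qed simp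
  also have "\<dots> = (\<integral>\<^sup>+x. \<integral>\<^sup>+y. ennreal 4 * (ennreal (u x * u x) * ennreal ((\<bar>w y\<bar> * gn w y) * ker (3/2) (x - y))) \<partial>lborel \<partial>lborel)"
    by (simp add: nn_integral_cmult mult.left_commute)
  also have "\<dots> = (\<integral>\<^sup>+y. \<integral>\<^sup>+x. ennreal 4 * (ennreal (u x * u x) * ennreal ((\<bar>w y\<bar> * gn w y) * ker (3/2) (x - y))) \<partial>lborel \<partial>lborel)"
    by (rule lborel_pair.Fubini') measurable
  also have "\<dots> = (\<integral>\<^sup>+y. (ennreal 4 * ennreal (\<bar>w y\<bar> * gn w y)) * (\<integral>\<^sup>+x. ennreal ((u x * u x) * ker (3/2) (y - x)) \<partial>lborel) \<partial>lborel)"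
  proof (intro nn_integral_cong)
    fix y
    have "ennreal 4 * (ennreal (u x * u x) * ennreal ((\<bar>w y\<bar> * gn w y) * ker (3/2) (x - y)))
      = (ennreal 4 * ennreal (\<bar>w y\<bar> * gn w y)) * ennreal ((u x * u x) * ker (3/2) (y - x))" for x
    proof -
      have "ennreal (u x * u x) * ennreal ((\<bar>w y\<bar> * gn w y) * ker (3/2) (x - y)) = ennreal (\<bar>w y\<bar> * gn w y) * ennreal ((u x * u x) * ker (3/2) (y - x))"
        by (subst (1 2) ennreal_mult'[symmetric]) (auto simp: ker_commute[of _ y] mult_ac)
      then show ?thesis by (simp add: mult.assoc)
    qed
    then show "(\<integral>\<^sup>+x. ennreal 4 * (ennreal (u x * u x) * ennreal ((\<bar>w y\<bar> * gn w y) * ker (3/2) (x - y))) \<partial>lborel)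
      = (ennreal 4 * ennreal (\<bar>w y\<bar> * gn w y)) * (\<integral>\<^sup>+x. ennreal ((u x * u x) * ker (3/2) (y - x)) \<partial>lborel)"
      by (simp add: nn_integral_cmult)
  qed
  also have "\<dots> \<le> (\<integral>\<^sup>+y. (ennreal 4 * ennreal (\<bar>w y\<bar> * gn w y)) * ennreal (Mh u) \<partial>lborel)"
    unfolding Mh_def by (intro nn_integral_mono mult_left_mono nn_pot_square_le u N) auto
  also have "\<dots> = (ennreal 4 * ennreal (Mh u)) * (\<integral>\<^sup>+y. ennreal (\<bar>w y\<bar> * gn w y) \<partial>lborel)"
    by (subst nn_integral_cmult[symmetric]) (auto simp: mult_ac)
  also have "(\<integral>\<^sup>+y. ennreal (\<bar>w y\<bar> * gn w y) \<partial>lborel) = ennreal (ip (\<lambda>y. \<bar>w y\<bar>) (gn w))"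
    unfolding ip_def by (rule nn_integral_eq_integral[OF L2_integrable_mult[OF L2_abs[OF H1_L2[OF w]] gn_L2[OF w]]]) auto
  also have "(ennreal 4 * ennreal (Mh u)) * ennreal (ip (\<lambda>y. \<bar>w y\<bar>) (gn w)) \<le> (ennreal 4 * ennreal (Mh u)) * ennreal (nm w * sqrt (dirichlet w))"
  proof (intro mult_left_mono ennreal_leI)
    have "nm (\<lambda>y. \<bar>w y\<bar>) = nm w" by (simp add: nm_def ip_def)
    then show "ip (\<lambda>y. \<bar>w y\<bar>) (gn w) \<le> nm w * sqrt (dirichlet w)"
      using ip_Cauchy_Schwarz[OF L2_abs[OF H1_L2[OF w]] gn_L2[OF w]] by (simp add: nm_gn)
  qed simp
  also have "\<dots> = ennreal (4 * Mh u * (nm w * sqrt (dirichlet w)))"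
    by (simp add: ennreal_mult dirichlet_nonneg)
  finally show ?thesis .
qed

text \<open>Three regions. For |z| <= e^2 the factor sqrt |z| <= e is traded for the exponent 5/2;
  for e^2 < |z| <= R the kernel is at most e^-4; beyond R it is at most R^-2.\<close>

lemma ker2_split:
  assumes e: "e > 0" and R: "R > 0"
  shows "ker 2 z \<le> e * ker (5/2) z + ((if norm z \<le> R then inverse (e ^ 4) else 0) + inverse (R\<^sup>2))"
proof (cases "z = 0")
  case False
  define r where "r = norm z"
  have r: "r > 0" using False by (simp add: r_def)
  have k2: "ker 2 z = inverse (r\<^sup>2)" using r by (simp add: ker_def r_def powr_minus)
  consider "sqrt r \<le> e" | "sqrt r > e" "r \<le> R" | "r > R" by linarith
  then show ?thesis
  proof cases
    case 1
    have "r powr (-2) = sqrt r * r powr (-5/2)"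
      using r by (simp add: powr_half_sqrt[symmetric] powr_add[symmetric])
    also have "\<dots> \<le> e * r powr (-5/2)" using 1 by (intro mult_right_mono) auto
    finally have "ker 2 z \<le> e * ker (5/2) z" by (simp add: ker_def r_def)
    then show ?thesis using e R by (simp add: add_increasing2)
  next
    case 2
    have "e ^ 2 \<le> (sqrt r) ^ 2" using 2 e by (intro power_mono) auto
    then have "(e\<^sup>2)\<^sup>2 \<le> r\<^sup>2" using r by (intro power_mono) auto
    then have "inverse (r\<^sup>2) \<le> inverse (e ^ 4)" using e by (intro le_imp_inverse_le) (auto simp: power_mult[symmetric])
    then show ?thesis using 2 e R unfolding k2 r_def by (simp add: add_increasing add_increasing2)
  next
    case 3
    then have "inverse (r\<^sup>2) \<le> inverse (R\<^sup>2)" using R by (intro le_imp_inverse_le power_mono) auto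
    then show ?thesis using 3 e unfolding k2 r_def by (simp add: add_increasing)
  qed
qed (use assms in \<open>simp add: ker_def\<close>)

text \<open>The same cut at |z| = e^2; outside it |z|^(\<gamma>-2) is at most
  e^(2(\<gamma>-2)).\<close>

lemma ker2_interpolate:
  assumes e: "e > 0" and \<gamma>: "\<gamma> \<le> 2"
  shows "ker 2 z \<le> e * ker (5/2) z + e powr (2 * (\<gamma> - 2)) * ker \<gamma> z"
proof (cases "z = 0")
  case False
  define r where "r = norm z"
  have r: "r > 0" using False by (simp add: r_def)
  consider "sqrt r \<le> e" | "sqrt r > e" by linarith
  then show ?thesis
  proof cases
    case 1
    have "r powr (-2) = sqrt r * r powr (-5/2)"
      using r by (simp add: powr_half_sqrt[symmetric] powr_add[symmetric])
    also have "\<dots> \<le> e * r powr (-5/2)" using 1 by (intro mult_right_mono) auto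
    finally have "ker 2 z \<le> e * ker (5/2) z" by (simp add: ker_def r_def)
    then show ?thesis by (simp add: add_increasing2)
  next
    case 2
    have "r powr (-2) = r powr (\<gamma> - 2) * r powr (-\<gamma>)" by (simp add: powr_add[symmetric])
    also have "r powr (\<gamma> - 2) = (sqrt r) powr (2 * (\<gamma> - 2))"
      using r by (simp add: powr_half_sqrt[symmetric] powr_powr diff_divide_distrib)
    also have "\<dots> * r powr (-\<gamma>) \<le> e powr (2 * (\<gamma> - 2)) * r powr (-\<gamma>)"
      using 2 e \<gamma> by (intro mult_right_mono powr_mono2') auto
    finally have "ker 2 z \<le> e powr (2 * (\<gamma> - 2)) * ker \<gamma> z" by (simp add: ker_def r_def)
    then show ?thesis using e by (simp add: add_increasing)
  qed
qed (use e in \<open>simp add: ker_def\<close>)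

lemma ker_le_ker2:
  assumes \<gamma>: "0 \<le> \<gamma>" "\<gamma> \<le> 2" and R: "R > 0"
  shows "ker \<gamma> z \<le> R powr (2 - \<gamma>) * ker 2 z + R powr (-\<gamma>)"
proof (cases "z = 0")
  case False
  define r where "r = norm z"
  have r: "r > 0" using False by (simp add: r_def)
  show ?thesis
  proof (cases "r \<le> R")
    case True
    have "r powr (-\<gamma>) = r powr (2 - \<gamma>) * r powr (-2)" by (simp add: powr_add[symmetric])
    also have "\<dots> \<le> R powr (2 - \<gamma>) * r powr (-2)" using True r \<gamma> by (intro mult_right_mono powr_mono2) auto
    finally show ?thesis by (simp add: ker_def r_def add_increasing2)
  next
    case False
    then have "r powr (-\<gamma>) \<le> R powr (-\<gamma>)" using R \<gamma> by (intro powr_mono2') auto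
    then show ?thesis by (simp add: ker_def r_def add_increasing)
  qed
qed (simp add: ker_def)

text \<open>\<open>ker2_split\<close> integrated: the near part is controlled by
  \<open>nn_five_halves\<close>, the far part by the masses, and only the middle part sees the local
  mass of w.\<close>

lemma I2_split:
  fixes u w :: "real^'n::finite \<Rightarrow> real"
  assumes u: "u \<in> H1" and w: "w \<in> H1" and N: "CARD('n) \<ge> 3" and e: "e > 0" and R: "R > 0"
  shows "I 2 (\<lambda>x. u x * u x) (\<lambda>x. w x * w x) \<le> e * (4 * Mh u * (nm w * sqrt (dirichlet w)))
    + (inverse (e ^ 4) * (LINT x|lborel. (u x * u x) * loc R w x) + inverse (R\<^sup>2) * mass u * mass w)"
proof -
  note L = H1_L2[OF u] H1_L2[OF w]
  note [measurable] = L2_measurable[OF L(1)] L2_measurable[OF L(2)] loc_measurable[OF L(2)]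
  let ?U = "\<lambda>x. u x * u x" and ?W = "\<lambda>x. w x * w x"
  have locint: "integrable lborel (\<lambda>x. ?U x * loc R w x)"
  proof (rule Bochner_Integration.integrable_bound[where f="\<lambda>x. ?U x * mass w"])
    show "AE x in lborel. norm (?U x * loc R w x) \<le> norm (?U x * mass w)"
    proof (intro AE_I2)
      fix x
      have "?U x * loc R w x \<le> ?U x * mass w" by (intro mult_left_mono loc_bounds L) auto
      then show "norm (?U x * loc R w x) \<le> norm (?U x * mass w)"
        using loc_bounds(1)[OF L(2)] by (simp add: abs_mult mass_nonneg)
    qed
  qed (use u_square_wd(1)[OF u] in auto)
  have "ennreal (I 2 ?U ?W) = (\<integral>\<^sup>+x. \<integral>\<^sup>+y. ennreal (?U x * (ker 2 (x - y) * ?W y)) \<partial>lborel \<partial>lborel)"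
    by (rule I_nn) (use u_square_wd(1)[OF u] PB_square[OF w N] in auto)
  also have "\<dots> \<le> (\<integral>\<^sup>+x. \<integral>\<^sup>+y. ennreal e * ennreal (?U x * (ker (5/2) (x - y) * ?W y))
      + (ennreal (inverse (e ^ 4) * ?U x) * ennreal (if norm (x - y) \<le> R then ?W y else 0)
       + ennreal (inverse (R\<^sup>2) * ?U x) * ennreal (?W y)) \<partial>lborel \<partial>lborel)"
  proof (intro nn_integral_mono)
    fix x y
    have "?U x * (ker 2 (x - y) * ?W y) \<le> ?U x * ((e * ker (5/2) (x - y) + ((if norm (x - y) \<le> R then inverse (e ^ 4) else 0) + inverse (R\<^sup>2))) * ?W y)"
      by (intro mult_left_mono mult_right_mono ker2_split e R) auto
    also have "\<dots> = e * (?U x * (ker (5/2) (x - y) * ?W y)) + ((inverse (e ^ 4) * ?U x) * (if norm (x - y) \<le> R then ?W y else 0) + (inverse (R\<^sup>2) * ?U x) * ?W y)"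
      by (simp add: algebra_simps)
    finally have "ennreal (?U x * (ker 2 (x - y) * ?W y)) \<le> ennreal \<dots>" by (rule ennreal_leI)
    then show "ennreal (?U x * (ker 2 (x - y) * ?W y)) \<le> ennreal e * ennreal (?U x * (ker (5/2) (x - y) * ?W y))
      + (ennreal (inverse (e ^ 4) * ?U x) * ennreal (if norm (x - y) \<le> R then ?W y else 0)
       + ennreal (inverse (R\<^sup>2) * ?U x) * ennreal (?W y))"
      using e R by (simp add: ennreal_plus[symmetric] ennreal_mult[symmetric] del: ennreal_plus)
  qed
  also have "\<dots> = ennreal e * (\<integral>\<^sup>+x. \<integral>\<^sup>+y. ennreal (?U x * (ker (5/2) (x - y) * ?W y)) \<partial>lborel \<partial>lborel)
     + ((\<integral>\<^sup>+x. ennreal (inverse (e ^ 4) * ?U x) * ennreal (loc R w x) \<partial>lborel) + (\<integral>\<^sup>+x. ennreal (inverse (R\<^sup>2) * ?U x) * ennreal (mass w) \<partial>lborel))"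
  proof -
    have "(\<integral>\<^sup>+y. ennreal (if norm (x - y) \<le> R then ?W y else 0) \<partial>lborel) = ennreal (loc R w x)" for x
      unfolding loc_def by (rule nn_integral_eq_integral[OF loc_integrable[OF L(2)]]) auto
    then show ?thesis
      by (simp add: nn_integral_add nn_integral_cmult nn_square[OF L(2)])
  qed
  also have "(\<integral>\<^sup>+x. ennreal (inverse (e ^ 4) * ?U x) * ennreal (loc R w x) \<partial>lborel) = ennreal (inverse (e ^ 4) * (LINT x|lborel. ?U x * loc R w x))"
  proof -
    have "(\<integral>\<^sup>+x. ennreal (inverse (e ^ 4) * ?U x) * ennreal (loc R w x) \<partial>lborel) = (\<integral>\<^sup>+x. ennreal (inverse (e ^ 4) * (?U x * loc R w x)) \<partial>lborel)"
      using loc_bounds(1)[OF L(2)] e by (intro nn_integral_cong) (simp add: ennreal_mult[symmetric] mult.assoc)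
    also have "\<dots> = ennreal (LINT x|lborel. inverse (e ^ 4) * (?U x * loc R w x))"
      by (rule nn_integral_eq_integral) (use locint loc_bounds(1)[OF L(2)] e in auto)
    finally show ?thesis by simp
  qed
  also have "(\<integral>\<^sup>+x. ennreal (inverse (R\<^sup>2) * ?U x) * ennreal (mass w) \<partial>lborel) = ennreal (inverse (R\<^sup>2) * mass u * mass w)"
    by (simp add: nn_integral_multc ennreal_mult nn_integral_cmult nn_square[OF L(1)] mass_nonneg)
  also have "ennreal e * (\<integral>\<^sup>+x. \<integral>\<^sup>+y. ennreal (?U x * (ker (5/2) (x - y) * ?W y)) \<partial>lborel \<partial>lborel)
     + (ennreal (inverse (e ^ 4) * (LINT x|lborel. ?U x * loc R w x)) + ennreal (inverse (R\<^sup>2) * mass u * mass w))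
    \<le> ennreal e * ennreal (4 * Mh u * (nm w * sqrt (dirichlet w)))
     + (ennreal (inverse (e ^ 4) * (LINT x|lborel. ?U x * loc R w x)) + ennreal (inverse (R\<^sup>2) * mass u * mass w))"
    by (intro add_right_mono mult_left_mono nn_five_halves u w N) auto
  also have "\<dots> = ennreal (e * (4 * Mh u * (nm w * sqrt (dirichlet w)))
     + (inverse (e ^ 4) * (LINT x|lborel. ?U x * loc R w x) + inverse (R\<^sup>2) * mass u * mass w))"
  proof -
    have "0 \<le> (LINT x|lborel. ?U x * loc R w x)"
      using loc_bounds(1)[OF L(2)] by (intro Bochner_Integration.integral_nonneg) auto
    then show ?thesis
      using e by (simp add: ennreal_mult[symmetric] mass_nonneg dirichlet_nonneg)
  qed
  finally show ?thesis
  proof (subst (asm) ennreal_le_iff)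
    have "0 \<le> (LINT x|lborel. ?U x * loc R w x)"
      using loc_bounds(1)[OF L(2)] by (intro Bochner_Integration.integral_nonneg) auto
    then show "0 \<le> e * (4 * Mh u * (nm w * sqrt (dirichlet w)))
     + (inverse (e ^ 4) * (LINT x|lborel. ?U x * loc R w x) + inverse (R\<^sup>2) * mass u * mass w)"
      using e by (intro add_nonneg_nonneg mult_nonneg_nonneg) (auto simp: mass_nonneg dirichlet_nonneg)
  qed
qed

text \<open>With u bounded in H1, a lower bound on \<open>D 2\<close> forces one on
  \<open>D \<gamma>\<close>. This keeps \<open>D \<theta>\<close> away from 0 along minimising
  sequences.\<close>

lemma D2_interpolate:
  fixes u :: "real^'n::finite \<Rightarrow> real"
  assumes u: "u \<in> H1" and N: "CARD('n) \<ge> 3" and e: "e > 0" and \<gamma>: "0 \<le> \<gamma>" "\<gamma> \<le> 2"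
  shows "D 2 u \<le> e * (4 * Mh u * (nm u * sqrt (dirichlet u))) + e powr (2 * (\<gamma> - 2)) * D \<gamma> u"
proof -
  note L = H1_L2[OF u]
  note [measurable] = L2_measurable[OF L]
  let ?U = "\<lambda>x. u x * u x"
  have D_nn: "ennreal (D s u) = (\<integral>\<^sup>+x. \<integral>\<^sup>+y. ennreal (?U x * (ker s (x - y) * ?U y)) \<partial>lborel \<partial>lborel)"
    if "0 \<le> s" "s \<le> 2" for s
    unfolding D_I by (rule I_nn) (use u_square_wd(1)[OF u] PB_square[OF u N] that in auto)
  have "ennreal (D 2 u) \<le> (\<integral>\<^sup>+x. \<integral>\<^sup>+y. ennreal e * ennreal (?U x * (ker (5/2) (x - y) * ?U y))
     + ennreal (e powr (2 * (\<gamma> - 2))) * ennreal (?U x * (ker \<gamma> (x - y) * ?U y)) \<partial>lborel \<partial>lborel)"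
    unfolding D_nn[of 2, simplified]
  proof (intro nn_integral_mono)
    fix x y
    have "?U x * (ker 2 (x - y) * ?U y) \<le> ?U x * ((e * ker (5/2) (x - y) + e powr (2 * (\<gamma> - 2)) * ker \<gamma> (x - y)) * ?U y)"
      by (intro mult_left_mono mult_right_mono ker2_interpolate e \<gamma>) auto
    also have "\<dots> = e * (?U x * (ker (5/2) (x - y) * ?U y)) + e powr (2 * (\<gamma> - 2)) * (?U x * (ker \<gamma> (x - y) * ?U y))"
      by (simp add: algebra_simps)
    finally have "ennreal (?U x * (ker 2 (x - y) * ?U y)) \<le> ennreal \<dots>" by (rule ennreal_leI)
    then show "ennreal (?U x * (ker 2 (x - y) * ?U y)) \<le> ennreal e * ennreal (?U x * (ker (5/2) (x - y) * ?U y))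
     + ennreal (e powr (2 * (\<gamma> - 2))) * ennreal (?U x * (ker \<gamma> (x - y) * ?U y))"
      using e by (simp add: ennreal_plus[symmetric] ennreal_mult[symmetric] del: ennreal_plus)
  qed
  also have "\<dots> = ennreal e * (\<integral>\<^sup>+x. \<integral>\<^sup>+y. ennreal (?U x * (ker (5/2) (x - y) * ?U y)) \<partial>lborel \<partial>lborel)
     + ennreal (e powr (2 * (\<gamma> - 2))) * ennreal (D \<gamma> u)"
    unfolding D_nn[OF \<gamma>] by (simp add: nn_integral_add nn_integral_cmult)
  also have "\<dots> \<le> ennreal e * ennreal (4 * Mh u * (nm u * sqrt (dirichlet u))) + ennreal (e powr (2 * (\<gamma> - 2))) * ennreal (D \<gamma> u)"
    by (intro add_right_mono mult_left_mono nn_five_halves u N) auto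
  also have "\<dots> = ennreal (e * (4 * Mh u * (nm u * sqrt (dirichlet u))) + e powr (2 * (\<gamma> - 2)) * D \<gamma> u)"
    using e D_nonneg[OF u N \<gamma>] by (simp add: ennreal_mult[symmetric] dirichlet_nonneg)
  finally show ?thesis
    using e D_nonneg[OF u N \<gamma>] by (subst (asm) ennreal_le_iff) (auto simp: dirichlet_nonneg)
qed

text \<open>Inside radius R the kernel of exponent \<gamma> is a multiple of that of exponent 2;
  outside it is at most R^(-\<gamma>), which is small for large R when \<gamma> > 0. Vanishing of
  the interaction is transferred from exponent 2 in this way.\<close>

lemma I_le_I2:
  fixes u w :: "real^'n::finite \<Rightarrow> real"
  assumes u: "u \<in> H1" and w: "w \<in> H1" and N: "CARD('n) \<ge> 3" and \<gamma>: "0 \<le> \<gamma>" "\<gamma> \<le> 2" and R: "R > 0"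
  shows "I \<gamma> (\<lambda>x. u x * u x) (\<lambda>x. w x * w x)
    \<le> R powr (2 - \<gamma>) * I 2 (\<lambda>x. u x * u x) (\<lambda>x. w x * w x) + R powr (-\<gamma>) * mass u * mass w"
proof -
  note L = H1_L2[OF u] H1_L2[OF w]
  note [measurable] = L2_measurable[OF L(1)] L2_measurable[OF L(2)]
  let ?U = "\<lambda>x. u x * u x" and ?W = "\<lambda>x. w x * w x"
  have I: "ennreal (I s ?U ?W) = (\<integral>\<^sup>+x. \<integral>\<^sup>+y. ennreal (?U x * (ker s (x - y) * ?W y)) \<partial>lborel \<partial>lborel)"
    "I s ?U ?W \<ge> 0" if "0 \<le> s" "s \<le> 2" for s
    by (rule I_nn; use u_square_wd(1)[OF u] PB_square[OF w N] that in auto)+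
  have "ennreal (I \<gamma> ?U ?W) \<le> (\<integral>\<^sup>+x. \<integral>\<^sup>+y. ennreal (R powr (2 - \<gamma>)) * ennreal (?U x * (ker 2 (x - y) * ?W y))
     + ennreal (R powr (-\<gamma>) * ?U x) * ennreal (?W y) \<partial>lborel \<partial>lborel)"
    unfolding I(1)[OF \<gamma>]
  proof (intro nn_integral_mono)
    fix x y
    have "?U x * (ker \<gamma> (x - y) * ?W y) \<le> ?U x * ((R powr (2 - \<gamma>) * ker 2 (x - y) + R powr (-\<gamma>)) * ?W y)"
      by (intro mult_left_mono mult_right_mono ker_le_ker2 R \<gamma>) auto
    also have "\<dots> = R powr (2 - \<gamma>) * (?U x * (ker 2 (x - y) * ?W y)) + (R powr (-\<gamma>) * ?U x) * ?W y"
      by (simp add: algebra_simps)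
    finally have "ennreal (?U x * (ker \<gamma> (x - y) * ?W y)) \<le> ennreal \<dots>" by (rule ennreal_leI)
    then show "ennreal (?U x * (ker \<gamma> (x - y) * ?W y)) \<le> ennreal (R powr (2 - \<gamma>)) * ennreal (?U x * (ker 2 (x - y) * ?W y))
     + ennreal (R powr (-\<gamma>) * ?U x) * ennreal (?W y)"
      by (simp add: ennreal_plus[symmetric] ennreal_mult[symmetric] del: ennreal_plus)
  qed
  also have "\<dots> = ennreal (R powr (2 - \<gamma>)) * ennreal (I 2 ?U ?W) + ennreal (R powr (-\<gamma>) * mass u * mass w)"
    by (simp add: I nn_integral_add nn_integral_cmult nn_integral_multc nn_square[OF L(1)] nn_square[OF L(2)] ennreal_mult mass_nonneg)
  also have "\<dots> = ennreal (R powr (2 - \<gamma>) * I 2 ?U ?W + R powr (-\<gamma>) * mass u * mass w)"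
    using I(2)[of 2] by (simp add: ennreal_mult[symmetric] mass_nonneg)
  finally show ?thesis
    by (subst (asm) ennreal_le_iff) (auto simp: mass_nonneg I)
qed

lemma I2_cross_tendsto:
  fixes u :: "real^'n::finite \<Rightarrow> real"
  assumes u: "u \<in> H1" and w: "\<And>n. w n \<in> H1" and N: "CARD('n) \<ge> 3"
    and bd: "\<And>n. mass (w n) \<le> m" "\<And>n. dirichlet (w n) \<le> a"
    and loc: "\<And>R. (\<lambda>n. loc R (w n) 0) \<longlonglongrightarrow> 0"
  shows "(\<lambda>n. I 2 (\<lambda>x. u x * u x) (\<lambda>x. w n x * w n x)) \<longlonglongrightarrow> 0"
proof (rule LIMSEQ_I)
  fix r :: real assume r: "r > 0"
  have L: "w n \<in> L2" for n by (rule H1_L2[OF w])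
  note [measurable] = L2_measurable[OF H1_L2[OF u]] loc_measurable[OF L]
  have m0: "m \<ge> 0" "a \<ge> 0" using order_trans[OF mass_nonneg bd(1)] order_trans[OF dirichlet_nonneg bd(2)] by auto
  define C where "C = 4 * Mh u * (sqrt m * sqrt a)"
  have C0: "C \<ge> 0" using m0 by (simp add: C_def)
  \<comment> \<open>Chosen, like R below, so that the near and the far term of
    \<open>I2_split\<close> are at most r/3 each; the added 1 guards against a zero
    constant.\<close>
  define e where "e = r / (3 * (C + 1))"
  have e: "e > 0" using r C0 by (simp add: e_def)
  have eC: "e * C \<le> r / 3"
  proof -
    have *: "r / (3 * c) * c = r / 3" if "c \<noteq> 0" for c using that by simp
    have "e * C \<le> e * (C + 1)" using e by simp
    also have "\<dots> = r / 3" unfolding e_def using C0 by (intro *) simp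
    finally show ?thesis .
  qed
  define R where "R = sqrt (3 * (mass u * m + 1) / r)"
  have mm: "mass u * m \<ge> 0" using m0 by (simp add: mass_nonneg)
  have R: "R > 0" using r mm by (simp add: R_def)
  have Rm: "inverse (R\<^sup>2) * mass u * m \<le> r / 3"
  proof -
    have "inverse (R\<^sup>2) = r / (3 * (mass u * m + 1))" using r mm by (simp add: R_def)
    then have "inverse (R\<^sup>2) * mass u * m = (r / 3) * ((mass u * m) / (mass u * m + 1))" by simp
    also have "\<dots> \<le> (r / 3) * 1" using r mm by (intro mult_left_mono) auto
    finally show ?thesis by simp
  qed
  \<comment> \<open>For the middle term e and R are now fixed: the local masses tend to 0 at every
    point and are bounded by m, so dominated convergence applies.\<close>
  have "(\<lambda>n. LINT x|lborel. (u x * u x) * loc R (w n) x) \<longlonglongrightarrow> (LINT x|lborel. (u x * u x) * 0)"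
  proof (rule integral_dominated_convergence[where w="\<lambda>x. m * (u x * u x)"])
    show "AE x in lborel. (\<lambda>n. u x * u x * loc R (w n) x) \<longlonglongrightarrow> u x * u x * 0"
    proof (intro AE_I2 tendsto_intros)
      fix x
      show "(\<lambda>n. loc R (w n) x) \<longlonglongrightarrow> 0"
      proof (rule tendsto_sandwich[OF _ _ tendsto_const loc[of "R + norm x"]])
        show "\<forall>\<^sub>F n in sequentially. 0 \<le> loc R (w n) x" using loc_bounds[OF L] by simp
        show "\<forall>\<^sub>F n in sequentially. loc R (w n) x \<le> loc (R + norm x) (w n) 0" using loc_le_center[OF L] by simp
      qed
    qed
    show "AE x in lborel. norm (u x * u x * loc R (w n) x) \<le> m * (u x * u x)" for n
    proof (intro AE_I2)
      fix x
      have "(u x * u x) * loc R (w n) x \<le> (u x * u x) * m"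
        using loc_bounds(2)[OF L, of R n x] bd(1)[of n] by (intro mult_left_mono) auto
      then show "norm (u x * u x * loc R (w n) x) \<le> m * (u x * u x)"
        using loc_bounds(1)[OF L, of R n x] by (simp add: abs_mult mult.commute)
    qed
    show "integrable lborel (\<lambda>x. m * (u x * u x))" using u_square_wd(1)[OF u] by simp
  qed auto
  then have "(\<lambda>n. inverse (e ^ 4) * (LINT x|lborel. (u x * u x) * loc R (w n) x)) \<longlonglongrightarrow> inverse (e ^ 4) * 0"
    by (intro tendsto_intros) simp
  then have "eventually (\<lambda>n. inverse (e ^ 4) * (LINT x|lborel. (u x * u x) * loc R (w n) x) < r / 3) sequentially"
    using r by (intro order_tendstoD) auto
  then obtain n0 where n0: "\<And>n. n \<ge> n0 \<Longrightarrow> inverse (e ^ 4) * (LINT x|lborel. (u x * u x) * loc R (w n) x) < r / 3"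
    by (auto simp: eventually_sequentially)
  have "norm (I 2 (\<lambda>x. u x * u x) (\<lambda>x. w n x * w n x) - 0) < r" if "n \<ge> n0" for n
  proof -
    have nonneg: "I 2 (\<lambda>x. u x * u x) (\<lambda>x. w n x * w n x) \<ge> 0"
      by (rule I_nn(2)) (use u_square_wd(1)[OF u] PB_square[OF w N] in auto)
    have "nm (w n) \<le> sqrt m" using bd(1)[of n] by (simp add: mass_nm real_le_rsqrt)
    then have "nm (w n) * sqrt (dirichlet (w n)) \<le> sqrt m * sqrt a"
      using bd(2)[of n] m0 by (intro mult_mono) (auto simp: dirichlet_nonneg)
    then have "e * (4 * Mh u * (nm (w n) * sqrt (dirichlet (w n)))) \<le> e * C"
      unfolding C_def using e by (intro mult_left_mono) auto
    moreover have "inverse (R\<^sup>2) * mass u * mass (w n) \<le> inverse (R\<^sup>2) * mass u * m"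
      using bd(1)[of n] by (intro mult_left_mono) (auto simp: mass_nonneg)
    ultimately have "I 2 (\<lambda>x. u x * u x) (\<lambda>x. w n x * w n x) < r"
      using I2_split[OF u w[of n] N e R] n0[OF that] eC Rm by linarith
    with nonneg show ?thesis by simp
  qed
  then show "\<exists>n0. \<forall>n\<ge>n0. norm (I 2 (\<lambda>x. u x * u x) (\<lambda>x. w n x * w n x) - 0) < r" by blast
qed

lemma I_cross_tendsto:
  fixes u :: "real^'n::finite \<Rightarrow> real"
  assumes u: "u \<in> H1" and w: "\<And>n. w n \<in> H1" and N: "CARD('n) \<ge> 3"
    and bd: "\<And>n. mass (w n) \<le> m" "\<And>n. dirichlet (w n) \<le> a"
    and loc: "\<And>R. (\<lambda>n. loc R (w n) 0) \<longlonglongrightarrow> 0" and \<gamma>: "0 < \<gamma>" "\<gamma> \<le> 2"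
  shows "(\<lambda>n. I \<gamma> (\<lambda>x. u x * u x) (\<lambda>x. w n x * w n x)) \<longlonglongrightarrow> 0"
proof (rule LIMSEQ_I)
  fix r :: real assume r: "r > 0"
  have m0: "m \<ge> 0" using order_trans[OF mass_nonneg bd(1)] by auto
  have mm: "mass u * m \<ge> 0" using m0 by (simp add: mass_nonneg)
  define R where "R = (2 * (mass u * m + 1) / r) powr (1 / \<gamma>)"
  have R: "R > 0" using r mm by (simp add: R_def)
  have Rm: "R powr (-\<gamma>) * mass u * m \<le> r / 2"
  proof -
    have "R powr (-\<gamma>) = r / (2 * (mass u * m + 1))" using r mm \<gamma> by (simp add: R_def powr_powr powr_minus)
    then have "R powr (-\<gamma>) * mass u * m = (r / 2) * ((mass u * m) / (mass u * m + 1))" by simp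
    also have "\<dots> \<le> (r / 2) * 1" using r mm by (intro mult_left_mono) auto
    finally show ?thesis by simp
  qed
  have "(\<lambda>n. R powr (2 - \<gamma>) * I 2 (\<lambda>x. u x * u x) (\<lambda>x. w n x * w n x)) \<longlonglongrightarrow> R powr (2 - \<gamma>) * 0"
    by (intro tendsto_intros I2_cross_tendsto[OF u w N bd loc])
  then have "eventually (\<lambda>n. R powr (2 - \<gamma>) * I 2 (\<lambda>x. u x * u x) (\<lambda>x. w n x * w n x) < r / 2) sequentially"
    using r by (intro order_tendstoD) auto
  then obtain n0 where n0: "\<And>n. n \<ge> n0 \<Longrightarrow> R powr (2 - \<gamma>) * I 2 (\<lambda>x. u x * u x) (\<lambda>x. w n x * w n x) < r / 2"
    by (auto simp: eventually_sequentially)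
  have "norm (I \<gamma> (\<lambda>x. u x * u x) (\<lambda>x. w n x * w n x) - 0) < r" if "n \<ge> n0" for n
  proof -
    have nonneg: "I \<gamma> (\<lambda>x. u x * u x) (\<lambda>x. w n x * w n x) \<ge> 0"
      by (rule I_nn(2)) (use u_square_wd(1)[OF u] PB_square[OF w N] \<gamma> in auto)
    have "R powr (-\<gamma>) * mass u * mass (w n) \<le> R powr (-\<gamma>) * mass u * m"
      using bd(1)[of n] by (intro mult_left_mono) (auto simp: mass_nonneg)
    then have "I \<gamma> (\<lambda>x. u x * u x) (\<lambda>x. w n x * w n x) < r"
      using I_le_I2[OF u w[of n] N _ \<gamma>(2) R] \<gamma>(1) n0[OF that] Rm by force
    with nonneg show ?thesis by simp
  qed
  then show "\<exists>n0. \<forall>n\<ge>n0. norm (I \<gamma> (\<lambda>x. u x * u x) (\<lambda>x. w n x * w n x) - 0) < r" by blast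
qed

text \<open>Up to a small error in norm u has compact support, where w n carries little mass. The
  absolute values matter: the product u w n tends to 0 in L1 and may then be paired with bounded
  potentials, as in \<open>I_mult_le\<close>.\<close>

lemma ip_abs_tendsto_0:
  fixes u :: "real^'n::finite \<Rightarrow> real"
  assumes u: "u \<in> L2" and w: "\<And>n. w n \<in> L2" "\<And>n. nm (w n) \<le> m"
    and loc: "\<And>R. (\<lambda>n. loc R (w n) 0) \<longlonglongrightarrow> 0"
  shows "(\<lambda>n. ip (\<lambda>x. \<bar>u x\<bar>) (\<lambda>x. \<bar>w n x\<bar>)) \<longlonglongrightarrow> 0"
proof (rule LIMSEQ_I)
  fix r :: real assume r: "r > 0"
  have m0: "m \<ge> 0" using order_trans[OF nm_nonneg w(2)] .
  obtain \<phi> where \<phi>: "\<phi> \<in> test_functions" "nm (\<lambda>x. u x - \<phi> x) < r / (2 * (m + 1))"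
    using test_dense[OF u, of "r / (2 * (m + 1))"] r m0 by auto
  obtain R where R: "\<And>x. norm x > R \<Longrightarrow> \<phi> x = 0" using test_support[OF \<phi>(1)] by blast
  note L\<phi> = test_L2[OF \<phi>(1)]
  have "(\<lambda>n. nm \<phi> * sqrt (loc R (w n) 0)) \<longlonglongrightarrow> nm \<phi> * sqrt 0"
    by (intro tendsto_intros loc)
  then have "eventually (\<lambda>n. nm \<phi> * sqrt (loc R (w n) 0) < r / 2) sequentially"
    using r by (intro order_tendstoD) auto
  then obtain n0 where n0: "\<And>n. n \<ge> n0 \<Longrightarrow> nm \<phi> * sqrt (loc R (w n) 0) < r / 2"
    by (auto simp: eventually_sequentially)
  have "norm (ip (\<lambda>x. \<bar>u x\<bar>) (\<lambda>x. \<bar>w n x\<bar>) - 0) < r" if "n \<ge> n0" for n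
  proof -
    define v where "v x = (if norm x \<le> R then w n x else 0)" for x
    have v: "v = (\<lambda>x. indicator (cball 0 R) x * w n x)" by (auto simp: v_def indicator_def)
    have vL: "v \<in> L2"
      unfolding v by (rule L2_bounded_mult[OF w(1), where B=1]) (auto simp: indicator_def)
    have nmv: "nm v = sqrt (loc R (w n) 0)"
      by (simp add: nm_def ip_def loc_def v_def if_distrib cong: if_cong)
    have nab: "nm (\<lambda>x. \<bar>f x\<bar>) = nm f" for f :: "real^'n \<Rightarrow> real" by (simp add: nm_def ip_def)
    have "ip (\<lambda>x. \<bar>u x\<bar>) (\<lambda>x. \<bar>w n x\<bar>) \<le> ip (\<lambda>x. \<bar>\<phi> x\<bar>) (\<lambda>x. \<bar>v x\<bar>) + ip (\<lambda>x. \<bar>u x - \<phi> x\<bar>) (\<lambda>x. \<bar>w n x\<bar>)"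
      unfolding ip_def
    proof (subst Bochner_Integration.integral_add[symmetric], goal_cases)
      case 3
      show ?case
      proof (rule integral_mono)
        fix x
        have "\<bar>u x\<bar> * \<bar>w n x\<bar> \<le> (\<bar>\<phi> x\<bar> + \<bar>u x - \<phi> x\<bar>) * \<bar>w n x\<bar>" by (intro mult_right_mono) auto
        also have "\<dots> = \<bar>\<phi> x\<bar> * \<bar>v x\<bar> + \<bar>u x - \<phi> x\<bar> * \<bar>w n x\<bar>" using R[of x] by (auto simp: v_def algebra_simps)
        finally show "\<bar>u x\<bar> * \<bar>w n x\<bar> \<le> \<bar>\<phi> x\<bar> * \<bar>v x\<bar> + \<bar>u x - \<phi> x\<bar> * \<bar>w n x\<bar>" .
      qed (intro Bochner_Integration.integrable_add L2_integrable_mult L2_abs L2_diff u w L\<phi> vL)+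
    qed (intro L2_integrable_mult L2_abs L2_diff u w L\<phi> vL)+
    also have "\<dots> \<le> nm \<phi> * nm v + nm (\<lambda>x. u x - \<phi> x) * nm (w n)"
      using ip_Cauchy_Schwarz[OF L2_abs[OF L\<phi>] L2_abs[OF vL]] ip_Cauchy_Schwarz[OF L2_abs[OF L2_diff[OF u L\<phi>]] L2_abs[OF w(1)[of n]]]
      unfolding nab by linarith
    also have "nm (\<lambda>x. u x - \<phi> x) * nm (w n) \<le> (r / (2 * (m + 1))) * (m + 1)"
      using \<phi>(2) w(2)[of n] r m0 by (intro mult_mono) auto
    also have "(r / (2 * (m + 1))) * (m + 1) = r / 2"
    proof -
      have "r / (2 * c) * c = r / 2" if "c \<noteq> 0" for c using that by simp
      then show ?thesis using m0 by (metis add_nonneg_pos less_irrefl zero_less_one)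
    qed
    finally have "ip (\<lambda>x. \<bar>u x\<bar>) (\<lambda>x. \<bar>w n x\<bar>) < r" using n0[OF that] unfolding nmv by linarith
    moreover have "ip (\<lambda>x. \<bar>u x\<bar>) (\<lambda>x. \<bar>w n x\<bar>) \<ge> 0" by (simp add: ip_def)
    ultimately show ?thesis by simp
  qed
  then show "\<exists>n0. \<forall>n\<ge>n0. norm (ip (\<lambda>x. \<bar>u x\<bar>) (\<lambda>x. \<bar>w n x\<bar>) - 0) < r" by blast
qed

lemma ip_tendsto_0:
  fixes u :: "real^'n::finite \<Rightarrow> real"
  assumes u: "u \<in> L2" and w: "\<And>n. w n \<in> L2" "\<And>n. nm (w n) \<le> m"
    and loc: "\<And>R. (\<lambda>n. loc R (w n) 0) \<longlonglongrightarrow> 0"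
  shows "(\<lambda>n. ip u (w n)) \<longlonglongrightarrow> 0"
proof (rule Lim_null_comparison[OF _ ip_abs_tendsto_0[OF assms]])
  have "\<bar>ip u (w n)\<bar> \<le> ip (\<lambda>x. \<bar>u x\<bar>) (\<lambda>x. \<bar>w n x\<bar>)" for n
    using integral_abs_bound[of lborel "\<lambda>x. u x * w n x"] by (simp add: ip_def abs_mult)
  then show "\<forall>\<^sub>F n in sequentially. norm (ip u (w n)) \<le> ip (\<lambda>x. \<bar>u x\<bar>) (\<lambda>x. \<bar>w n x\<bar>)" by simp
qed

lemma I_mult_le:
  fixes u w g :: "real^'n::finite \<Rightarrow> real"
  assumes "u \<in> L2" "w \<in> L2" and g: "g \<in> borel_measurable borel" "PB \<gamma> g" "\<And>x. \<bar>pot \<gamma> g x\<bar> \<le> M"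
  shows "\<bar>I \<gamma> (\<lambda>x. u x * w x) g\<bar> \<le> M * ip (\<lambda>x. \<bar>u x\<bar>) (\<lambda>x. \<bar>w x\<bar>)"
proof -
  have "\<bar>I \<gamma> (\<lambda>x. u x * w x) g\<bar> \<le> (LINT x|lborel. \<bar>(u x * w x) * pot \<gamma> g x\<bar>)"
    unfolding I_def by (rule integral_abs_bound)
  also have "\<dots> \<le> (LINT x|lborel. M * (\<bar>u x\<bar> * \<bar>w x\<bar>))"
    using integrable_abs[OF I_integrable[OF L2_integrable_mult[OF assms(1,2)] g(2)], unfolded abs_mult] L2_integrable_mult[OF L2_abs[OF assms(1)] L2_abs[OF assms(2)]] g(3)
    by (intro integral_mono) (auto simp: abs_mult mult.commute[of M] intro!: mult_left_mono)
  finally show ?thesis by (simp add: ip_def)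
qed

text \<open>The Brezis-Lieb property of \<open>D\<close>. In \<open>D_expand\<close> at t = 1, the
  mixed terms containing the product u w are an L1-small function against a bounded potential; the
  remaining one pairs u^2 with w^2 and is \<open>I_cross_tendsto\<close>.\<close>

lemma D_splitting:
  fixes u :: "real^'n::finite \<Rightarrow> real"
  assumes u: "u \<in> H1" and w: "\<And>n. w n \<in> H1" and N: "CARD('n) \<ge> 3"
    and bd: "\<And>n. mass (w n) \<le> m" "\<And>n. dirichlet (w n) \<le> a"
    and loc: "\<And>R. (\<lambda>n. loc R (w n) 0) \<longlonglongrightarrow> 0" and \<gamma>: "0 < \<gamma>" "\<gamma> \<le> 2"
  shows "(\<lambda>n. D \<gamma> (\<lambda>x. u x + w n x) - D \<gamma> (w n)) \<longlonglongrightarrow> D \<gamma> u"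
proof -
  have m0: "m \<ge> 0" "a \<ge> 0" using order_trans[OF mass_nonneg bd(1)] order_trans[OF dirichlet_nonneg bd(2)] by auto
  have \<gamma>0: "0 \<le> \<gamma>" using \<gamma> by simp
  have L: "w n \<in> L2" for n by (rule H1_L2[OF w])
  note Lu = H1_L2[OF u]
  have nmw: "nm (w n) \<le> sqrt m" for n using bd(1)[of n] by (simp add: mass_nm real_le_rsqrt)
  have Mw: "Mh (w n) \<le> m + 4 * a" for n using bd[of n] by (simp add: Mh_def)
  let ?U = "\<lambda>x. u x * u x" and ?X = "\<lambda>n x. u x * w n x" and ?W = "\<lambda>n x. w n x * w n x"
  let ?p = "\<lambda>n. ip (\<lambda>x. \<bar>u x\<bar>) (\<lambda>x. \<bar>w n x\<bar>)"
  have p0: "?p \<longlonglongrightarrow> 0" by (rule ip_abs_tendsto_0[OF Lu L nmw loc])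
  have P: "PB \<gamma> ?U" "PB \<gamma> (?X n)" "PB \<gamma> (?W n)" for n by (intro PB_mult u w N \<gamma> \<gamma>0)+
  have T: "(\<lambda>n. f n) \<longlonglongrightarrow> 0" if "\<And>n. \<bar>f n\<bar> \<le> C * ?p n" for f :: "nat \<Rightarrow> real" and C
    by (rule Lim_null_comparison[OF _ tendsto_mult_right_zero[OF p0, of C]]) (use that in simp)
  have 1: "(\<lambda>n. I \<gamma> ?U (?X n)) \<longlonglongrightarrow> 0"
  proof (rule T)
    show "\<bar>I \<gamma> ?U (?X n)\<bar> \<le> Mh u * ?p n" for n
      unfolding I_commute[OF P(1,2)]
      by (rule I_mult_le[OF Lu L PB_measurable[OF P(1)] P(1)]) (simp add: pot_square_bounds u N \<gamma> \<gamma>0 Mh_def)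
  qed
  have 2: "(\<lambda>n. I \<gamma> (?X n) (?W n)) \<longlonglongrightarrow> 0"
  proof (rule T)
    show "\<bar>I \<gamma> (?X n) (?W n)\<bar> \<le> (m + 4 * a) * ?p n" for n
      by (rule I_mult_le[OF Lu L PB_measurable[OF P(3)] P(3)])
        (rule order_trans[OF pot_square_bounds[OF w N \<gamma>0 \<gamma>(2)] Mw[unfolded Mh_def]])
  qed
  have 3: "(\<lambda>n. I \<gamma> (?X n) (?X n)) \<longlonglongrightarrow> 0"
  proof (rule T)
    fix n
    show "\<bar>I \<gamma> (?X n) (?X n)\<bar> \<le> (Mh u + (m + 4 * a)) * ?p n"
    proof (rule I_mult_le[OF Lu L PB_measurable[OF P(2)] P(2)])
      fix x
      have int: "integrable lborel (\<lambda>y. ker \<gamma> (x - y) * ?U y)" "integrable lborel (\<lambda>y. ker \<gamma> (x - y) * ?W n y)"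
        "integrable lborel (\<lambda>y. ker \<gamma> (x - y) * ?X n y)"
        by (intro PB_pot_integrable P)+
      have "\<bar>pot \<gamma> (?X n) x\<bar> \<le> (LINT y|lborel. \<bar>ker \<gamma> (x - y) * ?X n y\<bar>)"
        unfolding pot_def by (rule integral_abs_bound)
      \<comment> \<open>The potential of u w is dominated by the sum of the potentials of u^2 and
        w^2, both uniformly bounded.\<close>
      also have "\<dots> \<le> (LINT y|lborel. ker \<gamma> (x - y) * ?U y + ker \<gamma> (x - y) * ?W n y)"
      proof (rule integral_mono)
        fix y
        have "2 * \<bar>u y\<bar> * \<bar>w n y\<bar> \<le> ?U y + ?W n y"
          using sum_squares_bound[of "\<bar>u y\<bar>" "\<bar>w n y\<bar>"] by (simp add: power2_eq_square)
        moreover have "0 \<le> \<bar>u y\<bar> * \<bar>w n y\<bar>" by simp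
        ultimately have "\<bar>u y\<bar> * \<bar>w n y\<bar> \<le> ?U y + ?W n y" by linarith
        from mult_left_mono[OF this, of "ker \<gamma> (x - y)"]
        show "\<bar>ker \<gamma> (x - y) * ?X n y\<bar> \<le> ker \<gamma> (x - y) * ?U y + ker \<gamma> (x - y) * ?W n y"
          by (simp add: abs_mult distrib_left)
      qed (use int in auto)
      also have "\<dots> = pot \<gamma> ?U x + pot \<gamma> (?W n) x" using int by (simp add: pot_def)
      also have "\<dots> \<le> Mh u + (m + 4 * a)"
        using pot_square_bounds[OF u N \<gamma>0 \<gamma>(2), of x] pot_square_bounds[OF w N \<gamma>0 \<gamma>(2), of n x] Mw[of n]
        by (simp add: Mh_def)
      finally show "\<bar>pot \<gamma> (?X n) x\<bar> \<le> Mh u + (m + 4 * a)" .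
    qed
  qed
  note 4 = I_cross_tendsto[OF u w N bd loc \<gamma>]
  have "(\<lambda>n. D \<gamma> u + 4 * I \<gamma> ?U (?X n) + (4 * I \<gamma> (?X n) (?X n) + 2 * I \<gamma> ?U (?W n)) + 4 * I \<gamma> (?X n) (?W n)) \<longlonglongrightarrow>
     D \<gamma> u + 4 * 0 + (4 * 0 + 2 * 0) + 4 * 0"
    by (intro tendsto_intros 1 2 3 4)
  moreover have "D \<gamma> (\<lambda>x. u x + w n x) - D \<gamma> (w n) = D \<gamma> u + 4 * I \<gamma> ?U (?X n) + (4 * I \<gamma> (?X n) (?X n) + 2 * I \<gamma> ?U (?W n)) + 4 * I \<gamma> (?X n) (?W n)" for n
    using D_expand[OF u w[of n] N \<gamma>0 \<gamma>(2), of 1] by simp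
  ultimately show ?thesis by simp
qed

section \<open>Compactness up to translation\<close>

text \<open>The mean of u over the ball of radius \<epsilon> around x. It plays the part of a
  mollification: equicontinuous for a bounded set in H1, and close to u in norm.\<close>

definition av :: "real \<Rightarrow> (real^'n::finite \<Rightarrow> real) \<Rightarrow> real^'n \<Rightarrow> real" where
  "av \<epsilon> u x = ip (indicator (ball 0 \<epsilon>)) (\<lambda>z. u (z + x)) / measure lborel (ball (0::real^'n) \<epsilon>)"

lemma ball_volume_pos: "\<epsilon> > 0 \<Longrightarrow> measure lborel (ball (0::real^'n::finite) \<epsilon>) > 0"
  using content_ball_pos[of \<epsilon> "0::real^'n"] by simp

lemma indicator_ball_L2: "(indicator (ball (0::real^'n::finite) \<epsilon>) :: _ \<Rightarrow> real) \<in> L2"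
  by (rule indicator_L2) auto

lemma ip_indicator_ball: "ip (indicator (ball (0::real^'n::finite) \<epsilon>)) (indicator (ball 0 \<epsilon>)) = measure lborel (ball (0::real^'n) \<epsilon>)"
proof -
  have "ip (indicator (ball (0::real^'n::finite) \<epsilon>)) (indicator (ball 0 \<epsilon>)) = (LINT x|lborel. indicator (ball (0::real^'n) \<epsilon>) x)"
    unfolding ip_def by (rule Bochner_Integration.integral_cong) (auto simp: indicator_def)
  then show ?thesis by simp
qed

lemma av_bounds:
  fixes u :: "real^'n::finite \<Rightarrow> real"
  assumes u: "u \<in> H1" and \<epsilon>: "\<epsilon> > 0"
  defines "K \<equiv> nm (indicator (ball (0::real^'n) \<epsilon>)) / measure lborel (ball (0::real^'n) \<epsilon>)"
  shows "\<bar>av \<epsilon> u x\<bar> \<le> K * nm u" "\<bar>av \<epsilon> u x - av \<epsilon> u y\<bar> \<le> K * (norm (x - y) * (\<Sum>i\<in>UNIV. nm (pd u i)))"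
proof -
  note L = H1_L2[OF u]
  let ?b = "indicator (ball (0::real^'n) \<epsilon>) :: _ \<Rightarrow> real"
  let ?V = "measure lborel (ball (0::real^'n) \<epsilon>)"
  have V: "?V > 0" by (rule ball_volume_pos[OF \<epsilon>])
  have "\<bar>ip ?b (\<lambda>z. u (z + x))\<bar> \<le> nm ?b * nm u"
    using ip_Cauchy_Schwarz[OF indicator_ball_L2 L2_translate[OF L]] by (simp add: nm_translate)
  then show "\<bar>av \<epsilon> u x\<bar> \<le> K * nm u"
    using V by (simp add: av_def K_def divide_right_mono)
  have "\<bar>ip ?b (\<lambda>z. u (z + x)) - ip ?b (\<lambda>z. u (z + y))\<bar> = \<bar>ip ?b (\<lambda>z. u (z + x) - u (z + y))\<bar>"
    by (simp add: ip_diff_right indicator_ball_L2 L2_translate L)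
  also have "\<dots> \<le> nm ?b * nm (\<lambda>z. u (z + x) - u (z + y))"
    by (rule ip_Cauchy_Schwarz[OF indicator_ball_L2 L2_diff[OF L2_translate[OF L] L2_translate[OF L]]])
  also have "nm (\<lambda>z. u (z + x) - u (z + y)) = nm (\<lambda>z. u (z + (x - y)) - u z)"
    using nm_translate[of "\<lambda>z. u (z + (x - y)) - u z" y] by (simp add: add.assoc)
  also have "nm ?b * nm (\<lambda>z. u (z + (x - y)) - u z) \<le> nm ?b * (norm (x - y) * (\<Sum>i\<in>UNIV. nm (pd u i)))"
    by (intro mult_left_mono nm_translate_le[OF L pd_L2[OF u] pd_wd[OF u]]) simp
  finally have "\<bar>ip ?b (\<lambda>z. u (z + x)) - ip ?b (\<lambda>z. u (z + y))\<bar> \<le> nm ?b * (norm (x - y) * (\<Sum>i\<in>UNIV. nm (pd u i)))" .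
  then show "\<bar>av \<epsilon> u x - av \<epsilon> u y\<bar> \<le> K * (norm (x - y) * (\<Sum>i\<in>UNIV. nm (pd u i)))"
    using V unfolding av_def K_def diff_divide_distrib[symmetric] by (simp add: divide_right_mono)
qed

text \<open>Cauchy-Schwarz on the ball bounds the squared deviation by the mean of |u(x+z) -
  u(x)|^2; exchanging the integrals leaves the norm of a translation difference with |z| <
  \<epsilon>.\<close>

lemma av_diff:
  fixes u :: "real^'n::finite \<Rightarrow> real"
  assumes u: "u \<in> H1" and \<epsilon>: "\<epsilon> > 0"
  shows "(\<lambda>x. av \<epsilon> u x - u x) \<in> L2" "nm (\<lambda>x. av \<epsilon> u x - u x) \<le> \<epsilon> * (\<Sum>i\<in>UNIV. nm (pd u i))"
proof -
  note L = H1_L2[OF u]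
  let ?b = "indicator (ball (0::real^'n) \<epsilon>) :: _ \<Rightarrow> real"
  let ?V = "measure lborel (ball (0::real^'n) \<epsilon>)"
  let ?G = "\<Sum>i\<in>UNIV. nm (pd u i)"
  note [measurable] = L2_measurable[OF L]
  have [measurable]: "ball (0::real^'n) \<epsilon> \<in> sets borel" by simp
  have V: "?V > 0" by (rule ball_volume_pos[OF \<epsilon>])
  have G: "?G \<ge> 0" by (intro sum_nonneg) simp
  have cont: "isCont (av \<epsilon> u) x" for x
  proof -
    define C where "C = nm ?b / ?V * ?G"
    have "((\<lambda>y. C * norm (y - x)) \<longlongrightarrow> C * norm (x - x)) (at x)" by (intro tendsto_intros)
    then have "((\<lambda>y. C * norm (y - x)) \<longlongrightarrow> 0) (at x)" by simp
    moreover have "norm (av \<epsilon> u y - av \<epsilon> u x) \<le> C * norm (y - x)" for y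
      using av_bounds(2)[OF u \<epsilon>, of y x] by (simp add: C_def mult_ac)
    ultimately have "((\<lambda>y. av \<epsilon> u y - av \<epsilon> u x) \<longlongrightarrow> 0) (at x)"
      by (intro Lim_null_comparison[of "\<lambda>y. av \<epsilon> u y - av \<epsilon> u x"] always_eventually allI)
    then show ?thesis unfolding isCont_def by (rule LIM_zero_cancel)
  qed
  then have [measurable]: "av \<epsilon> u \<in> borel_measurable borel"
    by (intro borel_measurable_continuous_onI continuous_at_imp_continuous_on) auto
  have pt: "(av \<epsilon> u x - u x)\<^sup>2 \<le> (1 / ?V) * (LINT z|lborel. ?b z * (u (x + z) - u x)\<^sup>2)"
     and int: "integrable lborel (\<lambda>z. ?b z * (u (x + z) - u x)\<^sup>2)" for x
  proof -
    define h where "h z = ?b z * (u (z + x) - u x)" for z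
    have h: "h \<in> L2"
    proof -
      have "h = (\<lambda>z. ?b z * u (z + x) - u x * ?b z)" by (auto simp: h_def algebra_simps)
      moreover have "(\<lambda>z. ?b z * u (z + x)) \<in> L2"
        by (rule L2_bounded_mult[OF L2_translate[OF L], where B=1]) (auto simp: indicator_def)
      ultimately show ?thesis by (simp only:) (intro L2_diff L2_scale indicator_ball_L2)
    qed
    have bh: "ip ?b h = ip ?b (\<lambda>z. u (z + x)) - u x * ?V"
    proof -
      have "ip ?b h = ip ?b (\<lambda>z. u (z + x) - u x * ?b z)"
        unfolding ip_def by (rule Bochner_Integration.integral_cong) (auto simp: h_def indicator_def)
      also have "\<dots> = ip ?b (\<lambda>z. u (z + x)) - ip ?b (\<lambda>z. u x * ?b z)"
        by (intro ip_diff_right L2_translate L L2_scale indicator_ball_L2)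
      finally show ?thesis by (simp add: ip_scale_right ip_indicator_ball)
    qed
    have "ip ?b (\<lambda>z. u (z + x)) = av \<epsilon> u x * ?V" using V by (simp add: av_def)
    then have avh: "av \<epsilon> u x - u x = ip ?b h / ?V" using bh V by (simp add: field_simps)
    have "(ip ?b h)\<^sup>2 \<le> (nm ?b * nm h)\<^sup>2"
      using ip_Cauchy_Schwarz[OF indicator_ball_L2 h] by (simp add: abs_le_square_iff[symmetric])
    also have "\<dots> = ?V * ip h h" by (simp add: power_mult_distrib nm_square ip_indicator_ball)
    finally have "(av \<epsilon> u x - u x)\<^sup>2 \<le> (1 / ?V) * ip h h"
      using V by (simp add: avh power_divide field_simps power2_eq_square)
    moreover have e: "h z * h z = ?b z * (u (x + z) - u x)\<^sup>2" for z
      by (auto simp: h_def indicator_def power2_eq_square add.commute)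
    ultimately show "(av \<epsilon> u x - u x)\<^sup>2 \<le> (1 / ?V) * (LINT z|lborel. ?b z * (u (x + z) - u x)\<^sup>2)"
      by (simp add: ip_def)
    show "integrable lborel (\<lambda>z. ?b z * (u (x + z) - u x)\<^sup>2)"
      using L2_integrable_mult[OF h h] unfolding e .
  qed
  have "(\<integral>\<^sup>+x. ennreal ((av \<epsilon> u x - u x)\<^sup>2) \<partial>lborel) \<le> (\<integral>\<^sup>+x. \<integral>\<^sup>+z. ennreal (1 / ?V) * ennreal (?b z * (u (x + z) - u x)\<^sup>2) \<partial>lborel \<partial>lborel)"
  proof (rule nn_integral_mono)
    fix x
    have "ennreal ((av \<epsilon> u x - u x)\<^sup>2) \<le> ennreal ((1 / ?V) * (LINT z|lborel. ?b z * (u (x + z) - u x)\<^sup>2))"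
      by (rule ennreal_leI[OF pt])
    also have "\<dots> = ennreal (1 / ?V) * ennreal (LINT z|lborel. ?b z * (u (x + z) - u x)\<^sup>2)"
      using V by (intro ennreal_mult') simp
    also have "ennreal (LINT z|lborel. ?b z * (u (x + z) - u x)\<^sup>2) = (\<integral>\<^sup>+z. ennreal (?b z * (u (x + z) - u x)\<^sup>2) \<partial>lborel)"
      by (rule nn_integral_eq_integral[OF int, symmetric]) auto
    finally show "ennreal ((av \<epsilon> u x - u x)\<^sup>2) \<le> (\<integral>\<^sup>+z. ennreal (1 / ?V) * ennreal (?b z * (u (x + z) - u x)\<^sup>2) \<partial>lborel)"
      by (simp add: nn_integral_cmult)
  qed
  also have "\<dots> = (\<integral>\<^sup>+z. \<integral>\<^sup>+x. ennreal (1 / ?V) * ennreal (?b z * (u (x + z) - u x)\<^sup>2) \<partial>lborel \<partial>lborel)"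
    by (rule lborel_pair.Fubini') measurable
  also have "\<dots> \<le> (\<integral>\<^sup>+z. ennreal (1 / ?V) * (ennreal ((\<epsilon> * ?G)\<^sup>2) * indicator (ball (0::real^'n) \<epsilon>) z) \<partial>lborel)"
  proof (rule nn_integral_mono)
    fix z
    show "(\<integral>\<^sup>+x. ennreal (1 / ?V) * ennreal (?b z * (u (x + z) - u x)\<^sup>2) \<partial>lborel) \<le> ennreal (1 / ?V) * (ennreal ((\<epsilon> * ?G)\<^sup>2) * indicator (ball (0::real^'n) \<epsilon>) z)"
    proof (cases "z \<in> ball 0 \<epsilon>")
      case True
      have dL: "(\<lambda>x. u (x + z) - u x) \<in> L2" by (intro L2_diff L2_translate L)
      have "(\<integral>\<^sup>+x. ennreal ((u (x + z) - u x)\<^sup>2) \<partial>lborel) = ennreal ((nm (\<lambda>x. u (x + z) - u x))\<^sup>2)"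
        unfolding nm_square ip_def power2_eq_square[symmetric]
        by (rule nn_integral_eq_integral[OF L2_integrable_square[OF dL]]) auto
      also have "\<dots> \<le> ennreal ((\<epsilon> * ?G)\<^sup>2)"
      proof (intro ennreal_leI power_mono)
        have "nm (\<lambda>x. u (x + z) - u x) \<le> norm z * ?G" by (rule nm_translate_le[OF L pd_L2[OF u] pd_wd[OF u]])
        also have "\<dots> \<le> \<epsilon> * ?G" using True G by (intro mult_right_mono) auto
        finally show "nm (\<lambda>x. u (x + z) - u x) \<le> \<epsilon> * ?G" .
      qed simp
      finally show ?thesis using True by (simp add: nn_integral_cmult mult_left_mono)
    qed simp
  qed
  also have "\<dots> = ennreal (1 / ?V) * (ennreal ((\<epsilon> * ?G)\<^sup>2) * emeasure lborel (ball (0::real^'n) \<epsilon>))"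
    by (simp add: nn_integral_cmult)
  also have "emeasure lborel (ball (0::real^'n) \<epsilon>) = ennreal ?V"
    by (rule emeasure_eq_ennreal_measure) (use emeasure_lborel_ball_finite[of "0::real^'n" \<epsilon>] in auto)
  also have "ennreal (1 / ?V) * (ennreal ((\<epsilon> * ?G)\<^sup>2) * ennreal ?V) = ennreal ((\<epsilon> * ?G)\<^sup>2)"
  proof -
    have "(1 / ?V) * ((\<epsilon> * ?G)\<^sup>2 * ?V) = (\<epsilon> * ?G)\<^sup>2" using V by simp
    then show ?thesis using V by (simp add: ennreal_mult[symmetric])
  qed
  finally have le: "(\<integral>\<^sup>+x. ennreal ((av \<epsilon> u x - u x)\<^sup>2) \<partial>lborel) \<le> ennreal ((\<epsilon> * ?G)\<^sup>2)" .
  show dL: "(\<lambda>x. av \<epsilon> u x - u x) \<in> L2"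
    using le_less_trans[OF le ennreal_less_top] by (auto simp: L2_iff integrable_iff_bounded)
  have "(\<integral>\<^sup>+x. ennreal ((av \<epsilon> u x - u x)\<^sup>2) \<partial>lborel) = ennreal ((nm (\<lambda>x. av \<epsilon> u x - u x))\<^sup>2)"
    unfolding nm_square ip_def power2_eq_square[symmetric]
    by (rule nn_integral_eq_integral[OF L2_integrable_square[OF dL]]) auto
  with le have "(nm (\<lambda>x. av \<epsilon> u x - u x))\<^sup>2 \<le> (\<epsilon> * ?G)\<^sup>2" by (simp add: ennreal_le_iff)
  then show "nm (\<lambda>x. av \<epsilon> u x - u x) \<le> \<epsilon> * ?G" by (rule power2_le_imp_le) (use \<epsilon> G in auto)
qed

section \<open>Rellich compactness on balls\<close>

lemma loc_nm: "loc R w 0 = (nm (\<lambda>x. indicator (cball 0 R) x * w x))\<^sup>2"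
  unfolding nm_square ip_def loc_def by (rule Bochner_Integration.integral_cong) (auto simp: indicator_def)

lemma L2_cut: "w \<in> L2 \<Longrightarrow> (\<lambda>x. indicator (cball 0 R) x * w x :: real) \<in> L2"
  by (rule L2_bounded_mult[where B=1]) (auto simp: indicator_def)

lemma nm_cut_le: "w \<in> L2 \<Longrightarrow> nm (\<lambda>x. indicator (cball 0 R) x * w x :: real) \<le> nm w"
  by (rule order_trans[OF nm_mult_bounded[where B=1]]) (auto simp: indicator_def)

lemma loc_mono: "w \<in> L2 \<Longrightarrow> R \<le> R' \<Longrightarrow> loc R w 0 \<le> loc R' w 0"
  unfolding loc_def by (rule integral_mono[OF loc_integrable loc_integrable]) auto

text \<open>Arzela-Ascoli is applied to the ball means at one fixed scale \<epsilon>, so the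
  subsequence is Cauchy only up to the precision e; a diagonal argument removes this
  restriction.\<close>

lemma loc_Cauchy_subsequence:
  fixes u :: "nat \<Rightarrow> real^'n::finite \<Rightarrow> real"
  assumes u: "\<And>n. u n \<in> H1" and bd: "\<And>n. nm (u n) \<le> m" "\<And>n. (\<Sum>i\<in>UNIV. nm (pd (u n) i)) \<le> a"
    and e: "e > 0"
  obtains r :: "nat \<Rightarrow> nat" where "strict_mono r" "\<And>p q. loc R (\<lambda>x. u (r p) x - u (r q) x) 0 < e"
proof -
  have L: "u n \<in> L2" for n by (rule H1_L2[OF u])
  have a0: "a \<ge> 0" using order_trans[OF sum_nonneg bd(2)] by simp
  \<comment> \<open>Three errors of size \<eta> occur: one between the means and two between a mean
    and its function. Their squared sum is 9e/16 < e.\<close>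
  define \<eta> where "\<eta> = sqrt e / 4"
  have \<eta>: "\<eta> > 0" using e by (simp add: \<eta>_def)
  define \<epsilon> where "\<epsilon> = \<eta> / (a + 1)"
  have \<epsilon>: "\<epsilon> > 0" using \<eta> a0 by (simp add: \<epsilon>_def)
  have \<epsilon>a: "\<epsilon> * (\<Sum>i\<in>UNIV. nm (pd (u n) i)) \<le> \<eta>" for n
  proof -
    have "\<epsilon> * (\<Sum>i\<in>UNIV. nm (pd (u n) i)) \<le> \<epsilon> * (a + 1)" using bd(2)[of n] \<epsilon> by (intro mult_left_mono) auto
    then show ?thesis using a0 by (simp add: \<epsilon>_def)
  qed
  define K where "K = nm (indicator (ball (0::real^'n) \<epsilon>)) / measure lborel (ball (0::real^'n) \<epsilon>)"
  have K: "K \<ge> 0" by (simp add: K_def)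
  define c where "c = nm (indicator (cball (0::real^'n) R))"
  have c: "c \<ge> 0" by (simp add: c_def)
  obtain g k where k: "strict_mono (k :: nat \<Rightarrow> nat)"
      "\<And>e. 0 < e \<Longrightarrow> \<exists>N. \<forall>n x. n \<ge> N \<and> x \<in> cball 0 R \<longrightarrow> norm (av \<epsilon> (u (k n)) x - g x) < e"
  proof (rule Arzela_Ascoli[of "cball (0::real^'n) R" "\<lambda>n. av \<epsilon> (u n)" "K * m"])
    show "norm (av \<epsilon> (u n) x) \<le> K * m" for n x
      using av_bounds(1)[OF u \<epsilon>, of n x] mult_left_mono[OF bd(1)[of n] K] by (simp add: K_def)
    fix x :: "real^'n" and e' :: real assume e': "0 < e'"
    define d where "d = e' / (K * a + 1)"
    have Ka: "K * a + 1 > 0" using K a0 by (simp add: add_nonneg_pos)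
    have "d > 0" using e' Ka by (simp add: d_def)
    moreover have "norm (av \<epsilon> (u n) x - av \<epsilon> (u n) y) < e'" if "norm (x - y) < d" for n y
    proof -
      have "\<bar>av \<epsilon> (u n) x - av \<epsilon> (u n) y\<bar> \<le> K * (norm (x - y) * (\<Sum>i\<in>UNIV. nm (pd (u n) i)))"
        using av_bounds(2)[OF u \<epsilon>] by (simp add: K_def)
      also have "\<dots> \<le> K * (norm (x - y) * a)" by (intro mult_left_mono bd K) simp
      also have "\<dots> \<le> norm (x - y) * (K * a + 1)" by (simp add: algebra_simps)
      also have "\<dots> < d * (K * a + 1)" using that Ka by simp
      also have "\<dots> = e'" using Ka by (simp add: d_def)
      finally show ?thesis by simp
    qed
    ultimately show "\<exists>d>0. \<forall>n y. y \<in> cball 0 R \<and> norm (x - y) < d \<longrightarrow> norm (av \<epsilon> (u n) x - av \<epsilon> (u n) y) < e'" by blast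
  qed auto
  obtain N where N: "\<And>n x. n \<ge> N \<Longrightarrow> x \<in> cball 0 R \<Longrightarrow> \<bar>av \<epsilon> (u (k n)) x - g x\<bar> < \<eta> / (2 * (c + 1))"
    using k(2)[of "\<eta> / (2 * (c + 1))"] \<eta> c by auto
  show ?thesis
  proof (rule that[of "\<lambda>n. k (n + N)"])
    show "strict_mono (\<lambda>n. k (n + N))" using k(1) by (simp add: strict_mono_def)
    fix p q
    let ?i = "k (p + N)" and ?j = "k (q + N)"
    let ?\<chi> = "indicator (cball (0::real^'n) R) :: _ \<Rightarrow> real"
    define A where "A n x = av \<epsilon> (u n) x - u n x" for n x
    have A: "A n \<in> L2" "nm (A n) \<le> \<eta>" for n
      using av_diff[OF u[of n] \<epsilon>] \<epsilon>a[of n] by (auto simp: A_def[abs_def])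
    define B where "B x = ?\<chi> x * (av \<epsilon> (u ?i) x - av \<epsilon> (u ?j) x)" for x
    have Beq: "B = (\<lambda>x. ?\<chi> x * ((A ?i x - A ?j x) + (u ?i x - u ?j x)))" by (auto simp: B_def A_def)
    have B: "B \<in> L2" unfolding Beq by (intro L2_cut L2_add L2_diff A L)
    have \<chi>L: "?\<chi> \<in> L2" by (rule indicator_L2) auto
    have "\<bar>B x\<bar> \<le> \<bar>\<eta> / (c + 1) * ?\<chi> x\<bar>" for x
    proof (cases "x \<in> cball 0 R")
      case True
      then have "\<bar>av \<epsilon> (u ?i) x - av \<epsilon> (u ?j) x\<bar> \<le> \<eta> / (2 * (c + 1)) + \<eta> / (2 * (c + 1))"
        using N[of "p + N" x] N[of "q + N" x] by linarith
      also have "t / (2 * d) + t / (2 * d) = t / d" for t d :: real by (cases "d = 0") (auto simp: field_simps)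
      finally show ?thesis using True \<eta> c by (simp add: B_def)
    qed (simp add: B_def)
    then have "nm B \<le> nm (\<lambda>x. \<eta> / (c + 1) * ?\<chi> x)" by (intro nm_mono_abs B L2_scale \<chi>L)
    also have "\<dots> = \<bar>\<eta> / (c + 1)\<bar> * c" unfolding nm_scale c_def[symmetric] ..
    also have "\<dots> = \<eta> * (c / (c + 1))" using \<eta> c by simp
    also have "\<dots> \<le> \<eta> * 1" using \<eta> c by (intro mult_left_mono) auto
    finally have nB: "nm B \<le> \<eta>" by simp
    have eq: "(\<lambda>x. ?\<chi> x * (u ?i x - u ?j x)) = (\<lambda>x. B x + ?\<chi> x * (A ?j x - A ?i x))"
      by (auto simp: B_def A_def algebra_simps)
    have "nm (\<lambda>x. ?\<chi> x * (u ?i x - u ?j x)) \<le> nm B + nm (\<lambda>x. ?\<chi> x * (A ?j x - A ?i x))"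
      unfolding eq by (intro nm_triangle B L2_cut L2_diff A)
    also have "nm (\<lambda>x. ?\<chi> x * (A ?j x - A ?i x)) \<le> nm (\<lambda>x. A ?j x - A ?i x)"
      by (intro nm_cut_le L2_diff A)
    also have "\<dots> \<le> nm (A ?j) + nm (A ?i)"
      using nm_triangle[OF A(1)[of ?j] L2_uminus[OF A(1)[of ?i]]] nm_scale[of "-1" "A ?i"] by simp
    finally have "nm (\<lambda>x. ?\<chi> x * (u ?i x - u ?j x)) \<le> 3 * \<eta>" using nB A(2)[of ?i] A(2)[of ?j] by linarith
    then have "(nm (\<lambda>x. ?\<chi> x * (u ?i x - u ?j x)))\<^sup>2 \<le> (3 * \<eta>)\<^sup>2" by (intro power_mono) auto
    also have "\<dots> = (9 / 16) * e" using e by (simp add: \<eta>_def power_mult_distrib power_divide)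
    also have "\<dots> < e" using e by simp
    finally show "loc R (\<lambda>x. u ?i x - u ?j x) 0 < e" by (simp add: loc_nm)
  qed
qed

text \<open>The limit is obtained twice: as a weak limit U, which inherits weak derivatives and so
  lies in H1, and as a strong limit F of the weighted sequence. Testing shows that U is F divided by
  the weight.\<close>

lemma H1_compactness:
  fixes u :: "nat \<Rightarrow> real^'n::finite \<Rightarrow> real"
  assumes u: "\<And>n. u n \<in> H1" and bd: "\<And>n. mass (u n) \<le> m" "\<And>n. dirichlet (u n) \<le> a"
  obtains r v where "strict_mono r" "v \<in> H1" "\<And>R. (\<lambda>n. loc R (\<lambda>x. u (r n) x - v x) 0) \<longlonglongrightarrow> 0"
proof -
  have L: "u n \<in> L2" for n by (rule H1_L2[OF u])
  have nmu: "nm (u n) \<le> sqrt m" for n using bd(1)[of n] by (simp add: mass_nm real_le_rsqrt)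
  have nmp: "nm (pd (u n) i) \<le> sqrt a" for n i
  proof -
    have "(nm (pd (u n) i))\<^sup>2 \<le> (\<Sum>i\<in>UNIV. (nm (pd (u n) i))\<^sup>2)" by (rule member_le_sum) auto
    also have "\<dots> \<le> a" using bd(2)[of n] by (simp add: dirichlet_eq u)
    finally show ?thesis by (rule real_le_rsqrt)
  qed
  have sump: "(\<Sum>i\<in>UNIV. nm (pd (u n) i)) \<le> real CARD('n) * sqrt a" for n
    using sum_bounded_above[of UNIV "\<lambda>i. nm (pd (u n) i)" "sqrt a"] nmp by simp
  \<comment> \<open>Radius and precision are tied to the same k, and the property survives passing
    to further subsequences, as diagonalisation requires.\<close>
  define P where "P k s = (\<exists>n0. \<forall>p\<ge>n0. \<forall>q\<ge>n0. loc (real k) (\<lambda>x. u (s p) x - u (s q) x) 0 < inverse (real (Suc k)))" for k and s :: "nat \<Rightarrow> nat"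
  interpret subseqs P
  proof
    fix k s assume "strict_mono (s :: nat \<Rightarrow> nat)"
    have pos: "0 < inverse (real (Suc k))" by simp
    obtain r :: "nat \<Rightarrow> nat" where r: "strict_mono r" "\<And>p q. loc (real k) (\<lambda>x. u (s (r p)) x - u (s (r q)) x) 0 < inverse (real (Suc k))"
      using loc_Cauchy_subsequence[where u="\<lambda>n. u (s n)" and R="real k", OF u nmu sump pos] by blast
    show "\<exists>r'. strict_mono r' \<and> P k (s \<circ> r')"
      unfolding P_def o_def by (intro exI[of _ r] conjI exI[of _ 0] allI impI r)
  qed
  define d where "d = diagseq"
  have d: "strict_mono d" unfolding d_def by (rule subseq_diagseq)
  define v where "v n = u (d n)" for n
  have vH: "v n \<in> H1" for n by (simp add: v_def u)
  have vL: "v n \<in> L2" for n by (rule H1_L2[OF vH])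
  have nmv: "nm (v n) \<le> sqrt m" for n by (simp add: v_def nmu)
  have m0: "0 \<le> sqrt m" using order_trans[OF nm_nonneg nmv] .
  have CauchyP: "\<exists>n0. \<forall>p\<ge>n0. \<forall>q\<ge>n0. loc (real k) (\<lambda>x. v p x - v q x) 0 < inverse (real (Suc k))" for k
  proof -
    have "P k (diagseq \<circ> (+) (Suc k))"
    proof (rule diagseq_holds)
      fix r s :: "nat \<Rightarrow> nat" and n assume r: "strict_mono r" and "P n s"
      then obtain n0 where n0: "\<And>p q. p \<ge> n0 \<Longrightarrow> q \<ge> n0 \<Longrightarrow> loc (real n) (\<lambda>x. u (s p) x - u (s q) x) 0 < inverse (real (Suc n))"
        by (auto simp: P_def)
      have "r p \<ge> n0" if "p \<ge> n0" for p using seq_suble[OF r, of p] that by simp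
      with n0 show "P n (s \<circ> r)" unfolding P_def by (intro exI[of _ n0]) auto
    qed
    then obtain n0 where n0: "\<And>p q. p \<ge> n0 \<Longrightarrow> q \<ge> n0 \<Longrightarrow>
        loc (real k) (\<lambda>x. v (Suc k + p) x - v (Suc k + q) x) 0 < inverse (real (Suc k))"
      by (auto simp: P_def v_def d_def)
    have "loc (real k) (\<lambda>x. v p x - v q x) 0 < inverse (real (Suc k))" if "p \<ge> n0 + Suc k" "q \<ge> n0 + Suc k" for p q
      using n0[of "p - Suc k" "q - Suc k"] that by simp
    then show ?thesis by blast
  qed
  have Cauchy: "\<exists>n0. \<forall>p\<ge>n0. \<forall>q\<ge>n0. loc R (\<lambda>x. v p x - v q x) 0 < e" if e: "e > 0" for R e
  proof -
    obtain k1 :: nat where k1: "R \<le> real k1" using real_arch_simple by blast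
    obtain k2 :: nat where k2: "inverse (real (Suc k2)) < e" using reals_Archimedean[OF e] by blast
    define k where "k = max k1 k2"
    obtain n0 where n0: "\<forall>p\<ge>n0. \<forall>q\<ge>n0. loc (real k) (\<lambda>x. v p x - v q x) 0 < inverse (real (Suc k))"
      using CauchyP by blast
    have "inverse (real (Suc k)) \<le> inverse (real (Suc k2))" by (auto simp: k_def)
    moreover have "loc R (\<lambda>x. v p x - v q x) 0 \<le> loc (real k) (\<lambda>x. v p x - v q x) 0" for p q
      by (rule loc_mono[OF L2_diff[OF vL vL]]) (use k1 in \<open>auto simp: k_def\<close>)
    ultimately have "loc R (\<lambda>x. v p x - v q x) 0 < e" if "p \<ge> n0" "q \<ge> n0" for p q
      using n0[rule_format, OF that] k2 by (meson le_less_trans less_le_trans less_trans)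
    then show ?thesis by blast
  qed
  text \<open>The weight makes convergence on balls of a bounded sequence equivalent to convergence in norm.\<close>
  define \<omega> where "\<omega> x = inverse (1 + norm x)" for x :: "real^'n"
  have \<omega>: "\<omega> x > 0" "\<omega> x \<le> 1" "\<bar>\<omega> x\<bar> \<le> 1" for x by (auto simp: \<omega>_def field_simps add_pos_nonneg)
  have [measurable]: "\<omega> \<in> borel_measurable borel" unfolding \<omega>_def by measurable
  have \<omega>L: "(\<lambda>x. \<omega> x * f x) \<in> L2" if "f \<in> L2" for f by (rule L2_bounded_mult[OF that _ \<omega>(3)]) simp
  define f where "f n x = \<omega> x * v n x" for n x
  have fL: "f n \<in> L2" for n unfolding f_def by (rule \<omega>L[OF vL])
  have fC: "\<exists>n0. \<forall>p\<ge>n0. \<forall>q\<ge>n0. nm (\<lambda>x. f p x - f q x) < e" if e: "e > 0" for e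
  proof -
    \<comment> \<open>Outside this ball the weight is at most 1/R, and differences have norm at most
      2 sqrt m, so the outer part is below e/2.\<close>
    define R where "R = 4 * sqrt m / e + 1"
    have R: "R > 0" using e m0 by (simp add: R_def add_nonneg_pos)
    obtain n0 where n0: "\<And>p q. p \<ge> n0 \<Longrightarrow> q \<ge> n0 \<Longrightarrow> loc R (\<lambda>x. v p x - v q x) 0 < (e/2)\<^sup>2"
      using Cauchy[of "(e/2)\<^sup>2" R] e by auto
    have "nm (\<lambda>x. f p x - f q x) < e" if pq: "p \<ge> n0" "q \<ge> n0" for p q
    proof -
      define w where "w x = v p x - v q x" for x
      have wL: "w \<in> L2" unfolding w_def by (intro L2_diff vL)
      have nw: "nm w \<le> 2 * sqrt m"
        using nm_triangle[OF vL[of p] L2_uminus[OF vL[of q]]] nm_scale[of "-1" "v q"] nmv[of p] nmv[of q]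
        by (simp add: w_def[abs_def])
      have c1: "(\<lambda>x. indicator (cball 0 R) x * w x) \<in> L2" by (rule L2_cut[OF wL])
      have "\<bar>f p x - f q x\<bar> \<le> \<bar>\<bar>indicator (cball 0 R) x * w x\<bar> + \<bar>inverse R * w x\<bar>\<bar>" for x
      proof -
        have fw: "\<bar>f p x - f q x\<bar> = \<omega> x * \<bar>w x\<bar>" using \<omega>(1)[of x] by (simp add: f_def w_def abs_mult right_diff_distrib[symmetric])
        show ?thesis
        proof (cases "norm x \<le> R")
          case True
          have "\<omega> x * \<bar>w x\<bar> \<le> 1 * \<bar>w x\<bar>" using \<omega> by (intro mult_right_mono) auto
          then show ?thesis using True fw by simp
        next
          case False
          have "\<omega> x \<le> inverse R" unfolding \<omega>_def using False R by (intro le_imp_inverse_le) auto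
          then have "\<omega> x * \<bar>w x\<bar> \<le> inverse R * \<bar>w x\<bar>" by (intro mult_right_mono) auto
          then show ?thesis using False fw R by (simp add: abs_mult)
        qed
      qed
      then have "nm (\<lambda>x. f p x - f q x) \<le> nm (\<lambda>x. \<bar>indicator (cball 0 R) x * w x\<bar> + \<bar>inverse R * w x\<bar>)"
        by (intro nm_mono_abs L2_diff fL L2_add L2_abs c1 L2_scale wL)
      also have "\<dots> \<le> nm (\<lambda>x. \<bar>indicator (cball 0 R) x * w x\<bar>) + nm (\<lambda>x. \<bar>inverse R * w x\<bar>)"
        by (intro nm_triangle L2_abs c1 L2_scale wL)
      also have "nm (\<lambda>x. \<bar>inverse R * w x\<bar>) = inverse R * nm w"
        using R nm_scale[of "inverse R" w] by (simp add: nm_def ip_def)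
      also have "\<dots> \<le> inverse R * (2 * sqrt m)" using nw R by (intro mult_left_mono) auto
      also have "\<dots> < e / 2"
      proof -
        have "4 * sqrt m < e * R" using e by (simp add: R_def distrib_left)
        then show ?thesis using R by (simp add: field_simps)
      qed
      also have "nm (\<lambda>x. \<bar>indicator (cball 0 R) x * w x\<bar>) = sqrt (loc R w 0)"
        by (simp add: loc_nm) (simp add: nm_def ip_def)
      also have "\<dots> < e / 2"
        using n0[OF pq] e real_sqrt_less_mono[of "loc R w 0" "(e/2)\<^sup>2"] by (simp add: w_def[abs_def])
      finally show ?thesis by simp
    qed
    then show ?thesis by blast
  qed
  obtain F where F: "F \<in> L2" "(\<lambda>n. nm (\<lambda>x. f n x - F x)) \<longlonglongrightarrow> 0" using L2_complete[of f, OF fL fC] by blast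
  have div: "(\<lambda>x. \<phi> x / \<omega> x) \<in> L2" if p: "\<phi> \<in> test_functions" for \<phi>
  proof -
    obtain B where B: "\<And>x. \<bar>\<phi> x\<bar> \<le> B" using test_bounded[OF p] by blast
    obtain R where R: "R > 0" "\<And>x. norm x > R \<Longrightarrow> \<phi> x = 0" using test_support[OF p] by blast
    note [measurable] = test_measurable[OF p]
    have "(\<lambda>x. (indicator (cball 0 R) x / \<omega> x) * \<phi> x) \<in> L2"
      by (rule L2_bounded_mult[OF test_L2[OF p], where B="1 + R"]) (use R(1) in \<open>auto simp: indicator_def \<omega>_def divide_inverse\<close>)
    moreover have "(\<lambda>x. (indicator (cball 0 R) x / \<omega> x) * \<phi> x) = (\<lambda>x. \<phi> x / \<omega> x)"
    proof
      fix x show "(indicator (cball 0 R) x / \<omega> x) * \<phi> x = \<phi> x / \<omega> x"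
        using R(2)[of x] by (cases "norm x \<le> R") auto
    qed
    ultimately show ?thesis by (simp only:)
  qed
  have weak: "(\<lambda>n. ip (v n) \<phi>) \<longlonglongrightarrow> ip F (\<lambda>x. \<phi> x / \<omega> x)" if p: "\<phi> \<in> test_functions" for \<phi>
  proof -
    have "ip (v n) \<phi> = ip (f n) (\<lambda>x. \<phi> x / \<omega> x)" for n
    proof -
      have "v n x * \<phi> x = f n x * (\<phi> x / \<omega> x)" for x using \<omega>(1)[of x] by (simp add: f_def)
      then show ?thesis by (simp add: ip_def)
    qed
    then show ?thesis using ip_tendsto_left[OF fL F(1) div[OF p] F(2)] by simp
  qed
  have test_sub: "test_functions \<subseteq> (L2 :: (real^'n \<Rightarrow> real) set)" using test_L2 by blast
  obtain U where U: "U \<in> L2" "\<And>\<phi>. \<phi> \<in> test_functions \<Longrightarrow> ip U \<phi> = ip F (\<lambda>x. \<phi> x / \<omega> x)"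
    using weak_limit[OF vL nmv test_sub weak] by blast
  have "\<exists>g. g \<in> L2 \<and> wd i U g" for i
  proof -
    have "(\<lambda>n. ip (pd (v n) i) \<phi>) \<longlonglongrightarrow> - ip U (partial_deriv i \<phi>)" if p: "\<phi> \<in> test_functions" for \<phi>
    proof -
      have "ip (pd (v n) i) \<phi> = - ip (v n) (partial_deriv i \<phi>)" for n
        using wdD[OF pd_wd[OF vH] p, of n i] by (simp add: ip_def)
      moreover have "(\<lambda>n. ip (v n) (partial_deriv i \<phi>)) \<longlonglongrightarrow> ip U (partial_deriv i \<phi>)"
        using weak[OF test_partial[OF p]] U(2)[OF test_partial[OF p]] by simp
      ultimately show ?thesis by (simp add: tendsto_minus)
    qed
    then obtain g where g: "g \<in> L2" "\<And>\<phi>. \<phi> \<in> test_functions \<Longrightarrow> ip g \<phi> = - ip U (partial_deriv i \<phi>)"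
      using weak_limit[of "\<lambda>n. pd (v n) i" "sqrt a" test_functions "\<lambda>\<phi>. - ip U (partial_deriv i \<phi>)", OF pd_L2[OF vH] _ test_sub]
        nmp by (auto simp: v_def)
    then have "wd i U g" by (simp add: wd_def ip_def)
    with g show ?thesis by blast
  qed
  then obtain G where "\<And>i. G i \<in> L2" "\<And>i. wd i U (G i)" by metis
  then have UH: "U \<in> H1" by (rule H1I[OF U(1)])
  \<comment> \<open>The two limits have the same pairings with test functions, so the fundamental
    lemma makes this difference zero.\<close>
  define E where "E x = U x - F x / \<omega> x" for x
  have AE: "AE x in lborel. E x = 0"
  proof (rule AE_zero_if_test_zero)
    note [measurable] = L2_measurable[OF U(1)] L2_measurable[OF F(1)]
    have "(\<lambda>x. indicator (cball 0 R) x * (F x / \<omega> x)) \<in> L2" for R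
    proof -
      have "(\<lambda>x. (indicator (cball 0 R) x / \<omega> x) * F x) \<in> L2"
        by (rule L2_bounded_mult[OF F(1), where B="1 + \<bar>R\<bar>"]) (auto simp: indicator_def \<omega>_def divide_inverse)
      then show ?thesis by simp
    qed
    then have "(\<lambda>x. indicator (cball 0 R) x * U x - indicator (cball 0 R) x * (F x / \<omega> x)) \<in> L2" for R
      using L2_diff[OF L2_cut[OF U(1)]] by blast
    then have EL: "(\<lambda>x. indicator (cball 0 R) x * E x) \<in> L2" for R by (simp add: E_def right_diff_distrib)
    show lE: "locint E"
      unfolding locint_def
    proof (intro conjI allI)
      show "E \<in> borel_measurable borel" unfolding E_def by measurable
      fix R
      have "integrable lborel (\<lambda>x. indicator (cball 0 R) x * (indicator (cball 0 R) x * E x))"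
        by (rule L2_integrable_mult[OF indicator_L2 EL]) auto
      moreover have "indicator (cball 0 R) x * (indicator (cball 0 R) x * E x) = indicator (cball 0 R) x * E x" for x
        by (auto simp: indicator_def)
      ultimately show "integrable lborel (\<lambda>x. indicator (cball 0 R) x * E x)" by simp
    qed
    fix \<phi> :: "real^'n \<Rightarrow> real" assume p: "\<phi> \<in> test_functions"
    have "integrable lborel (\<lambda>x. U x * \<phi> x)" "integrable lborel (\<lambda>x. F x * (\<phi> x / \<omega> x))"
      by (intro L2_integrable_mult U F test_L2 p div)+
    then show "(LINT x|lborel. E x * \<phi> x) = 0"
      using U(2)[OF p] by (simp add: E_def ip_def left_diff_distrib)
  qed
  have conv: "(\<lambda>n. loc R (\<lambda>x. v n x - U x) 0) \<longlonglongrightarrow> 0" for R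
  proof (rule Lim_null_comparison)
    show "(\<lambda>n. (1 + \<bar>R\<bar>)\<^sup>2 * (nm (\<lambda>x. f n x - F x))\<^sup>2) \<longlonglongrightarrow> 0"
      using tendsto_mult_left[OF tendsto_power[OF F(2), of 2], of "(1 + \<bar>R\<bar>)\<^sup>2"] by simp
    have "norm (loc R (\<lambda>x. v n x - U x) 0) \<le> (1 + \<bar>R\<bar>)\<^sup>2 * (nm (\<lambda>x. f n x - F x))\<^sup>2" for n
    proof -
      have dL: "(\<lambda>x. v n x - U x) \<in> L2" "(\<lambda>x. f n x - F x) \<in> L2" by (intro L2_diff vL U fL F)+
      have "loc R (\<lambda>x. v n x - U x) 0 \<le> (LINT x|lborel. (1 + \<bar>R\<bar>)\<^sup>2 * ((f n x - F x) * (f n x - F x)))"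
        unfolding loc_def
      proof (rule integral_mono_AE[OF loc_integrable[OF dL(1)]])
        show "integrable lborel (\<lambda>x. (1 + \<bar>R\<bar>)\<^sup>2 * ((f n x - F x) * (f n x - F x)))"
          using L2_integrable_mult[OF dL(2) dL(2)] by simp
        show "AE y in lborel. (if norm (0 - y) \<le> R then (v n y - U y) * (v n y - U y) else 0) \<le> (1 + \<bar>R\<bar>)\<^sup>2 * ((f n y - F y) * (f n y - F y))"
          using AE
        proof eventually_elim
          case (elim y)
          show ?case
          proof (cases "norm y \<le> R")
            case True
            have "F y = \<omega> y * U y" using elim \<omega>(1)[of y] by (simp add: E_def field_simps)
            then have fF: "f n y - F y = \<omega> y * (v n y - U y)" by (simp add: f_def right_diff_distrib)
            have "1 \<le> (1 + \<bar>R\<bar>) * \<omega> y"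
              unfolding \<omega>_def using True by (simp add: field_simps add_pos_nonneg)
            then have "1 \<le> ((1 + \<bar>R\<bar>) * \<omega> y)\<^sup>2" by (rule one_le_power)
            from mult_right_mono[OF this, of "(v n y - U y) * (v n y - U y)"]
            show ?thesis using True unfolding fF by (simp add: power2_eq_square mult_ac)
          qed simp
        qed
      qed
      then show ?thesis
        using loc_bounds(1)[OF dL(1)] by (simp add: nm_square ip_def)
    qed
    then show "\<forall>\<^sub>F n in sequentially. norm (loc R (\<lambda>x. v n x - U x) 0) \<le> (1 + \<bar>R\<bar>)\<^sup>2 * (nm (\<lambda>x. f n x - F x))\<^sup>2" by simp
  qed
  show ?thesis by (rule that[OF d UH conv[unfolded v_def]])
qed

section \<open>The scale-invariant minimisation problem\<close>

text \<open>If the integral of the nonnegative function u^2 times its potential were 0, the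
  potential would have to vanish at some point; but its integrand there is positive wherever u is
  nonzero, off a single point.\<close>

lemma D_pos:
  fixes u :: "real^'n::finite \<Rightarrow> real"
  assumes u: "u \<in> H1" and m: "mass u > 0" and N: "CARD('n) \<ge> 3" and \<gamma>: "0 \<le> \<gamma>" "\<gamma> \<le> 2"
  shows "D \<gamma> u > 0"
proof (rule ccontr)
  assume "\<not> ?thesis"
  then have z: "D \<gamma> u = 0" using D_nonneg[OF u N \<gamma>] by linarith
  let ?U = "\<lambda>x. u x * u x"
  have P: "PB \<gamma> ?U" by (rule PB_square[OF u N \<gamma>])
  have pot0: "pot \<gamma> ?U x \<ge> 0" for x unfolding pot_def by (intro Bochner_Integration.integral_nonneg) auto
  have AE: "AE x in lborel. ?U x * pot \<gamma> ?U x = 0"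
    using z integral_nonneg_eq_0_iff_AE[OF I_integrable[OF PB_integrable[OF P] P]] pot0
    by (simp add: D_I I_def)
  have nz: "\<not> (AE x in lborel. ?U x = 0)"
    using m integral_nonneg_eq_0_iff_AE[OF u_square_wd(1)[OF u]] by (auto simp: mass_ip ip_def)
  have "\<exists>x. pot \<gamma> ?U x = 0"
  proof (rule ccontr)
    assume n: "\<nexists>x. pot \<gamma> ?U x = 0"
    from AE have "AE x in lborel. ?U x = 0" by eventually_elim (use n in auto)
    with nz show False by simp
  qed
  then obtain x where "pot \<gamma> ?U x = 0" by blast
  then have "AE y in lborel. ker \<gamma> (x - y) * ?U y = 0"
    using integral_nonneg_eq_0_iff_AE[OF PB_pot_integrable[OF P, of x]] by (simp add: pot_def)
  with AE_lborel_singleton[of x] have "AE y in lborel. ?U y = 0"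
    by eventually_elim (auto simp: ker_def)
  with nz show False by simp
qed

text \<open>Hardy bounds the potential by 4 times the Dirichlet integral. The constant is crude but
  finite, which makes the set in \<open>best_const\<close> nonempty.\<close>

lemma D2_le:
  fixes u :: "real^'n::finite \<Rightarrow> real"
  assumes u: "u \<in> H1" and N: "CARD('n) \<ge> 3"
  shows "D 2 u \<le> 4 * dirichlet u * mass u"
proof -
  let ?U = "\<lambda>x. u x * u x"
  have P: "PB 2 ?U" by (rule PB_square[OF u N]) auto
  have p: "\<bar>pot 2 ?U x\<bar> \<le> 4 * dirichlet u" for x
    by (rule pot_abs_le_nn(2)[OF PB_measurable[OF P]]) (use nn_integral_hardy[OF u N, of x] in \<open>auto simp: dirichlet_nonneg\<close>)
  have "D 2 u \<le> (LINT x|lborel. ?U x * (4 * dirichlet u))"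
    unfolding D_I I_def
  proof (rule integral_mono[OF I_integrable[OF PB_integrable[OF P] P]])
    show "integrable lborel (\<lambda>x. ?U x * (4 * dirichlet u))" using u_square_wd(1)[OF u] by simp
    show "?U x * pot 2 ?U x \<le> ?U x * (4 * dirichlet u)" for x
      using p[of x] by (intro mult_left_mono) auto
  qed
  then show ?thesis by (simp add: mass_ip ip_def mult.commute)
qed

section \<open>The best constant, the mass threshold and the sign of \<open>Kf\<close>\<close>

lemma bump_mass_pos: "mass (bump :: real^'n::finite \<Rightarrow> real) > 0"
proof (rule ccontr)
  assume "\<not> ?thesis"
  then have "nm (bump :: real^'n \<Rightarrow> real) = 0" using mass_nonneg[of "bump :: real^'n \<Rightarrow> real"] by (simp add: mass_nm)
  then have AE: "AE x::real^'n in lborel. bump x = 0" by (simp add: nm_zero_iff test_L2 bump_test)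
  have "continuous_on UNIV (bump :: real^'n \<Rightarrow> real)"
    by (rule smooth_continuous[OF test_smooth[OF bump_test]])
  then have op: "open {x::real^'n. bump x \<noteq> 0}" using open_Collect_neq continuous_on_const by blast
  have "{x::real^'n. bump x \<noteq> 0} \<in> sets lborel" using op by simp
  then have "{x::real^'n. bump x \<noteq> 0} \<in> null_sets lborel" using AE by (simp add: AE_iff_null_sets Collect_neg_eq)
  then have "negligible {x::real^'n. bump x \<noteq> 0}" by (simp add: negligible_iff_null_sets null_sets_completionI)
  then have "{x::real^'n. bump x \<noteq> 0} = {}" using op open_not_negligible by blast
  then show False using bump_0[where ?'a='n] by (metis (mono_tags, lifting) empty_Collect_eq zero_neq_one)
qed

text \<open>The real infimum is meaningful because the set is nonempty by \<open>D2_le\<close> and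
  bounded below by the quotient of \<open>bump\<close>, which is positive. The third part says that
  smaller constants fail; existence of an optimiser is not asserted.\<close>

lemma best_const_props:
  assumes N: "CARD('n::finite) \<ge> 3"
  defines "b \<equiv> best_const TYPE('n) 2"
  shows "b > 0" "(u :: real^'n \<Rightarrow> real) \<in> H1 \<Longrightarrow> D 2 u \<le> b * dirichlet u * mass u"
    "C < b \<Longrightarrow> \<exists>u\<in>(H1 :: (real^'n \<Rightarrow> real) set). D 2 u > C * dirichlet u * mass u"
proof -
  let ?S = "{C. \<forall>u\<in>(H1 :: (real^'n \<Rightarrow> real) set). D 2 u \<le> C * dirichlet u * mass u}"
  have b: "b = Inf ?S" by (simp add: b_def best_const_def)
  have ne: "?S \<noteq> {}" using D2_le[OF _ N] by blast
  define v :: "real^'n \<Rightarrow> real" where "v = bump"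
  have v: "v \<in> H1" "mass v > 0" unfolding v_def by (rule test_H1[OF bump_test], rule bump_mass_pos)
  have Dv: "D 2 v > 0" by (rule D_pos[OF v N]) auto
  then have "4 * dirichlet v * mass v > 0" using D2_le[OF v(1) N] by linarith
  then have dv: "dirichlet v * mass v > 0" by simp
  have lower: "D 2 v / (dirichlet v * mass v) \<le> C" if "C \<in> ?S" for C
    using that v(1) dv by (simp add: divide_le_eq mult.assoc)
  have bdd: "bdd_below ?S" using lower by (rule bdd_belowI)
  show "b > 0"
  proof -
    have "0 < D 2 v / (dirichlet v * mass v)" using Dv dv by simp
    also have "\<dots> \<le> b" unfolding b by (intro cInf_greatest ne lower)
    finally show ?thesis .
  qed
  show le: "D 2 u \<le> b * dirichlet u * mass u" if u: "u \<in> H1" for u :: "real^'n \<Rightarrow> real"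
  proof (cases "dirichlet u * mass u = 0")
    case True
    then show ?thesis using D2_le[OF u N] by (auto simp: mult.assoc)
  next
    case False
    then have pos: "dirichlet u * mass u > 0"
      using dirichlet_nonneg[of u] mass_nonneg[of u] by (metis less_eq_real_def mult_nonneg_nonneg)
    have "D 2 u / (dirichlet u * mass u) \<le> b"
      unfolding b by (intro cInf_greatest ne) (use u pos in \<open>auto simp: divide_le_eq mult.assoc\<close>)
    then show ?thesis using pos by (simp add: divide_le_eq mult.assoc)
  qed
  show "\<exists>u\<in>(H1 :: (real^'n \<Rightarrow> real) set). D 2 u > C * dirichlet u * mass u" if "C < b"
  proof (rule ccontr)
    assume "\<not> ?thesis"
    then have "C \<in> ?S" by (auto simp: not_less)
    then have "b \<le> C" unfolding b by (rule cInf_lower[OF _ bdd])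
    with that show False by simp
  qed
qed

lemma c1_tilde_pos: "CARD('n::finite) \<ge> 3 \<Longrightarrow> c1_tilde TYPE('n) > 0"
  using best_const_props(1)[where ?'n='n] by (simp add: c1_tilde_def)

lemma D2_le_c1_tilde:
  fixes u :: "real^'n::finite \<Rightarrow> real"
  assumes "u \<in> H1" "CARD('n) \<ge> 3"
  shows "D 2 u \<le> 2 * dirichlet u * (mass u / c1_tilde TYPE('n))"
  using best_const_props(2)[OF assms(2,1)] by (simp add: c1_tilde_def mult_ac)

text \<open>Minus the part of the energy that scales like t^2 under mass-preserving dilations: the
  energy is \<open>D \<theta> u / 4 - Kf u\<close>.\<close>

definition Kf :: "(real^'n::finite \<Rightarrow> real) \<Rightarrow> real" where
  "Kf u = D 2 u / 4 - dirichlet u / 2"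

lemma Kf_le:
  fixes u :: "real^'n::finite \<Rightarrow> real"
  assumes "u \<in> H1" "CARD('n) \<ge> 3"
  shows "Kf u \<le> dirichlet u / 2 * (mass u / c1_tilde TYPE('n) - 1)"
  using D2_le_c1_tilde[OF assms] by (simp add: Kf_def right_diff_distrib)

lemma Kf_pos_mass:
  fixes u :: "real^'n::finite \<Rightarrow> real"
  assumes "u \<in> H1" "CARD('n) \<ge> 3" "Kf u > 0"
  shows "mass u > c1_tilde TYPE('n)" "dirichlet u > 0"
proof -
  have "0 < dirichlet u / 2 * (mass u / c1_tilde TYPE('n) - 1)" using Kf_le[OF assms(1,2)] assms(3) by linarith
  then have "dirichlet u > 0" "mass u / c1_tilde TYPE('n) - 1 > 0"
    using dirichlet_nonneg[of u] by (auto simp: zero_less_mult_iff)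
  then show "mass u > c1_tilde TYPE('n)" "dirichlet u > 0" using c1_tilde_pos[OF assms(2)] by (auto simp: field_simps)
qed

lemma Kf_pos_exists:
  assumes N: "CARD('n::finite) \<ge> 3" and c: "c > c1_tilde TYPE('n)"
  obtains u :: "real^'n \<Rightarrow> real" where "u \<in> H1" "mass u = c" "Kf u > 0"
proof -
  have cp: "c > 0" using c c1_tilde_pos[OF N] by linarith
  \<comment> \<open>This is c > \<open>c1_tilde\<close> rewritten, so 2/c is not an admissible
    constant. A function violating it has \<open>Kf > 0\<close> once its amplitude is adjusted to
    mass c.\<close>
  have "2 / c < best_const TYPE('n) 2"
    using c cp best_const_props(1)[OF N] by (simp add: c1_tilde_def field_simps)
  from best_const_props(3)[OF N this] obtain u :: "real^'n \<Rightarrow> real"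
    where u: "u \<in> H1" "D 2 u > 2 / c * dirichlet u * mass u" by blast
  have "2 / c * dirichlet u * mass u \<ge> 0" using cp by (simp add: dirichlet_nonneg mass_nonneg)
  then have "D 2 u > 0" using u(2) by linarith
  then have m: "mass u > 0" using D2_le[OF u(1) N] mass_nonneg[of u] by (cases "mass u = 0") auto
  define s where "s = sqrt (c / mass u)"
  have s2: "s\<^sup>2 = c / mass u" using cp m by (simp add: s_def)
  have s4: "s ^ 4 = c / mass u * (c / mass u)" using s2 by (metis (no_types) power2_eq_square power4_eq_xxxx mult.assoc)
  show ?thesis
  proof (rule that[of "\<lambda>x. s * u x"])
    show "(\<lambda>x. s * u x) \<in> H1" by (rule H1_scale[OF u(1)])
    show "mass (\<lambda>x. s * u x) = c" using m by (simp add: mass_scale s2)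
    define q where "q = c / mass u"
    have q: "q > 0" using cp m by (simp add: q_def)
    have "2 / c * dirichlet u * mass u = 2 / q * dirichlet u" by (simp add: q_def)
    then have "(q * q) * (2 / q * dirichlet u) < (q * q) * D 2 u" using u(2) q by (intro mult_strict_left_mono) auto
    moreover have "(q * q) * (2 / q * dirichlet u) = 2 * (q * dirichlet u)" using q by simp
    ultimately have "2 * (q * dirichlet u) < (q * q) * D 2 u" by simp
    then show "Kf (\<lambda>x. s * u x) > 0"
      by (simp add: Kf_def D_scale dirichlet_scale[OF u(1)] s2 s4 flip: q_def)
  qed
qed

section \<open>Dilation invariance of \<open>Ff\<close> and its decrease under a gain of
  amplitude\<close>

definition resc :: "real \<Rightarrow> (real^'n::finite \<Rightarrow> real) \<Rightarrow> real^'n \<Rightarrow> real" where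
  "resc t u x = sqrt (t ^ CARD('n)) * u (t *\<^sub>R x)"

lemma resc_props:
  fixes u :: "real^'n::finite \<Rightarrow> real"
  assumes u: "u \<in> H1" and t: "t > 0"
  shows "resc t u \<in> H1" "mass (resc t u) = mass u" "dirichlet (resc t u) = t\<^sup>2 * dirichlet u"
    "D \<gamma> (resc t u) = t powr \<gamma> * D \<gamma> u" "Kf (resc t u) = t\<^sup>2 * Kf u"
proof -
  have r: "resc t u = (\<lambda>x. sqrt (t ^ CARD('n)) * u (t *\<^sub>R x))" by (auto simp: resc_def)
  have q: "(sqrt (t ^ CARD('n))) ^ 4 = (t ^ CARD('n))\<^sup>2"
    using t by (simp add: power4_eq_xxxx power2_eq_square)
  show "resc t u \<in> H1" unfolding r by (intro H1_scale H1_dilate t u)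
  show "mass (resc t u) = mass u" using t by (simp add: r mass_scale H1_dilate(2)[OF t u])
  show A: "dirichlet (resc t u) = t\<^sup>2 * dirichlet u"
    using t by (simp add: r dirichlet_scale[OF H1_dilate(1)[OF t u]] H1_dilate(3)[OF t u])
  show B: "D \<gamma> (resc t u) = t powr \<gamma> * D \<gamma> u" for \<gamma>
    using t by (simp add: r D_scale D_dilate q)
  show "Kf (resc t u) = t\<^sup>2 * Kf u"
    using B[of 2] t by (simp add: Kf_def A right_diff_distrib)
qed

definition Ff :: "real \<Rightarrow> (real^'n::finite \<Rightarrow> real) \<Rightarrow> real" where
  "Ff \<theta> u = (D \<theta> u)\<^sup>2 / Kf u powr \<theta>"

lemma Ff_nonneg: "Ff \<theta> u \<ge> 0" by (simp add: Ff_def)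

lemma Ff_resc:
  fixes u :: "real^'n::finite \<Rightarrow> real"
  assumes u: "u \<in> H1" and t: "t > 0" and K: "Kf u > 0"
  shows "Ff \<theta> (resc t u) = Ff \<theta> u"
proof -
  have "(t\<^sup>2 * Kf u) powr \<theta> = (t powr \<theta>)\<^sup>2 * Kf u powr \<theta>"
    using t K by (simp add: powr_mult powr_power powr_powr flip: powr_numeral) (simp add: mult.commute)?
  then show ?thesis
    using t by (simp add: Ff_def resc_props[OF u t] power_mult_distrib)
qed

text \<open>On [1, 1+\<epsilon>] the convex function x^p lies below its chord, whose slope is at
  most 1/\<epsilon> because its value at 1+\<epsilon> is at most 2.\<close>

lemma amplitude_inequality:
  fixes \<sigma> \<epsilon> p :: real
  assumes \<sigma>: "1 < \<sigma>" "\<sigma> \<le> 1 + \<epsilon>" and \<epsilon>: "\<epsilon> > 0" and p: "p \<ge> 1" and le: "(1 + \<epsilon>) powr p \<le> 2"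
  shows "\<sigma> powr p < 1 + (\<sigma> - 1) * (1 + 1 / \<epsilon>)"
proof -
  have "convex_on {1..1 + \<epsilon>} (\<lambda>x. x powr p)"
    by (rule convex_on_subset[OF powr_convex[OF p]]) auto
  from convex_onD_Icc'[OF this, of \<sigma>] \<sigma>
  have "\<sigma> powr p \<le> ((1 + \<epsilon>) powr p - 1) / \<epsilon> * (\<sigma> - 1) + 1" by simp
  also have "\<dots> \<le> 1 / \<epsilon> * (\<sigma> - 1) + 1"
    using \<sigma> \<epsilon> le by (intro add_right_mono mult_right_mono divide_right_mono) auto
  also have "\<dots> < 1 + (\<sigma> - 1) * (1 + 1 / \<epsilon>)" using \<sigma> by (simp add: algebra_simps)
  finally show ?thesis .
qed

text \<open>This is where the smallness of \<open>c - c1_tilde\<close> enters: \<open>Kf v\<close> is then small relative to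
  \<open>dirichlet v\<close>, so raising the amplitude increases \<open>Kf\<close> faster than it increases \<open>D \<theta>\<close>.\<close>

lemma Ff_amplitude:
  fixes v :: "real^'n::finite \<Rightarrow> real"
  assumes v: "v \<in> H1" and N: "CARD('n) \<ge> 3" and K: "Kf v > 0" and \<theta>: "0 < \<theta>" "\<theta> < 2"
    and mc: "mass v \<le> c" and c: "(c / c1_tilde TYPE('n)) powr ((4 - \<theta>) / \<theta>) \<le> 2"
  defines "w \<equiv> \<lambda>x. sqrt (c / mass v) * v x"
  shows "w \<in> H1" "mass w = c" "Kf w > 0" "Ff \<theta> w \<le> Ff \<theta> v" "mass v < c \<Longrightarrow> Ff \<theta> w < Ff \<theta> v"
proof -
  let ?c1 = "c1_tilde TYPE('n)"
  have c1: "?c1 > 0" by (rule c1_tilde_pos[OF N])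
  have m: "mass v > ?c1" and A: "dirichlet v > 0" using Kf_pos_mass[OF v N K] by auto
  then have mp: "mass v > 0" and cp: "c > 0" using c1 mc by auto
  define \<sigma> where "\<sigma> = c / mass v"
  have \<sigma>1: "\<sigma> \<ge> 1" using mp mc by (simp add: \<sigma>_def)
  have w: "w = (\<lambda>x. sqrt \<sigma> * v x)" by (simp add: w_def \<sigma>_def)
  have s2: "(sqrt \<sigma>)\<^sup>2 = \<sigma>" and s4: "(sqrt \<sigma>) ^ 4 = \<sigma>\<^sup>2"
    using \<sigma>1 by (simp_all add: power4_eq_xxxx power2_eq_square)
  show "w \<in> H1" unfolding w by (rule H1_scale[OF v])
  show "mass w = c" unfolding w mass_scale s2 using mp by (simp add: \<sigma>_def)
  have Kw: "Kf w = \<sigma> * (\<sigma> * Kf v + (\<sigma> - 1) * (dirichlet v / 2))"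
    unfolding w Kf_def D_scale dirichlet_scale[OF v] s2 s4 by (simp add: algebra_simps power2_eq_square diff_divide_distrib)
  show Kwp: "Kf w > 0" unfolding Kw using \<sigma>1 K A by (intro mult_pos_pos add_pos_nonneg) auto
  have Bw: "D \<theta> w = \<sigma>\<^sup>2 * D \<theta> v" unfolding w D_scale s4 ..
  have Bp: "D \<theta> v > 0" by (rule D_pos[OF v mp N]) (use \<theta> in auto)
  have strict: "Ff \<theta> w < Ff \<theta> v" if "\<sigma> > 1"
  proof -
    define \<epsilon> where "\<epsilon> = c / ?c1 - 1"
    have "mass v < c" using that mp by (simp add: \<sigma>_def)
    then have \<epsilon>: "\<epsilon> > 0" using m c1 by (simp add: \<epsilon>_def)
    have "\<sigma> \<le> 1 + \<epsilon>" unfolding \<sigma>_def \<epsilon>_def using m c1 cp by (simp add: frac_le)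
    \<comment> \<open>Chosen so that 1 + p = 4/\<theta>. The square of \<open>D \<theta>\<close>
      grows by \<sigma>^4, so \<open>Ff\<close> decreases once \<open>Kf\<close> grows by more than
      \<sigma>^(4/\<theta>).\<close>
    define p where "p = (4 - \<theta>) / \<theta>"
    have p: "p \<ge> 1" using \<theta> by (simp add: p_def)
    have \<kappa>: "\<sigma> powr p < 1 + (\<sigma> - 1) * (1 + 1 / \<epsilon>)"
      by (rule amplitude_inequality[OF that \<open>\<sigma> \<le> 1 + \<epsilon>\<close> \<epsilon> p]) (use c in \<open>simp add: \<epsilon>_def p_def\<close>)
    \<comment> \<open>The decisive smallness: \<open>Kf v\<close> is at most \<epsilon> times half
      the Dirichlet integral, which supplies the additional growth (\<sigma> - 1)/\<epsilon> in the
      formula for \<open>Kf w\<close>.\<close>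
    have "Kf v \<le> dirichlet v / 2 * (mass v / ?c1 - 1)" by (rule Kf_le[OF v N])
    also have "\<dots> \<le> dirichlet v / 2 * \<epsilon>"
      using A mc c1 by (intro mult_left_mono) (auto simp: \<epsilon>_def divide_right_mono)
    finally have "Kf v / \<epsilon> \<le> dirichlet v / 2" using \<epsilon> by (simp add: field_simps)
    then have "Kf v * (1 + (\<sigma> - 1) * (1 + 1 / \<epsilon>)) \<le> \<sigma> * Kf v + (\<sigma> - 1) * (dirichlet v / 2)"
      using mult_left_mono[of "Kf v / \<epsilon>" "dirichlet v / 2" "\<sigma> - 1"] \<sigma>1 by (simp add: algebra_simps)
    moreover have "Kf v * \<sigma> powr p < Kf v * (1 + (\<sigma> - 1) * (1 + 1 / \<epsilon>))"
      using \<kappa> K by (rule mult_strict_left_mono)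
    ultimately have "\<sigma> * (Kf v * \<sigma> powr p) < Kf w"
      unfolding Kw using that by (intro mult_strict_left_mono) auto
    then have "(\<sigma> * (Kf v * \<sigma> powr p)) powr \<theta> < Kf w powr \<theta>"
      using \<sigma>1 K \<theta> by (intro powr_less_mono2) auto
    moreover have "(\<sigma> * (Kf v * \<sigma> powr p)) powr \<theta> = Kf v powr \<theta> * (\<sigma>\<^sup>2)\<^sup>2"
    proof -
      have "\<sigma> * (Kf v * \<sigma> powr p) = Kf v * \<sigma> powr (4 / \<theta>)"
      proof -
        have "\<sigma> * \<sigma> powr p = \<sigma> powr (1 + p)" using \<sigma>1 by (simp add: powr_add)
        also have "1 + p = 4 / \<theta>" using \<theta> by (simp add: p_def field_simps)
        finally show ?thesis by (simp add: mult.left_commute)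
      qed
      then have "(\<sigma> * (Kf v * \<sigma> powr p)) powr \<theta> = (Kf v * \<sigma> powr (4 / \<theta>)) powr \<theta>" by (simp only:)
      also have "\<dots> = Kf v powr \<theta> * \<sigma> powr 4"
        using K \<theta> by (simp add: powr_mult powr_powr)
      also have "\<sigma> powr 4 = (\<sigma>\<^sup>2)\<^sup>2" using \<sigma>1 by simp
      finally show ?thesis .
    qed
    ultimately have "Kf v powr \<theta> * (\<sigma>\<^sup>2)\<^sup>2 < Kf w powr \<theta>" by simp
    then have "(\<sigma>\<^sup>2)\<^sup>2 / Kf w powr \<theta> < 1 / Kf v powr \<theta>"
      using K Kwp by (simp add: field_simps)
    from mult_strict_left_mono[OF this, of "(D \<theta> v)\<^sup>2"]
    show ?thesis using Bp unfolding Ff_def Bw by (simp add: power_mult_distrib mult.commute)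
  qed
  show "mass v < c \<Longrightarrow> Ff \<theta> w < Ff \<theta> v" using strict mp by (simp add: \<sigma>_def)
  show "Ff \<theta> w \<le> Ff \<theta> v"
  proof (cases "\<sigma> = 1")
    case True
    then show ?thesis by (simp add: w)
  qed (use strict \<sigma>1 in auto)
qed

section \<open>Minimising sequences and the exclusion of loss of mass\<close>

lemma dip_tendsto_0:
  fixes v :: "real^'n::finite \<Rightarrow> real"
  assumes v: "v \<in> H1" and w: "\<And>n. w n \<in> H1" and bd: "\<And>n. mass (w n) \<le> m" "\<And>n. dirichlet (w n) \<le> a"
    and loc: "\<And>R. (\<lambda>n. loc R (w n) 0) \<longlonglongrightarrow> 0"
  shows "(\<lambda>n. dip v (w n)) \<longlonglongrightarrow> 0"
proof -
  have nmw: "nm (w n) \<le> sqrt m" for n using bd(1)[of n] by (simp add: mass_nm real_le_rsqrt)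
  have nmp: "nm (pd (w n) i) \<le> sqrt a" for n i
  proof -
    have "(nm (pd (w n) i))\<^sup>2 \<le> (\<Sum>i\<in>UNIV. (nm (pd (w n) i))\<^sup>2)" by (rule member_le_sum) auto
    also have "\<dots> \<le> a" using bd(2)[of n] by (simp add: dirichlet_eq w)
    finally show ?thesis by (rule real_le_rsqrt)
  qed
  have z: "ip (\<lambda>x. 0) f = 0" for f :: "real^'n \<Rightarrow> real" by (simp add: ip_def)
  have "(\<lambda>n. ip (pd (w n) i) (pd v i)) \<longlonglongrightarrow> ip (\<lambda>x. 0) (pd v i)" for i
  proof (rule weak_conv_L2[OF pd_L2[OF w] nmp L2_zero _ pd_L2[OF v]])
    fix \<phi> :: "real^'n \<Rightarrow> real" assume p: "\<phi> \<in> test_functions"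
    \<comment> \<open>The derivative moves to the test function, where only the local decay of w is
      needed; bounded gradients then converge weakly to 0 in \<open>L2\<close>.\<close>
    have "(\<lambda>n. - ip (partial_deriv i \<phi>) (w n)) \<longlonglongrightarrow> - 0"
      by (intro tendsto_minus ip_tendsto_0[OF test_L2[OF test_partial[OF p]] H1_L2[OF w] nmw loc])
    moreover have "ip (pd (w n) i) \<phi> = - ip (partial_deriv i \<phi>) (w n)" for n
      using wdD[OF pd_wd[OF w] p, of n i] by (simp add: ip_def mult.commute)
    ultimately show "(\<lambda>n. ip (pd (w n) i) \<phi>) \<longlonglongrightarrow> ip (\<lambda>x. 0) \<phi>" by (simp add: z)
  qed
  then have "(\<lambda>n. \<Sum>i\<in>UNIV. ip (pd v i) (pd (w n) i)) \<longlonglongrightarrow> (\<Sum>i\<in>(UNIV :: 'n set). 0)"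
    by (intro tendsto_sum) (simp add: z ip_commute[of "pd v _"])
  then show ?thesis by (simp add: dip_eq v w)
qed

lemma concentration:
  fixes u :: "real^'n::finite \<Rightarrow> real"
  assumes N: "CARD('n) \<ge> 3" and c: "c > 0"
  obtains R \<eta> where "R > 0" "\<eta> > 0"
    "\<And>u :: real^'n \<Rightarrow> real. u \<in> H1 \<Longrightarrow> mass u = c \<Longrightarrow> dirichlet u = 1 \<Longrightarrow> D 2 u > 2 \<Longrightarrow> \<exists>x. loc R u x \<ge> \<eta>"
proof -
  \<comment> \<open>The constants make the near, middle and far parts of \<open>I2_split\<close> at
    most 1/2, 1 and 1/2, in sum 2, against the hypothesis \<open>D 2 u > 2\<close>.\<close>
  define C where "C = 4 * (c + 4) * sqrt c"
  have C: "C > 0" using c by (simp add: C_def)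
  define e where "e = 1 / (2 * C)"
  have e: "e > 0" using C by (simp add: e_def)
  define R where "R = sqrt (2 * c\<^sup>2)"
  have R: "R > 0" "inverse (R\<^sup>2) * c * c = 1 / 2" using c by (simp_all add: R_def power2_eq_square field_simps)
  define \<eta> where "\<eta> = e ^ 4 / c"
  have \<eta>: "\<eta> > 0" using e c by (simp add: \<eta>_def)
  show ?thesis
  proof (rule that[OF R(1) \<eta>], rule ccontr)
    fix u :: "real^'n \<Rightarrow> real"
    assume u: "u \<in> H1" "mass u = c" "dirichlet u = 1" "D 2 u > 2" and "\<nexists>x. loc R u x \<ge> \<eta>"
    then have l: "loc R u x \<le> \<eta>" for x by (metis linear)
    note L = H1_L2[OF u(1)]
    have "(LINT x|lborel. (u x * u x) * loc R u x) \<le> (LINT x|lborel. (u x * u x) * \<eta>)"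
    proof (rule integral_mono)
      note [measurable] = L2_measurable[OF L] loc_measurable[OF L]
      show i: "integrable lborel (\<lambda>x. (u x * u x) * \<eta>)" using u_square_wd(1)[OF u(1)] by simp
      show le: "(u x * u x) * loc R u x \<le> (u x * u x) * \<eta>" for x by (intro mult_left_mono l) auto
      show "integrable lborel (\<lambda>x. (u x * u x) * loc R u x)"
        by (rule Bochner_Integration.integrable_bound[OF i])
          (use le loc_bounds(1)[OF L] \<eta> in \<open>auto simp: abs_mult\<close>)
    qed
    also have "\<dots> = c * \<eta>" using u(2) by (simp add: mass_ip ip_def)
    also have "\<dots> = e ^ 4" using c by (simp add: \<eta>_def)
    finally have "inverse (e ^ 4) * (LINT x|lborel. (u x * u x) * loc R u x) \<le> inverse (e ^ 4) * e ^ 4"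
      using e by (intro mult_left_mono) auto
    also have "inverse (e ^ 4) * e ^ 4 = 1" using e by simp
    moreover have "e * (4 * Mh u * (nm u * sqrt (dirichlet u))) = 1 / 2"
    proof -
      have "nm u = sqrt c" using u(2) by (simp add: mass_nm real_sqrt_unique)
      then have "4 * Mh u * (nm u * sqrt (dirichlet u)) = C" by (simp add: Mh_def u C_def)
      then show ?thesis using C by (simp add: e_def)
    qed
    moreover have "D 2 u \<le> e * (4 * Mh u * (nm u * sqrt (dirichlet u)))
      + (inverse (e ^ 4) * (LINT x|lborel. (u x * u x) * loc R u x) + inverse (R\<^sup>2) * mass u * mass u)"
      unfolding D_I by (rule I2_split[OF u(1) u(1) N e R(1)])
    ultimately show False using R(2) u(2,4) by simp
  qed
qed

lemma convergent_subsequence_real2: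
  fixes a b :: "nat \<Rightarrow> real"
  assumes "\<And>n. \<bar>a n\<bar> \<le> M" "\<And>n. \<bar>b n\<bar> \<le> M'"
  obtains r l l' where "strict_mono (r :: nat \<Rightarrow> nat)" "(\<lambda>n. a (r n)) \<longlonglongrightarrow> l" "(\<lambda>n. b (r n)) \<longlonglongrightarrow> l'"
proof -
  have "compact (cbox (-M, -M') (M, M'))" by simp
  then have sc: "seq_compact (cbox (-M, -M') (M, M'))" by (simp add: compact_eq_seq_compact_metric)
  have mem: "\<forall>n. (a n, b n) \<in> cbox (-M, -M') (M, M')"
    using assms by (auto simp: cbox_Pair_eq abs_le_iff minus_le_iff)
  obtain l and r :: "nat \<Rightarrow> nat" where r: "strict_mono r" "((\<lambda>n. (a n, b n)) \<circ> r) \<longlonglongrightarrow> l"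
    by (rule seq_compactE[OF sc mem])
  show ?thesis
    by (rule that[OF r(1), of "fst l" "snd l"]) (use tendsto_fst[OF r(2)] tendsto_snd[OF r(2)] in \<open>auto simp: o_def\<close>)
qed

lemma minimising_sequence:
  assumes N: "CARD('n::finite) \<ge> 3" and c: "c > c1_tilde TYPE('n)" and \<theta>: "0 < \<theta>" "\<theta> < 2"
  obtains u :: "nat \<Rightarrow> real^'n \<Rightarrow> real" and f v K B where
    "\<And>n. u n \<in> H1" "\<And>n. mass (u n) = c" "\<And>n. dirichlet (u n) = 1" "\<And>n. D 2 (u n) > 2"
    "\<And>w :: real^'n \<Rightarrow> real. w \<in> H1 \<Longrightarrow> mass w = c \<Longrightarrow> Kf w > 0 \<Longrightarrow> f \<le> Ff \<theta> w"
    "v \<in> H1" "mass v > 0" "\<And>R. (\<lambda>n. loc R (\<lambda>x. u n x - v x) 0) \<longlonglongrightarrow> 0"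
    "(\<lambda>n. Kf (u n)) \<longlonglongrightarrow> K" "(\<lambda>n. D \<theta> (u n)) \<longlonglongrightarrow> B" "K > 0" "B > 0" "f = B\<^sup>2 / K powr \<theta>"
proof -
  have cp: "c > 0" using c c1_tilde_pos[OF N] by linarith
  have \<theta>': "0 \<le> \<theta>" "\<theta> \<le> 2" using \<theta> by auto
  define S where "S = {u :: real^'n \<Rightarrow> real. u \<in> H1 \<and> mass u = c \<and> Kf u > 0}"
  obtain u0 :: "real^'n \<Rightarrow> real" where "u0 \<in> S" using Kf_pos_exists[OF N c] unfolding S_def by blast
  then have ne: "Ff \<theta> ` S \<noteq> {}" by blast
  have bdd: "bdd_below (Ff \<theta> ` S)" by (rule bdd_belowI[of _ 0]) (auto simp: Ff_nonneg)
  define f where "f = Inf (Ff \<theta> ` S)"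
  have f_le: "f \<le> Ff \<theta> w" if "w \<in> S" for w unfolding f_def using that by (intro cInf_lower bdd) auto
  have "\<exists>w\<in>S. Ff \<theta> w < f + inverse (real (Suc n)) \<and> dirichlet w = 1" for n
  proof -
    have "\<exists>y\<in>Ff \<theta> ` S. y < f + inverse (real (Suc n))"
      using cInf_lessD[OF ne, of "f + inverse (real (Suc n))"] by (auto simp: f_def)
    then obtain u where u: "u \<in> S" "Ff \<theta> u < f + inverse (real (Suc n))" by blast
    then have uH: "u \<in> H1" and K: "Kf u > 0" and m: "mass u = c" by (auto simp: S_def)
    have A: "dirichlet u > 0" using Kf_pos_mass[OF uH N K] by simp
    \<comment> \<open>Since \<open>Ff\<close> is invariant, dilating to Dirichlet integral 1 costs
      nothing and turns \<open>Kf > 0\<close> into \<open>D 2 > 2\<close>.\<close>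
    define t where "t = inverse (sqrt (dirichlet u))"
    have t: "t > 0" "t\<^sup>2 * dirichlet u = 1" using A by (simp_all add: t_def power_inverse)
    show ?thesis
      using u(2) uH K m t resc_props[OF uH t(1)] Ff_resc[OF uH t(1) K]
      by (intro bexI[of _ "resc t u"]) (auto simp: S_def)
  qed
  then obtain u1 where u1: "\<And>n. u1 n \<in> S" "\<And>n. Ff \<theta> (u1 n) < f + inverse (real (Suc n))" "\<And>n. dirichlet (u1 n) = 1"
    by metis
  obtain R \<eta> where R: "R > 0" and \<eta>: "\<eta> > 0"
    and conc: "\<And>u :: real^'n \<Rightarrow> real. u \<in> H1 \<Longrightarrow> mass u = c \<Longrightarrow> dirichlet u = 1 \<Longrightarrow> D 2 u > 2 \<Longrightarrow> \<exists>x. loc R u x \<ge> \<eta>"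
    using concentration[OF N cp] by blast
  have u1D: "D 2 (u1 n) > 2" for n using u1(1,3)[of n] by (simp add: S_def Kf_def)
  have "\<exists>x. loc R (u1 n) x \<ge> \<eta>" for n
    using u1(1,3)[of n] u1D[of n] by (intro conc) (auto simp: S_def)
  then obtain x where x: "\<And>n. loc R (u1 n) (x n) \<ge> \<eta>" by metis
  define u2 where "u2 n = (\<lambda>y. u1 n (y + x n))" for n
  have u2: "u2 n \<in> H1" "mass (u2 n) = c" "dirichlet (u2 n) = 1" "D \<gamma> (u2 n) = D \<gamma> (u1 n)" "Kf (u2 n) = Kf (u1 n)" for n \<gamma>
    using u1(1,3)[of n] by (auto simp: u2_def S_def H1_translate mass_translate dirichlet_translate D_translate Kf_def)
  have u2K: "Kf (u2 n) > 0" for n using u1(1)[of n] by (simp add: u2 S_def)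
  have u2F: "Ff \<theta> (u2 n) < f + inverse (real (Suc n))" for n using u1(2)[of n] by (simp add: Ff_def u2)
  have u2loc: "loc R (u2 n) 0 \<ge> \<eta>" for n
  proof -
    have "loc R (u2 n) 0 = loc R (u1 n) (x n)"
      using integral_translate[of "\<lambda>y. if norm (x n - y) \<le> R then u1 n y * u1 n y else 0" "x n"]
      by (simp add: loc_def u2_def)
    with x show ?thesis by simp
  qed
  obtain r v where r: "strict_mono r" "v \<in> H1" "\<And>R. (\<lambda>n. loc R (\<lambda>x. u2 (r n) x - v x) 0) \<longlonglongrightarrow> 0"
    using H1_compactness[of u2 c 1] u2 by auto
  have Mh: "Mh (u2 n) = c + 4" for n by (simp add: Mh_def u2)
  have nmu: "nm (u2 n) = sqrt c" for n using u2(2)[of n] by (simp add: mass_nm real_sqrt_unique)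
  have Kbd: "\<bar>Kf (u2 (r n))\<bar> \<le> c" for n
  proof -
    have "D 2 (u2 (r n)) \<le> 4 * c" using D2_le[OF u2(1) N, of "r n"] by (simp add: u2)
    then show ?thesis using u2K[of "r n"] by (simp add: Kf_def u2)
  qed
  have Bbd: "\<bar>D \<theta> (u2 (r n))\<bar> \<le> c * (c + 4)" for n
  proof -
    let ?u = "u2 (r n)"
    let ?U = "\<lambda>x. ?u x * ?u x"
    have P: "PB \<theta> ?U" by (rule PB_square[OF u2(1) N \<theta>'])
    have "D \<theta> ?u \<le> (LINT x|lborel. ?U x * (c + 4))"
      unfolding D_I I_def
    proof (rule integral_mono[OF I_integrable[OF PB_integrable[OF P] P]])
      show "integrable lborel (\<lambda>x. ?U x * (c + 4))" using u_square_wd(1)[OF u2(1)] by simp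
      show "?U x * pot \<theta> ?U x \<le> ?U x * (c + 4)" for x
        using pot_square_bounds[OF u2(1) N \<theta>', of "r n" x] by (intro mult_left_mono) (auto simp: u2)
    qed
    also have "\<dots> = c * (c + 4)" using u2(2)[of "r n"] by (simp add: mass_ip ip_def)
    finally show ?thesis using D_nonneg[OF u2(1) N \<theta>', of "r n"] by simp
  qed
  obtain r' K B where r': "strict_mono r'" "(\<lambda>n. Kf (u2 (r (r' n)))) \<longlonglongrightarrow> K" "(\<lambda>n. D \<theta> (u2 (r (r' n)))) \<longlonglongrightarrow> B"
    using convergent_subsequence_real2[of "\<lambda>n. Kf (u2 (r n))" c "\<lambda>n. D \<theta> (u2 (r n))" "c * (c + 4)", OF Kbd Bbd] by blast
  define s where "s n = r (r' n)" for n
  have s: "strict_mono s" using strict_mono_o[OF r(1) r'(1)] by (simp add: s_def[abs_def] o_def)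
  define u where "u n = u2 (s n)" for n
  have loc: "(\<lambda>n. loc \<rho> (\<lambda>x. u n x - v x) 0) \<longlonglongrightarrow> 0" for \<rho>
    using LIMSEQ_subseq_LIMSEQ[OF r(3)[of \<rho>] r'(1)] by (simp add: u_def s_def o_def)
  have KB: "(\<lambda>n. Kf (u n)) \<longlonglongrightarrow> K" "(\<lambda>n. D \<theta> (u n)) \<longlonglongrightarrow> B" using r'(2,3) by (simp_all add: u_def s_def)
  text \<open>\<open>D \<theta>\<close> cannot become small, since \<open>D 2 > 2\<close> is interpolated between \<open>D \<theta>\<close> and a bounded quantity.\<close>
  define b0 where "b0 = ((1 / (4 * (c + 4) * sqrt c)) powr (2 * (2 - \<theta>)))"
  have b0: "b0 > 0" using cp by (simp add: b0_def)
  have Bn: "D \<theta> (u n) \<ge> b0" for n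
  proof -
    \<comment> \<open>This e makes the first term of \<open>D2_interpolate\<close> equal to 1, so
      that the second must supply the rest of \<open>D 2 > 2\<close>.\<close>
    define e where "e = 1 / (4 * (c + 4) * sqrt c)"
    have e: "e > 0" using cp by (simp add: e_def)
    have "D 2 (u n) \<le> e * (4 * Mh (u n) * (nm (u n) * sqrt (dirichlet (u n)))) + e powr (2 * (\<theta> - 2)) * D \<theta> (u n)"
      unfolding u_def by (rule D2_interpolate[OF u2(1) N e \<theta>'])
    also have "e * (4 * Mh (u n) * (nm (u n) * sqrt (dirichlet (u n)))) = 1"
      using cp by (simp add: u_def Mh nmu u2 e_def)
    finally have "e powr (2 * (\<theta> - 2)) * D \<theta> (u n) \<ge> 1" using u1D[of "s n"] by (simp add: u_def u2)
    then have "e powr (2 * (2 - \<theta>)) * (e powr (2 * (\<theta> - 2)) * D \<theta> (u n)) \<ge> e powr (2 * (2 - \<theta>)) * 1"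
      by (intro mult_left_mono) auto
    moreover have "e powr (2 * (2 - \<theta>)) * e powr (2 * (\<theta> - 2)) = 1" using e by (simp add: powr_add[symmetric])
    ultimately show ?thesis unfolding b0_def e_def[symmetric] by (metis mult.assoc mult_1 mult.right_neutral)
  qed
  have Bpos: "B > 0"
  proof -
    have "b0 \<le> B" by (rule LIMSEQ_le_const[OF KB(2)]) (use Bn in auto)
    with b0 show ?thesis by linarith
  qed
  have f0: "f \<ge> 0" unfolding f_def by (rule cInf_greatest[OF ne]) (auto simp: Ff_nonneg)
  have Fn: "Ff \<theta> (u n) < f + inverse (real (Suc n))" "f \<le> Ff \<theta> (u n)" for n
  proof -
    have "inverse (real (Suc (s n))) \<le> inverse (real (Suc n))" using seq_suble[OF s, of n] by simp
    then show "Ff \<theta> (u n) < f + inverse (real (Suc n))" using u2F[of "s n"] unfolding u_def by linarith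
    show "f \<le> Ff \<theta> (u n)" by (rule f_le) (use u2 u2K in \<open>auto simp: S_def u_def\<close>)
  qed
  have Kn: "Kf (u n) > 0" for n by (simp add: u_def u2K)
  \<comment> \<open>With \<open>Ff\<close> at most f + 1 and \<open>D \<theta>\<close> at least b0,
    the definition of \<open>Ff\<close> bounds \<open>Kf\<close> from below, so the limit K is
    positive and the limit of the quotients is a genuine quotient.\<close>
  define k0 where "k0 = (b0\<^sup>2 / (f + 1)) powr (1 / \<theta>)"
  have k0: "k0 > 0" using b0 f0 by (simp add: k0_def)
  have "Kf (u n) \<ge> k0" for n
  proof -
    have "inverse (real (Suc n)) \<le> 1" by (simp add: field_simps)
    then have "Ff \<theta> (u n) \<le> f + 1" using Fn(1)[of n] by linarith
    then have "(D \<theta> (u n))\<^sup>2 \<le> (f + 1) * Kf (u n) powr \<theta>"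
      using Kn[of n] by (simp add: Ff_def divide_le_eq)
    moreover have "b0\<^sup>2 \<le> (D \<theta> (u n))\<^sup>2" using Bn[of n] b0 by (intro power_mono) auto
    ultimately have "b0\<^sup>2 / (f + 1) \<le> Kf (u n) powr \<theta>" using f0 by (simp add: divide_le_eq mult.commute)
    then have "(b0\<^sup>2 / (f + 1)) powr (1 / \<theta>) \<le> (Kf (u n) powr \<theta>) powr (1 / \<theta>)"
      using \<theta> f0 by (intro powr_mono2) auto
    then show ?thesis using \<theta> Kn[of n] by (simp add: k0_def powr_powr)
  qed
  then have "k0 \<le> K" by (intro LIMSEQ_le_const[OF KB(1)]) auto
  with k0 have Kpos: "K > 0" by linarith
  have feq: "f = B\<^sup>2 / K powr \<theta>"
  proof -
    have "(\<lambda>n. Ff \<theta> (u n)) \<longlonglongrightarrow> B\<^sup>2 / K powr \<theta>"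
      unfolding Ff_def by (intro tendsto_intros KB) (use Kpos in auto)
    moreover have "(\<lambda>n. Ff \<theta> (u n)) \<longlonglongrightarrow> f"
    proof (rule tendsto_sandwich[OF _ _ tendsto_const])
      show "(\<lambda>n. f + inverse (real (Suc n))) \<longlonglongrightarrow> f"
        using tendsto_add[OF tendsto_const LIMSEQ_inverse_real_of_nat, of f] by simp
    qed (use Fn in \<open>auto intro!: always_eventually less_imp_le simp del: of_nat_Suc\<close>)
    ultimately show ?thesis by (rule LIMSEQ_unique[symmetric])
  qed
  \<comment> \<open>The translates were centred so that a ball of radius R carries mass at least
    \<eta>, and convergence on that ball keeps it in the limit.\<close>
  have vpos: "mass v > 0"
  proof (rule ccontr)
    assume "\<not> ?thesis"
    then have v0: "nm v = 0" using mass_nonneg[of v] by (simp add: mass_nm)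
    have "(\<lambda>n. sqrt (loc R (\<lambda>x. u n x - v x) 0)) \<longlonglongrightarrow> sqrt 0" by (intro tendsto_intros loc)
    moreover have "sqrt \<eta> \<le> sqrt (loc R (\<lambda>x. u n x - v x) 0)" for n
    proof -
      have uL: "u n \<in> L2" and vL: "v \<in> L2" using H1_L2[OF u2(1)] H1_L2[OF r(2)] by (auto simp: u_def)
      let ?\<chi> = "indicator (cball (0::real^'n) R) :: _ \<Rightarrow> real"
      have "sqrt \<eta> \<le> sqrt (loc R (u n) 0)" using u2loc[of "s n"] by (simp add: u_def)
      also have "\<dots> = nm (\<lambda>x. ?\<chi> x * (u n x - v x) + ?\<chi> x * v x)"
        by (simp add: loc_nm right_diff_distrib)
      also have "\<dots> \<le> nm (\<lambda>x. ?\<chi> x * (u n x - v x)) + nm (\<lambda>x. ?\<chi> x * v x)"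
        by (intro nm_triangle L2_cut L2_diff uL vL)
      also have "nm (\<lambda>x. ?\<chi> x * v x) \<le> 0" using nm_cut_le[OF vL, of R] v0 by simp
      finally show ?thesis by (simp add: loc_nm)
    qed
    ultimately have "sqrt \<eta> \<le> sqrt 0" by (intro LIMSEQ_le_const) auto
    with \<eta> show False by simp
  qed
  show ?thesis
    by (rule that[of u f v K B, OF _ _ _ _ _ r(2) vpos loc KB Kpos Bpos feq])
      (use u2 u1D f_le in \<open>auto simp: u_def S_def\<close>)
qed

text \<open>The mass, \<open>D\<close> and \<open>Kf\<close> all split between the weak limit v and
  the remainders w n. The sign of \<open>Kf v\<close> decides which of the two pieces could do at
  least as well as the infimum.\<close>

lemma minimiser_exists:
  assumes N: "CARD('n::finite) \<ge> 3" and c: "c > c1_tilde TYPE('n)" and \<theta>: "0 < \<theta>" "\<theta> < 2"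
    and small: "(c / c1_tilde TYPE('n)) powr ((4 - \<theta>) / \<theta>) \<le> 2"
  obtains u :: "real^'n \<Rightarrow> real" where "u \<in> H1" "mass u = c" "Kf u > 0"
    "\<And>w :: real^'n \<Rightarrow> real. w \<in> H1 \<Longrightarrow> mass w = c \<Longrightarrow> Kf w > 0 \<Longrightarrow> Ff \<theta> u \<le> Ff \<theta> w"
proof -
  let ?c1 = "c1_tilde TYPE('n)"
  have c1: "?c1 > 0" by (rule c1_tilde_pos[OF N])
  then have cp: "c > 0" using c by linarith
  have \<theta>': "0 \<le> \<theta>" "\<theta> \<le> 2" using \<theta> by auto
  \<comment> \<open>The exponent in the smallness hypothesis exceeds 1, so it already bounds c /
    \<open>c1_tilde\<close> itself by 2.\<close>
  have c2: "c < 2 * ?c1"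
  proof -
    have q: "c / ?c1 > 1" using c c1 by simp
    then have "(c / ?c1) powr 1 < (c / ?c1) powr ((4 - \<theta>) / \<theta>)" using \<theta> by (intro powr_less_mono) auto
    moreover have "(c / ?c1) powr 1 = c / ?c1" using q by (intro powr_one) linarith
    ultimately have "c / ?c1 < 2" using small by linarith
    then show ?thesis using c1 by (simp add: divide_less_eq)
  qed
  obtain u :: "nat \<Rightarrow> real^'n \<Rightarrow> real" and f v K B where
    u: "\<And>n. u n \<in> H1" "\<And>n. mass (u n) = c" "\<And>n. dirichlet (u n) = 1" "\<And>n. D 2 (u n) > 2"
    and f: "\<And>w :: real^'n \<Rightarrow> real. w \<in> H1 \<Longrightarrow> mass w = c \<Longrightarrow> Kf w > 0 \<Longrightarrow> f \<le> Ff \<theta> w"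
    and v: "v \<in> H1" "mass v > 0" and loc: "\<And>R. (\<lambda>n. loc R (\<lambda>x. u n x - v x) 0) \<longlonglongrightarrow> 0"
    and KB: "(\<lambda>n. Kf (u n)) \<longlonglongrightarrow> K" "(\<lambda>n. D \<theta> (u n)) \<longlonglongrightarrow> B" "K > 0" "B > 0" "f = B\<^sup>2 / K powr \<theta>"
    using minimising_sequence[OF N c \<theta>] by blast
  define w where "w n x = u n x - v x" for n x
  have wH: "w n \<in> H1" for n unfolding w_def by (rule H1_diff[OF u(1) v(1)])
  have uvw: "u n = (\<lambda>x. v x + 1 * w n x)" for n by (auto simp: w_def)
  have wm: "mass (w n) = c - 2 * ip v (u n) + mass v" for n
    using ip_diff_square[OF H1_L2[OF u(1)] H1_L2[OF v(1)], of n] u(2)[of n]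
    by (simp add: w_def[abs_def] mass_ip ip_commute)
  have bd: "mass (w n) \<le> 2 * c + 2 * mass v" "dirichlet (w n) \<le> 2 + 2 * dirichlet v" for n
  proof -
    have "\<bar>ip v (u n)\<bar> \<le> nm v * nm (u n)" by (rule ip_Cauchy_Schwarz[OF H1_L2[OF v(1)] H1_L2[OF u(1)]])
    moreover have "2 * nm v * nm (u n) \<le> (nm v)\<^sup>2 + (nm (u n))\<^sup>2" by (rule sum_squares_bound)
    ultimately have "- 2 * ip v (u n) \<le> mass v + c" using u(2)[of n] by (simp add: mass_nm abs_le_iff)
    then show "mass (w n) \<le> 2 * c + 2 * mass v" unfolding wm by linarith
    have "dirichlet (\<lambda>x. u n x + (-1) * v x) = dirichlet (u n) + 2 * (-1) * dip (u n) v + (-1)\<^sup>2 * dirichlet v"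
      by (rule dirichlet_add[OF u(1) v(1)])
    moreover have "dirichlet (\<lambda>x. u n x + 1 * v x) = dirichlet (u n) + 2 * 1 * dip (u n) v + 1\<^sup>2 * dirichlet v"
      by (rule dirichlet_add[OF u(1) v(1)])
    moreover have "dirichlet (\<lambda>x. u n x + 1 * v x) \<ge> 0" by (rule dirichlet_nonneg)
    moreover have "(\<lambda>x. u n x + (-1) * v x) = w n" by (auto simp: w_def)
    ultimately show "dirichlet (w n) \<le> 2 + 2 * dirichlet v" using u(3)[of n] by simp
  qed
  have loc': "(\<lambda>n. loc R (w n) 0) \<longlonglongrightarrow> 0" for R using loc[of R] by (simp add: w_def[abs_def])
  have nmw: "nm (w n) \<le> sqrt (2 * c + 2 * mass v)" for n using bd(1)[of n] by (simp add: mass_nm real_le_rsqrt)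
  have "(\<lambda>n. c - mass v - 2 * ip v (w n)) \<longlonglongrightarrow> c - mass v - 2 * 0"
    by (intro tendsto_intros ip_tendsto_0[OF H1_L2[OF v(1)] H1_L2[OF wH] nmw loc'])
  moreover have "mass (w n) = c - mass v - 2 * ip v (w n)" for n
    using mass_add[OF H1_L2[OF v(1)] H1_L2[OF wH[of n]], of 1] u(2)[of n] unfolding uvw[of n, symmetric] by simp
  ultimately have mw: "(\<lambda>n. mass (w n)) \<longlonglongrightarrow> c - mass v" by simp
  have "(\<lambda>n. 1 - dirichlet v - 2 * dip v (w n)) \<longlonglongrightarrow> 1 - dirichlet v - 2 * 0"
    by (intro tendsto_intros dip_tendsto_0[OF v(1) wH bd loc'])
  moreover have "dirichlet (w n) = 1 - dirichlet v - 2 * dip v (w n)" for n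
    using dirichlet_add[OF v(1) wH[of n], of 1] u(3)[of n] unfolding uvw[of n, symmetric] by simp
  ultimately have dw: "(\<lambda>n. dirichlet (w n)) \<longlonglongrightarrow> 1 - dirichlet v" by simp
  have Dsplit: "(\<lambda>n. D \<gamma> (u n) - D \<gamma> (w n)) \<longlonglongrightarrow> D \<gamma> v" if "0 < \<gamma>" "\<gamma> \<le> 2" for \<gamma>
    using D_splitting[OF v(1) wH N bd loc' that] unfolding uvw by simp
  have "(\<lambda>n. D \<theta> (u n) - (D \<theta> (u n) - D \<theta> (w n))) \<longlonglongrightarrow> B - D \<theta> v"
    by (intro tendsto_diff KB Dsplit \<theta> \<theta>')
  then have Bw: "(\<lambda>n. D \<theta> (w n)) \<longlonglongrightarrow> B - D \<theta> v" by simp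
  \<comment> \<open>Subtracting the split differences rewrites \<open>Kf (w n)\<close>, so that its
    limit follows from those for \<open>D 2\<close> and the Dirichlet integral.\<close>
  have "(\<lambda>n. Kf (u n) - ((D 2 (u n) - D 2 (w n)) / 4 - (1 - dirichlet (w n)) / 2)) \<longlonglongrightarrow> K - (D 2 v / 4 - (1 - (1 - dirichlet v)) / 2)"
    by (intro tendsto_intros KB Dsplit dw) auto
  moreover have "Kf (u n) - ((D 2 (u n) - D 2 (w n)) / 4 - (1 - dirichlet (w n)) / 2) = Kf (w n)" for n
    by (simp add: Kf_def u(3) field_simps)
  ultimately have Kw: "(\<lambda>n. Kf (w n)) \<longlonglongrightarrow> K - Kf v" by (simp add: Kf_def)
  have Bv0: "D \<theta> v > 0" by (rule D_pos[OF v N \<theta>'])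
  have Bw0: "B - D \<theta> v \<ge> 0" by (rule LIMSEQ_le_const[OF Bw]) (use D_nonneg[OF wH N \<theta>'] in auto)
  have vc: "mass v \<le> c"
  proof -
    have "c - mass v \<ge> 0" by (rule LIMSEQ_le_const[OF mw]) (use mass_nonneg in auto)
    then show ?thesis by simp
  qed
  show ?thesis
  proof (cases "Kf v > 0")
    \<comment> \<open>Here v uses more than \<open>c1_tilde\<close> of the mass, the remainder has
      less than that and hence \<open>Kf \<le> 0\<close>. So \<open>Kf v\<close> is at least K while
      \<open>D \<theta> v\<close> is at most B, which gives \<open>Ff \<theta> v \<le> f\<close>. A
      mass below c would contradict the strict gain of amplitude.\<close>
    case True
    have "mass v > ?c1" by (rule Kf_pos_mass(1)[OF v(1) N True])
    then have "c - mass v < ?c1" using c2 by linarith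
    then have "eventually (\<lambda>n. mass (w n) < ?c1) sequentially" by (rule order_tendstoD(2)[OF mw])
    then have "eventually (\<lambda>n. Kf (w n) \<le> 0) sequentially"
      by eventually_elim (use Kf_pos_mass(1)[OF wH N] in \<open>force simp: not_le[symmetric]\<close>)
    then have "K - Kf v \<le> 0" by (intro tendsto_upperbound[OF Kw]) auto
    then have "K powr \<theta> \<le> Kf v powr \<theta>" using KB(3) \<theta> by (intro powr_mono2) auto
    moreover have "(D \<theta> v)\<^sup>2 \<le> B\<^sup>2" using Bw0 Bv0 by (intro power_mono) auto
    ultimately have Fv: "Ff \<theta> v \<le> f"
      unfolding Ff_def KB(5) using KB(3) by (intro frac_le) auto
    have "\<not> mass v < c"
    proof
      assume "mass v < c"
      note amp = Ff_amplitude[OF v(1) N True \<theta> vc small]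
      have "f \<le> Ff \<theta> (\<lambda>x. sqrt (c / mass v) * v x)" by (rule f[OF amp(1-3)])
      with amp(5)[OF \<open>mass v < c\<close>] Fv show False by linarith
    qed
    then have "mass v = c" using vc by linarith
    then show ?thesis by (rule that[OF v(1) _ True]) (rule order_trans[OF Fv f], assumption+)
  next
    \<comment> \<open>Here the remainder keeps at least all of K but loses
      \<open>D \<theta> v > 0\<close>. Raised to mass c it would yield a value below the infimum, so
      this case is impossible.\<close>
    case False
    have lim: "K - Kf v > 0" using False KB(3) by linarith
    have "eventually (\<lambda>n. Kf (w n) > 0) sequentially" by (rule order_tendstoD(1)[OF Kw lim])
    moreover have "eventually (\<lambda>n. mass (w n) < c) sequentially" by (rule order_tendstoD(2)[OF mw]) (use v(2) in simp)
    ultimately have "eventually (\<lambda>n. f \<le> Ff \<theta> (w n)) sequentially"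
    proof eventually_elim
      case (elim n)
      note amp = Ff_amplitude[OF wH N elim(1) \<theta> less_imp_le[OF elim(2)] small]
      show ?case using f[OF amp(1-3)] amp(4) by linarith
    qed
    moreover have "(\<lambda>n. Ff \<theta> (w n)) \<longlonglongrightarrow> (B - D \<theta> v)\<^sup>2 / (K - Kf v) powr \<theta>"
      unfolding Ff_def by (intro tendsto_intros Bw Kw) (use lim in auto)
    ultimately have "f \<le> (B - D \<theta> v)\<^sup>2 / (K - Kf v) powr \<theta>"
      by (intro tendsto_lowerbound) auto
    also have "\<dots> \<le> (B - D \<theta> v)\<^sup>2 / K powr \<theta>"
      using False KB(3) \<theta> by (intro divide_left_mono powr_mono2) auto
    also have "\<dots> < B\<^sup>2 / K powr \<theta>"
      using Bw0 Bv0 KB(3) by (intro divide_strict_right_mono power_strict_mono) auto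
    finally show ?thesis using KB(5) by simp
  qed
qed

section \<open>From the minimiser of the quotient to a solution on the Pohozaev set\<close>

lemma pohozaev_Kf: "pohozaev 2 \<theta> u = \<theta> / 4 * D \<theta> u - 2 * Kf u"
  by (simp add: pohozaev_def Kf_def)

lemma energy_Kf: "energy 2 \<theta> u = D \<theta> u / 4 - Kf u"
  by (simp add: energy_def Kf_def)

lemma normalise_to_pohozaev:
  fixes u :: "real^'n::finite \<Rightarrow> real"
  assumes u: "u \<in> H1" "mass u = c" "Kf u > 0" and N: "CARD('n) \<ge> 3" and c: "c > 0" and \<theta>: "0 < \<theta>" "\<theta> < 2"
  obtains w :: "real^'n \<Rightarrow> real" where "w \<in> H1" "mass w = c" "Kf w = \<theta> / 8 * D \<theta> w" "Ff \<theta> w = Ff \<theta> u" "Kf w > 0"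
proof -
  have B: "D \<theta> u > 0" by (rule D_pos[OF u(1) _ N]) (use u(2) c \<theta> in auto)
  \<comment> \<open>The solution of t^2 K = (\<theta>/8) t^\<theta> B, unique among positive t since
    \<theta> < 2.\<close>
  define t where "t = (\<theta> * D \<theta> u / (8 * Kf u)) powr (1 / (2 - \<theta>))"
  have t: "t > 0" using B u(3) \<theta> by (simp add: t_def)
  have "t powr (2 - \<theta>) = \<theta> * D \<theta> u / (8 * Kf u)" using B u(3) \<theta> by (simp add: t_def powr_powr)
  moreover have "t\<^sup>2 = t powr (2 - \<theta>) * t powr \<theta>" using t by (simp add: powr_add[symmetric])
  ultimately have "t\<^sup>2 * Kf u = \<theta> / 8 * (t powr \<theta> * D \<theta> u)" using u(3) by simp
  then show ?thesis
    using that[of "resc t u"] resc_props[OF u(1) t] Ff_resc[OF u(1) t u(3)] u t by simp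
qed

text \<open>Substituting K = \<theta> B / 8 leaves an increasing function of B; as the energy there
  is a positive multiple of B, minimising \<open>Ff\<close> is minimising the energy.\<close>

lemma Ff_on_pohozaev:
  assumes "D \<theta> u > 0" "\<theta> > 0" "Kf u = \<theta> / 8 * D \<theta> u"
  shows "Ff \<theta> u = D \<theta> u powr (2 - \<theta>) * (\<theta> / 8) powr (- \<theta>)"
proof -
  have "(D \<theta> u)\<^sup>2 = D \<theta> u powr (2 - \<theta>) * D \<theta> u powr \<theta>" using assms(1) by (simp add: powr_add[symmetric])
  moreover have "Kf u powr \<theta> = (\<theta> / 8) powr \<theta> * D \<theta> u powr \<theta>"
    unfolding assms(3) by (intro powr_mult)
  moreover have "D \<theta> u powr \<theta> > 0" using assms(1) by simp
  ultimately show ?thesis by (simp add: Ff_def powr_minus_divide)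
qed

text \<open>Positivity of b, k and m is an open condition, so 0 is an unconstrained local minimum of
  the logarithm of the quotient. The term in m carries the mass constraint.\<close>

lemma DERIV_log_quotient_zero:
  fixes b k m :: "real \<Rightarrow> real"
  assumes d: "(b has_real_derivative b') (at 0)" "(k has_real_derivative k') (at 0)" "(m has_real_derivative m') (at 0)"
    and pos: "b 0 > 0" "k 0 > 0" "m 0 > 0"
    and min: "\<And>s. b s > 0 \<Longrightarrow> k s > 0 \<Longrightarrow> m s > 0 \<Longrightarrow>
      2 * ln (b 0) - p * ln (k 0) - q * ln (m 0) \<le> 2 * ln (b s) - p * ln (k s) - q * ln (m s)"
  shows "2 * (b' / b 0) - p * (k' / k 0) - q * (m' / m 0) = 0"
proof -
  define L where "L s = 2 * ln (b s) - p * ln (k s) - q * ln (m s)" for s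
  have D: "(L has_real_derivative 2 * (b' / b 0) - p * (k' / k 0) - q * (m' / m 0)) (at 0)"
    unfolding L_def using pos by (auto intro!: derivative_eq_intros d simp: field_simps)
  have "eventually (\<lambda>s. f s > 0) (at 0)" if "(f has_real_derivative f') (at 0)" "f 0 > 0" for f :: "real \<Rightarrow> real" and f'
    using DERIV_isCont[OF that(1)] that(2) unfolding isCont_def by (rule order_tendstoD(1))
  from this[OF d(1) pos(1)] this[OF d(2) pos(2)] this[OF d(3) pos(3)]
  have "eventually (\<lambda>s. b s > 0 \<and> k s > 0 \<and> m s > 0) (at 0)"
    by eventually_elim simp
  then obtain e where e: "e > 0" "\<And>s. s \<noteq> 0 \<Longrightarrow> \<bar>s\<bar> < e \<Longrightarrow> b s > 0 \<and> k s > 0 \<and> m s > 0"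
    by (auto simp: eventually_at dist_real_def)
  have "\<forall>y. \<bar>0 - y\<bar> < e \<longrightarrow> L 0 \<le> L y"
  proof (intro allI impI)
    fix y :: real assume "\<bar>0 - y\<bar> < e"
    then show "L 0 \<le> L y" using e(2)[of y] min[of y] by (cases "y = 0") (auto simp: L_def)
  qed
  from DERIV_local_min[OF D e(1) this] show ?thesis .
qed

lemma weak_solution_I:
  fixes u v :: "real^'n::finite \<Rightarrow> real"
  shows "(LINT x|lborel. riesz_conv \<gamma> u x * u x * v x) = I \<gamma> (\<lambda>x. u x * v x) (\<lambda>x. u x * u x)"
  by (simp add: riesz_conv_pot I_def mult_ac)

text \<open>Varying along u + s v changes the mass, which is restored by an amplitude factor. Being
  on the Pohozaev set equalises the coefficients of the two nonlocal terms, as the equation demands;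
  everything multiplying \<open>ip u v\<close> is collected in the multiplier.\<close>

lemma minimiser_weak_solution:
  fixes u :: "real^'n::finite \<Rightarrow> real"
  assumes N: "CARD('n) \<ge> 3" and c: "c > 0" and \<theta>: "0 < \<theta>" "\<theta> < 2"
    and u: "u \<in> H1" "mass u = c" "Kf u > 0" "Kf u = \<theta> / 8 * D \<theta> u"
    and min: "\<And>w :: real^'n \<Rightarrow> real. w \<in> H1 \<Longrightarrow> mass w = c \<Longrightarrow> Kf w > 0 \<Longrightarrow> Ff \<theta> u \<le> Ff \<theta> w"
  shows "weak_solution 2 \<theta> (dirichlet u / c - D \<theta> u * (4 - 2 * \<theta>) / (4 * c)) u"
  unfolding weak_solution_def
proof
  fix v :: "real^'n \<Rightarrow> real" assume v: "v \<in> H1"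
  have \<theta>': "0 \<le> \<theta>" "\<theta> \<le> 2" using \<theta> by auto
  have B: "D \<theta> u > 0" by (rule D_pos[OF u(1) _ N]) (use u(2) c \<theta> in auto)
  let ?U = "\<lambda>x. u x * u x" and ?X = "\<lambda>x. u x * v x"
  define h where "h s x = u x + s * v x" for s x
  have hH: "h s \<in> H1" for s using H1_lin(1)[OF u(1) v, of 1 s] by (simp add: h_def[abs_def])
  define b where "b s = D \<theta> (h s)" for s
  define m where "m s = mass (h s)" for s
  \<comment> \<open>After restoring the mass with \<sigma> = c / m s, the quartic term scales by
    \<sigma>^2 but the Dirichlet term only by \<sigma>; the weight m s / c compensates, so that
    \<open>Kf w = \<sigma>\<^sup>2 * k s\<close>.\<close>
  define k where "k s = D 2 (h s) / 4 - m s * dirichlet (h s) / (2 * c)" for s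
  have m_eq: "m s = c + 2 * s * ip u v + s\<^sup>2 * mass v" for s
    using mass_add[OF H1_L2[OF u(1)] H1_L2[OF v], of s] u(2) by (simp add: m_def h_def[abs_def])
  have a_eq: "dirichlet (h s) = dirichlet u + 2 * s * dip u v + s\<^sup>2 * dirichlet v" for s
    using dirichlet_add[OF u(1) v, of s] by (simp add: h_def[abs_def])
  have DD: "((\<lambda>s. D \<gamma> (h s)) has_real_derivative 4 * I \<gamma> ?U ?X) (at 0)" if "0 \<le> \<gamma>" "\<gamma> \<le> 2" for \<gamma>
    unfolding h_def D_expand[OF u(1) v N that] by (auto intro!: derivative_eq_intros)
  have dm: "(m has_real_derivative 2 * ip u v) (at 0)"
    unfolding m_eq by (auto intro!: derivative_eq_intros)
  have da: "((\<lambda>s. dirichlet (h s)) has_real_derivative 2 * dip u v) (at 0)"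
    unfolding a_eq by (auto intro!: derivative_eq_intros)
  have h0: "h 0 = u" by (auto simp: h_def)
  have m0: "m 0 = c" and b0: "b 0 = D \<theta> u" and k0: "k 0 = Kf u"
    using c by (simp_all add: m_def b_def k_def h0 u(2) Kf_def)
  have dk: "(k has_real_derivative I 2 ?U ?X - (2 * ip u v * dirichlet u + c * (2 * dip u v)) / (2 * c)) (at 0)"
  proof -
    have "((\<lambda>s. D 2 (h s) / 4 - m s * dirichlet (h s) / (2 * c)) has_real_derivative
      (4 * I 2 ?U ?X) / 4 - (2 * ip u v * dirichlet (h 0) + 2 * dip u v * m 0) / (2 * c)) (at 0)"
      by (rule DERIV_diff[OF DERIV_cdivide[OF DD] DERIV_cdivide[OF DERIV_mult[OF dm da]]]) auto
    then show ?thesis unfolding k_def[abs_def] by (simp add: h0 m0 mult.commute)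
  qed
  have "2 * (4 * I \<theta> ?U ?X / b 0) - \<theta> * ((I 2 ?U ?X - (2 * ip u v * dirichlet u + c * (2 * dip u v)) / (2 * c)) / k 0)
     - (4 - 2 * \<theta>) * (2 * ip u v / m 0) = 0"
  proof (rule DERIV_log_quotient_zero[where b=b and k=k and m=m])
    show "(b has_real_derivative 4 * I \<theta> ?U ?X) (at 0)" unfolding b_def[abs_def] by (rule DD[OF \<theta>'])
    show "b 0 > 0" "k 0 > 0" "m 0 > 0" using B u(3) c by (simp_all add: b0 k0 m0)
    fix s assume pos: "b s > 0" "k s > 0" "m s > 0"
    define \<sigma> where "\<sigma> = c / m s"
    have \<sigma>: "\<sigma> > 0" using pos c by (simp add: \<sigma>_def)
    define w where "w = (\<lambda>x. sqrt \<sigma> * h s x)"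
    have s2: "(sqrt \<sigma>)\<^sup>2 = \<sigma>" and s4: "(sqrt \<sigma>) ^ 4 = \<sigma>\<^sup>2"
      using \<sigma> by (simp_all add: power4_eq_xxxx power2_eq_square)
    have wH: "w \<in> H1" unfolding w_def by (rule H1_scale[OF hH])
    have wm: "mass w = c" unfolding w_def mass_scale s2 using pos by (simp add: \<sigma>_def m_def)
    have "\<sigma>\<^sup>2 * (m s * dirichlet (h s) / (2 * c)) = \<sigma> * dirichlet (h s) / 2"
      using pos c by (simp add: \<sigma>_def power2_eq_square)
    then have wK: "Kf w = \<sigma>\<^sup>2 * k s"
      unfolding w_def Kf_def D_scale dirichlet_scale[OF hH] s2 s4 k_def by (simp add: right_diff_distrib)
    have wB: "D \<theta> w = \<sigma>\<^sup>2 * b s" unfolding w_def D_scale s4 b_def ..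
    have "Ff \<theta> u \<le> Ff \<theta> w" by (rule min[OF wH wm]) (use wK pos \<sigma> in simp)
    moreover have "Ff \<theta> u > 0" using B u(3) by (simp add: Ff_def)
    ultimately have F1: "ln (Ff \<theta> u) \<le> ln (Ff \<theta> w)" by simp
    have F2: "ln (Ff \<theta> u) = 2 * ln (b 0) - \<theta> * ln (k 0)"
      using B u(3) by (simp add: Ff_def b0 k0 ln_div ln_realpow ln_powr)
    have F3: "ln (Ff \<theta> w) = 2 * ln (\<sigma>\<^sup>2 * b s) - \<theta> * ln (\<sigma>\<^sup>2 * k s)"
      using pos \<sigma> by (simp add: Ff_def wB wK ln_div ln_realpow ln_powr)
    \<comment> \<open>The powers of \<sigma> contribute (4 - 2\<theta>)(ln c - ln (m s)), which is
      the origin of the exponent 4 - 2\<theta> of the mass.\<close>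
    have F4: "ln (\<sigma>\<^sup>2 * b s) = 2 * (ln c - ln (m s)) + ln (b s)" "ln (\<sigma>\<^sup>2 * k s) = 2 * (ln c - ln (m s)) + ln (k s)"
      using pos \<sigma> c by (simp_all add: ln_mult ln_realpow \<sigma>_def ln_div)
    from F1[unfolded F2 F3 F4] show "2 * ln (b 0) - \<theta> * ln (k 0) - (4 - 2 * \<theta>) * ln (m 0)
      \<le> 2 * ln (b s) - \<theta> * ln (k s) - (4 - 2 * \<theta>) * ln (m s)"
      by (simp add: m0 algebra_simps)
  qed (use dm dk in auto)
  then have eq: "2 * (4 * I \<theta> ?U ?X / D \<theta> u) - \<theta> * ((I 2 ?U ?X - (2 * ip u v * dirichlet u + c * (2 * dip u v)) / (2 * c)) / (\<theta> / 8 * D \<theta> u))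
     - (4 - 2 * \<theta>) * (2 * ip u v / c) = 0"
    by (simp add: b0 k0 m0 u(4))
  \<comment> \<open>This factor normalises the coefficient of the \<theta>-term to 1; since
    \<open>Kf u\<close> is \<theta>/8 times \<open>D \<theta> u\<close>, it does the same for the
    exponent 2.\<close>
  have "D \<theta> u / 8 * (2 * (4 * I \<theta> ?U ?X / D \<theta> u) - \<theta> * ((I 2 ?U ?X - (2 * ip u v * dirichlet u + c * (2 * dip u v)) / (2 * c)) / (\<theta> / 8 * D \<theta> u))
     - (4 - 2 * \<theta>) * (2 * ip u v / c)) =
     I \<theta> ?U ?X - (I 2 ?U ?X - ip u v * dirichlet u / c - dip u v) - D \<theta> u * (4 - 2 * \<theta>) / (4 * c) * ip u v"
    using B \<theta> c by (simp add: field_simps)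
  then have "dip u v + (dirichlet u / c - D \<theta> u * (4 - 2 * \<theta>) / (4 * c)) * ip u v = I 2 ?U ?X - I \<theta> ?U ?X"
    unfolding eq by (simp add: algebra_simps)
  moreover have "I \<gamma> ?U ?X = I \<gamma> ?X ?U" if "0 \<le> \<gamma>" "\<gamma> \<le> 2" for \<gamma>
    by (intro I_commute PB_mult u v N that)
  ultimately show "(LINT x|lborel. weak_grad u x \<bullet> weak_grad v x)
      + (dirichlet u / c - D \<theta> u * (4 - 2 * \<theta>) / (4 * c)) * (LINT x|lborel. u x * v x)
     = (LINT x|lborel. riesz_conv 2 u x * u x * v x) - (LINT x|lborel. riesz_conv \<theta> u x * u x * v x)"
    using \<theta>' unfolding weak_solution_I by (simp add: dip_def ip_def)
qed

section \<open>Regularity and the Pohozaev identity\<close>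

lemma nm_pd_le: "u \<in> H1 \<Longrightarrow> nm (pd u i) \<le> sqrt (dirichlet u)"
proof -
  assume "u \<in> H1"
  then have "(nm (pd u i))\<^sup>2 \<le> dirichlet u"
    unfolding dirichlet_eq[OF \<open>u \<in> H1\<close>] by (intro member_le_sum) auto
  from real_le_rsqrt[OF this] show ?thesis .
qed

text \<open>The equation is tested with a second difference of \<open>u\<close>.\<close>

lemma weak_equation_translate_le:
  fixes u :: "real^'n::finite \<Rightarrow> real"
  assumes u: "u \<in> H1" and f: "f \<in> L2" and eq: "\<And>v. v \<in> H1 \<Longrightarrow> dip u v = ip f v"
  shows "nm (\<lambda>x. pd u j (x + t *\<^sub>R axis i 1) - pd u j x) \<le> nm f * \<bar>t\<bar>"
proof -
  let ?e = "t *\<^sub>R axis i 1 :: real^'n"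
  define w where "w x = u (x + ?e) - u x" for x
  have w: "w \<in> H1" unfolding w_def[abs_def] by (intro H1_diff H1_translate u)
  have tw: "(\<lambda>x. w (x + - ?e)) \<in> H1" by (rule H1_translate[OF w])
  have "dirichlet w = dip (\<lambda>x. u (x + ?e)) w - dip u w"
    unfolding dirichlet_dip by (subst (1) w_def[abs_def]) (rule dip_diff[OF H1_translate(1)[OF u] u w])
  \<comment> \<open>Translation invariance shifts the difference from u to w, so that the equation
    is tested with a difference of w.\<close>
  also have "dip (\<lambda>x. u (x + ?e)) w = dip u (\<lambda>x. w (x + - ?e))"
    using dip_translate[OF u tw, of ?e] by simp
  also have "dip u (\<lambda>x. w (x + - ?e)) - dip u w = ip f (\<lambda>x. w (x + - ?e) - w x)"
    unfolding eq[OF tw] eq[OF w] by (rule ip_diff_right[symmetric]) (intro f H1_L2 w tw)+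
  also have "\<dots> \<le> nm f * nm (\<lambda>x. w (x + - ?e) - w x)"
    using ip_Cauchy_Schwarz[OF f L2_diff[OF H1_L2[OF tw] H1_L2[OF w]]] by linarith
  also have "\<dots> \<le> nm f * (\<bar>- t\<bar> * nm (pd w i))"
    using nm_translate_axis_le[OF H1_L2[OF w] pd_L2[OF w] pd_wd[OF w], of "- t" i]
    by (intro mult_left_mono) auto
  also have "\<dots> \<le> nm f * (\<bar>- t\<bar> * sqrt (dirichlet w))"
    by (intro mult_left_mono nm_pd_le w) auto
  finally have "sqrt (dirichlet w) * sqrt (dirichlet w) \<le> nm f * \<bar>t\<bar> * sqrt (dirichlet w)"
    by (simp add: dirichlet_nonneg)
  \<comment> \<open>The difference of w costs |t| times its gradient norm, which cancels against one
    factor of the Dirichlet integral on the left.\<close>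
  then have 1: "sqrt (dirichlet w) \<le> nm f * \<bar>t\<bar>"
    using real_sqrt_ge_zero[OF dirichlet_nonneg, of w] mult_right_le_imp_le[of "sqrt (dirichlet w)" "sqrt (dirichlet w)" "nm f * \<bar>t\<bar>"]
    by (cases "sqrt (dirichlet w) = 0") (simp, linarith)
  have L: "(\<lambda>x. pd u j (x + ?e) - pd u j x) \<in> L2" by (intro L2_diff H1_translate pd_L2 u)
  have "wd j w (\<lambda>x. pd u j (x + ?e) + (-1) * pd u j x)"
    using wd_add_L2[OF H1_L2[OF H1_translate(1)[OF u, where h="?e"]] L2_scale[OF H1_L2[OF u], of "-1"] H1_translate(2)[OF u] L2_scale[OF pd_L2[OF u]] H1_translate(3)[OF u, where h="?e"] wd_scale[OF pd_wd[OF u], of _ "-1"], of j]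
    by (simp add: w_def[abs_def])
  then have wdw: "wd j w (\<lambda>x. pd u j (x + ?e) - pd u j x)" by simp
  have "nm (\<lambda>x. pd u j (x + ?e) - pd u j x) = nm (pd w j)"
    unfolding nm_def using ip_pd_left[OF w L wdw L] ip_pd_left[OF w L wdw pd_L2[OF w], of j] by (simp add: ip_commute)
  also have "\<dots> \<le> nm f * \<bar>t\<bar>" using order_trans[OF nm_pd_le[OF w] 1] .
  finally show ?thesis .
qed

text \<open>Difference quotients of \<open>pd u j\<close> are bounded by \<open>nm f\<close>, so
  they have a weak limit. Differences commute with the derivative in direction j, hence the same
  limit is also the derivative of \<open>pd u i\<close> in direction j; this symmetry is needed for
  testing with vector fields.\<close>

lemma weak_equation_second_derivative:
  fixes u :: "real^'n::finite \<Rightarrow> real"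
  assumes u: "u \<in> H1" and f: "f \<in> L2" and eq: "\<And>v. v \<in> H1 \<Longrightarrow> dip u v = ip f v"
  obtains h where "h \<in> L2" "wd i (pd u j) h" "wd j (pd u i) h"
proof -
  define t where "t n = inverse (real (Suc n))" for n
  have t: "t n \<noteq> 0" "t \<longlonglongrightarrow> 0" for n using LIMSEQ_inverse_real_of_nat by (auto simp: t_def[abs_def])
  have ft: "filterlim t (at 0) sequentially" using t by (auto simp: filterlim_at)
  define d where "d n x = inverse (t n) * (pd u j (x + t n *\<^sub>R axis i 1) - pd u j x)" for n x
  have dL: "d n \<in> L2" for n unfolding d_def[abs_def] by (intro L2_scale L2_diff L2_translate pd_L2 u)
  have dn: "nm (d n) \<le> nm f" for n
    using weak_equation_translate_le[OF assms, of j "t n" i] t(1)[of n] unfolding d_def[abs_def] nm_scale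
    by (simp add: field_simps)
  have dip_eq': "ip (d n) \<phi> = (LINT x|lborel. pd u j x * ((\<phi> (x + t n *\<^sub>R (- axis i 1)) - \<phi> x) / t n))"
    if p: "\<phi> \<in> test_functions" for n \<phi>
  proof -
    let ?h = "t n *\<^sub>R axis i 1 :: real^'n"
    have "ip (d n) \<phi> = inverse (t n) * (ip (\<lambda>x. pd u j (x + ?h)) \<phi> - ip (pd u j) \<phi>)"
      unfolding d_def[abs_def] ip_scale_left by (simp add: ip_diff_left L2_translate u test_L2 p pd_L2)
    also have "ip (\<lambda>x. pd u j (x + ?h)) \<phi> - ip (pd u j) \<phi> = ip (pd u j) (\<lambda>x. \<phi> (x + - ?h) - \<phi> x)"
      using ip_diff_right[OF L2_translate[OF test_L2[OF p], where h="- ?h"] test_L2[OF p] pd_L2[OF u]] by (simp add: ip_translate_left)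
    also have "inverse (t n) * \<dots> = (LINT x|lborel. pd u j x * ((\<phi> (x + t n *\<^sub>R (- axis i 1)) - \<phi> x) / t n))"
      unfolding ip_scale_right[symmetric] by (simp add: ip_def divide_inverse mult_ac)
    finally show ?thesis .
  qed
  have conv: "(\<lambda>n. ip (d n) \<phi>) \<longlonglongrightarrow> - (LINT x|lborel. pd u j x * partial_deriv i \<phi> x)" if p: "\<phi> \<in> test_functions" for \<phi>
  proof -
    have "(LINT x|lborel. pd u j x * (\<Sum>k\<in>UNIV. (- axis i 1) $ k * partial_deriv k \<phi> x)) = - (LINT x|lborel. pd u j x * partial_deriv i \<phi> x)"
      by (simp add: sum_negf sum_axis)
    with filterlim_compose[OF difference_quotient_test[OF L2_locint[OF pd_L2[OF u, of j]] p, of "- axis i 1"] ft]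
    show ?thesis by (simp only: dip_eq'[OF p])
  qed
  obtain h where h: "h \<in> L2" "\<And>\<phi>. \<phi> \<in> test_functions \<Longrightarrow> ip h \<phi> = - (LINT x|lborel. pd u j x * partial_deriv i \<phi> x)"
    using weak_limit[of d "nm f" test_functions, OF dL dn _ conv] test_L2 by (metis subsetI)
  show ?thesis
  proof (rule that[OF h(1)])
    show "wd i (pd u j) h" using h(2) by (simp add: wd_def ip_def)
    show "wd j (pd u i) h"
      unfolding wd_def
    proof
      fix \<phi> :: "real^'n \<Rightarrow> real" assume p: "\<phi> \<in> test_functions"
      have 1: "(\<lambda>n. ip (\<lambda>x. (u (x + t n *\<^sub>R axis i 1) - u x) / t n) (partial_deriv j \<phi>)) \<longlonglongrightarrow> ip (pd u i) (partial_deriv j \<phi>)"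
        by (rule difference_quotient_weak(3)[OF H1_L2[OF u] pd_L2[OF u] pd_wd[OF u] t test_L2[OF test_partial[OF p]]])
      have 2: "ip (\<lambda>x. (u (x + t n *\<^sub>R axis i 1) - u x) / t n) (partial_deriv j \<phi>) = - ip (d n) \<phi>" for n
      proof -
        let ?h = "t n *\<^sub>R axis i 1 :: real^'n"
        have "wd j (\<lambda>x. inverse (t n) * (u (x + ?h) + (-1) * u x)) (\<lambda>x. inverse (t n) * (pd u j (x + ?h) + (-1) * pd u j x))"
          by (intro wd_scale wd_add_L2 H1_translate L2_scale H1_L2 pd_L2 pd_wd u)
        from wdD[OF this p] show ?thesis by (simp add: ip_def d_def divide_inverse mult_ac)
      qed
      have "(\<lambda>n. - ip (d n) \<phi>) \<longlonglongrightarrow> ip (pd u i) (partial_deriv j \<phi>)" using 1 unfolding 2 .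
      moreover have "(\<lambda>n. - ip (d n) \<phi>) \<longlonglongrightarrow> - ip h \<phi>"
        unfolding h(2)[OF p] by (intro tendsto_minus conv p)
      ultimately have "ip (pd u i) (partial_deriv j \<phi>) = - ip h \<phi>" by (rule LIMSEQ_unique)
      then show "(LINT x|lborel. pd u i x * partial_deriv j \<phi> x) = - (LINT x|lborel. h x * \<phi> x)" by (simp add: ip_def)
    qed
  qed
qed

text \<open>The function v is the derivative of u along X. The second derivatives in its gradient
  occur only through the derivative of |grad u|^2 / 2 along X, so after integration by parts only
  first derivatives of u and of X remain.\<close>

lemma field_derivative:
  fixes u :: "real^'n::finite \<Rightarrow> real"
  assumes u: "u \<in> H1" and h: "\<And>i j. h i j \<in> L2" "\<And>i j. wd i (pd u j) (h i j)" "\<And>i j. wd j (pd u i) (h i j)"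
    and X: "\<And>j. X j \<in> test_functions"
  defines "v \<equiv> \<lambda>x. \<Sum>j\<in>UNIV. X j x * pd u j x"
  shows "v \<in> H1"
    and "dip u v = (\<Sum>i\<in>UNIV. \<Sum>j\<in>UNIV. (LINT x|lborel. partial_deriv i (X j) x * (pd u i x * pd u j x)))
      - 1/2 * (\<Sum>i\<in>UNIV. \<Sum>j\<in>UNIV. (LINT x|lborel. partial_deriv j (X j) x * (pd u i x * pd u i x)))"
    and "ip u v = - 1/2 * (\<Sum>j\<in>UNIV. (LINT x|lborel. partial_deriv j (X j) x * (u x * u x)))"
proof -
  have bL: "(\<lambda>x. \<phi> x * f x) \<in> L2" if "\<phi> \<in> test_functions" "f \<in> L2" for \<phi> f :: "real^'n \<Rightarrow> real"
    using test_bounded[OF that(1)] L2_bounded_mult[OF that(2) test_measurable[OF that(1)]] by blast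
  have XL: "(\<lambda>x. X j x * f x) \<in> L2" "(\<lambda>x. partial_deriv i (X j) x * f x) \<in> L2" if "f \<in> L2" for i j f
    by (intro bL X test_partial that)+
  note pL = pd_L2[OF u]
  define v' where "v' i x = (\<Sum>j\<in>UNIV. partial_deriv i (X j) x * pd u j x + X j x * h i j x)" for i x
  have vL: "v \<in> L2" unfolding v_def by (intro L2_sum XL pL)
  have v'L: "v' i \<in> L2" for i unfolding v'_def[abs_def] by (intro L2_sum L2_add XL pL h)
  have wds: "wd i (\<lambda>x. \<Sum>j\<in>J. X j x * pd u j x) (\<lambda>x. \<Sum>j\<in>J. partial_deriv i (X j) x * pd u j x + X j x * h i j x)"
    if "finite J" for i J
    using that
  proof induction
    case empty
    then show ?case by (simp add: wd_def)
  next
    case (insert k J)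
    have 1: "wd i (\<lambda>x. X k x * pd u k x) (\<lambda>x. partial_deriv i (X k) x * pd u k x + X k x * h i k x)"
      by (rule wd_smooth_mult[OF test_smooth[OF X]]) (intro L2_locint pL h)+
    have "wd i (\<lambda>x. X k x * pd u k x + (\<Sum>j\<in>J. X j x * pd u j x))
      (\<lambda>x. (partial_deriv i (X k) x * pd u k x + X k x * h i k x) + (\<Sum>j\<in>J. partial_deriv i (X j) x * pd u j x + X j x * h i j x))"
      by (intro wd_add_L2 1 insert.IH L2_sum L2_add XL pL h)
    then show ?case using insert.hyps by simp
  qed
  have wdv: "wd i v (v' i)" for i using wds[of UNIV i] by (simp add: v_def v'_def[abs_def])
  show vH: "v \<in> H1" by (rule H1I[OF vL v'L wdv])
  have Int: "integrable lborel (\<lambda>x. f x * g x)" if "f \<in> L2" "g \<in> L2" for f g :: "real^'n \<Rightarrow> real"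
    by (rule L2_integrable_mult[OF that])
  \<comment> \<open>Here the symmetry of the second derivatives enters: h i j is read as the
    derivative of \<open>pd u i\<close> in direction j.\<close>
  have ibp: "(LINT x|lborel. pd u i x * (X j x * h i j x)) = - 1/2 * (LINT x|lborel. partial_deriv j (X j) x * (pd u i x * pd u i x))" for i j
  proof -
    have "(LINT x|lborel. pd u i x * pd u i x * partial_deriv j (X j) x) = - (LINT x|lborel. (h i j x * pd u i x + pd u i x * h i j x) * X j x)"
      by (rule wdD[OF wd_mult[OF pL h(1,3) pL h(1,3)] X])
    also have "(\<lambda>x. (h i j x * pd u i x + pd u i x * h i j x) * X j x) = (\<lambda>x. 2 * (pd u i x * (X j x * h i j x)))"
      by (auto simp: algebra_simps)
    finally show ?thesis by (simp add: mult_ac)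
  qed
  have "dip u v = (\<Sum>i\<in>UNIV. ip (pd u i) (v' i))"
    by (rule dip_wd[OF u pL pd_wd[OF u] vH v'L wdv])
  also have "\<dots> = (\<Sum>i\<in>UNIV. \<Sum>j\<in>UNIV. (LINT x|lborel. partial_deriv i (X j) x * (pd u i x * pd u j x)) - 1/2 * (LINT x|lborel. partial_deriv j (X j) x * (pd u i x * pd u i x)))"
  proof (rule sum.cong[OF refl])
    fix i
    have "ip (pd u i) (v' i) = (LINT x|lborel. (\<Sum>j\<in>UNIV. pd u i x * (partial_deriv i (X j) x * pd u j x) + pd u i x * (X j x * h i j x)))"
      by (simp add: ip_def v'_def sum_distrib_left distrib_left)
    also have "\<dots> = (\<Sum>j\<in>UNIV. (LINT x|lborel. pd u i x * (partial_deriv i (X j) x * pd u j x)) + (LINT x|lborel. pd u i x * (X j x * h i j x)))"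
      using Int[OF pL XL(2)[OF pL]] Int[OF pL XL(1)[OF h(1)]] by (simp add: Bochner_Integration.integral_sum)
    finally show "ip (pd u i) (v' i) = (\<Sum>j\<in>UNIV. (LINT x|lborel. partial_deriv i (X j) x * (pd u i x * pd u j x)) - 1/2 * (LINT x|lborel. partial_deriv j (X j) x * (pd u i x * pd u i x)))"
      unfolding ibp by (simp add: mult_ac)
  qed
  finally show "dip u v = (\<Sum>i\<in>UNIV. \<Sum>j\<in>UNIV. (LINT x|lborel. partial_deriv i (X j) x * (pd u i x * pd u j x)))
      - 1/2 * (\<Sum>i\<in>UNIV. \<Sum>j\<in>UNIV. (LINT x|lborel. partial_deriv j (X j) x * (pd u i x * pd u i x)))"
    by (simp add: sum_subtractf sum_distrib_left)
  have "ip u v = (LINT x|lborel. (\<Sum>j\<in>UNIV. u x * (X j x * pd u j x)))"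
    by (simp add: ip_def v_def sum_distrib_left)
  also have "\<dots> = (\<Sum>j\<in>UNIV. (LINT x|lborel. u x * (X j x * pd u j x)))"
    by (intro Bochner_Integration.integral_sum Int H1_L2 u XL pL)
  also have "\<dots> = (\<Sum>j\<in>UNIV. - 1/2 * (LINT x|lborel. partial_deriv j (X j) x * (u x * u x)))"
  proof (rule sum.cong[OF refl])
    fix j
    show "(LINT x|lborel. u x * (X j x * pd u j x)) = - 1/2 * (LINT x|lborel. partial_deriv j (X j) x * (u x * u x))"
    proof -
      have "(LINT x|lborel. u x * u x * partial_deriv j (X j) x) = - (LINT x|lborel. 2 * (u x * pd u j x) * X j x)"
        by (rule wdD[OF u_square_wd(3)[OF u] X])
      also have "(\<lambda>x. 2 * (u x * pd u j x) * X j x) = (\<lambda>x. 2 * (u x * (X j x * pd u j x)))" by auto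
      finally show ?thesis by (simp only: integral_mult_right_zero) (simp add: mult_ac)
    qed
  qed
  finally show "ip u v = - 1/2 * (\<Sum>j\<in>UNIV. (LINT x|lborel. partial_deriv j (X j) x * (u x * u x)))"
    by (simp add: sum_distrib_left)
qed

section \<open>The nonlocal term tested with a vector field\<close>

lemma pair_integrable_bounded:
  fixes f g :: "'a::euclidean_space \<Rightarrow> real"
  assumes f: "integrable lborel f" and g: "integrable lborel g"
    and k[measurable]: "k \<in> borel_measurable (lborel \<Otimes>\<^sub>M lborel)" "\<And>p. \<bar>k p\<bar> \<le> B"
  shows "integrable (lborel \<Otimes>\<^sub>M lborel) (\<lambda>(x, y). f x * (k (x, y) * g y))"
proof -
  note [measurable] = borel_measurable_integrable[OF f] borel_measurable_integrable[OF g]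
  have B: "B \<ge> 0" using k(2)[of undefined] by linarith
  have "(\<integral>\<^sup>+p. ennreal (norm (case p of (x, y) \<Rightarrow> f x * (k (x, y) * g y))) \<partial>(lborel \<Otimes>\<^sub>M lborel))
    \<le> (\<integral>\<^sup>+p. ennreal (case p of (x, y) \<Rightarrow> \<bar>f x\<bar> * (B * \<bar>g y\<bar>)) \<partial>(lborel \<Otimes>\<^sub>M lborel))"
    by (intro nn_integral_mono ennreal_leI) (auto simp: abs_mult intro!: mult_left_mono mult_right_mono k)
  also have "\<dots> = (\<integral>\<^sup>+x. \<integral>\<^sup>+y. ennreal \<bar>f x\<bar> * ennreal (B * \<bar>g y\<bar>) \<partial>lborel \<partial>lborel)"
    using B by (subst lborel.nn_integral_fst[symmetric]) (auto simp: ennreal_mult[symmetric])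
  also have "\<dots> = (\<integral>\<^sup>+x. ennreal \<bar>f x\<bar> \<partial>lborel) * (ennreal B * (\<integral>\<^sup>+y. ennreal \<bar>g y\<bar> \<partial>lborel))"
    using B by (simp add: nn_integral_cmult nn_integral_multc ennreal_mult)
  also have "\<dots> < \<infinity>" using f g by (auto simp: integrable_iff_bounded ennreal_mult_less_top)
  finally show ?thesis by (simp add: integrable_iff_bounded)
qed

lemma AE_off_diagonal: "AE p in lborel \<Otimes>\<^sub>M (lborel :: 'a::euclidean_space measure). fst p \<noteq> snd p"
proof (rule lborel_pair.AE_pair_measure)
  show "{p \<in> space (lborel \<Otimes>\<^sub>M (lborel :: 'a measure)). fst p \<noteq> snd p} \<in> sets (lborel \<Otimes>\<^sub>M lborel)"
    by measurable
  show "AE x in lborel. AE y in lborel. fst (x, y) \<noteq> snd (x :: 'a, y)"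
    using AE_lborel_singleton by (auto simp: eq_commute)
qed

definition divg :: "('n::finite \<Rightarrow> real^'n \<Rightarrow> real) \<Rightarrow> real^'n \<Rightarrow> real" where
  "divg X x = (\<Sum>j\<in>UNIV. partial_deriv j (X j) x)"

text \<open>Symmetrising in \<open>x\<close> and \<open>y\<close> replaces \<open>X x\<close> by \<open>X x - X y\<close> in the derivative of the kernel,
  so that \<open>virial\<close> is no more singular than the kernel itself and \<open>\<delta>\<close> can tend to \<open>0\<close>.\<close>

definition virial :: "real \<Rightarrow> real \<Rightarrow> ('n::finite \<Rightarrow> real^'n \<Rightarrow> real) \<Rightarrow> real^'n \<Rightarrow> real^'n \<Rightarrow> real" where
  "virial \<gamma> \<delta> X x y = (divg X x + divg X y) * rq y \<delta> x powr (-\<gamma>/2)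
     - \<gamma> * (\<Sum>j\<in>UNIV. (X j x - X j y) * (x $ j - y $ j)) * rq y \<delta> x powr (-\<gamma>/2 - 1)"

lemma rq_commute: "rq y \<delta> x = rq x \<delta> y" by (simp add: rq_def norm_minus_commute)

lemma rq_le_ker:
  assumes "x \<noteq> y" "\<delta> \<ge> 0" "\<gamma> \<ge> 0"
  shows "rq y \<delta> x powr (-\<gamma>/2) \<le> ker \<gamma> (x - y)"
  unfolding ker_commute[of \<gamma> x] ker_rq[OF assms(1)] rq_def using assms by (intro powr_mono2') auto

text \<open>The Lipschitz bound on X gains |x - y|^2, which is at most
  \<open>rq y \<delta> x\<close> and offsets the extra power -1. The bound is uniform in \<delta>
  and includes \<delta> = 0 off the diagonal.\<close>

lemma virial_bound:
  fixes X :: "'n::finite \<Rightarrow> real^'n \<Rightarrow> real"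
  assumes xy: "x \<noteq> y" and \<delta>: "\<delta> \<ge> 0" and \<gamma>: "\<gamma> \<ge> 0"
    and B: "\<And>x. \<bar>divg X x\<bar> \<le> B" and L: "\<And>j x y. \<bar>X j x - X j y\<bar> \<le> L * norm (x - y)" "L \<ge> 0"
  shows "\<bar>virial \<gamma> \<delta> X x y\<bar> \<le> (2 * B + \<gamma> * real CARD('n) * L) * ker \<gamma> (x - y)"
proof -
  let ?q = "rq y \<delta> x" and ?S = "\<Sum>j\<in>UNIV. (X j x - X j y) * (x $ j - y $ j)"
  have q: "?q > 0" "(norm (x - y))\<^sup>2 \<le> ?q" using xy \<delta> by (auto simp: rq_def intro: add_pos_nonneg)
  have B0: "B \<ge> 0" using B[of 0] by linarith
  have "\<bar>?S\<bar> \<le> (\<Sum>j\<in>(UNIV::'n set). (L * norm (x - y)) * norm (x - y))"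
    using component_le_norm_cart[of "x - y"]
    by (intro order_trans[OF sum_abs sum_mono]) (auto simp: abs_mult L intro!: mult_mono)
  also have "\<dots> = real CARD('n) * L * (norm (x - y))\<^sup>2" by (simp add: power2_eq_square)
  also have "\<dots> \<le> real CARD('n) * L * ?q" using q L(2) by (intro mult_left_mono) auto
  finally have S: "\<bar>?S\<bar> \<le> real CARD('n) * L * ?q" .
  have "?q * ?q powr (-\<gamma>/2 - 1) = ?q powr (-\<gamma>/2)" using q by (simp add: powr_diff)
  then have "\<bar>\<gamma> * ?S * ?q powr (-\<gamma>/2 - 1)\<bar> \<le> \<gamma> * real CARD('n) * L * ?q powr (-\<gamma>/2)"
    using mult_right_mono[OF mult_left_mono[OF S \<gamma>], of "?q powr (-\<gamma>/2 - 1)"] \<gamma> by (simp add: abs_mult mult_ac)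
  moreover have "\<bar>(divg X x + divg X y) * ?q powr (-\<gamma>/2)\<bar> \<le> 2 * B * ?q powr (-\<gamma>/2)"
    using B[of x] B[of y] by (auto simp: abs_mult intro!: mult_right_mono)
  ultimately have "\<bar>virial \<gamma> \<delta> X x y\<bar> \<le> (2 * B + \<gamma> * real CARD('n) * L) * ?q powr (-\<gamma>/2)"
    unfolding virial_def by (simp add: distrib_right)
  also have "\<dots> \<le> (2 * B + \<gamma> * real CARD('n) * L) * ker \<gamma> (x - y)"
    using B0 L(2) \<gamma> by (intro mult_left_mono rq_le_ker xy \<delta>) auto
  finally show ?thesis .
qed

lemma virial_measurable:
  assumes X: "\<And>j. X j \<in> test_functions"
  shows "(\<lambda>p. virial \<gamma> \<delta> X (fst p) (snd p)) \<in> borel_measurable (lborel \<Otimes>\<^sub>M lborel)"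
proof -
  have [measurable]: "X j \<in> borel_measurable borel" "partial_deriv i (X j) \<in> borel_measurable borel"
    "(\<lambda>v::real^'a. v $ j) \<in> borel_measurable borel" for i j
    using test_measurable[OF X] test_measurable[OF test_partial[OF X]]
    by (auto intro!: borel_measurable_continuous_onI continuous_intros)
  show ?thesis unfolding virial_def divg_def rq_def by measurable
qed

lemma virial_tendsto:
  assumes "x \<noteq> y"
  shows "(\<lambda>n. virial \<gamma> (inverse (real (Suc n))) X x y) \<longlonglongrightarrow> virial \<gamma> 0 X x y"
proof -
  have "(\<lambda>n. rq y (inverse (real (Suc n))) x) \<longlonglongrightarrow> rq y 0 x"
    unfolding rq_def by (intro tendsto_intros LIMSEQ_inverse_real_of_nat)
  moreover have "rq y 0 x \<noteq> 0" using assms by (simp add: rq_def)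
  ultimately show ?thesis unfolding virial_def by (intro tendsto_intros) auto
qed

text \<open>For fixed y, u times its derivative along X is half the derivative of u^2; integrating
  by parts against the compactly supported field \<open>rq y \<delta> x powr (-\<gamma>/2)\<close>
  times X moves it to the weight.\<close>

lemma field_potential_regularised:
  fixes u :: "real^'n::finite \<Rightarrow> real"
  assumes u: "u \<in> H1" and X: "\<And>j. X j \<in> test_functions" and \<delta>: "\<delta> > 0"
  shows "(LINT x|lborel. (u x * (\<Sum>j\<in>UNIV. X j x * pd u j x)) * rq y \<delta> x powr (-\<gamma>/2))
    = - 1/2 * (LINT x|lborel. (u x * u x) * (divg X x * rq y \<delta> x powr (-\<gamma>/2)
         - \<gamma> * (\<Sum>j\<in>UNIV. X j x * (x $ j - y $ j)) * rq y \<delta> x powr (-\<gamma>/2 - 1)))"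
proof -
  let ?k = "\<lambda>p x. rq y \<delta> x powr p"
  have T: "(\<lambda>x. ?k (-\<gamma>/2) x * X j x) \<in> test_functions" for j by (rule test_mult[OF X rq_powr(1)[OF \<delta>]])
  have pT: "partial_deriv j (\<lambda>x. ?k (-\<gamma>/2) x * X j x) x
    = partial_deriv j (X j) x * ?k (-\<gamma>/2) x - \<gamma> * (X j x * (x $ j - y $ j)) * ?k (-\<gamma>/2 - 1) x" for j x
    unfolding partial_deriv_smooth_mult[OF rq_powr(1)[OF \<delta>] test_smooth[OF X]] rq_powr(2)[OF \<delta>] by simp
  have i1: "integrable lborel (\<lambda>x. (u x * u x) * partial_deriv j (\<lambda>x. ?k (-\<gamma>/2) x * X j x) x)" for j
    by (rule locint_test_integrable[OF integrable_locint[OF u_square_wd(1)[OF u]] test_partial[OF T]])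
  have i2: "integrable lborel (\<lambda>x. (2 * (u x * pd u j x)) * (?k (-\<gamma>/2) x * X j x))" for j
    by (rule locint_test_integrable[OF integrable_locint[OF u_square_wd(2)[OF u]] T])
  have "(LINT x|lborel. (u x * u x) * (divg X x * ?k (-\<gamma>/2) x
         - \<gamma> * (\<Sum>j\<in>UNIV. X j x * (x $ j - y $ j)) * ?k (-\<gamma>/2 - 1) x))
    = (LINT x|lborel. (\<Sum>j\<in>UNIV. (u x * u x) * partial_deriv j (\<lambda>x. ?k (-\<gamma>/2) x * X j x) x))"
    unfolding pT divg_def
    by (simp add: sum_distrib_left[symmetric] sum_distrib_right[symmetric] sum_subtractf)
  also have "\<dots> = (\<Sum>j\<in>UNIV. - (LINT x|lborel. (2 * (u x * pd u j x)) * (?k (-\<gamma>/2) x * X j x)))"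
    unfolding Bochner_Integration.integral_sum[OF i1] by (intro sum.cong refl wdD[OF u_square_wd(3)[OF u] T])
  also have "\<dots> = - (LINT x|lborel. (\<Sum>j\<in>UNIV. (2 * (u x * pd u j x)) * (?k (-\<gamma>/2) x * X j x)))"
    using i2 by (simp add: Bochner_Integration.integral_sum sum_negf del: integral_mult_right_zero)
  also have "(\<lambda>x. \<Sum>j\<in>UNIV. (2 * (u x * pd u j x)) * (?k (-\<gamma>/2) x * X j x))
    = (\<lambda>x. 2 * ((u x * (\<Sum>j\<in>UNIV. X j x * pd u j x)) * ?k (-\<gamma>/2) x))"
    by (simp add: sum_distrib_left sum_distrib_right mult_ac)
  finally show ?thesis by simp
qed

text \<open>The factor 1/4 is 1/2 from u grad u = grad(u^2)/2 times 1/2 from symmetrising. All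
  exchanges of integrals are done for \<delta> > 0; dominated convergence then removes the
  regularisation.\<close>

lemma field_potential:
  fixes u :: "real^'n::finite \<Rightarrow> real"
  assumes u: "u \<in> H1" and N: "CARD('n) \<ge> 3" and \<gamma>: "0 \<le> \<gamma>" "\<gamma> \<le> 2" and X: "\<And>j. X j \<in> test_functions"
    and v: "(\<lambda>x. \<Sum>j\<in>UNIV. X j x * pd u j x) \<in> H1"
  shows "I \<gamma> (\<lambda>x. u x * (\<Sum>j\<in>UNIV. X j x * pd u j x)) (\<lambda>x. u x * u x)
    = - 1/4 * (\<integral>(x, y). (u x * u x) * (virial \<gamma> 0 X x y * (u y * u y)) \<partial>(lborel \<Otimes>\<^sub>M lborel))"
proof -
  let ?P = "lborel \<Otimes>\<^sub>M (lborel :: (real^'n) measure)"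
  define U where "U x = u x * u x" for x
  define V where "V x = u x * (\<Sum>j\<in>UNIV. X j x * pd u j x)" for x
  have PU: "PB \<gamma> U" and PV: "PB \<gamma> V" unfolding U_def[abs_def] V_def[abs_def] by (intro PB_mult u v N \<gamma>)+
  note iU = PB_integrable[OF PU] and iV = PB_integrable[OF PV]
  note [measurable] = PB_measurable[OF PU] PB_measurable[OF PV] virial_measurable[OF X]
  have Xm[measurable]: "X j \<in> borel_measurable borel" "partial_deriv i (X j) \<in> borel_measurable borel"
    "(\<lambda>v::real^'n. v $ j) \<in> borel_measurable borel" for i j
    using test_measurable[OF X] test_measurable[OF test_partial[OF X]]
    by (auto intro!: borel_measurable_continuous_onI continuous_intros)
  define \<delta> where "\<delta> n = inverse (real (Suc n))" for n
  have \<delta>: "\<delta> n > 0" for n by (simp add: \<delta>_def)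
  have "\<exists>B>0. \<forall>x. \<bar>partial_deriv j (X j) x\<bar> \<le> B" for j using test_bounded[OF test_partial[OF X]] by metis
  then obtain b where b: "\<And>j x. \<bar>partial_deriv j (X j) x\<bar> \<le> b j" by metis
  define B where "B = (\<Sum>j\<in>UNIV. b j)"
  have B: "\<bar>divg X x\<bar> \<le> B" for x
    unfolding divg_def B_def by (intro order_trans[OF sum_abs sum_mono] b)
  have "\<exists>L>0. \<forall>x y. \<bar>X j x - X j y\<bar> \<le> L * norm (x - y)" for j using test_Lipschitz[OF X] by metis
  then obtain l where l: "\<And>j. l j > 0" "\<And>j x y. \<bar>X j x - X j y\<bar> \<le> l j * norm (x - y)" by metis
  define L where "L = (\<Sum>j\<in>UNIV. l j)"
  have L0: "L \<ge> 0" unfolding L_def using l(1) by (intro sum_nonneg) (auto intro: less_imp_le)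
  have L: "\<bar>X j x - X j y\<bar> \<le> L * norm (x - y)" for j x y
  proof -
    have "l j \<le> L" unfolding L_def using l(1) by (intro member_le_sum) (auto intro: less_imp_le)
    from order_trans[OF l(2) mult_right_mono[OF this]] show ?thesis by simp
  qed
  define C where "C = 2 * B + \<gamma> * real CARD('n) * L"
  define K where "K n x y = rq y (\<delta> n) x powr (-\<gamma>/2)" for n and x y :: "real^'n"
  define K' where "K' n x y = rq y (\<delta> n) x powr (-\<gamma>/2 - 1)" for n and x y :: "real^'n"
  \<comment> \<open>The kernel before symmetrisation. It is bounded for each n, but not by a
    multiple of the singular kernel uniformly in n, so only its symmetrised form is taken to the
    limit.\<close>
  define F where "F n x y = divg X x * K n x y - \<gamma> * (\<Sum>j\<in>UNIV. X j x * (x $ j - y $ j)) * K' n x y" for n x y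
  have Fsym: "F n x y + F n y x = virial \<gamma> (\<delta> n) X x y" for n x y
  proof -
    have "(\<Sum>j\<in>UNIV. X j x * (x $ j - y $ j)) + (\<Sum>j\<in>UNIV. X j y * (y $ j - x $ j)) = (\<Sum>j\<in>UNIV. (X j x - X j y) * (x $ j - y $ j))"
      unfolding sum.distrib[symmetric] by (intro sum.cong refl) (simp add: algebra_simps)
    then show ?thesis
      unfolding F_def K_def K'_def virial_def by (simp add: rq_commute[of x _ y] algebra_simps flip: distrib_left)
  qed
  have Km: "(\<lambda>p. K n (fst p) (snd p)) \<in> borel_measurable ?P" "(\<lambda>p. F n (fst p) (snd p)) \<in> borel_measurable ?P" for n
    unfolding F_def K_def K'_def divg_def rq_def by measurable
  have Kb: "\<bar>K n x y\<bar> \<le> \<delta> n powr (-\<gamma>/2)" for n x y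
    unfolding K_def using \<gamma> rq_ge(1)[OF \<delta>, of n y x] \<delta>[of n] by (simp add: powr_mono2')
  have "\<exists>C. \<forall>x. \<bar>X j x\<bar> \<le> C" for j using test_bounded[OF X] by metis
  then obtain xb where xb: "\<And>j x. \<bar>X j x\<bar> \<le> xb j" by metis
  \<comment> \<open>This bound degenerates as n grows and is used only to justify Fubini for fixed
    n.\<close>
  have Fb: "\<exists>C. \<forall>x y. \<bar>F n x y\<bar> \<le> C" for n
  proof -
    have 1: "\<bar>X j x * (x $ j - y $ j) * K' n x y\<bar> \<le> xb j * \<delta> n powr (-\<gamma>/2 - 1/2)" for j x y
    proof -
      have "\<bar>x $ j - y $ j\<bar> \<le> norm (x - y)" using component_le_norm_cart[of "x - y" j] by simp
      also have "\<dots> \<le> rq y (\<delta> n) x powr (1/2)" by (rule rq_ge(2)[OF \<delta>])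
      finally have "\<bar>x $ j - y $ j\<bar> * K' n x y \<le> rq y (\<delta> n) x powr (1/2) * K' n x y"
        by (intro mult_right_mono) (auto simp: K'_def)
      also have "\<dots> = rq y (\<delta> n) x powr (-\<gamma>/2 - 1/2)"
        unfolding K'_def powr_add[symmetric] by (rule arg_cong[where f="(powr) _"]) simp
      also have "\<dots> \<le> \<delta> n powr (-\<gamma>/2 - 1/2)"
        using \<gamma> rq_ge(1)[OF \<delta>, of n y x] \<delta>[of n] by (intro powr_mono2') auto
      finally have "\<bar>X j x\<bar> * (\<bar>x $ j - y $ j\<bar> * K' n x y) \<le> xb j * \<delta> n powr (-\<gamma>/2 - 1/2)"
        using xb[of j x] by (intro mult_mono) (auto simp: K'_def)
      then show ?thesis by (simp add: abs_mult K'_def mult.assoc)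
    qed
    have "\<bar>F n x y\<bar> \<le> B * \<delta> n powr (-\<gamma>/2) + \<gamma> * (\<Sum>j\<in>UNIV. xb j * \<delta> n powr (-\<gamma>/2 - 1/2))" for x y
    proof -
      have "\<bar>divg X x * K n x y\<bar> \<le> B * \<delta> n powr (-\<gamma>/2)"
        unfolding abs_mult using B[of x] B[of 0] by (intro mult_mono Kb) auto
      moreover have "\<bar>\<gamma> * (\<Sum>j\<in>UNIV. X j x * (x $ j - y $ j) * K' n x y)\<bar> \<le> \<gamma> * (\<Sum>j\<in>UNIV. xb j * \<delta> n powr (-\<gamma>/2 - 1/2))"
      proof -
        have "\<bar>\<Sum>j\<in>UNIV. X j x * (x $ j - y $ j) * K' n x y\<bar> \<le> (\<Sum>j\<in>UNIV. xb j * \<delta> n powr (-\<gamma>/2 - 1/2))"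
          by (rule order_trans[OF sum_abs sum_mono[OF 1]])
        from mult_left_mono[OF this \<gamma>(1)] show ?thesis using \<gamma>(1) by (simp add: abs_mult)
      qed
      ultimately show ?thesis unfolding F_def by (simp add: sum_distrib_right mult.assoc)
    qed
    then show ?thesis by blast
  qed
  have reg: "(\<integral>(x, y). V x * (K n x y * U y) \<partial>?P) = - 1/4 * (\<integral>(x, y). U x * (virial \<gamma> (\<delta> n) X x y * U y) \<partial>?P)" for n
  proof -
    obtain C where C: "\<And>x y. \<bar>F n x y\<bar> \<le> C" using Fb[of n] by blast
    have iVK: "integrable ?P (\<lambda>(x, y). V x * (K n x y * U y))"
      using pair_integrable_bounded[OF iV iU Km(1) Kb] by simp
    have iUF: "integrable ?P (\<lambda>(x, y). U x * (F n x y * U y))"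
      using pair_integrable_bounded[OF iU iU Km(2) C] by simp
    have iUF': "integrable ?P (\<lambda>(x, y). U y * (F n y x * U x))"
      using lborel_pair.integrable_product_swap[OF iUF] by simp
    have "(\<integral>(x, y). V x * (K n x y * U y) \<partial>?P) = (LINT y|lborel. LINT x|lborel. V x * (K n x y * U y))"
      by (rule lborel_pair.integral_snd[OF iVK, symmetric])
    also have "\<dots> = (LINT y|lborel. LINT x|lborel. - 1/2 * (U x * (F n x y * U y)))"
    proof (rule Bochner_Integration.integral_cong[OF refl])
      fix y
      have "(LINT x|lborel. V x * K n x y) = - 1/2 * (LINT x|lborel. U x * F n x y)"
        unfolding V_def K_def U_def F_def K'_def by (rule field_potential_regularised[OF u X \<delta>])
      then show "(LINT x|lborel. V x * (K n x y * U y)) = (LINT x|lborel. - 1/2 * (U x * (F n x y * U y)))"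
        using integral_mult_left_zero[of lborel "\<lambda>x. V x * K n x y" "U y"] integral_mult_left_zero[of lborel "\<lambda>x. U x * F n x y" "U y"]
        by (simp add: mult.assoc)
    qed
    also have "\<dots> = - 1/2 * (LINT y|lborel. LINT x|lborel. U x * (F n x y * U y))"
      by (simp only: integral_mult_right_zero)
    also have "(LINT y|lborel. LINT x|lborel. U x * (F n x y * U y)) = (\<integral>(x, y). U x * (F n x y * U y) \<partial>?P)"
      by (rule lborel_pair.integral_snd[OF iUF])
    finally have 1: "(\<integral>(x, y). V x * (K n x y * U y) \<partial>?P) = - 1/2 * (\<integral>(x, y). U x * (F n x y * U y) \<partial>?P)" .
    have 2: "(\<integral>(x, y). U y * (F n y x * U x) \<partial>?P) = (\<integral>(x, y). U x * (F n x y * U y) \<partial>?P)"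
      using lborel_pair.integral_product_swap[OF borel_measurable_integrable[OF iUF]] by simp
    have "(\<integral>(x, y). U x * (virial \<gamma> (\<delta> n) X x y * U y) \<partial>?P)
      = (\<integral>p. (case p of (x, y) \<Rightarrow> U x * (F n x y * U y)) + (case p of (x, y) \<Rightarrow> U y * (F n y x * U x)) \<partial>?P)"
      by (intro Bochner_Integration.integral_cong refl) (auto simp: Fsym[symmetric] algebra_simps split: prod.split)
    also have "\<dots> = 2 * (\<integral>(x, y). U x * (F n x y * U y) \<partial>?P)"
      unfolding Bochner_Integration.integral_add[OF iUF iUF'] 2 by simp
    finally show ?thesis unfolding 1 by simp
  qed
  have ae: "AE p in ?P. fst p \<noteq> snd p" by (rule AE_off_diagonal)
  have l1: "(\<lambda>n. \<integral>(x, y). V x * (K n x y * U y) \<partial>?P) \<longlonglongrightarrow> (\<integral>(x, y). V x * (ker \<gamma> (x - y) * U y) \<partial>?P)"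
  proof (rule integral_dominated_convergence[where w="\<lambda>p. norm (case p of (x, y) \<Rightarrow> V x * (ker \<gamma> (x - y) * U y))"])
    show "AE p in ?P. (\<lambda>n. case p of (x, y) \<Rightarrow> V x * (K n x y * U y)) \<longlonglongrightarrow> (case p of (x, y) \<Rightarrow> V x * (ker \<gamma> (x - y) * U y))"
      using ae
    proof eventually_elim
      case (elim p)
      then have "(\<lambda>n. K n (fst p) (snd p)) \<longlonglongrightarrow> ker \<gamma> (fst p - snd p)"
        using ker_le_liminf(1)[OF \<gamma>(1), of "snd p" "fst p"] unfolding K_def \<delta>_def by (simp add: ker_commute[of \<gamma> "fst p"])
      then show ?case by (auto simp: split_beta intro!: tendsto_intros)
    qed
    show "AE p in ?P. norm (case p of (x, y) \<Rightarrow> V x * (K n x y * U y)) \<le> norm (case p of (x, y) \<Rightarrow> V x * (ker \<gamma> (x - y) * U y))" for n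
      using ae
    proof eventually_elim
      case (elim p)
      then have "\<bar>K n (fst p) (snd p)\<bar> \<le> ker \<gamma> (fst p - snd p)"
        unfolding K_def using rq_le_ker[OF elim less_imp_le[OF \<delta>] \<gamma>(1)] by simp
      then show ?case by (auto simp: split_beta abs_mult intro!: mult_left_mono mult_right_mono)
    qed
    show "integrable ?P (\<lambda>p. norm (case p of (x, y) \<Rightarrow> V x * (ker \<gamma> (x - y) * U y)))"
      by (intro integrable_norm I_pair_integrable iV PU)
    show "(\<lambda>(x, y). V x * (K n x y * U y)) \<in> borel_measurable ?P" for n
      using Km(1)[of n] by (simp add: split_beta) 
  qed (use borel_measurable_integrable[OF I_pair_integrable[OF iV PU]] in auto)
  \<comment> \<open>Domination by C times the kernel of exponent \<gamma>, with C from
    \<open>virial_bound\<close> independent of n.\<close>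
  have l2: "(\<lambda>n. \<integral>(x, y). U x * (virial \<gamma> (\<delta> n) X x y * U y) \<partial>?P) \<longlonglongrightarrow> (\<integral>(x, y). U x * (virial \<gamma> 0 X x y * U y) \<partial>?P)"
  proof (rule integral_dominated_convergence[where w="\<lambda>p. C * norm (case p of (x, y) \<Rightarrow> U x * (ker \<gamma> (x - y) * U y))"])
    show "AE p in ?P. (\<lambda>n. case p of (x, y) \<Rightarrow> U x * (virial \<gamma> (\<delta> n) X x y * U y)) \<longlonglongrightarrow> (case p of (x, y) \<Rightarrow> U x * (virial \<gamma> 0 X x y * U y))"
      using ae
    proof eventually_elim
      case (elim p)
      then show ?case unfolding \<delta>_def split_beta by (intro tendsto_intros virial_tendsto)
    qed
    show "AE p in ?P. norm (case p of (x, y) \<Rightarrow> U x * (virial \<gamma> (\<delta> n) X x y * U y)) \<le> C * norm (case p of (x, y) \<Rightarrow> U x * (ker \<gamma> (x - y) * U y))" for n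
      using ae
    proof eventually_elim
      case (elim p)
      then have "\<bar>virial \<gamma> (\<delta> n) X (fst p) (snd p)\<bar> \<le> C * ker \<gamma> (fst p - snd p)"
        unfolding C_def by (intro virial_bound B L L0 \<gamma> less_imp_le[OF \<delta>])
      from mult_left_mono[OF this, of "\<bar>U (fst p)\<bar> * \<bar>U (snd p)\<bar>"]
      show ?case by (auto simp: split_beta abs_mult mult_ac)
    qed
    show "integrable ?P (\<lambda>p. C * norm (case p of (x, y) \<Rightarrow> U x * (ker \<gamma> (x - y) * U y)))"
      by (intro integrable_mult_right integrable_norm I_pair_integrable iU PU)
  qed (simp_all add: split_beta)
  have "(\<integral>(x, y). V x * (ker \<gamma> (x - y) * U y) \<partial>?P) = - 1/4 * (\<integral>(x, y). U x * (virial \<gamma> 0 X x y * U y) \<partial>?P)"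
    by (rule LIMSEQ_unique[OF l1]) (unfold reg, rule tendsto_mult_left[OF l2])
  moreover have "I \<gamma> V U = (\<integral>(x, y). V x * (ker \<gamma> (x - y) * U y) \<partial>?P)"
    using lborel_pair.integral_fst[OF I_pair_integrable[OF iV PU]] by (simp add: I_def pot_def)
  ultimately show ?thesis by (simp add: U_def[abs_def] V_def[abs_def])
qed

text \<open>Truncations of the generator \<open>x\<close> of dilations, all rescaled from one compactly supported field, so
  that their Lipschitz constants do not depend on \<open>n\<close>.\<close>

definition ident_field :: "nat \<Rightarrow> 'n::finite \<Rightarrow> real^'n \<Rightarrow> real" where
  "ident_field n j x = x $ j * bump (x /\<^sub>R (1 + real n))"

lemma ident_field_test: "ident_field n j \<in> test_functions"
  unfolding ident_field_def[abs_def] by (rule test_mult[OF bump_scaled smooth_coord])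

lemma ident_field_scaled: "ident_field n j x = (1 + real n) * ident_field 0 j (x /\<^sub>R (1 + real n))"
  by (simp add: ident_field_def field_simps)

lemma ident_field_partial: "partial_deriv i (ident_field n j) x = partial_deriv i (ident_field 0 j) (x /\<^sub>R (1 + real n))"
proof -
  let ?a = "inverse (1 + real n)" and ?f = "ident_field 0 j :: real^'a \<Rightarrow> real"
  have s: "smooth (\<lambda>x. ?f (?a *\<^sub>R x + 0))"
    by (intro smooth_affine test_smooth ident_field_test)
  have "ident_field n j = (\<lambda>x. (1 + real n) * ?f (?a *\<^sub>R x + 0))"
    using ident_field_scaled[of n j] by auto
  then have "partial_deriv i (ident_field n j) x = (1 + real n) * partial_deriv i (\<lambda>x. ?f (?a *\<^sub>R x + 0)) x"
    using partial_deriv_smooth_mult[OF smooth_const[of "1 + real n"] s, of i x]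
    by (simp add: partial_deriv_eq[OF has_derivative_const])
  also have "\<dots> = (1 + real n) * (?a * partial_deriv i ?f (?a *\<^sub>R x + 0))"
    by (simp only: partial_deriv_affine[OF test_smooth[OF ident_field_test]])
  finally show ?thesis by simp
qed

lemma ident_field_tendsto: "(\<lambda>n. ident_field n j x) \<longlonglongrightarrow> x $ j"
  unfolding ident_field_def using tendsto_mult_left[OF bump_tendsto, of "x $ j" x] by simp

lemma ident_field_partial_tendsto:
  "(\<lambda>n. partial_deriv i (ident_field n j) x) \<longlonglongrightarrow> (if i = j then 1 else 0)"
proof -
  let ?p = "partial_deriv i (ident_field 0 j) :: real^'a \<Rightarrow> real"
  have "?p 0 = (if i = j then 1 else 0)"
  proof -
    have "ident_field 0 j = (\<lambda>x::real^'a. x $ j * bump x)" by (auto simp: ident_field_def)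
    then show ?thesis
      using partial_deriv_smooth_mult[OF smooth_coord[of j] test_smooth[OF bump_test], of i 0]
      by (simp add: partial_deriv_coord bump_0)
  qed
  moreover have "isCont ?p 0"
    using smooth_continuous[OF smooth_partial[OF test_smooth[OF ident_field_test]]] continuous_on_eq_continuous_at by blast
  ultimately show ?thesis
    using isCont_tendsto_compose[OF _ scaled_tendsto_0[of x], of ?p] by (subst ident_field_partial) simp
qed

lemma ident_field_bounds:
  obtains B L where "B \<ge> 0" "L \<ge> 0" "\<And>n i j (x :: real^'n::finite). \<bar>partial_deriv i (ident_field n j) x\<bar> \<le> B"
    "\<And>n j (x :: real^'n) y. \<bar>ident_field n j x - ident_field n j y\<bar> \<le> L * norm (x - y)"
proof -
  have "\<exists>B>0. \<forall>x. \<bar>partial_deriv i (ident_field 0 j) x\<bar> \<le> B" for i j :: 'n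
    using test_bounded[OF test_partial[OF ident_field_test]] by metis
  then obtain b where b: "\<And>i j :: 'n. b i j > 0" "\<And>i j x. \<bar>partial_deriv i (ident_field 0 j) x\<bar> \<le> b i j" by metis
  have "\<exists>L>0. \<forall>x y. \<bar>ident_field 0 j x - ident_field 0 j y\<bar> \<le> L * norm (x - y)" for j :: 'n
    using test_Lipschitz[OF ident_field_test] by metis
  then obtain l where l: "\<And>j :: 'n. l j > 0" "\<And>j x y. \<bar>ident_field 0 j x - ident_field 0 j y\<bar> \<le> l j * norm (x - y)" by metis
  define B where "B = (\<Sum>i\<in>UNIV. \<Sum>j\<in>UNIV. b i j)"
  define L where "L = (\<Sum>j\<in>UNIV. l j)"
  have bB: "b i j \<le> B" for i j
  proof -
    have "b i j \<le> (\<Sum>j\<in>UNIV. b i j)" using b(1) by (intro member_le_sum) (auto intro: less_imp_le)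
    also have "\<dots> \<le> B" unfolding B_def using b(1)
      by (intro member_le_sum[of i UNIV "\<lambda>i. \<Sum>j\<in>UNIV. b i j"]) (auto intro: less_imp_le sum_nonneg)
    finally show ?thesis .
  qed
  have lL: "l j \<le> L" for j unfolding L_def using l(1) by (intro member_le_sum) (auto intro: less_imp_le)
  show ?thesis
  proof (rule that[of B L])
    show "B \<ge> 0" "L \<ge> 0" using order_trans[OF less_imp_le[OF b(1)] bB] order_trans[OF less_imp_le[OF l(1)] lL] by auto
    show "\<bar>partial_deriv i (ident_field n j) x\<bar> \<le> B" for n i j and x :: "real^'n"
      by (subst ident_field_partial) (rule order_trans[OF b(2) bB])
    fix n j and x y :: "real^'n"
    let ?s = "1 + real n"
    have "\<bar>ident_field n j x - ident_field n j y\<bar> = ?s * \<bar>ident_field 0 j (x /\<^sub>R ?s) - ident_field 0 j (y /\<^sub>R ?s)\<bar>"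
      unfolding ident_field_scaled[of n] right_diff_distrib[symmetric] abs_mult by simp
    also have "\<dots> \<le> ?s * (L * norm (x /\<^sub>R ?s - y /\<^sub>R ?s))"
      by (intro mult_left_mono order_trans[OF l(2) mult_right_mono[OF lL]]) auto
    also have "\<dots> = L * norm (x - y)" by (simp flip: scaleR_diff_right)
    finally show "\<bar>ident_field n j x - ident_field n j y\<bar> \<le> L * norm (x - y)" .
  qed
qed

lemma ident_field_integral_tendsto:
  assumes f: "integrable lborel (f :: real^'n::finite \<Rightarrow> real)"
  shows "(\<lambda>n. LINT x|lborel. partial_deriv i (ident_field n j) x * f x) \<longlonglongrightarrow> (if i = j then (LINT x|lborel. f x) else 0)"
proof -
  obtain B where B: "B \<ge> 0" "\<And>n (x :: real^'n). \<bar>partial_deriv i (ident_field n j) x\<bar> \<le> B"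
    using ident_field_bounds by metis
  note [measurable] = borel_measurable_integrable[OF f] test_measurable[OF test_partial[OF ident_field_test]]
  have "(\<lambda>n. LINT x|lborel. partial_deriv i (ident_field n j) x * f x) \<longlonglongrightarrow> (LINT x|lborel. (if i = j then 1 else 0) * f x)"
  proof (rule integral_dominated_convergence[where w="\<lambda>x. B * \<bar>f x\<bar>"])
    show "AE x in lborel. (\<lambda>n. partial_deriv i (ident_field n j) x * f x) \<longlonglongrightarrow> (if i = j then 1 else 0) * f x"
      by (intro AE_I2 tendsto_intros ident_field_partial_tendsto)
    show "AE x in lborel. norm (partial_deriv i (ident_field n j) x * f x) \<le> B * \<bar>f x\<bar>" for n
      by (auto simp: abs_mult intro!: mult_right_mono B)
  qed (use f in auto)
  then show ?thesis by (cases "i = j") auto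
qed

text \<open>In the limit the field is the identity: its divergence N occurs once for x and once for
  y, and the remaining term is \<gamma> |x-y|^2 |x-y|^(-\<gamma>-2).\<close>

lemma virial_ident_tendsto:
  fixes x y :: "real^'n::finite"
  assumes "x \<noteq> y"
  shows "(\<lambda>n. virial \<gamma> 0 (ident_field n) x y) \<longlonglongrightarrow> (2 * real CARD('n) - \<gamma>) * ker \<gamma> (x - y)"
proof -
  let ?q = "rq y 0 x"
  have q: "?q > 0" using assms by (simp add: rq_def)
  have q_sum: "?q = (\<Sum>j\<in>UNIV. (x $ j - y $ j) * (x $ j - y $ j))"
    by (simp add: rq_def power2_norm_eq_inner inner_vec_def)
  have "(\<lambda>n. virial \<gamma> 0 (ident_field n) x y) \<longlonglongrightarrow>
    ((\<Sum>j\<in>(UNIV::'n set). if j = j then 1 else 0) + (\<Sum>j\<in>(UNIV::'n set). if j = j then 1 else 0)) * ?q powr (-\<gamma>/2)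
     - \<gamma> * (\<Sum>j\<in>UNIV. (x $ j - y $ j) * (x $ j - y $ j)) * ?q powr (-\<gamma>/2 - 1)"
    unfolding virial_def divg_def
    by (intro tendsto_intros ident_field_partial_tendsto ident_field_tendsto)
  moreover have "?q * ?q powr (-\<gamma>/2 - 1) = ?q powr (-\<gamma>/2)" using q by (simp add: powr_diff)
  moreover have "?q powr (-\<gamma>/2) = ker \<gamma> (x - y)"
    unfolding ker_commute[of \<gamma> x] ker_rq[OF assms] by (simp add: rq_def)
  ultimately show ?thesis
    unfolding q_sum[symmetric] by (simp add: algebra_simps)
qed

lemma virial_ident_integral_tendsto:
  fixes u :: "real^'n::finite \<Rightarrow> real"
  assumes u: "u \<in> H1" and N: "CARD('n) \<ge> 3" and \<gamma>: "0 \<le> \<gamma>" "\<gamma> \<le> 2"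
  shows "(\<lambda>n. \<integral>(x, y). (u x * u x) * (virial \<gamma> 0 (ident_field n) x y * (u y * u y)) \<partial>(lborel \<Otimes>\<^sub>M lborel))
    \<longlonglongrightarrow> (2 * real CARD('n) - \<gamma>) * D \<gamma> u"
proof -
  let ?P = "lborel \<Otimes>\<^sub>M (lborel :: (real^'n) measure)"
  define U where "U x = u x * u x" for x
  have PU: "PB \<gamma> U" unfolding U_def[abs_def] by (intro PB_mult u N \<gamma>)
  note iU = PB_integrable[OF PU]
  note [measurable] = PB_measurable[OF PU] virial_measurable[OF ident_field_test]
  have ae: "AE p in ?P. fst p \<noteq> snd p" by (rule AE_off_diagonal)
  obtain b L where B: "b \<ge> 0" "L \<ge> 0" "\<And>n i j (x :: real^'n). \<bar>partial_deriv i (ident_field n j) x\<bar> \<le> b"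
    "\<And>n j (x :: real^'n) y. \<bar>ident_field n j x - ident_field n j y\<bar> \<le> L * norm (x - y)"
    using ident_field_bounds by metis
  have dB: "\<bar>divg (ident_field n) x\<bar> \<le> real CARD('n) * b" for n and x :: "real^'n"
  proof -
    have "\<bar>divg (ident_field n) x\<bar> \<le> (\<Sum>j\<in>(UNIV::'n set). b)"
      unfolding divg_def by (intro order_trans[OF sum_abs sum_mono] B)
    then show ?thesis by simp
  qed
  let ?C = "2 * (real CARD('n) * b) + \<gamma> * real CARD('n) * L"
  have "(\<lambda>n. \<integral>(x, y). U x * (virial \<gamma> 0 (ident_field n) x y * U y) \<partial>?P)
    \<longlonglongrightarrow> (\<integral>p. (2 * real CARD('n) - \<gamma>) * (case p of (x, y) \<Rightarrow> U x * (ker \<gamma> (x - y) * U y)) \<partial>?P)"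
  proof (rule integral_dominated_convergence[where w="\<lambda>p. ?C * norm (case p of (x, y) \<Rightarrow> U x * (ker \<gamma> (x - y) * U y))"])
    show "AE p in ?P. (\<lambda>n. case p of (x, y) \<Rightarrow> U x * (virial \<gamma> 0 (ident_field n) x y * U y))
      \<longlonglongrightarrow> (2 * real CARD('n) - \<gamma>) * (case p of (x, y) \<Rightarrow> U x * (ker \<gamma> (x - y) * U y))"
      using ae
    proof eventually_elim
      case (elim p)
      have "(\<lambda>n. U (fst p) * (virial \<gamma> 0 (ident_field n) (fst p) (snd p) * U (snd p)))
        \<longlonglongrightarrow> U (fst p) * ((2 * real CARD('n) - \<gamma>) * ker \<gamma> (fst p - snd p) * U (snd p))"
        by (intro tendsto_intros virial_ident_tendsto elim)
      then show ?case by (simp add: split_beta mult_ac)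
    qed
    show "AE p in ?P. norm (case p of (x, y) \<Rightarrow> U x * (virial \<gamma> 0 (ident_field n) x y * U y)) \<le> ?C * norm (case p of (x, y) \<Rightarrow> U x * (ker \<gamma> (x - y) * U y))" for n
      using ae
    proof eventually_elim
      case (elim p)
      then have "\<bar>virial \<gamma> 0 (ident_field n) (fst p) (snd p)\<bar> \<le> ?C * ker \<gamma> (fst p - snd p)"
        by (intro virial_bound dB B \<gamma>) auto
      from mult_left_mono[OF this, of "\<bar>U (fst p)\<bar> * \<bar>U (snd p)\<bar>"]
      show ?case by (auto simp: split_beta abs_mult mult_ac)
    qed
    show "integrable ?P (\<lambda>p. ?C * norm (case p of (x, y) \<Rightarrow> U x * (ker \<gamma> (x - y) * U y)))"
      by (intro integrable_mult_right integrable_norm I_pair_integrable iU PU)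
  qed (simp_all add: split_beta)
  moreover have "(\<integral>(x, y). U x * (ker \<gamma> (x - y) * U y) \<partial>?P) = D \<gamma> u"
    using lborel_pair.integral_fst[OF I_pair_integrable[OF iU PU]] by (simp add: D_I I_def pot_def U_def[abs_def])
  ultimately show ?thesis by (simp add: U_def)
qed

text \<open>The derivative of u along the truncated identity field is the rigorous form of the
  generator of dilations. Testing with it gives one relation in the limit; testing with u gives a
  second, which eliminates the multiplier.\<close>

lemma pohozaev_identity:
  fixes u :: "real^'n::finite \<Rightarrow> real"
  assumes N: "CARD('n) \<ge> 3" and u: "u \<in> H1" and \<theta>: "0 \<le> \<theta>" "\<theta> \<le> 2"
    and sol: "weak_solution 2 \<theta> l u"
  shows "pohozaev 2 \<theta> u = 0"
proof -
  let ?U = "\<lambda>x. u x * u x" and ?N = "real CARD('n)"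
  have eq: "dip u v + l * ip u v = I 2 (\<lambda>x. u x * v x) ?U - I \<theta> (\<lambda>x. u x * v x) ?U" if "v \<in> H1" for v
    using sol that unfolding weak_solution_def weak_solution_I dip_def ip_def by blast
  \<comment> \<open>The nonlinearity is a bounded potential times u, hence in \<open>L2\<close>;
    regularity is therefore that of a linear equation with right side f.\<close>
  define f where "f x = (pot 2 ?U x - pot \<theta> ?U x - l) * u x" for x
  have pm[measurable]: "pot \<gamma> ?U \<in> borel_measurable borel" for \<gamma>
    using L2_measurable[OF H1_L2[OF u]] by (intro pot_measurable) measurable
  have f: "f \<in> L2" unfolding f_def[abs_def]
  proof (rule L2_bounded_mult[OF H1_L2[OF u]])
    have *: "\<bar>a - b - l\<bar> \<le> 2 * M + \<bar>l\<bar>" if "\<bar>a\<bar> \<le> M" "\<bar>b\<bar> \<le> M" for a b M :: real using that by linarith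
    show "\<bar>pot 2 ?U x - pot \<theta> ?U x - l\<bar> \<le> 2 * (mass u + 4 * dirichlet u) + \<bar>l\<bar>" for x
      by (rule * ; rule pot_square_bounds[OF u N]) (use \<theta> in auto)
  qed measurable
  have weak: "dip u v = ip f v" if v: "v \<in> H1" for v
  proof -
    have i: "integrable lborel (\<lambda>x. u x * v x)" by (intro L2_integrable_mult H1_L2 u v)
    have "ip f v = (LINT x|lborel. ((u x * v x) * pot 2 ?U x - (u x * v x) * pot \<theta> ?U x) - l * (u x * v x))"
      by (simp add: ip_def f_def algebra_simps)
    also have "\<dots> = I 2 (\<lambda>x. u x * v x) ?U - I \<theta> (\<lambda>x. u x * v x) ?U - l * ip u v"
      using I_integrable[OF i PB_mult[OF u u N]] \<theta> i by (simp add: I_def ip_def)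
    finally show ?thesis using eq[OF v] by simp
  qed
  have "\<exists>h. h \<in> L2 \<and> wd i (pd u j) h \<and> wd j (pd u i) h" for i j
    using weak_equation_second_derivative[OF u f weak] by metis
  then obtain h where h: "\<And>i j. h i j \<in> L2" "\<And>i j. wd i (pd u j) (h i j)" "\<And>i j. wd j (pd u i) (h i j)" by metis
  define v where "v n x = (\<Sum>j\<in>UNIV. ident_field n j x * pd u j x)" for n x
  note X = ident_field_test
  have vH: "v n \<in> H1" for n unfolding v_def[abs_def] by (rule field_derivative(1)[OF u h X])
  have int: "integrable lborel (\<lambda>x. pd u i x * pd u j x)" for i j by (intro L2_integrable_mult pd_L2 u)
  have "(\<lambda>n. dip u (v n)) \<longlonglongrightarrow> (\<Sum>i\<in>UNIV. \<Sum>j\<in>UNIV. if i = j then (LINT x|lborel. pd u i x * pd u j x) else 0)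
      - 1/2 * (\<Sum>i\<in>UNIV. \<Sum>j\<in>(UNIV::'n set). if j = j then (LINT x|lborel. pd u i x * pd u i x) else 0)"
    unfolding v_def field_derivative(2)[OF u h X] by (intro tendsto_intros ident_field_integral_tendsto int)
  moreover have "dirichlet u = (\<Sum>i\<in>UNIV. (LINT x|lborel. pd u i x * pd u i x))"
    by (simp add: dirichlet_dip dip_eq[OF u u] ip_def)
  ultimately have 1: "(\<lambda>n. dip u (v n)) \<longlonglongrightarrow> dirichlet u - 1/2 * (?N * dirichlet u)"
    by (simp add: sum_distrib_left)
  have "(\<lambda>n. ip u (v n)) \<longlonglongrightarrow> - 1/2 * (\<Sum>j\<in>(UNIV::'n set). if j = j then (LINT x|lborel. u x * u x) else 0)"
    unfolding v_def field_derivative(3)[OF u h X]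
    by (intro tendsto_intros ident_field_integral_tendsto u_square_wd u)
  then have 2: "(\<lambda>n. ip u (v n)) \<longlonglongrightarrow> - 1/2 * (?N * mass u)" by (simp add: mass_ip ip_def)
  have 3: "(\<lambda>n. I \<gamma> (\<lambda>x. u x * v n x) ?U) \<longlonglongrightarrow> - 1/4 * ((2 * ?N - \<gamma>) * D \<gamma> u)" if "0 \<le> \<gamma>" "\<gamma> \<le> 2" for \<gamma>
    unfolding v_def field_potential[OF u N that X vH[unfolded v_def[abs_def]]]
    by (intro tendsto_mult_left virial_ident_integral_tendsto u N that)
  have "(\<lambda>n. dip u (v n) + l * ip u (v n)) \<longlonglongrightarrow> (dirichlet u - 1/2 * (?N * dirichlet u)) + l * (- 1/2 * (?N * mass u))"
    by (intro tendsto_intros 1 2)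
  moreover have "(\<lambda>n. dip u (v n) + l * ip u (v n)) \<longlonglongrightarrow> - 1/4 * ((2 * ?N - 2) * D 2 u) - - 1/4 * ((2 * ?N - \<theta>) * D \<theta> u)"
    unfolding eq[OF vH] by (intro tendsto_diff 3 \<theta>) auto
  ultimately have A: "(dirichlet u - 1/2 * (?N * dirichlet u)) + l * (- 1/2 * (?N * mass u))
    = - 1/4 * ((2 * ?N - 2) * D 2 u) - - 1/4 * ((2 * ?N - \<theta>) * D \<theta> u)"
    by (rule LIMSEQ_unique)
  \<comment> \<open>After substituting this for the multiplier term, all multiples of N cancel and
    the Pohozaev functional remains.\<close>
  have "dirichlet u + l * mass u = D 2 u - D \<theta> u"
    using eq[OF u] by (simp add: dirichlet_dip mass_ip D_I)
  then have lm: "l * mass u = D 2 u - D \<theta> u - dirichlet u" by simp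
  have "(dirichlet u - 1/2 * (?N * dirichlet u)) - 1/2 * (?N * (l * mass u))
    = - 1/4 * ((2 * ?N - 2) * D 2 u) - - 1/4 * ((2 * ?N - \<theta>) * D \<theta> u)"
    using A by (simp add: mult_ac)
  then show ?thesis unfolding lm by (simp add: pohozaev_def algebra_simps)
qed

section \<open>Existence of ground states just above the mass threshold\<close>

theorem theorem1p5:
  fixes \<gamma>1 \<gamma>2 :: real
  assumes "CARD('n::finite) \<ge> 3"
    and "0 < \<gamma>2" and "\<gamma>2 < \<gamma>1" and "\<gamma>1 = 2"
  shows "\<exists>c1_star > c1_tilde TYPE('n). \<forall>c. c1_tilde TYPE('n) < c \<and> c < c1_star \<longrightarrow>
    (\<exists>u :: real ^ 'n \<Rightarrow> real. ground_state \<gamma>1 \<gamma>2 c u \<and>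
       ereal (energy \<gamma>1 \<gamma>2 u) = Gamma_inf TYPE('n) \<gamma>1 \<gamma>2 c)"
proof -
  let ?c1 = "c1_tilde TYPE('n)"
  note N = assms(1) and g1 = assms(4)
  have g2: "0 < \<gamma>2" "\<gamma>2 < 2" using assms by auto
  have c1: "?c1 > 0" by (rule c1_tilde_pos[OF N])
  \<comment> \<open>The exponent is the reciprocal of (4 - \<theta>)/\<theta>, so that c < s *
    \<open>c1_tilde\<close> is the smallness condition of \<open>minimiser_exists\<close>.\<close>
  define s where "s = 2 powr (\<gamma>2 / (4 - \<gamma>2))"
  have s: "s > 1" unfolding s_def using g2 by (intro gr_one_powr) auto
  show ?thesis
  proof (intro exI[of _ "s * ?c1"] conjI allI impI)
    show "?c1 < s * ?c1" using mult_strict_right_mono[OF s c1] by simp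
    fix c assume "?c1 < c \<and> c < s * ?c1"
    then have c: "?c1 < c" "c < s * ?c1" by auto
    then have c0: "c > 0" using c1 by simp
    have "(c / ?c1) powr ((4 - \<gamma>2) / \<gamma>2) \<le> s powr ((4 - \<gamma>2) / \<gamma>2)"
      using c c1 c0 g2 by (intro powr_mono2) (auto simp: field_simps)
    also have "\<dots> = 2" using g2 by (simp add: s_def powr_powr)
    finally have small: "(c / ?c1) powr ((4 - \<gamma>2) / \<gamma>2) \<le> 2" .
    obtain u0 :: "real^'n \<Rightarrow> real" where u0: "u0 \<in> H1" "mass u0 = c" "Kf u0 > 0"
      and min0: "\<And>w :: real^'n \<Rightarrow> real. w \<in> H1 \<Longrightarrow> mass w = c \<Longrightarrow> Kf w > 0 \<Longrightarrow> Ff \<gamma>2 u0 \<le> Ff \<gamma>2 w"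
      by (rule minimiser_exists[OF N c(1) g2 small]) blast
    obtain u :: "real^'n \<Rightarrow> real" where u: "u \<in> H1" "mass u = c" "Kf u = \<gamma>2 / 8 * D \<gamma>2 u" "Kf u > 0"
      and Fu: "Ff \<gamma>2 u = Ff \<gamma>2 u0"
      using normalise_to_pohozaev[OF u0 N c0 g2] by metis
    have min: "Ff \<gamma>2 u \<le> Ff \<gamma>2 w" if "w \<in> H1" "mass w = c" "Kf w > 0" for w :: "real^'n \<Rightarrow> real"
      unfolding Fu by (rule min0[OF that])
    have P: "w \<in> pohozaev_set 2 \<gamma>2 c \<longleftrightarrow> w \<in> H1 \<and> mass w = c \<and> Kf w = \<gamma>2 / 8 * D \<gamma>2 w" for w :: "real^'n \<Rightarrow> real"
      by (auto simp: pohozaev_set_def mass_sphere_def pohozaev_Kf)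
    \<comment> \<open>On the Pohozaev set the energy is a positive multiple of
      \<open>D \<gamma>2\<close>, so comparing energies reduces to comparing
      \<open>D \<gamma>2\<close>, hence \<open>Ff\<close>.\<close>
    have E: "energy 2 \<gamma>2 w = (2 - \<gamma>2) / 8 * D \<gamma>2 w" if "w \<in> pohozaev_set 2 \<gamma>2 c" for w :: "real^'n \<Rightarrow> real"
      using that by (auto simp: P energy_Kf algebra_simps)
    have uP: "u \<in> pohozaev_set 2 \<gamma>2 c" using u by (simp add: P)
    have Dpos: "D \<gamma>2 w > 0" if "w \<in> pohozaev_set 2 \<gamma>2 c" for w :: "real^'n \<Rightarrow> real"
      using that c0 g2 by (intro D_pos N) (auto simp: P)
    have least: "energy 2 \<gamma>2 u \<le> energy 2 \<gamma>2 w" if w: "w \<in> pohozaev_set 2 \<gamma>2 c" for w :: "real^'n \<Rightarrow> real"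
    proof -
      have K: "Kf w = \<gamma>2 / 8 * D \<gamma>2 w" using w by (simp add: P)
      then have "Kf w > 0" using mult_pos_pos[OF g2(1) Dpos[OF w]] by linarith
      then have "Ff \<gamma>2 u \<le> Ff \<gamma>2 w" using w by (intro min) (auto simp: P)
      then have "D \<gamma>2 u powr (2 - \<gamma>2) \<le> D \<gamma>2 w powr (2 - \<gamma>2)"
        unfolding Ff_on_pohozaev[OF Dpos[OF uP] g2(1) u(3)] Ff_on_pohozaev[OF Dpos[OF w] g2(1) K]
        using g2 by simp
      then have "D \<gamma>2 u \<le> D \<gamma>2 w"
        using powr_less_mono2[of "2 - \<gamma>2" "D \<gamma>2 w" "D \<gamma>2 u"] Dpos[OF w] g2 by fastforce
      then show ?thesis using g2 unfolding E[OF uP] E[OF w] by (intro mult_left_mono) auto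
    qed
    have sol: "normalized_solution 2 \<gamma>2 c u"
      using minimiser_weak_solution[OF N c0 g2 u(1,2,4,3) min] u by (auto simp: normalized_solution_def mass_sphere_def)
    \<comment> \<open>Every competitor for the ground state lies in the set over which the infimum
      is taken, so minimality there suffices.\<close>
    have solP: "w \<in> pohozaev_set 2 \<gamma>2 c" if "normalized_solution 2 \<gamma>2 c w" for w :: "real^'n \<Rightarrow> real"
      using that pohozaev_identity[OF N] g2 by (auto simp: normalized_solution_def pohozaev_set_def mass_sphere_def)
    have "ground_state 2 \<gamma>2 c u" using sol least solP by (auto simp: ground_state_def)
    moreover have "ereal (energy 2 \<gamma>2 u) = Gamma_inf TYPE('n) 2 \<gamma>2 c"
      unfolding Gamma_inf_def
      by (intro antisym INF_greatest INF_lower[OF uP]) (simp add: least)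
    ultimately show "\<exists>u :: real ^ 'n \<Rightarrow> real. ground_state \<gamma>1 \<gamma>2 c u \<and> ereal (energy \<gamma>1 \<gamma>2 u) = Gamma_inf TYPE('n) \<gamma>1 \<gamma>2 c"
      using g1 by blast
  qed
qed

end
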